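(* Let $\Omega\subset\mathbb{R}^N$ ($N\ge 1$) be a bounded domain, $m\ge 1$, $s\ge 1$, $1\le r<\infty$. Let $T:\Omega\times\mathbb{R}^{m\times N}\to[0,\infty)$ be a Carathéodory function that is quasiconvex (in the sense of Morrey) in its second argument and satisfies, for some constants $0<\alpha_1\le\beta_1$, $$\alpha_1(1+|\xi|^r)\le T(x,\xi)\le\beta_1(1+|\xi|^r)\quad\text{for a.e. }x\in\Omega\text{ and all }\xi\in\mathbb{R}^{m\times N}.$$ Let $J:W^{1,s}(\Omega;\mathbb{R}^m)\to\mathbb{R}\cup\{+\infty\}$ be bounded from below and sequentially lower semicontinuous in the weak topology of $W^{1,s}(\Omega;\mathbb{R}^m)$. Let $g\in W^{1,\infty}(\Omega;\mathbb{R}^m)\cap C(\overline\Omega;\mathbb{R}^m)$ satisfy $J(g)<+\infty$ and $T(x,\nabla g(x))\le 1$ for a.e. $x\in\Omega$. For each $p\in(\max(r,s),\infty)$ let $u_p$ be any minimizer over $g+W^{1,p}_0(\Omega;\mathbb{R}^m)$ of $$J_p(v)=J(v)+\frac{r}{p}\int_\Omega T(x,\nabla v(x))^{p/r}\,dx .$$ Then: (i) For every $q\ge\max\{N+1,r,s\}$, the net $\{u_p\mid p\ge q,\ p\to\infty\}$ is bounded in $W^{1,q}(\Omega;\mathbb{R}^m)$ and relatively compact in $C^{\alpha}(\overline\Omega;\mathbb{R}^m)$, where $\alpha=1-N/q$. (ii) If $u_\infty$ is a cluster point of $\{u_p\mid p\to\infty\}$ in $C(\overline\Omega;\mathbb{R}^m)$,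 then $u_\infty$ is an optimal solution of the problem $$\inf\Big\{J(v)\ \Big|\ \operatorname*{ess\,sup}_{x\in\Omega}T(x,\nabla v(x))\le 1,\ v\in g+W_0^{1,s}(\Omega;\mathbb{R}^m)\Big\},$$ and, moreover, $$\lim_{p\to\infty}\min J_p=\lim_{p\to\infty}J_p(u_p)=\lim_{p\to\infty}J(u_p)=J(u_\infty)=\min J_\infty .$$
   Context: Quasiconvexity of $T$: for a.e. $x_0\in\Omega$ and every $\xi_0\in\mathbb{R}^{m\times N}$, $$T(x_0,\xi_0)\le\frac{1}{\mathcal{L}_N(D)}\int_D T(x_0,\xi_0+\nabla\phi(x))\,dx$$ for every bounded domain $D\subset\mathbb{R}^N$ and every $\phi\in W^{1,\infty}_0(D;\mathbb{R}^m)$, where $\mathcal{L}_N$ is Lebesgue measure. The functional $J_\infty:W^{1,s}(\Omega;\mathbb{R}^m)\to\mathbb{R}\cup\{+\infty\}$ is defined by $J_\infty(v)=J(v)$ if $\operatorname{ess\,sup}_{x\in\Omega}T(x,\nabla v(x))\le 1$ and $J_\infty(v)=+\infty$ otherwise. The symbol $\min J_\infty$ denotes the minimum of $J_\infty$ over $g+W_0^{1,s}(\Omega;\mathbb{R}^m)$ and $\min J_p$ denotes the minimum of $J_p$ over $g+W_0^{1,p}(\Omega;\mathbb{R}^m)$. Minimizers $u_p$ exist under the stated hypotheses by the direct method.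
   Formalization: Zero boundary values are taken as W^{1,p}∩W_0^{1,1} for every p (the usual W_0^{1,p} on Lipschitz domains), and compactness of u_p in C^α is claimed when g is in C^α, otherwise for u_p−g; on arbitrary bounded domains the literal claims fail. *)

theory Defs
  imports "HOL-Analysis.Analysis" "HOL-Probability.Essential_Supremum"
begin

(* R^N is real^'n, R^m is real^'m, and R^(m x N) is real^'n^'m, whose library norm is the
   Frobenius norm. Sobolev functions are represented by total functions on R^N, of which only the
   values on Omega, up to null sets, matter. *)

fun C_k :: "nat \<Rightarrow> (real^'n \<Rightarrow> real) \<Rightarrow> bool" where
  "C_k 0 f \<longleftrightarrow> continuous_on UNIV f"
| "C_k (Suc k) f \<longleftrightarrow> (\<forall>x. f differentiable (at x)) \<and>
     (\<forall>i. C_k k (\<lambda>x. frechet_derivative f (at x) (axis i 1)))"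

definition test_function :: "(real^'n) set \<Rightarrow> (real^'n \<Rightarrow> real) \<Rightarrow> bool" where
  "test_function \<Omega> \<phi> \<longleftrightarrow>
     (\<forall>k. C_k k \<phi>) \<and> compact (closure {x. \<phi> x \<noteq> 0}) \<and> closure {x. \<phi> x \<noteq> 0} \<subseteq> \<Omega>"

definition test_map :: "(real^'n) set \<Rightarrow> (real^'n \<Rightarrow> real^'m) \<Rightarrow> bool" where
  "test_map \<Omega> \<phi> \<longleftrightarrow> (\<forall>k. test_function \<Omega> (\<lambda>x. \<phi> x $ k))"

definition locally_integrable ::
  "(real^'n) set \<Rightarrow> (real^'n \<Rightarrow> 'b::euclidean_space) \<Rightarrow> bool" where
  "locally_integrable \<Omega> f \<longleftrightarrow> (\<forall>K. compact K \<and> K \<subseteq> \<Omega> \<longrightarrow> integrable (lebesgue_on K) f)"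

definition weak_gradient ::
  "(real^'n) set \<Rightarrow> (real^'n \<Rightarrow> real^'m) \<Rightarrow> (real^'n \<Rightarrow> real^'n^'m) \<Rightarrow> bool" where
  "weak_gradient \<Omega> u G \<longleftrightarrow> locally_integrable \<Omega> u \<and> locally_integrable \<Omega> G \<and>
     (\<forall>\<phi> k i. test_function \<Omega> \<phi> \<longrightarrow>
        (LINT x|lebesgue_on \<Omega>. u x $ k * frechet_derivative \<phi> (at x) (axis i 1)) =
        - (LINT x|lebesgue_on \<Omega>. G x $ k $ i * \<phi> x))"

(* A representative; weak gradients are unique up to null sets. *)
definition wgrad ::
  "(real^'n) set \<Rightarrow> (real^'n \<Rightarrow> real^'m) \<Rightarrow> real^'n \<Rightarrow> real^'n^'m" where
  "wgrad \<Omega> u = (SOME G. weak_gradient \<Omega> u G)"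

definition Lp_norm :: "ereal \<Rightarrow> (real^'n) set \<Rightarrow> (real^'n \<Rightarrow> 'b::euclidean_space) \<Rightarrow> ereal" where
  "Lp_norm p \<Omega> f =
     (if p = \<infinity> then esssup (lebesgue_on \<Omega>) (\<lambda>x. ereal (norm (f x)))
      else let I = (\<integral>\<^sup>+x. ennreal (norm (f x) powr real_of_ereal p) \<partial>lebesgue_on \<Omega>)
           in if I = \<infinity> then \<infinity> else ereal (enn2real I powr (1 / real_of_ereal p)))"

definition Lp :: "ereal \<Rightarrow> (real^'n) set \<Rightarrow> (real^'n \<Rightarrow> 'b::euclidean_space) set" where
  "Lp p \<Omega> = {f. f \<in> borel_measurable (lebesgue_on \<Omega>) \<and> Lp_norm p \<Omega> f < \<infinity>}"

definition W1 :: "ereal \<Rightarrow> (real^'n) set \<Rightarrow> (real^'n \<Rightarrow> real^'m) set" where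
  "W1 p \<Omega> = {u. u \<in> Lp p \<Omega> \<and> (\<exists>G. weak_gradient \<Omega> u G \<and> G \<in> Lp p \<Omega>)}"

definition W1_norm :: "ereal \<Rightarrow> (real^'n) set \<Rightarrow> (real^'n \<Rightarrow> real^'m) \<Rightarrow> ereal" where
  "W1_norm p \<Omega> u = Lp_norm p \<Omega> u + Lp_norm p \<Omega> (wgrad \<Omega> u)"

(* Zero boundary values are those of W_0^{1,1}, the W^{1,1}-closure of the smooth compactly
   supported maps, for every exponent: W_0^{1,p} = W^{1,p} \<inter> W_0^{1,1} for 1 \<le> p \<le> \<infinity>.
   For p = \<infinity> this is the usual definition in the calculus of variations. For p < \<infinity> and a
   Lipschitz domain it is the W^{1,p}-closure of the smooth compactly supported maps. On an arbitrary
   bounded domain it can be larger than that closure: in the punctured disc the closure imposes a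
   value at the puncture exactly when p > 2. The closures for different p are then incompatible,
   and a map with bounded gradient that lies in the closure for s need not lie in that for p. *)
definition W1_0 :: "ereal \<Rightarrow> (real^'n) set \<Rightarrow> (real^'n \<Rightarrow> real^'m) set" where
  "W1_0 p \<Omega> = {u \<in> W1 p \<Omega>. u \<in> W1 1 \<Omega> \<and>
     (\<exists>\<phi>. (\<forall>n::nat. test_map \<Omega> (\<phi> n)) \<and>
          (\<lambda>n. W1_norm 1 \<Omega> (\<lambda>x. \<phi> n x - u x)) \<longlonglongrightarrow> 0)}"

definition affine_W1_0 ::
  "(real^'n \<Rightarrow> real^'m) \<Rightarrow> ereal \<Rightarrow> (real^'n) set \<Rightarrow> (real^'n \<Rightarrow> real^'m) set" where
  "affine_W1_0 g p \<Omega> = {v. (\<lambda>x. v x - g x) \<in> W1_0 p \<Omega>}"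

definition W1_dual ::
  "ereal \<Rightarrow> (real^'n) set \<Rightarrow> ((real^'n \<Rightarrow> real^'m) \<Rightarrow> real) \<Rightarrow> bool" where
  "W1_dual p \<Omega> L \<longleftrightarrow>
     (\<forall>v\<in>W1 p \<Omega>. \<forall>w\<in>W1 p \<Omega>. L (\<lambda>x. v x + w x) = L v + L w) \<and>
     (\<forall>c. \<forall>v\<in>W1 p \<Omega>. L (\<lambda>x. c *\<^sub>R v x) = c * L v) \<and>
     (\<exists>C::real. \<forall>v\<in>W1 p \<Omega>. ereal \<bar>L v\<bar> \<le> ereal C * W1_norm p \<Omega> v)"

definition W1_weak_conv ::
  "ereal \<Rightarrow> (real^'n) set \<Rightarrow> (nat \<Rightarrow> real^'n \<Rightarrow> real^'m) \<Rightarrow> (real^'n \<Rightarrow> real^'m) \<Rightarrow> bool" where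
  "W1_weak_conv p \<Omega> v w \<longleftrightarrow> (\<forall>n. v n \<in> W1 p \<Omega>) \<and> w \<in> W1 p \<Omega> \<and>
     (\<forall>L. W1_dual p \<Omega> L \<longrightarrow> (\<lambda>n. L (v n)) \<longlonglongrightarrow> L w)"

definition weakly_seq_lsc ::
  "ereal \<Rightarrow> (real^'n) set \<Rightarrow> ((real^'n \<Rightarrow> real^'m) \<Rightarrow> ereal) \<Rightarrow> bool" where
  "weakly_seq_lsc p \<Omega> J \<longleftrightarrow>
     (\<forall>v w. W1_weak_conv p \<Omega> v w \<longrightarrow> J w \<le> liminf (\<lambda>n. J (v n)))"

(* J depends only on the almost-everywhere class of its argument. *)
definition respects_AE ::
  "ereal \<Rightarrow> (real^'n) set \<Rightarrow> ((real^'n \<Rightarrow> real^'m) \<Rightarrow> ereal) \<Rightarrow> bool" where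
  "respects_AE p \<Omega> J \<longleftrightarrow>
     (\<forall>v\<in>W1 p \<Omega>. \<forall>w\<in>W1 p \<Omega>. (AE x in lebesgue_on \<Omega>. v x = w x) \<longrightarrow> J v = J w)"

definition bounded_domain :: "(real^'n) set \<Rightarrow> bool" where
  "bounded_domain \<Omega> \<longleftrightarrow> open \<Omega> \<and> connected \<Omega> \<and> bounded \<Omega> \<and> \<Omega> \<noteq> {}"

definition caratheodory_function ::
  "(real^'n) set \<Rightarrow> (real^'n \<Rightarrow> real^'n^'m \<Rightarrow> real) \<Rightarrow> bool" where
  "caratheodory_function \<Omega> T \<longleftrightarrow>
     (\<forall>\<xi>. (\<lambda>x. T x \<xi>) \<in> borel_measurable (lebesgue_on \<Omega>)) \<and>
     (AE x in lebesgue_on \<Omega>. continuous_on UNIV (T x))"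

definition quasiconvex ::
  "(real^'n) set \<Rightarrow> (real^'n \<Rightarrow> real^'n^'m \<Rightarrow> real) \<Rightarrow> bool" where
  "quasiconvex \<Omega> T \<longleftrightarrow>
     (AE x0 in lebesgue_on \<Omega>. \<forall>\<xi>0. \<forall>D. \<forall>\<phi>. bounded_domain D \<and> \<phi> \<in> W1_0 \<infinity> D \<longrightarrow>
        T x0 \<xi>0 \<le> 1 / measure lebesgue D * (LINT x|lebesgue_on D. T x0 (\<xi>0 + wgrad D \<phi> x)))"

definition J_pow ::
  "((real^'n \<Rightarrow> real^'m) \<Rightarrow> ereal) \<Rightarrow> (real^'n \<Rightarrow> real^'n^'m \<Rightarrow> real) \<Rightarrow> (real^'n) set \<Rightarrow> real \<Rightarrow> real \<Rightarrow>
   (real^'n \<Rightarrow> real^'m) \<Rightarrow> ereal" where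
  "J_pow J T \<Omega> r p v =
     J v + ereal (r / p) *
       enn2ereal (\<integral>\<^sup>+x. ennreal (T x (wgrad \<Omega> v x) powr (p / r)) \<partial>lebesgue_on \<Omega>)"

definition sup_constraint ::
  "(real^'n \<Rightarrow> real^'n^'m \<Rightarrow> real) \<Rightarrow> (real^'n) set \<Rightarrow> (real^'n \<Rightarrow> real^'m) \<Rightarrow> bool" where
  "sup_constraint T \<Omega> v \<longleftrightarrow> esssup (lebesgue_on \<Omega>) (\<lambda>x. ereal (T x (wgrad \<Omega> v x))) \<le> 1"

definition J_infty ::
  "((real^'n \<Rightarrow> real^'m) \<Rightarrow> ereal) \<Rightarrow> (real^'n \<Rightarrow> real^'n^'m \<Rightarrow> real) \<Rightarrow> (real^'n) set \<Rightarrow>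
   (real^'n \<Rightarrow> real^'m) \<Rightarrow> ereal" where
  "J_infty J T \<Omega> v = (if sup_constraint T \<Omega> v then J v else \<infinity>)"

(* The continuous extension to the closure of the domain is unique when it exists. *)
definition continuous_representative ::
  "(real^'n) set \<Rightarrow> (real^'n \<Rightarrow> real^'m) \<Rightarrow> (real^'n \<Rightarrow> real^'m) \<Rightarrow> bool" where
  "continuous_representative \<Omega> v h \<longleftrightarrow>
     continuous_on (closure \<Omega>) h \<and> (AE x in lebesgue_on \<Omega>. h x = v x)"

definition holder_norm :: "real \<Rightarrow> (real^'n) set \<Rightarrow> (real^'n \<Rightarrow> real^'m) \<Rightarrow> ereal" where
  "holder_norm \<alpha> S f =
     (SUP x\<in>S. ereal (norm (f x))) +
     (SUP (x, y)\<in>{(x, y). x \<in> S \<and> y \<in> S \<and> x \<noteq> y}. ereal (norm (f x - f y) / dist x y powr \<alpha>))"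

definition holder_space :: "real \<Rightarrow> (real^'n) set \<Rightarrow> (real^'n \<Rightarrow> real^'m) set" where
  "holder_space \<alpha> S = {f. holder_norm \<alpha> S f < \<infinity>}"

(* Relative compactness of the net (v p), p in I, p tending to infinity: every sequence of indices
   in I that tends to infinity has a subsequence along which v converges in C^alpha. Nothing is
   claimed about sequences of indices that stay bounded. *)
definition holder_relatively_compact_net ::
  "real \<Rightarrow> (real^'n) set \<Rightarrow> real set \<Rightarrow> (real \<Rightarrow> real^'n \<Rightarrow> real^'m) \<Rightarrow> bool" where
  "holder_relatively_compact_net \<alpha> \<Omega> I v \<longleftrightarrow>
     (\<exists>h. (\<forall>p\<in>I. continuous_representative \<Omega> (v p) (h p) \<and> h p \<in> holder_space \<alpha> (closure \<Omega>)) \<and>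
       (\<forall>P::nat \<Rightarrow> real. range P \<subseteq> I \<and> filterlim P at_top sequentially \<longrightarrow>
          (\<exists>\<rho> w. strict_mono (\<rho>::nat \<Rightarrow> nat) \<and> w \<in> holder_space \<alpha> (closure \<Omega>) \<and>
             (\<lambda>k. holder_norm \<alpha> (closure \<Omega>) (\<lambda>x. h (P (\<rho> k)) x - w x)) \<longlonglongrightarrow> 0)))"

definition uniform_cluster_point ::
  "(real^'n) set \<Rightarrow> (real \<Rightarrow> real^'n \<Rightarrow> real^'m) \<Rightarrow> (real^'n \<Rightarrow> real^'m) \<Rightarrow> bool" where
  "uniform_cluster_point \<Omega> u w \<longleftrightarrow> continuous_on (closure \<Omega>) w \<and>
     (\<forall>\<epsilon>>0. \<exists>\<^sub>F p in at_top. \<exists>h. continuous_representative \<Omega> (u p) h \<and>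
        (\<forall>x\<in>closure \<Omega>. dist (h x) (w x) < \<epsilon>))"

end

theory Submission
  imports Defs "HOL-Complex_Analysis.Great_Picard"
begin

text \<open>Comparing \<open>u p\<close> with \<open>g\<close> bounds the integral of \<open>T (\<nabla>u p) powr (p / r)\<close> by a
  multiple of \<open>p\<close>. Hence the gradients are bounded in every \<open>L\<^sup>q\<close>, uniformly in \<open>p \<ge> q\<close>, and the part of
  \<open>T (\<nabla>u p)\<close> above any level \<open>l > 1\<close> vanishes in the mean. Morrey's inequality for the extension of
  \<open>u p - g\<close> by zero and the Arzela-Ascoli theorem give compactness.

  Suppose that a limit \<open>u\<close> violates \<open>T (\<nabla>u) \<le> 1\<close> on a set of positive measure. A piece of this
  set on which \<open>\<nabla>u\<close> and \<open>T x\<close> are nearly constant fills a suitable domain \<open>D\<close> up to a small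
  proportion. Quasiconvexity on \<open>D\<close>, tested with a cut-off of the mollified difference \<open>u p - u\<close>,
  bounds \<open>T (\<nabla>u)\<close> there by the mean of \<open>T (\<nabla>u p)\<close> up to small errors, a contradiction.

  Mazur's lemma, with iterated midpoints in place of convex combinations, identifies the weak limits, so
  that \<open>J\<close> is lower semicontinuous along the sequence. Conversely the gradient of a feasible \<open>v\<close> is
  bounded, so \<open>v\<close> competes for every \<open>p\<close> at a cost of at most \<open>J v + r / p * measure \<Omega>\<close>.\<close>

section \<open>Test functions and mollification on the whole space\<close>

subsection \<open>Smooth functions\<close>

text \<open>The domain \<Omega> carries no boundary regularity, and this shapes the proof. Zero
  boundary values are those of W^{1,1}, so the zero extension of u p - g is weakly differentiable on
  the whole space, and a feasible map can pass between the exponents s and p. But g need not be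
  Hoelder up to an irregular boundary, hence the compactness of u p - g and not of u p.

  The energy grows linearly in p, while exceeding a level l > 1 costs a factor exponential in p;
  this is why the tails vanish.

  Quasiconvexity tests with maps in W^{1,\<infinity>}_0, whereas u p - u lies only in some W^{1,q}:
  hence the mollification. The gradient of the cut-off is harmless because the convergence is
  uniform.

  Weak convergence is tested with abstract functionals on W^{1,s}: a functional that fails to
  converge stays away from its limit on entire midpoint hulls, where the convergence is strong.

  The limits in (ii) concern all p, although a cluster point controls only one sequence of indices:
  a bad sequence would have a feasible cluster point with a value of J below the minimum.\<close>

definition smooth :: "(real^'n \<Rightarrow> real) \<Rightarrow> bool" where
  "smooth f \<longleftrightarrow> (\<forall>k. C_k k f)"

definition pd :: "'n \<Rightarrow> (real^'n \<Rightarrow> real) \<Rightarrow> real^'n \<Rightarrow> real" where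
  "pd i f x = frechet_derivative f (at x) (axis i 1)"

lemma pd_eqI: "(f has_derivative D) (at x) \<Longrightarrow> pd i f x = D (axis i 1)"
  unfolding pd_def using frechet_derivative_at by metis

lemma frechet_derivative_worksI:
  "f differentiable (at x) \<Longrightarrow> (f has_derivative frechet_derivative f (at x)) (at x)"
  using frechet_derivative_works by blast

lemma C_k_Suc_D: "C_k (Suc k) f \<Longrightarrow> C_k k f"
proof (induction k arbitrary: f)
  case 0
  then show ?case
    by (auto intro!: differentiable_imp_continuous_on simp: differentiable_on_def)
qed auto

lemma C_k_Suc_iff:
  "C_k (Suc k) f \<longleftrightarrow> (\<forall>x. f differentiable (at x)) \<and> (\<forall>i. C_k k (pd i f))"
  by (simp add: pd_def[abs_def])

declare C_k.simps(2) [simp del]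

lemma C_k_add: "C_k k f \<Longrightarrow> C_k k g \<Longrightarrow> C_k k (\<lambda>x. f x + g x)"
proof (induction k arbitrary: f g)
  case 0
  then show ?case by (auto intro: continuous_intros)
next
  case (Suc k)
  have "pd i (\<lambda>x. f x + g x) = (\<lambda>x. pd i f x + pd i g x)" for i
  proof
    fix x
    have "(f has_derivative frechet_derivative f (at x)) (at x)" "(g has_derivative frechet_derivative g (at x)) (at x)"
      using Suc.prems unfolding C_k_Suc_iff by (auto dest: frechet_derivative_worksI)
    from has_derivative_add[OF this] show "pd i (\<lambda>x. f x + g x) x = pd i f x + pd i g x"
      by (subst pd_eqI) (auto simp: pd_def)
  qed
  then show ?case using Suc by (auto simp: C_k_Suc_iff)
qed

lemma C_k_mult: "C_k k f \<Longrightarrow> C_k k g \<Longrightarrow> C_k k (\<lambda>x. f x * g x)"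
proof (induction k arbitrary: f g)
  case 0
  then show ?case by (auto intro: continuous_intros)
next
  case (Suc k)
  have eq: "pd i (\<lambda>x. f x * g x) = (\<lambda>x. f x * pd i g x + pd i f x * g x)" for i
  proof
    fix x
    have "(f has_derivative frechet_derivative f (at x)) (at x)" "(g has_derivative frechet_derivative g (at x)) (at x)"
      using Suc.prems unfolding C_k_Suc_iff by (auto dest: frechet_derivative_worksI)
    from has_derivative_mult[OF this] show "pd i (\<lambda>x. f x * g x) x = f x * pd i g x + pd i f x * g x"
      by (subst pd_eqI) (auto simp: pd_def)
  qed
  have "C_k k f" "C_k k g" using Suc.prems C_k_Suc_D by auto
  then show ?case using Suc unfolding C_k_Suc_iff eq
    by (auto intro!: C_k_add)
qed

lemma C_k_const: "C_k k (\<lambda>x::real^'n. c)"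
proof (induction k arbitrary: c)
  case (Suc k)
  have "pd i (\<lambda>x. c) = (\<lambda>x. 0)" for i :: 'n
    by (rule ext, subst pd_eqI[OF has_derivative_const]) auto
  then show ?case using Suc by (auto simp: C_k_Suc_iff)
qed auto

lemma C_k_inner: "C_k k (\<lambda>x. x \<bullet> a)"
proof (cases k)
  case (Suc k')
  have "pd i (\<lambda>x. x \<bullet> a) = (\<lambda>x. axis i 1 \<bullet> a)" for i
    by (rule ext, rule pd_eqI) (auto intro!: derivative_eq_intros)
  then show ?thesis using C_k_const by (auto simp: Suc C_k_Suc_iff)
qed (auto intro: continuous_intros)

lemma smooth_add: "smooth f \<Longrightarrow> smooth g \<Longrightarrow> smooth (\<lambda>x. f x + g x)"
  and smooth_mult: "smooth f \<Longrightarrow> smooth g \<Longrightarrow> smooth (\<lambda>x. f x * g x)"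
  and smooth_const: "smooth (\<lambda>x. c)"
  by (auto simp: smooth_def C_k_add C_k_mult C_k_const)

lemma smooth_cmult: "smooth f \<Longrightarrow> smooth (\<lambda>x. c * f x)"
  using smooth_mult[OF smooth_const] by auto

lemma smooth_pd: "smooth f \<Longrightarrow> smooth (pd i f)"
  unfolding smooth_def by (meson C_k_Suc_iff)

lemma smooth_continuous: "smooth f \<Longrightarrow> continuous_on UNIV f"
  unfolding smooth_def by (metis C_k.simps(1))

lemma smooth_differentiable: "smooth f \<Longrightarrow> f differentiable (at x)"
  unfolding smooth_def by (meson C_k_Suc_iff)

definition grad :: "(real^'n \<Rightarrow> real) \<Rightarrow> real^'n \<Rightarrow> real^'n" where
  "grad f x = (\<chi> i. pd i f x)"

lemma differentiable_grad:
  assumes "f differentiable (at x)"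
  shows "(f has_derivative (\<lambda>h. grad f x \<bullet> h)) (at x)"
proof -
  have D: "(f has_derivative frechet_derivative f (at x)) (at x)"
    using assms frechet_derivative_works by blast
  interpret D: linear "frechet_derivative f (at x)"
    using has_derivative_linear[OF D] .
  have "frechet_derivative f (at x) h = grad f x \<bullet> h" for h
  proof -
    have "frechet_derivative f (at x) h = frechet_derivative f (at x) (\<Sum>i\<in>UNIV. h $ i *\<^sub>R axis i 1)"
      by (metis basis_expansion scalar_mult_eq_scaleR)
    also have "\<dots> = grad f x \<bullet> h"
      by (simp add: D.sum D.scale grad_def pd_def inner_vec_def mult.commute)
    finally show ?thesis .
  qed
  then have "frechet_derivative f (at x) = (\<lambda>h. grad f x \<bullet> h)" by auto
  then show ?thesis using D by simp
qed

lemma smooth_has_derivative: "smooth f \<Longrightarrow> (f has_derivative (\<lambda>h. grad f x \<bullet> h)) (at x)"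
  using differentiable_grad smooth_differentiable by blast

lemma pd_add: "smooth f \<Longrightarrow> smooth g \<Longrightarrow> pd i (\<lambda>x. f x + g x) x = pd i f x + pd i g x"
  by (subst pd_eqI[OF has_derivative_add[OF smooth_has_derivative smooth_has_derivative]])
     (auto simp: grad_def inner_axis)

lemma pd_mult: "smooth f \<Longrightarrow> smooth g \<Longrightarrow> pd i (\<lambda>x. f x * g x) x = f x * pd i g x + pd i f x * g x"
  by (subst pd_eqI[OF has_derivative_mult[OF smooth_has_derivative smooth_has_derivative]])
     (auto simp: grad_def inner_axis)

lemma pd_cmult: "smooth f \<Longrightarrow> pd i (\<lambda>x. c * f x) x = c * pd i f x"
  by (subst pd_eqI[OF has_derivative_mult_right[OF smooth_has_derivative]])
     (auto simp: grad_def inner_axis)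

lemma continuous_grad: "smooth f \<Longrightarrow> continuous_on UNIV (grad f)"
  unfolding grad_def[abs_def] using smooth_continuous[OF smooth_pd]
  by (intro continuous_on_vec_lambda) auto

subsection \<open>A smooth bump\<close>

text \<open>The factor t ^ j makes the family closed under differentiation: the derivative of
  \<open>eta j\<close> is \<open>eta (j + 2) - j * eta (j + 1)\<close>. Smoothness is then an
  induction over the order of differentiation with j left free, in place of a formula for the higher
  derivatives of exp (-1/t).\<close>

definition eta :: "nat \<Rightarrow> real \<Rightarrow> real" where
  "eta j t = (if t \<le> 0 then 0 else exp (- (1/t)) / t ^ j)"

lemma eta_nonneg: "eta j t \<ge> 0" by (auto simp: eta_def)

text \<open>The term of degree j + 2 in the series of exp (1/t) bounds exp (1/t) from below. The
  square on the right makes the difference quotients at 0 tend to 0.\<close>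

lemma eta_le: "eta j t \<le> fact (j + 2) * t\<^sup>2"
proof (cases "t \<le> 0")
  case False
  then have t: "t > 0" by simp
  have "(1/t) ^ (j + 2) / fact (j + 2) \<le> exp (1/t)"
    using sum_le_suminf[OF summable_exp_generic[of "1/t"], of "{j+2}"] t
    by (simp add: exp_def divideR_right field_simps del: fact_Suc)
  then have "1 / (t ^ (j+2) * fact (j+2)) \<le> exp (1/t)"
    by (simp add: power_divide del: fact_Suc power_Suc)
  then have "1 \<le> exp (1/t) * (t ^ (j+2) * fact (j+2))"
    using t by (subst (asm) pos_divide_le_eq) (auto simp del: fact_Suc power_Suc)
  then have "exp (- (1/t)) \<le> t ^ (j+2) * fact (j+2)"
    by (simp add: exp_minus field_simps del: fact_Suc power_Suc)
  then have "exp (- (1/t)) / t ^ j \<le> t ^ (j+2) * fact (j+2) / t ^ j"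
    using t by (intro divide_right_mono) auto
  also have "\<dots> = fact (j+2) * t\<^sup>2" using t by (simp add: power_add power2_eq_square del: fact_Suc)
  finally show ?thesis using t by (simp add: eta_def del: fact_Suc)
qed (auto simp: eta_def)

lemma eta_has_derivative:
  "(eta j has_field_derivative (eta (j + 2) t - real j * eta (j + 1) t)) (at t)"
proof -
  consider "t < 0" | "t = 0" | "t > 0" by linarith
  then show ?thesis
  proof cases
    case 1
    have "((\<lambda>t. 0) has_field_derivative 0) (at t)" by simp
    then have "(eta j has_field_derivative 0) (at t)"
      by (rule has_field_derivative_transform_within_open[of _ _ _ "{..<0}"]) (use 1 in \<open>auto simp: eta_def\<close>)
    then show ?thesis using 1 by (simp add: eta_def)
  next
    case 2
    have "((\<lambda>h. (eta j h - eta j 0) / h) \<longlongrightarrow> 0) (at 0)"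
    proof (rule tendsto_0_le[where K = 1 and f = "\<lambda>h. fact (j + 2) * h"])
      show "((\<lambda>h. fact (j + 2) * h) \<longlongrightarrow> 0) (at (0::real))"
        by (intro tendsto_mult_right_zero) auto
      have "norm ((eta j h - eta j 0) / h) \<le> norm (fact (j + 2) * h) * 1" if "h \<noteq> 0" for h
      proof -
        have "\<bar>eta j h\<bar> / \<bar>h\<bar> \<le> (fact (j+2) * h\<^sup>2) / \<bar>h\<bar>"
          using eta_le[of j h] eta_nonneg[of j h] by (intro divide_right_mono) auto
        also have "\<dots> = fact (j+2) * \<bar>h\<bar>"
          using that by (cases "h > 0") (simp_all add: power2_eq_square del: fact_Suc)
        finally show ?thesis by (simp add: eta_def abs_mult)
      qed
      then show "\<forall>\<^sub>F h in at 0. norm ((eta j h - eta j 0) / h) \<le> norm (fact (j + 2) * h) * 1"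
        by (auto simp: eventually_at_filter)
    qed
    then have "(eta j has_field_derivative 0) (at 0)"
      by (simp add: has_field_derivative_iff)
    then show ?thesis using 2 by (simp add: eta_def)
  next
    case 3
    have "((\<lambda>t. exp (- (1/t)) / t ^ j) has_field_derivative
            (exp (- (1/t)) / t ^ (j+2) - real j * (exp (- (1/t)) / t ^ (j+1)))) (at t)"
    proof -
      have "((\<lambda>t. exp (- (1/t))) has_field_derivative exp (- (1/t)) / t\<^sup>2) (at t)"
        using 3 by (auto intro!: derivative_eq_intros simp: power2_eq_square)
      moreover have "t ^ j \<noteq> 0" using 3 by simp
      ultimately have "((\<lambda>t. exp (- (1/t)) / t ^ j) has_field_derivative
          (exp (- (1/t)) / t\<^sup>2 * t ^ j - exp (- (1/t)) * (real j * t ^ (j - Suc 0))) / (t ^ j * t ^ j)) (at t)"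
        using DERIV_divide[OF _ DERIV_pow[of j]] by blast
      moreover have "(exp (- (1/t)) / t\<^sup>2 * t ^ j - exp (- (1/t)) * (real j * t ^ (j - Suc 0))) / (t ^ j * t ^ j)
          = exp (- (1/t)) / t ^ (j+2) - real j * (exp (- (1/t)) / t ^ (j+1))"
        using 3 by (cases j) (simp_all add: field_simps power2_eq_square)
      ultimately show ?thesis by simp
    qed
    then have "(eta j has_field_derivative (exp (- (1/t)) / t ^ (j+2) - real j * (exp (- (1/t)) / t ^ (j+1)))) (at t)"
      by (rule has_field_derivative_transform_within_open[of _ _ _ "{0<..}"]) (use 3 in \<open>auto simp: eta_def\<close>)
    then show ?thesis using 3 by (simp add: eta_def)
  qed
qed

text \<open>The inner function e - x \<bullet> x is quadratic, so each partial derivative is a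
  linear factor times members of the same family, and the induction closes.\<close>

lemma smooth_eta: "smooth (\<lambda>x::real^'n. eta j (e - x \<bullet> x))"
proof -
  have "C_k k (\<lambda>x::real^'n. eta j (e - x \<bullet> x))" for k
  proof (induction k arbitrary: j)
    case 0
    have "continuous_on UNIV (eta j)"
      by (meson DERIV_continuous_on eta_has_derivative has_field_derivative_at_within)
    then have "continuous_on UNIV (eta j \<circ> (\<lambda>x::real^'n. e - x \<bullet> x))"
      by (intro continuous_on_compose continuous_intros) (auto intro: continuous_on_subset)
    then show ?case by (simp add: o_def)
  next
    case (Suc k)
    have D: "((\<lambda>x::real^'n. eta j (e - x \<bullet> x)) has_derivative
       (\<lambda>h. (- 2 * (x \<bullet> h)) * (eta (j + 2) (e - x \<bullet> x) - real j * eta (j + 1) (e - x \<bullet> x)))) (at x)" for x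
    proof -
      have "((\<lambda>x::real^'n. e - x \<bullet> x) has_derivative (\<lambda>h. - 2 * (x \<bullet> h))) (at x)"
        by (auto intro!: derivative_eq_intros simp: inner_commute)
      from has_derivative_compose[OF this eta_has_derivative[unfolded has_field_derivative_def]]
      show ?thesis by (simp add: mult.commute)
    qed
    have eq: "pd i (\<lambda>x::real^'n. eta j (e - x \<bullet> x)) =
      (\<lambda>x. (- 2 * (x \<bullet> axis i 1)) * (eta (j + 2) (e - x \<bullet> x) + (- real j) * eta (j + 1) (e - x \<bullet> x)))" for i
      by (rule ext, subst pd_eqI[OF D]) auto
    have "C_k k (\<lambda>x::real^'n. (- 2 * (x \<bullet> axis i 1)) * (eta (j + 2) (e - x \<bullet> x) + (- real j) * eta (j + 1) (e - x \<bullet> x)))" for i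
      by (intro C_k_mult C_k_add C_k_const C_k_inner Suc.IH)
    then show ?case unfolding C_k_Suc_iff eq
      using D unfolding differentiable_def by blast
  qed
  then show ?thesis by (simp add: smooth_def)
qed

subsection \<open>Test functions\<close>

text \<open>Any compact set that carries \<open>\<phi>\<close> will do, so later constructions can
  exhibit one without computing the closure of the support.\<close>

lemma test_function_iff:
  "test_function \<Omega> \<phi> \<longleftrightarrow> smooth \<phi> \<and> (\<exists>K. compact K \<and> K \<subseteq> \<Omega> \<and> (\<forall>x. x \<notin> K \<longrightarrow> \<phi> x = 0))"
proof
  assume "test_function \<Omega> \<phi>"
  then show "smooth \<phi> \<and> (\<exists>K. compact K \<and> K \<subseteq> \<Omega> \<and> (\<forall>x. x \<notin> K \<longrightarrow> \<phi> x = 0))"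
    unfolding test_function_def smooth_def
    using closure_subset[of "{x. \<phi> x \<noteq> 0}"]
    by (intro conjI exI[of _ "closure {x. \<phi> x \<noteq> 0}"]) auto
next
  assume *: "smooth \<phi> \<and> (\<exists>K. compact K \<and> K \<subseteq> \<Omega> \<and> (\<forall>x. x \<notin> K \<longrightarrow> \<phi> x = 0))"
  then obtain K where K: "compact K" "K \<subseteq> \<Omega>" "\<And>x. x \<notin> K \<Longrightarrow> \<phi> x = 0" by blast
  have "{x. \<phi> x \<noteq> 0} \<subseteq> K" using K(3) by auto
  then have "closure {x. \<phi> x \<noteq> 0} \<subseteq> K"
    using K(1) by (simp add: closure_minimal compact_imp_closed)
  then show "test_function \<Omega> \<phi>"
    using * K compact_Int_closed[OF K(1), of "closure {x. \<phi> x \<noteq> 0}"] unfolding test_function_def smooth_def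
    by (auto simp: Int_absorb1)
qed

lemma test_function_smooth: "test_function \<Omega> \<phi> \<Longrightarrow> smooth \<phi>"
  by (simp add: test_function_iff)

lemma test_function_mono: "test_function \<Omega> \<phi> \<Longrightarrow> \<Omega> \<subseteq> \<Omega>' \<Longrightarrow> test_function \<Omega>' \<phi>"
  unfolding test_function_def by auto

lemma test_function_support:
  assumes "test_function \<Omega> \<phi>"
  shows "\<exists>K. compact K \<and> K \<subseteq> \<Omega> \<and> (\<forall>x. x \<notin> K \<longrightarrow> \<phi> x = 0) \<and> (\<forall>x i. x \<notin> K \<longrightarrow> pd i \<phi> x = 0)"
proof -
  obtain K where K: "compact K" "K \<subseteq> \<Omega>" "\<forall>x. x \<notin> K \<longrightarrow> \<phi> x = 0"
    using assms test_function_iff by metis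
  have "pd i \<phi> x = 0" if "x \<notin> K" for x i
  proof -
    have "((\<lambda>x. 0::real) has_derivative (\<lambda>h. 0)) (at x)" by simp
    then have "(\<phi> has_derivative (\<lambda>h. 0)) (at x)"
      by (rule has_derivative_transform_within_open[of _ _ _ _ "- K"])
        (use K that in \<open>auto simp: compact_imp_closed open_Compl\<close>)
    then show ?thesis by (rule pd_eqI)
  qed
  with K show ?thesis by blast
qed

lemma test_function_pd: "test_function \<Omega> \<phi> \<Longrightarrow> test_function \<Omega> (pd i \<phi>)"
proof -
  assume \<phi>: "test_function \<Omega> \<phi>"
  obtain K where K: "compact K" "K \<subseteq> \<Omega>" "\<And>x. x \<notin> K \<Longrightarrow> \<phi> x = 0" "\<And>x i. x \<notin> K \<Longrightarrow> pd i \<phi> x = 0"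
    using test_function_support[OF \<phi>] by auto
  show ?thesis unfolding test_function_iff
    using smooth_pd[OF test_function_smooth[OF \<phi>]] K by (intro conjI exI[of _ K] allI impI)
qed

lemma test_function_mult: "test_function \<Omega> \<phi> \<Longrightarrow> smooth f \<Longrightarrow> test_function \<Omega> (\<lambda>x. \<phi> x * f x)"
  unfolding test_function_iff using smooth_mult[of \<phi> f] by auto

lemma test_function_add:
  assumes "test_function \<Omega> f" "test_function \<Omega> g" shows "test_function \<Omega> (\<lambda>x. f x + g x)"
proof -
  obtain K where K: "compact K" "K \<subseteq> \<Omega>" "\<forall>x. x \<notin> K \<longrightarrow> f x = 0" using assms(1) test_function_iff by metis
  obtain L where L: "compact L" "L \<subseteq> \<Omega>" "\<forall>x. x \<notin> L \<longrightarrow> g x = 0" using assms(2) test_function_iff by metis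
  have "smooth (\<lambda>x. f x + g x)" using assms by (intro smooth_add test_function_smooth)
  moreover have "compact (K \<union> L) \<and> K \<union> L \<subseteq> \<Omega> \<and> (\<forall>x. x \<notin> K \<union> L \<longrightarrow> f x + g x = 0)"
    using K L by auto
  ultimately show ?thesis unfolding test_function_iff by blast
qed

lemma test_function_cmult: "test_function \<Omega> f \<Longrightarrow> test_function \<Omega> (\<lambda>x. c * f x)"
  unfolding test_function_iff using smooth_cmult[of f c] by auto

text \<open>These are convolution kernels seen as functions of the integration variable; the minus
  sign cancels the one in the weak gradient in \<open>pd_mollified\<close>.\<close>

lemma test_function_translate:
  fixes \<phi> :: "real^'n \<Rightarrow> real"
  assumes "smooth \<phi>"
  shows "smooth (\<lambda>y. \<phi> (x - y))" and "pd i (\<lambda>y. \<phi> (x - y)) y = - pd i \<phi> (x - y)"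
proof -
  have D: "((\<lambda>y. f (x - y)) has_derivative (\<lambda>h. - (grad f (x - y) \<bullet> h))) (at y)" if "smooth f" for f y
  proof -
    have "((\<lambda>y. x - y) has_derivative (\<lambda>h. - h)) (at y)" by (auto intro!: derivative_eq_intros)
    from has_derivative_compose[OF this smooth_has_derivative[OF that]] show ?thesis by simp
  qed
  have P: "pd i (\<lambda>y. f (x - y)) = (\<lambda>y. - pd i f (x - y))" if "smooth f" for f i
    by (rule ext, subst pd_eqI[OF D[OF that]]) (simp add: grad_def inner_axis)
  have "C_k k (\<lambda>y. f (x - y))" if "smooth f" for f k using that
  proof (induction k arbitrary: f)
    case 0
    then show ?case using continuous_on_compose2[OF smooth_continuous[OF 0], of UNIV "\<lambda>y. x - y"]
      by (simp add: continuous_on_diff)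
  next
    case (Suc k)
    have "C_k k (\<lambda>y. (-1) * pd i f (x - y))" for i
      using Suc smooth_pd by (intro C_k_mult C_k_const) auto
    then show ?case unfolding C_k_Suc_iff P[OF Suc.prems]
      using D[OF Suc.prems] by (auto simp: differentiable_def)
  qed
  then show "smooth (\<lambda>y. \<phi> (x - y))" using assms by (simp add: smooth_def)
  show "pd i (\<lambda>y. \<phi> (x - y)) y = - pd i \<phi> (x - y)" using P[OF assms] by meson
qed

text \<open>Two points at distance below 1 either both lie in the ball of radius R + 1, where the
  Heine-Cantor theorem applies, or both lie outside the support.\<close>

lemma uniformly_continuous_compact_support:
  fixes f :: "'a::euclidean_space \<Rightarrow> 'b::real_normed_vector"
  assumes f: "continuous_on UNIV f" and K: "compact K" "\<And>x. x \<notin> K \<Longrightarrow> f x = 0"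
  shows "uniformly_continuous_on UNIV f"
proof -
  obtain R where R: "K \<subseteq> cball 0 R" using compact_imp_bounded[OF K(1)] by (auto simp: bounded_iff subset_iff)
  have u: "uniformly_continuous_on (cball 0 (R+1)) f"
    by (rule compact_uniformly_continuous) (auto intro: continuous_on_subset[OF f])
  show ?thesis unfolding uniformly_continuous_on_def
  proof (intro allI impI)
    fix e :: real assume "e > 0"
    then obtain d where d: "d > 0" "\<And>x y. x \<in> cball 0 (R+1) \<Longrightarrow> y \<in> cball 0 (R+1) \<Longrightarrow> dist y x < d \<Longrightarrow> dist (f y) (f x) < e"
      using u unfolding uniformly_continuous_on_def by metis
    show "\<exists>d>0. \<forall>x\<in>UNIV. \<forall>x'\<in>UNIV. dist x' x < d \<longrightarrow> dist (f x') (f x) < e"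
    proof (intro exI[of _ "min d 1"] conjI ballI impI)
      fix x y :: 'a assume yx: "dist y x < min d 1"
      show "dist (f y) (f x) < e"
      proof (cases "x \<in> cball 0 R \<or> y \<in> cball 0 R")
        case True
        then have "x \<in> cball 0 (R+1)" "y \<in> cball 0 (R+1)"
          using yx norm_triangle_ineq[of x "y - x"] norm_triangle_ineq[of y "x - y"]
          by (auto simp: dist_norm norm_minus_commute)
        then show ?thesis using d yx by auto
      next
        case False
        then have "f x = 0" "f y = 0" using K(2) R by blast+
        then show ?thesis using \<open>e > 0\<close> by simp
      qed
    qed (use d(1) in auto)
  qed
qed

lemma test_function_bounded:
  assumes "test_function \<Omega> \<phi>"
  obtains B where "B > 0" "\<And>x. \<bar>\<phi> x\<bar> \<le> B"
proof -
  obtain K where K: "compact K" "K \<subseteq> \<Omega>" "\<And>x. x \<notin> K \<Longrightarrow> \<phi> x = 0" "\<And>x i. x \<notin> K \<Longrightarrow> pd i \<phi> x = 0"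
    using test_function_support[OF assms] by auto
  have "compact (\<phi> ` K)" using K smooth_continuous[OF test_function_smooth[OF assms]]
    by (intro compact_continuous_image) (auto intro: continuous_on_subset)
  then obtain B where B: "B > 0" "\<forall>y\<in>\<phi> ` K. norm y \<le> B"
    by (meson bounded_pos compact_imp_bounded)
  have "\<bar>\<phi> x\<bar> \<le> B" for x using B K(3)[of x] by (cases "x \<in> K") auto
  with B(1) that show ?thesis by blast
qed

lemma test_function_borel: "test_function \<Omega> \<phi> \<Longrightarrow> \<phi> \<in> borel_measurable borel"
  by (simp add: borel_measurable_continuous_onI smooth_continuous test_function_smooth)

lemma smooth_borel: "smooth \<phi> \<Longrightarrow> \<phi> \<in> borel_measurable borel"
  by (simp add: borel_measurable_continuous_onI smooth_continuous)

lemma test_function_integrable: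
  assumes "test_function \<Omega> \<phi>" shows "integrable lborel \<phi>"
proof -
  obtain K where K: "compact K" "K \<subseteq> \<Omega>" "\<And>x. x \<notin> K \<Longrightarrow> \<phi> x = 0" "\<And>x i. x \<notin> K \<Longrightarrow> pd i \<phi> x = 0"
    using test_function_support[OF assms] by auto
  have "set_integrable lborel K \<phi>"
    using K smooth_continuous[OF test_function_smooth[OF assms]]
    by (intro borel_integrable_compact[of K \<phi>, folded set_integrable_def] ) (auto intro: continuous_on_subset)
  moreover have "(\<lambda>x. indicator K x *\<^sub>R \<phi> x) = \<phi>" using K(3) by (auto simp: indicator_def fun_eq_iff)
  ultimately show ?thesis by (simp add: set_integrable_def)
qed

subsection \<open>Change of variables and Fubini for nonnegative integrals\<close>

lemma nn_integral_lborel_affine: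
  fixes f :: "'a::euclidean_space \<Rightarrow> ennreal"
  assumes [measurable]: "f \<in> borel_measurable borel" and c: "c \<noteq> 0"
  shows "(\<integral>\<^sup>+x. f x \<partial>lborel) = ennreal (\<bar>c\<bar> ^ DIM('a)) * (\<integral>\<^sup>+x. f (t + c *\<^sub>R x) \<partial>lborel)"
  by (subst lborel_affine[OF c, of t])
     (simp add: nn_integral_density nn_integral_distr nn_integral_cmult)

lemma nn_integral_lborel_reflect:
  fixes f :: "'a::euclidean_space \<Rightarrow> ennreal"
  assumes "f \<in> borel_measurable borel"
  shows "(\<integral>\<^sup>+x. f (t - x) \<partial>lborel) = (\<integral>\<^sup>+x. f x \<partial>lborel)"
  using nn_integral_lborel_affine[OF assms, of "-1" t] by simp

lemma nn_integral_lborel_shift: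
  fixes f :: "'a::euclidean_space \<Rightarrow> ennreal"
  assumes "f \<in> borel_measurable borel"
  shows "(\<integral>\<^sup>+x. f (x - t) \<partial>lborel) = (\<integral>\<^sup>+x. f x \<partial>lborel)"
  using nn_integral_lborel_affine[OF assms, of 1 "-t"] by simp

lemma integral_lborel_shift:
  fixes f :: "'a::euclidean_space \<Rightarrow> 'b::euclidean_space"
  assumes [measurable]: "f \<in> borel_measurable borel"
  shows "(LINT x|lborel. f (x - t)) = (LINT x|lborel. f x)"
  by (subst (2) lborel_affine[of 1 "-t"]) (simp_all add: integral_distr density_1)

lemma integrable_lborel_shift:
  fixes f :: "'a::euclidean_space \<Rightarrow> 'b::euclidean_space"
  assumes f: "integrable lborel f"
  shows "integrable lborel (\<lambda>x. f (x - t))"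
proof -
  have [measurable]: "f \<in> borel_measurable borel" using f by simp
  show ?thesis using f nn_integral_lborel_shift[of "\<lambda>x. ennreal (norm (f x))" t]
    by (simp add: integrable_iff_bounded)
qed

lemma nn_integral_Fubini_lborel:
  fixes F :: "'a::euclidean_space \<Rightarrow> 'b::euclidean_space \<Rightarrow> ennreal"
  assumes "case_prod F \<in> borel_measurable (borel \<Otimes>\<^sub>M borel)"
  shows "(\<integral>\<^sup>+x. (\<integral>\<^sup>+y. F x y \<partial>lborel) \<partial>lborel) = (\<integral>\<^sup>+y. (\<integral>\<^sup>+x. F x y \<partial>lborel) \<partial>lborel)"
proof -
  have "case_prod F \<in> borel_measurable (lborel \<Otimes>\<^sub>M lborel)"
    using assms by (simp cong: measurable_cong_sets sets_pair_measure_cong)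
  from lborel_pair.Fubini'[OF this] show ?thesis by simp
qed

subsection \<open>Continuity of translations in the mean\<close>

text \<open>Stated along sequences because the base case, an open set, rests on dominated
  convergence; \<open>translation_small\<close> recovers the form with a radius.\<close>

definition translation_continuous :: "('a::euclidean_space \<Rightarrow> 'b::euclidean_space) \<Rightarrow> bool" where
  "translation_continuous f \<longleftrightarrow>
     (\<forall>z::nat \<Rightarrow> 'a. z \<longlonglongrightarrow> 0 \<longrightarrow> (\<lambda>n. \<integral>\<^sup>+x. norm (f (x - z n) - f x) \<partial>lborel) \<longlonglongrightarrow> 0)"

lemma ennreal_tendsto_0I:
  fixes a :: "nat \<Rightarrow> ennreal"
  assumes "\<And>e::real. e > 0 \<Longrightarrow> \<forall>\<^sub>F n in sequentially. a n \<le> ennreal e"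
  shows "a \<longlonglongrightarrow> 0"
proof (rule order_tendstoI)
  fix y :: ennreal assume "0 < y"
  then obtain x where x: "0 < x" "x < y" using dense by blast
  obtain e where e: "e \<ge> 0" "x = ennreal e" using x by (cases x) auto
  have "e > 0" using x e by (simp add: ennreal_eq_0_iff flip: zero_less_iff_neq_zero)
  from assms[OF this] show "\<forall>\<^sub>F n in sequentially. a n < y"
    by eventually_elim (use x e in auto)
qed auto

lemma ennreal_tendsto_0D:
  fixes a :: "nat \<Rightarrow> ennreal"
  assumes "a \<longlonglongrightarrow> 0" "e > 0"
  shows "\<forall>\<^sub>F n in sequentially. a n \<le> ennreal e"
proof -
  have "\<forall>\<^sub>F n in sequentially. a n < ennreal e" using assms by (intro order_tendstoD) auto
  then show ?thesis by (rule eventually_mono) auto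
qed

text \<open>For an open set the translated indicator converges from below by openness, hence dominated
  convergence applies without approximating by compact sets.\<close>

lemma translation_continuous_open:
  fixes U :: "'a::euclidean_space set"
  assumes U: "open U" and fin: "emeasure lborel U < \<infinity>" and z: "z \<longlonglongrightarrow> 0"
  shows "(\<lambda>n::nat. \<integral>\<^sup>+x. norm (indicator U (x - z n) - indicator U x :: real) \<partial>lborel) \<longlonglongrightarrow> 0"
proof -
  have [measurable]: "U \<in> sets borel" using U by auto
  have *: "(\<lambda>n::nat. \<integral>\<^sup>+x. indicator U x * indicator (- U) (x - y n) \<partial>lborel) \<longlonglongrightarrow> 0"
    if y: "y \<longlonglongrightarrow> 0" for y :: "nat \<Rightarrow> 'a"
  proof -
    have "(\<lambda>n::nat. \<integral>\<^sup>+x. indicator U x * indicator (- U) (x - y n) \<partial>lborel) \<longlonglongrightarrow> (\<integral>\<^sup>+x. 0 \<partial>(lborel::'a measure))"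
    proof (rule nn_integral_dominated_convergence[where w = "indicator U"])
      show "(\<integral>\<^sup>+ x. indicator U x \<partial>lborel) < \<infinity>" using fin by simp
      show "AE x in lborel. (\<lambda>n. indicator U x * indicator (- U) (x - y n) :: ennreal) \<longlonglongrightarrow> 0"
      proof (rule AE_I2)
        fix x
        show "(\<lambda>n. indicator U x * indicator (- U) (x - y n) :: ennreal) \<longlonglongrightarrow> 0"
        proof (cases "x \<in> U")
          case True
          have "(\<lambda>n. x - y n) \<longlonglongrightarrow> x - 0" by (intro tendsto_intros y)
          then have "\<forall>\<^sub>F n in sequentially. x - y n \<in> U"
            using U True by (simp add: topological_tendstoD)
          then have "\<forall>\<^sub>F n in sequentially. indicator U x * indicator (- U) (x - y n) = (0::ennreal)"
            by eventually_elim auto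
          then show ?thesis by (rule tendsto_eventually)
        qed auto
      qed
    qed (auto simp: indicator_def)
    then show ?thesis by simp
  qed
  \<comment> \<open>The symmetric difference of U and its translate consists of two one-sided parts;
    shifting the second turns it into the first with - z n in place of z n.\<close>
  have eq: "(\<integral>\<^sup>+x. norm (indicator U (x - z n) - indicator U x :: real) \<partial>lborel) =
     (\<integral>\<^sup>+x. indicator U x * indicator (- U) (x - z n) \<partial>lborel) +
     (\<integral>\<^sup>+x. indicator U x * indicator (- U) (x - (- z n)) \<partial>lborel)" for n
  proof -
    have "(\<integral>\<^sup>+x. norm (indicator U (x - z n) - indicator U x :: real) \<partial>lborel) =
      (\<integral>\<^sup>+x. indicator U x * indicator (- U) (x - z n) + indicator U (x - z n) * indicator (- U) ((x - z n) + z n) \<partial>lborel)"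
      by (intro nn_integral_cong) (auto simp: indicator_def)
    also have "\<dots> = (\<integral>\<^sup>+x. indicator U x * indicator (- U) (x - z n) \<partial>lborel) +
        (\<integral>\<^sup>+x. indicator U (x - z n) * indicator (- U) ((x - z n) + z n) \<partial>lborel)"
      by (intro nn_integral_add) auto
    also have "(\<integral>\<^sup>+x. indicator U (x - z n) * indicator (- U) ((x - z n) + z n) \<partial>lborel) =
        (\<integral>\<^sup>+x. indicator U x * indicator (- U) (x + z n) \<partial>lborel)"
      by (rule nn_integral_lborel_shift[of "\<lambda>x. indicator U x * indicator (- U) (x + z n)"]) auto
    finally show ?thesis by simp
  qed
  have "(\<lambda>n. - z n) \<longlonglongrightarrow> 0" using tendsto_minus[OF z] by simp
  from tendsto_add[OF *[OF z] *[OF this]] show ?thesis unfolding eq by simp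
qed

text \<open>A three-epsilon argument: by translation invariance the shifted approximation error is
  as small as the unshifted one.\<close>

lemma translation_continuous_approx:
  fixes f :: "'a::euclidean_space \<Rightarrow> 'b::euclidean_space"
  assumes f: "integrable lborel f"
    and approx: "\<And>e::real. e > 0 \<Longrightarrow> \<exists>g. translation_continuous g \<and> integrable lborel g \<and>
       (\<integral>\<^sup>+x. norm (g x - f x) \<partial>lborel) \<le> ennreal e"
  shows "translation_continuous f"
  unfolding translation_continuous_def
proof (intro allI impI ennreal_tendsto_0I)
  fix z :: "nat \<Rightarrow> 'a" and e :: real assume z: "z \<longlonglongrightarrow> 0" and e: "e > 0"
  have [measurable]: "f \<in> borel_measurable borel" using f by simp
  obtain g where g: "translation_continuous g" "integrable lborel g" "(\<integral>\<^sup>+x. norm (g x - f x) \<partial>lborel) \<le> ennreal (e/3)"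
    using approx[of "e/3"] e by auto
  have [measurable]: "g \<in> borel_measurable borel" using g by simp
  have "\<forall>\<^sub>F n in sequentially. (\<integral>\<^sup>+x. norm (g (x - z n) - g x) \<partial>lborel) \<le> ennreal (e/3)"
    using g(1) z e by (intro ennreal_tendsto_0D) (auto simp: translation_continuous_def)
  then show "\<forall>\<^sub>F n in sequentially. (\<integral>\<^sup>+x. norm (f (x - z n) - f x) \<partial>lborel) \<le> ennreal e"
  proof eventually_elim
    case (elim n)
    have "(\<integral>\<^sup>+x. norm (f (x - z n) - f x) \<partial>lborel) \<le>
      (\<integral>\<^sup>+x. ennreal (norm (g (x - z n) - f (x - z n))) + (ennreal (norm (g (x - z n) - g x)) + norm (g x - f x)) \<partial>lborel)"
    proof (intro nn_integral_mono)
      fix x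
      have "f (x - z n) - f x = (f (x - z n) - g (x - z n)) + ((g (x - z n) - g x) + (g x - f x))" by simp
      also have "norm \<dots> \<le> norm (f (x - z n) - g (x - z n)) + (norm (g (x - z n) - g x) + norm (g x - f x))"
        by (intro norm_triangle_le add_left_mono norm_triangle_ineq)
      finally have "norm (f (x - z n) - f x) \<le> norm (g (x - z n) - f (x - z n)) + (norm (g (x - z n) - g x) + norm (g x - f x))"
        by (simp add: norm_minus_commute)
      then show "ennreal (norm (f (x - z n) - f x)) \<le>
        ennreal (norm (g (x - z n) - f (x - z n))) + (ennreal (norm (g (x - z n) - g x)) + norm (g x - f x))"
        by (simp flip: ennreal_plus)
    qed
    also have "\<dots> = (\<integral>\<^sup>+x. norm (g (x - z n) - f (x - z n)) \<partial>lborel) + ((\<integral>\<^sup>+x. norm (g (x - z n) - g x) \<partial>lborel) + (\<integral>\<^sup>+x. norm (g x - f x) \<partial>lborel))"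
      by (subst nn_integral_add; simp)+
    also have "\<dots> \<le> ennreal (e/3) + (ennreal (e/3) + ennreal (e/3))"
      using elim g(3) nn_integral_lborel_shift[of "\<lambda>x. ennreal (norm (g x - f x))" "z n"]
      by (intro add_mono) auto
    also have "\<dots> = ennreal e" using e by (simp flip: ennreal_plus)
    finally show ?case .
  qed
qed

text \<open>Indicators, sums and dominated limits generate all integrable functions. The base case
  is known for open sets, so a Borel set is first replaced by an open superset of slightly larger
  measure.\<close>

lemma translation_continuous_integrable:
  fixes f :: "'a::euclidean_space \<Rightarrow> 'b::euclidean_space"
  assumes "integrable lborel f" shows "translation_continuous f"
  using assms
proof (induction rule: integrable_induct)
  case (base A c)
  have [measurable]: "A \<in> sets borel" using base by simp
  have open_case: "translation_continuous (\<lambda>x::'a. indicator U x *\<^sub>R c)" if U: "open U" "emeasure lborel U < \<infinity>" for U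
    unfolding translation_continuous_def
  proof (intro allI impI)
    fix z :: "nat \<Rightarrow> 'a" assume z: "z \<longlonglongrightarrow> 0"
    have [measurable]: "U \<in> sets borel" using U by auto
    have "(\<integral>\<^sup>+x. norm (indicator U (x - z n) *\<^sub>R c - indicator U x *\<^sub>R c) \<partial>lborel) =
      (\<integral>\<^sup>+x. norm (indicator U (x - z n) - indicator U x :: real) \<partial>lborel) * norm c" for n
      by (subst nn_integral_multc[symmetric])
        (auto intro!: nn_integral_cong simp: ennreal_mult[symmetric] simp flip: scaleR_left_diff_distrib)
    then show "(\<lambda>n. \<integral>\<^sup>+x. norm (indicator U (x - z n) *\<^sub>R c - indicator U x *\<^sub>R c) \<partial>lborel) \<longlonglongrightarrow> 0"
      using ennreal_tendsto_cmult[OF _ translation_continuous_open[OF U z], of "norm c"]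
      by (simp add: mult.commute)
  qed
  show ?case
  proof (rule translation_continuous_approx)
    show "integrable lborel (\<lambda>x. indicator A x *\<^sub>R c)" using base by simp
    fix e :: real assume e: "e > 0"
    \<comment> \<open>The summand 1 keeps the quotient positive for c = 0.\<close>
    define e' where "e' = e / (norm c + 1)"
    have e': "e' > 0" using e by (simp add: e'_def add_nonneg_pos)
    obtain U where U: "open U" "A \<subseteq> U" "emeasure lborel (U - A) < e'"
      using outer_regular_lborel[of A e'] base e' by auto
    have [measurable]: "U \<in> sets borel" using U by auto
    have "emeasure lborel U \<le> emeasure lborel A + emeasure lborel (U - A)"
      using U(2) emeasure_subadditive[of A lborel "U - A"] by (simp add: Un_absorb1)
    also have "\<dots> < \<infinity>" using base U(3) by (auto simp: ennreal_add_eq_top less_top[symmetric])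
    finally have fin: "emeasure lborel U < \<infinity>" .
    have "(\<integral>\<^sup>+x. norm (indicator U x *\<^sub>R c - indicator A x *\<^sub>R c) \<partial>lborel) = (\<integral>\<^sup>+x. ennreal (norm c) * indicator (U - A) x \<partial>lborel)"
      using U(2) by (intro nn_integral_cong) (auto simp: indicator_def)
    also have "\<dots> = norm c * emeasure lborel (U - A)" by (simp add: nn_integral_cmult_indicator)
    also have "\<dots> \<le> norm c * ennreal e'" using U(3) by (intro mult_left_mono) auto
    also have "\<dots> \<le> ennreal e"
    proof -
      have "norm c * e \<le> (norm c + 1) * e" using e by (intro mult_right_mono) auto
      then have "norm c * e' \<le> e" unfolding e'_def by (simp add: divide_le_eq add_nonneg_pos mult.commute)
      then show ?thesis using e' by (simp flip: ennreal_mult add: ennreal_leI)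
    qed
    finally show "\<exists>g. translation_continuous g \<and> integrable lborel g \<and>
        (\<integral>\<^sup>+x. norm (g x - indicator A x *\<^sub>R c) \<partial>lborel) \<le> ennreal e"
      using open_case[OF U(1) fin] fin by (intro exI[of _ "\<lambda>x. indicator U x *\<^sub>R c"]) auto
  qed
next
  case (add f g)
  have [measurable]: "f \<in> borel_measurable borel" "g \<in> borel_measurable borel" using add by auto
  show ?case unfolding translation_continuous_def
  proof (intro allI impI)
    fix z :: "nat \<Rightarrow> 'a" assume z: "z \<longlonglongrightarrow> 0"
    have "(\<lambda>n. (\<integral>\<^sup>+x. norm (f (x - z n) - f x) \<partial>lborel) + (\<integral>\<^sup>+x. norm (g (x - z n) - g x) \<partial>lborel)) \<longlonglongrightarrow> 0 + 0"
      using add z by (intro tendsto_add) (auto simp: translation_continuous_def)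
    then have lim: "(\<lambda>n. (\<integral>\<^sup>+x. norm (f (x - z n) - f x) \<partial>lborel) + (\<integral>\<^sup>+x. norm (g (x - z n) - g x) \<partial>lborel)) \<longlonglongrightarrow> 0"
      by simp
    show "(\<lambda>n. \<integral>\<^sup>+x. norm (f (x - z n) + g (x - z n) - (f x + g x)) \<partial>lborel) \<longlonglongrightarrow> 0"
    proof (rule tendsto_sandwich[OF _ _ tendsto_const lim])
      show "\<forall>\<^sub>F n in sequentially. (\<integral>\<^sup>+x. norm (f (x - z n) + g (x - z n) - (f x + g x)) \<partial>lborel) \<le>
        (\<integral>\<^sup>+x. norm (f (x - z n) - f x) \<partial>lborel) + (\<integral>\<^sup>+x. norm (g (x - z n) - g x) \<partial>lborel)"
      proof (intro always_eventually allI)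
        fix n
        have "norm (f (x - z n) + g (x - z n) - (f x + g x)) \<le> norm (f (x - z n) - f x) + norm (g (x - z n) - g x)" for x
          by (rule norm_diff_triangle_ineq)
        then have "(\<integral>\<^sup>+x. norm (f (x - z n) + g (x - z n) - (f x + g x)) \<partial>lborel) \<le>
            (\<integral>\<^sup>+x. ennreal (norm (f (x - z n) - f x)) + ennreal (norm (g (x - z n) - g x)) \<partial>lborel)"
          by (intro nn_integral_mono) (simp flip: ennreal_plus)
        also have "\<dots> = (\<integral>\<^sup>+x. norm (f (x - z n) - f x) \<partial>lborel) + (\<integral>\<^sup>+x. norm (g (x - z n) - g x) \<partial>lborel)"
          by (rule nn_integral_add) auto
        finally show "(\<integral>\<^sup>+x. norm (f (x - z n) + g (x - z n) - (f x + g x)) \<partial>lborel) \<le>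
            (\<integral>\<^sup>+x. norm (f (x - z n) - f x) \<partial>lborel) + (\<integral>\<^sup>+x. norm (g (x - z n) - g x) \<partial>lborel)" .
      qed
    qed auto
  qed
next
  case (lim f s)
  show ?case
  proof (rule translation_continuous_approx[OF lim.hyps(4)])
    fix e :: real assume e: "e > 0"
    have "(\<lambda>n. \<integral>\<^sup>+x. norm (f x - s n x) \<partial>lborel) \<longlonglongrightarrow> 0"
    proof (rule nn_integral_dominated_convergence_norm[where w = "\<lambda>x. 2 * norm (f x)"])
      show "(\<integral>\<^sup>+ x. ennreal (2 * norm (f x)) \<partial>lborel) < \<infinity>"
        using lim.hyps(4) integrable_iff_bounded[of lborel "\<lambda>x. 2 *\<^sub>R f x"] by simp
    qed (use lim.hyps in auto)
    from ennreal_tendsto_0D[OF this e] obtain n where "(\<integral>\<^sup>+x. norm (f x - s n x) \<partial>lborel) \<le> ennreal e"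
      by (auto simp: eventually_sequentially)
    then show "\<exists>g. translation_continuous g \<and> integrable lborel g \<and> (\<integral>\<^sup>+x. norm (g x - f x) \<partial>lborel) \<le> ennreal e"
      using lim by (intro exI[of _ "s n"]) (auto simp: norm_minus_commute)
  qed
qed

lemma translation_small:
  fixes f :: "'a::euclidean_space \<Rightarrow> 'b::euclidean_space"
  assumes f: "integrable lborel f" and e: "(e::real) > 0"
  obtains d where "d > 0" "\<And>z. norm z < d \<Longrightarrow> (\<integral>\<^sup>+x. norm (f (x - z) - f x) \<partial>lborel) \<le> ennreal e"
proof -
  have "\<exists>d>0. \<forall>z. norm z < d \<longrightarrow> (\<integral>\<^sup>+x. norm (f (x - z) - f x) \<partial>lborel) \<le> ennreal e"
  proof (rule ccontr)
    assume "\<not> ?thesis"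
    then have "\<forall>n. \<exists>z. norm z < 1 / real (Suc n) \<and> \<not> (\<integral>\<^sup>+x. norm (f (x - z) - f x) \<partial>lborel) \<le> ennreal e"
      by (metis of_nat_0_less_iff zero_less_Suc zero_less_divide_1_iff)
    then obtain z where z: "\<And>n. norm (z n) < 1 / real (Suc n)" "\<And>n. \<not> (\<integral>\<^sup>+x. norm (f (x - z n) - f x) \<partial>lborel) \<le> ennreal e"
      by metis
    have "z \<longlonglongrightarrow> 0"
      by (rule tendsto_0_le[OF LIMSEQ_Suc[OF lim_1_over_n[where 'a=real]], of _ 1])
        (use less_imp_le[OF z(1)] in \<open>auto intro!: always_eventually simp del: of_nat_Suc\<close>)
    with translation_continuous_integrable[OF f] ennreal_tendsto_0D[OF _ e]
    have "\<forall>\<^sub>F n in sequentially. (\<integral>\<^sup>+x. norm (f (x - z n) - f x) \<partial>lborel) \<le> ennreal e"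
      by (auto simp: translation_continuous_def)
    then show False using z(2) by (auto simp: eventually_sequentially)
  qed
  then show ?thesis using that by blast
qed

subsection \<open>Mollification\<close>

definition conv :: "(real^'n \<Rightarrow> real) \<Rightarrow> (real^'n \<Rightarrow> 'b::euclidean_space) \<Rightarrow> real^'n \<Rightarrow> 'b" where
  "conv \<phi> f x = (LINT y|lborel. \<phi> (x - y) *\<^sub>R f y)"

lemma conv_integrable:
  fixes f :: "real^'n \<Rightarrow> 'b::euclidean_space"
  assumes \<phi>: "test_function \<Omega> \<phi>" and f: "integrable lborel f"
  shows "integrable lborel (\<lambda>y. \<phi> (x - y) *\<^sub>R f y)"
proof -
  obtain B where B: "B > 0" "\<And>x. \<bar>\<phi> x\<bar> \<le> B" using test_function_bounded[OF \<phi>] by blast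
  have [measurable]: "\<phi> \<in> borel_measurable borel" "f \<in> borel_measurable borel"
    using test_function_borel[OF \<phi>] f by auto
  show ?thesis
    by (rule Bochner_Integration.integrable_bound[where f = "\<lambda>y. B *\<^sub>R f y"])
      (use f B in \<open>auto intro!: AE_I2 mult_right_mono\<close>)
qed

lemma conv_borel:
  fixes f :: "real^'n \<Rightarrow> 'b::euclidean_space"
  assumes [measurable]: "\<phi> \<in> borel_measurable borel" "f \<in> borel_measurable borel"
  shows "conv \<phi> f \<in> borel_measurable borel"
  unfolding conv_def[abs_def] by simp

text \<open>The gradient is continuous with compact support, hence uniformly continuous, so one d
  serves all base points z. This uniformity lets the remainder be integrated against any integrable
  function.\<close>

lemma test_function_taylor:
  fixes \<phi> :: "real^'n \<Rightarrow> real"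
  assumes \<phi>: "test_function UNIV \<phi>" and e: "e > 0"
  shows "\<exists>d>0. \<forall>z h. norm h < d \<longrightarrow> \<bar>\<phi> (z + h) - \<phi> z - grad \<phi> z \<bullet> h\<bar> \<le> e * norm h"
proof -
  obtain K where K: "compact K" "\<And>x i. x \<notin> K \<Longrightarrow> pd i \<phi> x = 0"
    using test_function_support[OF \<phi>] by blast
  have "grad \<phi> x = 0" if "x \<notin> K" for x using K(2)[OF that] by (simp add: grad_def vec_eq_iff)
  then have "uniformly_continuous_on UNIV (grad \<phi>)"
    using uniformly_continuous_compact_support[OF continuous_grad[OF test_function_smooth[OF \<phi>]] K(1)] by blast
  then obtain d where d: "d > 0" "\<And>x y. dist y x < d \<Longrightarrow> dist (grad \<phi> y) (grad \<phi> x) < e"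
    using e unfolding uniformly_continuous_on_def by (metis UNIV_I)
  have "\<bar>\<phi> (z + h) - \<phi> z - grad \<phi> z \<bullet> h\<bar> \<le> e * norm h" if h: "norm h < d" for z h
  proof -
    have "norm (\<phi> (z + h) - \<phi> z - (\<lambda>h. grad \<phi> z \<bullet> h) ((z + h) - z)) \<le> norm ((z + h) - z) * e"
    proof (rule differentiable_bound_linearization[where S = "ball z d" and f' = "\<lambda>x h. grad \<phi> x \<bullet> h"])
      fix t :: real assume t: "t \<in> {0..1}"
      have "t * norm h \<le> 1 * norm h" using t by (intro mult_right_mono) auto
      then show "z + t *\<^sub>R (z + h - z) \<in> ball z d" using h t by (simp add: dist_norm)
    next
      fix x assume x: "x \<in> ball z d"
      show "(\<phi> has_derivative (\<lambda>h. grad \<phi> x \<bullet> h)) (at x within ball z d)"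
        using smooth_has_derivative[OF test_function_smooth[OF \<phi>]] has_derivative_at_withinI by blast
      have "dist (grad \<phi> x) (grad \<phi> z) < e" using d(2)[of x z] x by (simp add: dist_commute)
      then have "norm (grad \<phi> x - grad \<phi> z) \<le> e" by (simp add: dist_norm)
      then have "norm ((grad \<phi> x - grad \<phi> z) \<bullet> h) \<le> e * norm h" for h
        using Cauchy_Schwarz_ineq2[of "grad \<phi> x - grad \<phi> z" h] mult_right_mono[OF _ norm_ge_zero[of h]] order_trans
        by (metis real_norm_def)
      then show "onorm ((\<lambda>h. grad \<phi> x \<bullet> h) - (\<lambda>h. grad \<phi> z \<bullet> h)) \<le> e"
        using e by (intro onorm_bound) (auto simp: fun_diff_def inner_diff_left)
    qed (use d in auto)
    then show ?thesis by (simp add: mult.commute)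
  qed
  then show ?thesis using d(1) by blast
qed

text \<open>The remainder in \<open>test_function_taylor\<close> is uniform, so integrating it
  against f costs only the L^1 norm of f; all regularity comes from the kernel.\<close>

lemma conv_has_derivative:
  fixes f :: "real^'n \<Rightarrow> real"
  assumes \<phi>: "test_function UNIV \<phi>" and f: "integrable lborel f"
  shows "(conv \<phi> f has_derivative (\<lambda>h. \<Sum>i\<in>UNIV. h $ i * conv (pd i \<phi>) f x)) (at x)"
  unfolding has_derivative_at_alt
proof (intro conjI allI impI)
  show "bounded_linear (\<lambda>h. \<Sum>i\<in>UNIV. h $ i * conv (pd i \<phi>) f x)"
    by (intro bounded_linear_sum bounded_linear_mult_const bounded_linear_vec_nth)
  fix e :: real assume e: "e > 0"
  define A where "A = (LINT y|lborel. \<bar>f y\<bar>)"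
  have A: "A \<ge> 0" by (auto simp: A_def)
  define e' where "e' = e / (A + 1)"
  have e': "e' > 0" using e A by (auto simp: e'_def)
  obtain d where d: "d > 0" "\<And>z h. norm h < d \<Longrightarrow> \<bar>\<phi> (z + h) - \<phi> z - grad \<phi> z \<bullet> h\<bar> \<le> e' * norm h"
    using test_function_taylor[OF \<phi> e'] by blast
  have "norm (conv \<phi> f y - conv \<phi> f x - (\<Sum>i\<in>UNIV. (y - x) $ i * conv (pd i \<phi>) f x)) \<le> e * norm (y - x)"
    if yx: "norm (y - x) < d" for y
  proof -
    let ?r = "\<lambda>w. \<phi> ((x - w) + (y - x)) - \<phi> (x - w) - grad \<phi> (x - w) \<bullet> (y - x)"
    have int1: "integrable lborel (\<lambda>w. \<phi> (z - w) * f w)" for z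
      using conv_integrable[OF \<phi> f] by simp
    have int2: "integrable lborel (\<lambda>w. pd i \<phi> (z - w) * f w)" for z i
      using conv_integrable[OF test_function_pd[OF \<phi>] f] by simp
    have "(\<Sum>i\<in>UNIV. (y - x) $ i * conv (pd i \<phi>) f x) = (LINT w|lborel. (\<Sum>i\<in>UNIV. (y - x) $ i * (pd i \<phi> (x - w) * f w)))"
      using int2 by (simp add: conv_def)
    then have "conv \<phi> f y - conv \<phi> f x - (\<Sum>i\<in>UNIV. (y - x) $ i * conv (pd i \<phi>) f x) =
      (LINT w|lborel. \<phi> (y - w) * f w - \<phi> (x - w) * f w - (\<Sum>i\<in>UNIV. (y - x) $ i * (pd i \<phi> (x - w) * f w)))"
      using int1 int2 by (simp add: conv_def)
    also have "\<dots> = (LINT w|lborel. ?r w * f w)"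
      by (intro Bochner_Integration.integral_cong)
        (auto simp: grad_def inner_vec_def algebra_simps sum_distrib_left sum_distrib_right)
    also have "norm \<dots> \<le> (LINT w|lborel. e' * norm (y - x) * \<bar>f w\<bar>)"
    proof (rule Bochner_Integration.integral_norm_bound_integral)
      have "integrable lborel (\<lambda>w. \<phi> (y - w) * f w - \<phi> (x - w) * f w - (\<Sum>i\<in>UNIV. (y - x) $ i * (pd i \<phi> (x - w) * f w)))"
        using int1 int2 by auto
      then show "integrable lborel (\<lambda>w. ?r w * f w)"
        by (rule Bochner_Integration.integrable_cong[THEN iffD1, rotated 2])
          (auto simp: grad_def inner_vec_def algebra_simps sum_distrib_left sum_distrib_right)
      show "norm (?r w * f w) \<le> e' * norm (y - x) * \<bar>f w\<bar>" for w
        using d(2)[OF yx, of "x - w"] by (simp add: abs_mult mult_right_mono)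
    qed (use f in auto)
    also have "\<dots> = (e' * A) * norm (y - x)" by (simp add: A_def)
    also have "\<dots> \<le> e * norm (y - x)"
      using e A by (intro mult_right_mono) (auto simp: e'_def divide_le_eq algebra_simps)
    finally show ?thesis .
  qed
  then show "\<exists>d>0. \<forall>y. norm (y - x) < d \<longrightarrow> norm (conv \<phi> f y - conv \<phi> f x - (\<Sum>i\<in>UNIV. (y - x) $ i * conv (pd i \<phi>) f x)) \<le> e * norm (y - x)"
    using d(1) by blast
qed

lemma pd_conv:
  fixes f :: "real^'n \<Rightarrow> real"
  assumes "test_function UNIV \<phi>" "integrable lborel f"
  shows "pd i (conv \<phi> f) = conv (pd i \<phi>) f"
  by (rule ext, subst pd_eqI[OF conv_has_derivative[OF assms]])
    (simp add: axis_def if_distrib[where f = "\<lambda>x. x * _"] cong: if_cong)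

lemma smooth_conv:
  fixes f :: "real^'n \<Rightarrow> real"
  assumes \<phi>: "test_function UNIV \<phi>" and f: "integrable lborel f"
  shows "smooth (conv \<phi> f)"
proof -
  have "C_k k (conv \<phi> f)" if "test_function UNIV \<phi>" for k \<phi> using that
  proof (induction k arbitrary: \<phi>)
    case 0
    then show ?case using conv_has_derivative[OF _ f, THEN has_derivative_continuous]
      by (auto simp: continuous_on_eq_continuous_at)
  next
    case (Suc k)
    then show ?case unfolding C_k_Suc_iff pd_conv[OF Suc.prems f]
      using conv_has_derivative[OF _ f] test_function_pd unfolding differentiable_def by blast
  qed
  then show ?thesis using \<phi> by (simp add: smooth_def)
qed

definition bump :: "real \<Rightarrow> real^'n \<Rightarrow> real" where
  "bump e x = eta 0 (e\<^sup>2 - x \<bullet> x)"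

text \<open>Each radius is normalised by its own integral, in place of rescaling one fixed bump, so
  support radius and unit mass come directly from \<open>bump\<close>.\<close>

definition mollifier :: "real \<Rightarrow> real^'n \<Rightarrow> real" where
  "mollifier e x = bump e x / (LINT y|lborel. bump e (y::real^'n))"

lemma bump_eq_0: "e > 0 \<Longrightarrow> norm x \<ge> e \<Longrightarrow> bump e x = 0"
  using power_mono[of e "norm x" 2] by (simp add: bump_def eta_def power2_norm_eq_inner)

lemma bump_pos: "e > 0 \<Longrightarrow> norm x < e \<Longrightarrow> bump e x > 0"
  using power_strict_mono[of "norm x" e 2] by (simp add: bump_def eta_def power2_norm_eq_inner)

lemma bump_test: "e > 0 \<Longrightarrow> test_function UNIV (bump e :: real^'n \<Rightarrow> real)"
proof -
  assume e: "e > 0"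
  have "bump e x = 0" if "x \<notin> cball 0 e" for x :: "real^'n" using that bump_eq_0[OF e, of x] by simp
  moreover have "smooth (bump e :: real^'n \<Rightarrow> real)" unfolding bump_def[abs_def] by (rule smooth_eta)
  ultimately show ?thesis unfolding test_function_iff using compact_cball by blast
qed

lemma bump_integral_pos:
  assumes e: "e > 0" shows "(LINT y|lborel. bump e (y::real^'n)) > 0"
proof -
  have nn: "bump e (y::real^'n) \<ge> 0" for y by (simp add: bump_def eta_nonneg)
  have "(LINT y|lborel. bump e (y::real^'n)) \<noteq> 0"
  proof
    assume "(LINT y|lborel. bump e (y::real^'n)) = 0"
    then have "AE y in lborel. bump e (y::real^'n) = 0"
      using integral_nonneg_eq_0_iff_AE[OF test_function_integrable[OF bump_test[OF e]]] nn by blast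
    then have "AE y in lborel. y \<notin> ball (0::real^'n) e"
      by (rule AE_mp) (use bump_pos[OF e] in \<open>force intro!: AE_I2\<close>)
    then have "emeasure lborel (ball (0::real^'n) e) = 0"
      by (subst (asm) AE_iff_measurable[where N = "ball (0::real^'n) e"]) auto
    then have "ball (0::real^'n) e \<in> null_sets lebesgue"
      by (simp add: null_sets_def)
    then show False using e negligible_iff_null_sets open_not_negligible[of "ball (0::real^'n) e"] by auto
  qed
  moreover have "(LINT y|lborel. bump e (y::real^'n)) \<ge> 0" using nn by (intro integral_nonneg_AE) auto
  ultimately show ?thesis by linarith
qed

lemma mollifier_test: "e > 0 \<Longrightarrow> test_function UNIV (mollifier e)"
  unfolding mollifier_def[abs_def] divide_inverse
  by (subst mult.commute) (intro test_function_cmult bump_test)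

lemma mollifier_nonneg: "e > 0 \<Longrightarrow> mollifier e (x::real^'n) \<ge> 0"
  unfolding mollifier_def using bump_integral_pos[of e, where 'n='n] by (simp add: bump_def eta_nonneg less_imp_le)

lemma mollifier_eq_0: "e > 0 \<Longrightarrow> norm x \<ge> e \<Longrightarrow> mollifier e x = 0"
  by (simp add: mollifier_def bump_eq_0)

lemma mollifier_borel [measurable]: "mollifier e \<in> borel_measurable borel"
  unfolding mollifier_def[abs_def] bump_def[abs_def]
  using smooth_borel[OF smooth_eta] by measurable

lemma mollifier_nn_integral:
  assumes e: "e > 0" shows "(\<integral>\<^sup>+y. mollifier e (y::real^'n) \<partial>lborel) = 1"
proof -
  have "(\<integral>\<^sup>+y. mollifier e (y::real^'n) \<partial>lborel) = ennreal (LINT y|lborel. mollifier e (y::real^'n))"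
    using test_function_integrable[OF mollifier_test[OF e]] mollifier_nonneg[OF e, where 'n='n]
    by (intro nn_integral_eq_integral) auto
  also have "(LINT y|lborel. mollifier e (y::real^'n)) = 1"
    using bump_integral_pos[OF e, where 'n = 'n] by (simp add: mollifier_def)
  finally show ?thesis by simp
qed

lemma mollifier_nn_integral_shift:
  assumes e: "e > 0" shows "(\<integral>\<^sup>+y. mollifier e ((x::real^'n) - y) \<partial>lborel) = 1"
    and "(\<integral>\<^sup>+y. mollifier e ((y::real^'n) - x) \<partial>lborel) = 1"
  using nn_integral_lborel_reflect[of "\<lambda>y. ennreal (mollifier e y)" x]
    nn_integral_lborel_shift[of "\<lambda>y. ennreal (mollifier e y)" x] mollifier_nn_integral[OF e, where 'n = 'n]
  by simp_all

lemma mollifier_integral_shift: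
  assumes e: "e > 0" shows "integrable lborel (\<lambda>y. mollifier e ((x::real^'n) - y))"
    and "(LINT y|lborel. mollifier e ((x::real^'n) - y)) = 1"
proof -
  show "integrable lborel (\<lambda>y. mollifier e (x - y))"
    using mollifier_nn_integral_shift(1)[OF e, of x] mollifier_nonneg[OF e, where 'n='n]
    by (intro integrableI_nn_integral_finite[where x = 1]) auto
  show "(LINT y|lborel. mollifier e (x - y)) = 1"
    using mollifier_nn_integral_shift(1)[OF e, of x] mollifier_nonneg[OF e, where 'n='n]
    by (intro integral_eq_nn_integral[THEN trans]) auto
qed

lemma norm_conv_le_nn_integral:
  fixes f :: "real^'n \<Rightarrow> 'b::euclidean_space"
  assumes e: "e > 0" and f: "integrable lborel f"
  shows "ennreal (norm (conv (mollifier e) f x)) \<le> (\<integral>\<^sup>+y. mollifier e (x - y) * norm (f y) \<partial>lborel)"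
proof -
  have "ennreal (norm (conv (mollifier e) f x)) \<le> (\<integral>\<^sup>+y. norm (mollifier e (x - y) *\<^sub>R f y) \<partial>lborel)"
    unfolding conv_def by (intro integral_norm_bound_ennreal conv_integrable[OF mollifier_test] e f)
  then show ?thesis using mollifier_nonneg[OF e, where 'n='n] by simp
qed

lemma conv_bounded:
  fixes f :: "real^'n \<Rightarrow> 'b::euclidean_space"
  assumes e: "e > 0" and f: "integrable lborel f" and M: "AE x in lborel. norm (f x) \<le> M"
  shows "norm (conv (mollifier e) f x) \<le> M"
proof -
  \<comment> \<open>The bound holds almost everywhere on a space of infinite measure, hence at some
    point, and a norm is nonnegative there.\<close>
  have "M \<ge> 0"
  proof (rule ccontr)
    assume "\<not> M \<ge> 0"
    then have "\<And>x. \<not> norm (f x) \<le> M" by (metis norm_ge_zero order_trans)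
    then have "AE x in (lborel::(real^'n) measure). False" using M by simp
    then have "emeasure lborel (UNIV :: (real^'n) set) = 0"
      by (subst (asm) AE_iff_measurable[where N = UNIV]) auto
    then show False using emeasure_lborel_UNIV[where 'a = "real^'n"] by simp
  qed
  have "(\<integral>\<^sup>+y. mollifier e (x - y) * norm (f y) \<partial>lborel) \<le> (\<integral>\<^sup>+y. ennreal M * mollifier e (x - y) \<partial>lborel)"
    using M mollifier_nonneg[OF e, where 'n='n]
    by (intro nn_integral_mono_AE) (auto elim!: eventually_mono simp: mult.commute ennreal_mult[symmetric] \<open>M \<ge> 0\<close> intro!: ennreal_leI mult_right_mono)
  also have "\<dots> = ennreal M" using mollifier_nn_integral_shift(1)[OF e, of x] by (simp add: nn_integral_cmult)
  finally have "ennreal (norm (conv (mollifier e) f x)) \<le> ennreal M"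
    using norm_conv_le_nn_integral[OF e f, of x] by (meson order_trans)
  then show ?thesis using \<open>M \<ge> 0\<close> by simp
qed

lemma conv_eq_0:
  fixes f :: "real^'n \<Rightarrow> 'b::euclidean_space"
  assumes e: "e > 0" and "\<And>y. dist x y < e \<Longrightarrow> f y = 0"
  shows "conv (mollifier e) f x = 0"
proof -
  have "mollifier e (x - y) *\<^sub>R f y = 0" for y
    using mollifier_eq_0[OF e, of "x - y"] assms(2)[of y] by (cases "dist x y < e") (auto simp: dist_norm)
  then have "conv (mollifier e) f x = (LINT y|(lborel::(real^'n) measure). 0)"
    unfolding conv_def by (intro Bochner_Integration.integral_cong) auto
  then show ?thesis by simp
qed

text \<open>The error is the average, with weight \<open>mollifier e z\<close>, of the translation
  errors of f. By Fubini its L^1 norm is at most a common bound of those errors for |z| < e.\<close>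

lemma conv_L1:
  fixes f :: "real^'n \<Rightarrow> 'b::euclidean_space"
  assumes f: "integrable lborel f" and \<eta>: "(\<eta>::real) > 0"
  shows "\<exists>d>0. \<forall>e. 0 < e \<and> e < d \<longrightarrow> (\<integral>\<^sup>+x. norm (conv (mollifier e) f x - f x) \<partial>lborel) \<le> ennreal \<eta>"
proof -
  obtain d where d: "d > 0" "\<And>z. norm z < d \<Longrightarrow> (\<integral>\<^sup>+x. norm (f (x - z) - f x) \<partial>lborel) \<le> ennreal \<eta>"
    using translation_small[OF f \<eta>] by blast
  have [measurable]: "f \<in> borel_measurable borel" using f by simp
  have "(\<integral>\<^sup>+x. norm (conv (mollifier e) f x - f x) \<partial>lborel) \<le> ennreal \<eta>" if e: "0 < e" "e < d" for e
  proof -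
    have "ennreal (norm (conv (mollifier e) f x - f x)) \<le> (\<integral>\<^sup>+z. mollifier e z * norm (f (x - z) - f x) \<partial>lborel)" for x
    proof -
      note i1 = conv_integrable[OF mollifier_test[OF e(1)] f, of x]
      note i2 = integrable_scaleR_left[OF mollifier_integral_shift(1)[OF e(1), of x], of "f x"]
      have "conv (mollifier e) f x - f x = (LINT y|lborel. mollifier e (x - y) *\<^sub>R f y) - (LINT y|lborel. mollifier e (x - y) *\<^sub>R f x)"
        using mollifier_integral_shift[OF e(1), of x] by (simp add: conv_def)
      also have "\<dots> = (LINT y|lborel. mollifier e (x - y) *\<^sub>R f y - mollifier e (x - y) *\<^sub>R f x)"
        using i1 i2 by (intro Bochner_Integration.integral_diff[symmetric])
      also have "\<dots> = (LINT y|lborel. mollifier e (x - y) *\<^sub>R (f y - f x))" by (simp add: scaleR_diff_right)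
      also have "ennreal (norm \<dots>) \<le> (\<integral>\<^sup>+y. norm (mollifier e (x - y) *\<^sub>R (f y - f x)) \<partial>lborel)"
        using Bochner_Integration.integrable_diff[OF i1 i2]
        by (intro integral_norm_bound_ennreal) (simp add: scaleR_diff_right)
      also have "\<dots> = (\<integral>\<^sup>+y. ennreal (mollifier e (x - y) * norm (f (x - (x - y)) - f x)) \<partial>lborel)"
        using mollifier_nonneg[OF e(1), where 'n='n] by simp
      also have "\<dots> = (\<integral>\<^sup>+z. mollifier e z * norm (f (x - z) - f x) \<partial>lborel)"
        by (rule nn_integral_lborel_reflect[of "\<lambda>z. ennreal (mollifier e z * norm (f (x - z) - f x))"]) simp
      finally show ?thesis .
    qed
    then have "(\<integral>\<^sup>+x. norm (conv (mollifier e) f x - f x) \<partial>lborel) \<le>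
      (\<integral>\<^sup>+x. (\<integral>\<^sup>+z. mollifier e z * norm (f (x - z) - f x) \<partial>lborel) \<partial>lborel)"
      by (intro nn_integral_mono)
    also have "\<dots> = (\<integral>\<^sup>+z. (\<integral>\<^sup>+x. mollifier e z * norm (f (x - z) - f x) \<partial>lborel) \<partial>lborel)"
      by (rule nn_integral_Fubini_lborel) simp
    also have "\<dots> \<le> (\<integral>\<^sup>+z. mollifier e z * ennreal \<eta> \<partial>(lborel::(real^'n) measure))"
    proof (rule nn_integral_mono)
      fix z
      have "(\<integral>\<^sup>+x. mollifier e z * norm (f (x - z) - f x) \<partial>lborel) = mollifier e z * (\<integral>\<^sup>+x. norm (f (x - z) - f x) \<partial>lborel)"
        using mollifier_nonneg[OF e(1), of z] by (subst nn_integral_cmult[symmetric]) (auto simp: ennreal_mult)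
      also have "\<dots> \<le> mollifier e z * ennreal \<eta>"
        using d(2)[of z] e mollifier_eq_0[OF e(1), of z] by (cases "norm z < e") (auto intro!: mult_left_mono)
      finally show "(\<integral>\<^sup>+x. mollifier e z * norm (f (x - z) - f x) \<partial>lborel) \<le> mollifier e z * ennreal \<eta>" .
    qed
    also have "\<dots> = ennreal \<eta>" using mollifier_nn_integral[OF e(1), where 'n = 'n] by (simp add: nn_integral_multc)
    finally show ?thesis .
  qed
  then show ?thesis using d(1) by blast
qed

subsection \<open>Jensen's inequality for mollification\<close>

text \<open>The tangent inequality t^q >= A^q + q A^(q-1) (t - A), rearranged, and obtained here
  from Young's inequality. Averaging it in t with A the mean yields Jensen's inequality for
  powers.\<close>

lemma powr_tangent:
  fixes t A q :: real
  assumes "t \<ge> 0" "A \<ge> 0" "q \<ge> 1"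
  shows "q * (t * A powr (q - 1)) \<le> t powr q + (q - 1) * A powr q"
proof (cases "q = 1")
  case False
  then have q: "q > 1" using assms by simp
  have "t * A powr (q - 1) \<le> t powr q / q + (A powr (q - 1)) powr (q / (q - 1)) / (q / (q - 1))"
    by (rule Youngs_inequality) (use q assms in \<open>auto simp: field_simps\<close>)
  also have "(A powr (q - 1)) powr (q / (q - 1)) = A powr q" using q by (simp add: powr_powr)
  finally have "q * (t * A powr (q - 1)) \<le> q * (t powr q / q + A powr q / (q / (q - 1)))"
    using q by (intro mult_left_mono) auto
  also have "\<dots> = t powr q + (q - 1) * A powr q" using q by (simp add: field_simps)
  finally show ?thesis .
qed (use assms in auto)

lemma norm_conv_powr_le:
  fixes f :: "real^'n \<Rightarrow> 'b::euclidean_space"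
  assumes e: "e > 0" and f: "integrable lborel f" and q: "q \<ge> 1"
  shows "ennreal (norm (conv (mollifier e) f x) powr q) \<le> (\<integral>\<^sup>+y. mollifier e (x - y) * norm (f y) powr q \<partial>lborel)"
proof (cases "(\<integral>\<^sup>+y. mollifier e (x - y) * norm (f y) powr q \<partial>lborel) = \<infinity>")
  case False
  have [measurable]: "f \<in> borel_measurable borel" using f by simp
  let ?m = "\<lambda>y. mollifier e (x - y)"
  have int1: "integrable lborel (\<lambda>y. ?m y * norm (f y) powr q)"
    using False mollifier_nonneg[OF e, where 'n='n] by (intro integrableI_nonneg) (auto simp: less_top)
  have int0: "integrable lborel (\<lambda>y. ?m y * norm (f y))"
    using integrable_norm[OF conv_integrable[OF mollifier_test[OF e] f, of x]] mollifier_nonneg[OF e, where 'n='n] by simp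
  \<comment> \<open>A is the weighted mean of |f|. Averaging the tangent inequality at A leaves A
    powr q on the small side.\<close>
  define A where "A = (LINT y|lborel. ?m y * norm (f y))"
  have A: "A \<ge> 0" unfolding A_def using mollifier_nonneg[OF e, where 'n='n] by (intro integral_nonneg_AE) auto
  have nA: "norm (conv (mollifier e) f x) \<le> A"
    using integral_norm_bound[of lborel "\<lambda>y. ?m y *\<^sub>R f y"] mollifier_nonneg[OF e, where 'n='n] by (simp add: conv_def A_def)
  have "(LINT y|lborel. ?m y * (q * (norm (f y) * A powr (q - 1)))) \<le> (LINT y|lborel. ?m y * (norm (f y) powr q + (q - 1) * A powr q))"
  proof (rule integral_mono)
    show "integrable lborel (\<lambda>y. ?m y * (q * (norm (f y) * A powr (q - 1))))"
      using integrable_mult_right[OF int0, of "q * A powr (q - 1)"] by (simp add: mult_ac)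
    show "integrable lborel (\<lambda>y. ?m y * (norm (f y) powr q + (q - 1) * A powr q))"
      using Bochner_Integration.integrable_add[OF int1 integrable_mult_left[OF mollifier_integral_shift(1)[OF e, of x], of "(q - 1) * A powr q"]]
      by (simp add: algebra_simps)
  qed (use powr_tangent[OF _ A q] mollifier_nonneg[OF e, where 'n='n] in \<open>auto intro!: mult_left_mono\<close>)
  also have "(LINT y|lborel. ?m y * (norm (f y) powr q + (q - 1) * A powr q)) = (LINT y|lborel. ?m y * norm (f y) powr q) + (q - 1) * A powr q"
    using int1 mollifier_integral_shift[OF e, of x] by (simp add: distrib_left)
  also have "(LINT y|lborel. ?m y * (q * (norm (f y) * A powr (q - 1)))) = (LINT y|lborel. (q * A powr (q - 1)) * (?m y * norm (f y)))"
    by (simp add: mult_ac)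
  also have "\<dots> = q * (A powr (q - 1) * A)"
    unfolding integral_mult_right_zero A_def[symmetric] by simp
  also have "A powr (q - 1) * A = A powr q"
    using A q by (cases "A = 0") (auto simp: powr_diff)
  finally have "A powr q \<le> (LINT y|lborel. ?m y * norm (f y) powr q)" by (simp add: algebra_simps)
  moreover have "norm (conv (mollifier e) f x) powr q \<le> A powr q" using nA q by (intro powr_mono2) auto
  ultimately have "ennreal (norm (conv (mollifier e) f x) powr q) \<le> ennreal (LINT y|lborel. ?m y * norm (f y) powr q)"
    by (intro ennreal_leI) auto
  also have "\<dots> = (\<integral>\<^sup>+y. ?m y * norm (f y) powr q \<partial>lborel)"
    using int1 mollifier_nonneg[OF e, where 'n='n] by (intro nn_integral_eq_integral[symmetric]) auto
  finally show ?thesis .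
qed auto

text \<open>The pointwise Jensen inequality is integrated by Fubini; the kernel has mass 1 in the
  variable x as well.\<close>

lemma nn_integral_conv_powr_le:
  fixes f :: "real^'n \<Rightarrow> 'b::euclidean_space"
  assumes e: "e > 0" and f: "integrable lborel f" and q: "q \<ge> 1"
  shows "(\<integral>\<^sup>+x. norm (conv (mollifier e) f x) powr q \<partial>lborel) \<le> (\<integral>\<^sup>+x. norm (f x) powr q \<partial>lborel)"
proof -
  have [measurable]: "f \<in> borel_measurable borel" using f by simp
  have "(\<integral>\<^sup>+x. norm (conv (mollifier e) f x) powr q \<partial>lborel) \<le>
    (\<integral>\<^sup>+x. (\<integral>\<^sup>+y. mollifier e (x - y) * norm (f y) powr q \<partial>lborel) \<partial>lborel)"
    by (intro nn_integral_mono norm_conv_powr_le e f q)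
  also have "\<dots> = (\<integral>\<^sup>+y. (\<integral>\<^sup>+x. mollifier e (x - y) * norm (f y) powr q \<partial>lborel) \<partial>lborel)"
    by (rule nn_integral_Fubini_lborel) simp
  also have "\<dots> = (\<integral>\<^sup>+y. (\<integral>\<^sup>+x. mollifier e (x - y) \<partial>lborel) * norm (f y) powr q \<partial>lborel)"
    using mollifier_nonneg[OF e, where 'n='n]
    by (subst nn_integral_multc[symmetric]) (auto simp: ennreal_mult)
  also have "\<dots> = (\<integral>\<^sup>+y. norm (f y) powr q \<partial>lborel)"
    by (simp add: mollifier_nn_integral_shift(2) e)
  finally show ?thesis .
qed

subsection \<open>Integration by parts\<close>

text \<open>\<open>\<phi>\<close> and its shift by t along axis i have the same integral, so - t
  times the integral of \<open>pd i \<phi>\<close> is the integral of the Taylor remainder, which is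
  at most e * t on a fixed ball. Dividing by t and letting e tend to 0 leaves 0.\<close>

lemma test_integral_pd:
  fixes \<phi> :: "real^'n \<Rightarrow> real"
  assumes \<phi>: "test_function UNIV \<phi>"
  shows "(LINT x|lborel. pd i \<phi> x) = 0"
proof -
  obtain K where K: "compact K" "\<And>x. x \<notin> K \<Longrightarrow> \<phi> x = 0" "\<And>x i. x \<notin> K \<Longrightarrow> pd i \<phi> x = 0"
    using test_function_support[OF \<phi>] by blast
  obtain R where R: "K \<subseteq> cball 0 R" using compact_imp_bounded[OF K(1)] by (auto simp: bounded_iff subset_iff)
  define M where "M = measure lborel (cball (0::real^'n) (R+1))"
  have M: "M \<ge> 0" by (simp add: M_def)
  have bound: "\<bar>LINT x|lborel. pd i \<phi> x\<bar> \<le> e * M" if e: "e > 0" for e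
  proof -
    obtain d where d: "d > 0" "\<And>z h. norm h < d \<Longrightarrow> \<bar>\<phi> (z + h) - \<phi> z - grad \<phi> z \<bullet> h\<bar> \<le> e * norm h"
      using test_function_taylor[OF \<phi> e] by blast
    \<comment> \<open>t < d makes the Taylor bound applicable; t \<le> 1 keeps the shifted support
      inside the ball of radius R + 1.\<close>
    define t where "t = min (d/2) 1"
    have t: "0 < t" "t < d" "t \<le> 1" using d by (auto simp: t_def)
    let ?h = "axis i t :: real^'n"
    have nh: "norm ?h = t" using t by (simp add: norm_eq_sqrt_inner inner_axis_axis)
    have gh: "grad \<phi> x \<bullet> ?h = t * pd i \<phi> x" for x by (simp add: inner_axis grad_def)
    have sh: "integrable lborel (\<lambda>x. \<phi> (x + ?h))" "(LINT x|lborel. \<phi> (x + ?h)) = (LINT x|lborel. \<phi> x)"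
      using integrable_lborel_shift[OF test_function_integrable[OF \<phi>], of "- ?h"]
        integral_lborel_shift[OF test_function_borel[OF \<phi>], of "- ?h"] by simp_all
    note ip = test_function_integrable[OF \<phi>] test_function_integrable[OF test_function_pd[OF \<phi>], of i]
    have "(LINT x|lborel. \<phi> (x + ?h) - \<phi> x - t * pd i \<phi> x) = - t * (LINT x|lborel. pd i \<phi> x)"
      using sh ip by simp
    moreover have "norm (LINT x|lborel. \<phi> (x + ?h) - \<phi> x - t * pd i \<phi> x) \<le> (LINT x|lborel. e * t * indicator (cball (0::real^'n) (R+1)) x)"
    proof (rule Bochner_Integration.integral_norm_bound_integral)
      show "norm (\<phi> (x + ?h) - \<phi> x - t * pd i \<phi> x) \<le> e * t * indicator (cball (0::real^'n) (R+1)) x" for x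
      proof (cases "x \<in> cball 0 (R+1)")
        case True
        then show ?thesis using d(2)[of ?h x] t nh gh[of x] by simp
      next
        case False
        have "norm x \<le> norm (x + ?h) + norm ?h" using norm_triangle_ineq4[of "x + ?h" ?h] by simp
        then have "x \<notin> cball 0 R" "x + ?h \<notin> cball 0 R" using False nh t by auto
        then have "x \<notin> K" "x + ?h \<notin> K" using R by blast+
        then show ?thesis using False K(2)[of x] K(2)[of "x + ?h"] K(3)[of x i] by simp
      qed
      show "integrable lborel (\<lambda>x::real^'n. e * t * indicator (cball (0::real^'n) (R+1)) x)"
        using emeasure_compact_finite[OF compact_cball, of "0::real^'n" "R+1"]
        by (intro integrable_mult_right integrable_real_indicator) auto
    qed (use sh ip in auto)
    moreover have "(LINT x|lborel. e * t * indicator (cball (0::real^'n) (R+1)) x) = t * (e * M)"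
      by (simp add: M_def)
    ultimately have "t * \<bar>LINT x|lborel. pd i \<phi> x\<bar> \<le> t * (e * M)" using t e by (simp add: abs_mult)
    then show ?thesis using t by simp
  qed
  have "\<bar>LINT x|lborel. pd i \<phi> x\<bar> \<le> 0 + e" if "e > 0" for e
  proof -
    have "\<bar>LINT x|lborel. pd i \<phi> x\<bar> \<le> e / (M + 1) * M" using that M by (intro bound) auto
    also have "\<dots> \<le> e" using that M by (simp add: divide_le_eq algebra_simps)
    finally show ?thesis by simp
  qed
  then show ?thesis using field_le_epsilon by (metis abs_le_zero_iff)
qed

lemma test_ibp:
  fixes \<phi> :: "real^'n \<Rightarrow> real"
  assumes \<phi>: "test_function UNIV \<phi>" and f: "smooth f"
  shows "(LINT x|lborel. \<phi> x * pd i f x) = - (LINT x|lborel. pd i \<phi> x * f x)"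
proof -
  have "pd i (\<lambda>x. \<phi> x * f x) = (\<lambda>x. \<phi> x * pd i f x + pd i \<phi> x * f x)"
    using pd_mult[OF test_function_smooth[OF \<phi>] f] by (intro ext)
  with test_integral_pd[OF test_function_mult[OF \<phi> f], of i]
  have "(LINT x|lborel. \<phi> x * pd i f x + pd i \<phi> x * f x) = 0" by simp
  moreover have "integrable lborel (\<lambda>x. \<phi> x * pd i f x)" "integrable lborel (\<lambda>x. pd i \<phi> x * f x)"
    using test_function_integrable test_function_mult[OF \<phi> smooth_pd[OF f]] test_function_mult[OF test_function_pd[OF \<phi>] f] by auto
  ultimately show ?thesis by simp
qed

subsection \<open>Cutoff functions\<close>

text \<open>Mollify the indicator of the closed 2e-neighbourhood of K at radius e: the average is 1
  on K and vanishes off the 3e-neighbourhood, which lies in D since 3 * e <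
  \<open>\<delta>\<close>.\<close>

lemma smooth_cutoff:
  fixes K D :: "(real^'n) set"
  assumes K: "compact K" and D: "open D" "K \<subseteq> D"
  obtains \<theta> where "test_function D \<theta>" "\<And>x. 0 \<le> \<theta> x" "\<And>x. \<theta> x \<le> 1" "\<And>x. x \<in> K \<Longrightarrow> \<theta> x = 1"
proof -
  obtain \<delta> where \<delta>: "\<delta> > 0" "(\<Union>x\<in>K. ball x \<delta>) \<subseteq> D"
    using compact_subset_open_imp_ball_epsilon_subset[OF K D] by blast
  define e where "e = \<delta> / 4"
  have e: "e > 0" "3 * e < \<delta>" using \<delta> by (auto simp: e_def)
  define KK where "KK = (\<lambda>r. {x + y |x y. x \<in> K \<and> y \<in> cball (0::real^'n) r})"
  have cK: "compact (KK r)" for r unfolding KK_def by (intro compact_sums K compact_cball)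
  have [measurable]: "KK r \<in> sets borel" for r using cK[of r] by (simp add: borel_compact)
  define f :: "real^'n \<Rightarrow> real" where "f = indicator (KK (2 * e))"
  have fi: "integrable lborel f" unfolding f_def
    using emeasure_compact_finite[OF cK, of "2 * e"] by (intro integrable_real_indicator) auto
  define \<theta> where "\<theta> = conv (mollifier e) f"
  have mem: "x \<in> KK r" if "y \<in> K" "dist y x \<le> r" for x y r
    unfolding KK_def mem_Collect_eq using that
    by (intro exI[of _ y] exI[of _ "x - y"] conjI) (auto simp: dist_norm norm_minus_commute)
  have "KK (3 * e) \<subseteq> D"
  proof
    fix z assume "z \<in> KK (3 * e)"
    then obtain x y where "z = x + y" "x \<in> K" "norm y \<le> 3 * e" by (auto simp: KK_def)
    then have "z \<in> ball x \<delta>" using e by (simp add: dist_norm)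
    then show "z \<in> D" using \<delta>(2) \<open>x \<in> K\<close> by blast
  qed
  moreover have "\<theta> x = 0" if x: "x \<notin> KK (3 * e)" for x
    unfolding \<theta>_def
  proof (rule conv_eq_0[OF e(1)])
    fix y assume y: "dist x y < e"
    have "y \<notin> KK (2 * e)"
    proof
      assume "y \<in> KK (2 * e)"
      then obtain a b where ab: "y = a + b" "a \<in> K" "norm b \<le> 2 * e" by (auto simp: KK_def)
      then have "dist a x \<le> 3 * e" using y dist_triangle[of a x y] by (simp add: dist_norm norm_minus_commute)
      then show False using mem[OF ab(2)] x by blast
    qed
    then show "f y = 0" by (simp add: f_def)
  qed
  ultimately have "test_function D \<theta>"
    unfolding test_function_iff \<theta>_def using smooth_conv[OF mollifier_test[OF e(1)] fi] cK by blast
  moreover have "0 \<le> \<theta> x" for x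
    unfolding \<theta>_def conv_def by (intro integral_nonneg_AE AE_I2) (simp add: f_def mollifier_nonneg e)
  moreover have "\<theta> x \<le> 1" for x
    using conv_bounded[OF e(1) fi, of 1 x] by (simp add: \<theta>_def f_def indicator_def)
  moreover have "\<theta> x = 1" if x: "x \<in> K" for x
  proof -
    have "mollifier e (x - y) *\<^sub>R f y = mollifier e (x - y)" for y
    proof (cases "dist x y < e")
      case True
      then have "y \<in> KK (2 * e)" using mem[OF x, of y "2 * e"] e by simp
      then show ?thesis by (simp add: f_def)
    next
      case False
      then show ?thesis using mollifier_eq_0[OF e(1), of "x - y"] by (simp add: dist_norm)
    qed
    then have "\<theta> x = (LINT y|lborel. mollifier e (x - y))" unfolding \<theta>_def conv_def by (simp only:)
    then show ?thesis using mollifier_integral_shift(2)[OF e(1)] by metis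
  qed
  ultimately show ?thesis by (rule that)
qed

section \<open>Lebesgue spaces, weak gradients and zero boundary values\<close>

subsection \<open>Borel representatives\<close>

lemma lebesgue_borel_rep:
  fixes f :: "'a::euclidean_space \<Rightarrow> 'b::euclidean_space"
  assumes f: "f \<in> borel_measurable lebesgue"
  shows "\<exists>g\<in>borel_measurable borel. AE x in lebesgue. f x = g x"
proof -
  have "\<exists>g\<in>borel_measurable borel. AE x in lebesgue. f x \<bullet> b = g x" for b
  proof -
    have "(\<lambda>x. f x \<bullet> b) \<in> borel_measurable lebesgue" using f by simp
    from completion_ex_borel_measurable_real[OF this] show ?thesis by (auto simp: AE_completion_iff)
  qed
  then obtain g where g: "\<And>b. g b \<in> borel_measurable borel" "\<And>b. AE x in lebesgue. f x \<bullet> b = g b x" by metis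
  have "AE x in lebesgue. \<forall>b\<in>Basis. f x \<bullet> b = g b x"
    using g(2) by (intro AE_finite_allI) auto
  then have "AE x in lebesgue. f x = (\<Sum>b\<in>Basis. g b x *\<^sub>R b)"
  proof eventually_elim
    case (elim x)
    have "(\<Sum>b\<in>Basis. (f x \<bullet> b) *\<^sub>R b) = (\<Sum>b\<in>Basis. g b x *\<^sub>R b)"
      using elim by (intro sum.cong) auto
    then show ?case by (simp only: euclidean_representation)
  qed
  moreover have "(\<lambda>x. \<Sum>b\<in>Basis. g b x *\<^sub>R b) \<in> borel_measurable borel"
    by (rule borel_measurable_sum, rule borel_measurable_scaleR[OF g(1) borel_measurable_const])
  ultimately show ?thesis by (rule rev_bexI[rotated])
qed

text \<open>The Fubini and substitution lemmas above concern Borel functions on the whole space. A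
  Borel representative that vanishes off \<Omega> turns integrals over \<Omega> into integrals over
  \<open>lborel\<close>.\<close>

lemma lebesgue_on_borel_rep:
  fixes f :: "'a::euclidean_space \<Rightarrow> 'b::euclidean_space"
  assumes \<Omega>: "open \<Omega>" and f: "f \<in> borel_measurable (lebesgue_on \<Omega>)"
  shows "\<exists>g. g \<in> borel_measurable borel \<and> (\<forall>x. x \<notin> \<Omega> \<longrightarrow> g x = 0) \<and> (AE x in lebesgue_on \<Omega>. g x = f x)"
proof -
  have [measurable]: "\<Omega> \<in> sets borel" using \<Omega> by simp
  have \<Omega>l: "\<Omega> \<inter> space lebesgue \<in> sets lebesgue" using \<Omega> by simp
  have "(\<lambda>x. indicator \<Omega> x *\<^sub>R f x) \<in> borel_measurable lebesgue"
    using f borel_measurable_restrict_space_iff[OF \<Omega>l] by blast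
  from lebesgue_borel_rep[OF this] obtain h where h: "h \<in> borel_measurable borel" "AE x in lebesgue. indicator \<Omega> x *\<^sub>R f x = h x"
    by blast
  have "AE x in lebesgue_on \<Omega>. indicator \<Omega> x *\<^sub>R h x = f x"
    unfolding AE_restrict_space_iff[OF \<Omega>l] using h(2) by eventually_elim auto
  then show ?thesis using h(1) by (intro exI[of _ "\<lambda>x. indicator \<Omega> x *\<^sub>R h x"]) auto
qed

lemma nn_integral_lebesgue_on:
  assumes "open \<Omega>" and g: "g \<in> borel_measurable borel" and "\<And>x. x \<notin> \<Omega> \<Longrightarrow> g x = 0"
  shows "(\<integral>\<^sup>+x. g x \<partial>lebesgue_on \<Omega>) = (\<integral>\<^sup>+x. g x \<partial>lborel)"
proof -
  have "(\<integral>\<^sup>+x. g x \<partial>lebesgue_on \<Omega>) = (\<integral>\<^sup>+x. g x * indicator \<Omega> x \<partial>lebesgue)"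
    using assms by (intro nn_integral_restrict_space) auto
  also have "\<dots> = (\<integral>\<^sup>+x. g x \<partial>lebesgue)"
    using assms(3) by (intro nn_integral_cong) (auto simp: indicator_def)
  also have "\<dots> = (\<integral>\<^sup>+x. g x \<partial>lborel)" by (simp add: nn_integral_completion)
  finally show ?thesis .
qed

lemma integral_lebesgue_on:
  fixes g :: "'a::euclidean_space \<Rightarrow> 'b::euclidean_space"
  assumes "open \<Omega>" and g: "g \<in> borel_measurable borel" and "\<And>x. x \<notin> \<Omega> \<Longrightarrow> g x = 0"
  shows "(LINT x|lebesgue_on \<Omega>. g x) = (LINT x|lborel. g x)"
    and "integrable (lebesgue_on \<Omega>) g \<longleftrightarrow> integrable lborel g"
proof -
  have eq: "(\<lambda>x. indicator \<Omega> x *\<^sub>R g x) = g" using assms(3) by (auto simp: indicator_def)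
  have \<Omega>l: "\<Omega> \<inter> space lebesgue \<in> sets lebesgue" using assms(1) by simp
  have [measurable]: "g \<in> borel_measurable lborel" using g by simp
  show "(LINT x|lebesgue_on \<Omega>. g x) = (LINT x|lborel. g x)"
    unfolding integral_restrict_space[OF \<Omega>l] eq using g by (simp add: integral_completion)
  show "integrable (lebesgue_on \<Omega>) g \<longleftrightarrow> integrable lborel g"
    unfolding integrable_restrict_space[OF \<Omega>l] eq using g by (simp add: integrable_completion)
qed

subsection \<open>The fundamental lemma of the calculus of variations\<close>

lemma locally_integrable_test:
  assumes f: "locally_integrable \<Omega> f" and \<phi>: "test_function \<Omega> \<phi>" and \<Omega>: "open \<Omega>"
  shows "integrable (lebesgue_on \<Omega>) (\<lambda>x. \<phi> x *\<^sub>R f x)"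
proof -
  obtain K where K: "compact K" "K \<subseteq> \<Omega>" "\<And>x. x \<notin> K \<Longrightarrow> \<phi> x = 0" using test_function_support[OF \<phi>] by blast
  obtain B where B: "B > 0" "\<And>x. \<bar>\<phi> x\<bar> \<le> B" using test_function_bounded[OF \<phi>] by blast
  have sK: "K \<in> sets lebesgue" using K(1) by (simp add: borel_compact)
  have "integrable (lebesgue_on K) f" using f K by (simp add: locally_integrable_def)
  then have fK: "integrable lebesgue (\<lambda>x. indicator K x *\<^sub>R f x)"
    using sK by (simp add: integrable_restrict_space)
  have "integrable lebesgue (\<lambda>x. \<phi> x *\<^sub>R (indicator K x *\<^sub>R f x))"
  proof (rule Bochner_Integration.integrable_bound[OF integrable_scaleR_right[OF fK, of B]])
    have "\<phi> \<in> borel_measurable lebesgue" using test_function_borel[OF \<phi>] by (simp add: measurable_completion)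
    then show "(\<lambda>x. \<phi> x *\<^sub>R indicator K x *\<^sub>R f x) \<in> borel_measurable lebesgue"
      by (rule borel_measurable_scaleR[OF _ borel_measurable_integrable[OF fK]])
    show "AE x in lebesgue. norm (\<phi> x *\<^sub>R indicator K x *\<^sub>R f x) \<le> norm (B *\<^sub>R indicator K x *\<^sub>R f x)"
      using B by (intro AE_I2) (auto simp: indicator_def intro!: mult_right_mono)
  qed
  moreover have "(\<lambda>x. \<phi> x *\<^sub>R (indicator K x *\<^sub>R f x)) = (\<lambda>x. indicator \<Omega> x *\<^sub>R (\<phi> x *\<^sub>R f x))"
    using K by (auto simp: indicator_def fun_eq_iff)
  ultimately show ?thesis using \<Omega> by (simp add: integrable_restrict_space)
qed

text \<open>Near an interior point the mollifications of f are themselves integrals of f against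
  test functions, hence 0, and they converge to f in the mean. Countably many of the resulting balls
  cover \<Omega> by Lindelof's theorem, so the exceptional null sets add up to a null set.\<close>

lemma du_Bois_Reymond:
  fixes f :: "real^'n \<Rightarrow> real"
  assumes \<Omega>: "open \<Omega>" and f: "locally_integrable \<Omega> f"
    and 0: "\<And>\<phi>. test_function \<Omega> \<phi> \<Longrightarrow> (LINT x|lebesgue_on \<Omega>. \<phi> x * f x) = 0"
  shows "AE x in lebesgue_on \<Omega>. f x = 0"
proof -
  have \<Omega>l: "\<Omega> \<inter> space lebesgue \<in> sets lebesgue" using \<Omega> by simp
  have loc: "\<exists>\<delta>>0. ball x0 \<delta> \<subseteq> \<Omega> \<and> (AE x in lebesgue. x \<in> ball x0 \<delta> \<longrightarrow> f x = 0)" if x0: "x0 \<in> \<Omega>" for x0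
  proof -
    obtain r where r: "r > 0" "cball x0 r \<subseteq> \<Omega>" using \<Omega> x0 open_contains_cball by metis
    \<comment> \<open>Half the radius leaves room for the kernel: centred at a point of the
      \<open>\<delta>\<close>-ball, its support stays in the r-ball, where g represents f.\<close>
    define \<delta> where "\<delta> = r / 2"
    have \<delta>: "\<delta> > 0" "r = 2 * \<delta>" using r by (auto simp: \<delta>_def)
    have "integrable (lebesgue_on (cball x0 r)) f" using f r by (simp add: locally_integrable_def)
    then have fi: "integrable lebesgue (\<lambda>x. indicator (cball x0 r) x *\<^sub>R f x)" by (simp add: integrable_restrict_space)
    then obtain g where g: "g \<in> borel_measurable borel" "AE x in lebesgue. indicator (cball x0 r) x *\<^sub>R f x = g x"
      using lebesgue_borel_rep by blast
    have gi: "integrable lborel g"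
    proof -
      have "g \<in> borel_measurable lebesgue" using g(1) by (simp add: measurable_completion)
      then have "integrable lebesgue g" using g(2) fi by (subst integrable_cong_AE[symmetric, OF _ _ g(2)]) auto
      then show ?thesis using integrable_completion[of g lborel] g(1) by simp
    qed
    have conv0: "conv (mollifier e) g x = 0" if e: "0 < e" "e < \<delta>" and x: "x \<in> ball x0 \<delta>" for e x
    proof -
      have sub: "cball x e \<subseteq> cball x0 r"
      proof
        fix y assume "y \<in> cball x e"
        then show "y \<in> cball x0 r" using x e \<delta> dist_triangle[of x0 y x] by simp
      qed
      have "mollifier e (x - y) = 0" if "y \<notin> cball x e" for y
        using that mollifier_eq_0[OF e(1), of "x - y"] by (simp add: dist_norm)
      then have "compact (cball x e) \<and> cball x e \<subseteq> \<Omega> \<and> (\<forall>y. y \<notin> cball x e \<longrightarrow> mollifier e (x - y) = 0)"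
        using sub r(2) by auto
      then have t: "test_function \<Omega> (\<lambda>y. mollifier e (x - y))"
        unfolding test_function_iff
        using test_function_translate(1)[OF test_function_smooth[OF mollifier_test[OF e(1)]], of x] by blast
      have "conv (mollifier e) g x = (LINT y|lebesgue. mollifier e (x - y) * g y)"
        unfolding conv_def using g(1) by (subst integral_completion) auto
      also have "\<dots> = (LINT y|lebesgue. indicator \<Omega> y *\<^sub>R (mollifier e (x - y) * f y))"
      proof (rule integral_cong_AE)
        show m: "(\<lambda>y. mollifier e (x - y) * g y) \<in> borel_measurable lebesgue"
          using g(1) by (intro measurable_completion) simp
        show "(\<lambda>y. indicator \<Omega> y *\<^sub>R (mollifier e (x - y) * f y)) \<in> borel_measurable lebesgue"
          using locally_integrable_test[OF f t \<Omega>] \<Omega> by (simp add: integrable_restrict_space borel_measurable_integrable)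
        show "AE y in lebesgue. mollifier e (x - y) * g y = indicator \<Omega> y *\<^sub>R (mollifier e (x - y) * f y)"
          using g(2)
        proof eventually_elim
          case (elim y)
          show ?case
          proof (cases "y \<in> cball x0 r")
            case True then show ?thesis using elim r(2) by auto
          next
            case False
            then have "y \<notin> cball x e" using sub by blast
            then have "mollifier e (x - y) = 0" using mollifier_eq_0[OF e(1), of "x - y"] by (simp add: dist_norm)
            then show ?thesis by simp
          qed
        qed
      qed
      also have "\<dots> = (LINT y|lebesgue_on \<Omega>. mollifier e (x - y) * f y)" by (simp add: integral_restrict_space[OF \<Omega>l])
      also have "\<dots> = 0" by (rule 0[OF t])
      finally show ?thesis .
    qed
    have "(\<integral>\<^sup>+x. ennreal (norm (g x)) * indicator (ball x0 \<delta>) x \<partial>lborel) \<le> 0 + ennreal \<eta>" if \<eta>: "\<eta> > 0" for \<eta>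
    proof -
      obtain d where d: "d > 0" "\<And>e. 0 < e \<and> e < d \<Longrightarrow> (\<integral>\<^sup>+x. norm (conv (mollifier e) g x - g x) \<partial>lborel) \<le> ennreal \<eta>"
        using conv_L1[OF gi \<eta>] by blast
      define e where "e = min d \<delta> / 2"
      have e: "0 < e" "e < d" "e < \<delta>" using d \<delta> by (auto simp: e_def)
      have "(\<integral>\<^sup>+x. ennreal (norm (g x)) * indicator (ball x0 \<delta>) x \<partial>lborel) \<le> (\<integral>\<^sup>+x. norm (conv (mollifier e) g x - g x) \<partial>lborel)"
      proof (rule nn_integral_mono)
        fix x
        show "ennreal (norm (g x)) * indicator (ball x0 \<delta>) x \<le> ennreal (norm (conv (mollifier e) g x - g x))"
          using conv0[OF e(1,3), of x] by (cases "x \<in> ball x0 \<delta>") auto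
      qed
      also have "\<dots> \<le> ennreal \<eta>" using d e by auto
      finally show ?thesis by simp
    qed
    then have "(\<integral>\<^sup>+x. ennreal (norm (g x)) * indicator (ball x0 \<delta>) x \<partial>lborel) \<le> 0" by (rule ennreal_le_epsilon) auto
    moreover have [measurable]: "g \<in> borel_measurable borel" by (rule g(1))
    moreover have "(\<lambda>x. ennreal (norm (g x)) * indicator (ball x0 \<delta>) x) \<in> borel_measurable lborel"
      using g(1) by (intro borel_measurable_times_ennreal measurable_compose[OF _ measurable_ennreal] borel_measurable_norm borel_measurable_indicator) auto
    ultimately have "AE x in lborel. ennreal (norm (g x)) * indicator (ball x0 \<delta>) x = 0"
      by (subst nn_integral_0_iff_AE[symmetric]) (simp_all only: order.antisym zero_le)
    then have "AE x in lebesgue. ennreal (norm (g x)) * indicator (ball x0 \<delta>) x = 0" by (rule AE_completion)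
    then have "AE x in lebesgue. x \<in> ball x0 \<delta> \<longrightarrow> f x = 0"
      using g(2) by eventually_elim (use \<delta> in \<open>auto simp: indicator_def split: if_splits\<close>)
    moreover have "ball x0 \<delta> \<subseteq> \<Omega>" using r \<delta> ball_subset_cball[of x0 r] subset_ball[of \<delta> r x0] by auto
    ultimately show ?thesis using \<delta>(1) by blast
  qed
  then obtain \<delta> where \<delta>: "\<And>x. x \<in> \<Omega> \<Longrightarrow> \<delta> x > 0" "\<And>x. x \<in> \<Omega> \<Longrightarrow> AE y in lebesgue. y \<in> ball x (\<delta> x) \<longrightarrow> f y = 0"
    by metis
  obtain X where X: "X \<subseteq> (\<lambda>x. ball x (\<delta> x)) ` \<Omega>" "countable X" "\<Union>X = \<Union>((\<lambda>x. ball x (\<delta> x)) ` \<Omega>)"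
    by (rule Lindelof[of "(\<lambda>x. ball x (\<delta> x)) ` \<Omega>"]) auto
  have "AE y in lebesgue. \<forall>B\<in>X. y \<in> B \<longrightarrow> f y = 0"
    using X(1) \<delta>(2) by (subst AE_ball_countable[OF X(2)]) blast
  then have "AE y in lebesgue. y \<in> \<Omega> \<longrightarrow> f y = 0"
  proof eventually_elim
    case (elim y)
    show ?case
    proof
      assume "y \<in> \<Omega>"
      then have "y \<in> \<Union>X" unfolding X(3) using \<delta>(1) by force
      then show "f y = 0" using elim by blast
    qed
  qed
  then show ?thesis by (simp add: AE_restrict_space_iff[OF \<Omega>l])
qed

subsection \<open>Lebesgue spaces\<close>

lemma finite_measure_lebesgue_on:
  "open \<Omega> \<Longrightarrow> bounded \<Omega> \<Longrightarrow> finite_measure (lebesgue_on (\<Omega>::('a::euclidean_space) set))"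
  using emeasure_bounded_finite[of \<Omega>]
  by (intro finite_measureI) (simp add: emeasure_restrict_space space_restrict_space)

lemma lebesgue_on_AE_measurable:
  fixes f g :: "'a::euclidean_space \<Rightarrow> 'b::euclidean_space"
  assumes \<Omega>: "open \<Omega>" and f: "f \<in> borel_measurable (lebesgue_on \<Omega>)" and fg: "AE x in lebesgue_on \<Omega>. f x = g x"
  shows "g \<in> borel_measurable (lebesgue_on \<Omega>)"
proof -
  have \<Omega>l: "\<Omega> \<inter> space lebesgue \<in> sets lebesgue" using \<Omega> by simp
  have "(\<lambda>x. indicator \<Omega> x *\<^sub>R f x) \<in> borel_measurable lebesgue"
    using f borel_measurable_restrict_space_iff[OF \<Omega>l] by blast
  moreover have "AE x in lebesgue. indicator \<Omega> x *\<^sub>R f x = indicator \<Omega> x *\<^sub>R g x"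
    using fg unfolding AE_restrict_space_iff[OF \<Omega>l] by eventually_elim (auto simp: indicator_def)
  ultimately have "(\<lambda>x. indicator \<Omega> x *\<^sub>R g x) \<in> borel_measurable lebesgue" by (rule borel_measurable_AE)
  then show ?thesis using borel_measurable_restrict_space_iff[OF \<Omega>l] by blast
qed

text \<open>Up to the level l the first term dominates, above it the second. With l free this takes
  the place of Hoelder's inequality: l = 1 gives inclusions between L^p spaces, and other levels
  balance the terms in Morrey's inequality and make the gradient bounds uniform in p.\<close>

lemma powr_mix:
  fixes t l s q :: real
  assumes "t \<ge> 0" "l > 0" "0 \<le> s" "s \<le> q"
  shows "t powr s \<le> l powr s + l powr (s - q) * t powr q"
proof (cases "t \<le> l")
  case True
  then have "t powr s \<le> l powr s" using assms by (intro powr_mono2) auto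
  then show ?thesis by (simp add: add_increasing2)
next
  case False
  then have "t powr s = t powr (s - q) * t powr q" using assms by (simp flip: powr_add)
  also have "\<dots> \<le> l powr (s - q) * t powr q"
    using False assms by (intro mult_right_mono powr_mono2') auto
  finally show ?thesis by (simp add: add_increasing)
qed

lemma Lp_iff:
  fixes q :: real
  shows "f \<in> Lp q \<Omega> \<longleftrightarrow> f \<in> borel_measurable (lebesgue_on \<Omega>) \<and> (\<integral>\<^sup>+x. norm (f x) powr q \<partial>lebesgue_on \<Omega>) < \<infinity>"
  by (auto simp: Lp_def Lp_norm_def Let_def less_top split: if_splits)

lemma Lp_norm_le:
  fixes q B :: real
  assumes "(\<integral>\<^sup>+x. norm (f x) powr q \<partial>lebesgue_on \<Omega>) \<le> ennreal B" "B \<ge> 0" "q > 0"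
  shows "Lp_norm q \<Omega> f \<le> ereal (B powr (1 / q))"
proof -
  have fin: "(\<integral>\<^sup>+x. norm (f x) powr q \<partial>lebesgue_on \<Omega>) \<noteq> \<infinity>"
    using assms(1) by (auto simp: top_unique)
  have "enn2real (\<integral>\<^sup>+x. norm (f x) powr q \<partial>lebesgue_on \<Omega>) \<le> B"
    using assms by (intro enn2real_leI) auto
  then have "enn2real (\<integral>\<^sup>+x. norm (f x) powr q \<partial>lebesgue_on \<Omega>) powr (1/q) \<le> B powr (1/q)"
    using assms(3) by (intro powr_mono2) auto
  then show ?thesis using fin by (simp add: Lp_norm_def Let_def)
qed

lemma Lp_norm_cong:
  assumes "AE x in lebesgue_on \<Omega>. f x = g x"
    and "f \<in> borel_measurable (lebesgue_on \<Omega>)" "g \<in> borel_measurable (lebesgue_on \<Omega>)"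
  shows "Lp_norm p \<Omega> f = Lp_norm p \<Omega> g"
proof -
  have "(\<integral>\<^sup>+x. norm (f x) powr real_of_ereal p \<partial>lebesgue_on \<Omega>) = (\<integral>\<^sup>+x. norm (g x) powr real_of_ereal p \<partial>lebesgue_on \<Omega>)"
    using assms(1) by (intro nn_integral_cong_AE) (auto elim: eventually_mono)
  moreover have "esssup (lebesgue_on \<Omega>) (\<lambda>x. ereal (norm (f x))) = esssup (lebesgue_on \<Omega>) (\<lambda>x. ereal (norm (g x)))"
    using assms by (intro esssup_AE_cong) (auto elim: eventually_mono)
  ultimately show ?thesis by (simp add: Lp_norm_def)
qed

text \<open>Infinity is excluded because \<open>esssup\<close> over a null set is minus
  infinity.\<close>

lemma Lp_norm_nonneg: "q \<noteq> \<infinity> \<Longrightarrow> Lp_norm q \<Omega> f \<ge> 0"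
  by (simp add: Lp_norm_def Let_def)

lemma Lp_norm_1: "Lp_norm 1 \<Omega> f = enn2ereal (\<integral>\<^sup>+x. norm (f x) \<partial>lebesgue_on \<Omega>)"
proof (cases "(\<integral>\<^sup>+x. norm (f x) \<partial>lebesgue_on \<Omega>) = \<infinity>")
  case False
  then obtain r where "r \<ge> 0" "(\<integral>\<^sup>+x. norm (f x) \<partial>lebesgue_on \<Omega>) = ennreal r"
    by (cases "\<integral>\<^sup>+x. norm (f x) \<partial>lebesgue_on \<Omega>") auto
  then show ?thesis by (simp add: Lp_norm_def one_ereal_def enn2ereal_ennreal)
qed (simp add: Lp_norm_def one_ereal_def)

lemma Lp_inf_iff:
  "f \<in> Lp \<infinity> \<Omega> \<longleftrightarrow> f \<in> borel_measurable (lebesgue_on \<Omega>) \<and> (\<exists>M::real. AE x in lebesgue_on \<Omega>. norm (f x) \<le> M)"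
proof
  assume f: "f \<in> Lp \<infinity> \<Omega>"
  then have "esssup (lebesgue_on \<Omega>) (\<lambda>x. ereal (norm (f x))) < \<infinity>" by (simp add: Lp_def Lp_norm_def)
  then obtain M where M: "esssup (lebesgue_on \<Omega>) (\<lambda>x. ereal (norm (f x))) \<le> ereal M"
    by (cases "esssup (lebesgue_on \<Omega>) (\<lambda>x. ereal (norm (f x)))") auto
  have "AE x in lebesgue_on \<Omega>. norm (f x) \<le> M"
    using esssup_AE[of "\<lambda>x. ereal (norm (f x))" "lebesgue_on \<Omega>"]
  proof eventually_elim
    case (elim x)
    then have "ereal (norm (f x)) \<le> ereal M" using M by (rule order_trans)
    then show ?case by simp
  qed
  then show "f \<in> borel_measurable (lebesgue_on \<Omega>) \<and> (\<exists>M::real. AE x in lebesgue_on \<Omega>. norm (f x) \<le> M)"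
    using f by (auto simp: Lp_def)
next
  assume "f \<in> borel_measurable (lebesgue_on \<Omega>) \<and> (\<exists>M::real. AE x in lebesgue_on \<Omega>. norm (f x) \<le> M)"
  then obtain M where f: "f \<in> borel_measurable (lebesgue_on \<Omega>)" "AE x in lebesgue_on \<Omega>. norm (f x) \<le> M" by blast
  then have "esssup (lebesgue_on \<Omega>) (\<lambda>x. ereal (norm (f x))) \<le> ereal M" by (intro esssup_I) auto
  then show "f \<in> Lp \<infinity> \<Omega>" using f by (auto simp: Lp_def Lp_norm_def)
qed

lemma nn_integral_powr_mix:
  fixes l s q :: real
  assumes "l > 0" "0 \<le> s" "s \<le> q" and [measurable]: "f \<in> borel_measurable M"
  shows "(\<integral>\<^sup>+x. norm (f x) powr s \<partial>M) \<le> ennreal (l powr s) * emeasure M (space M) + ennreal (l powr (s - q)) * (\<integral>\<^sup>+x. norm (f x) powr q \<partial>M)"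
proof -
  have "(\<integral>\<^sup>+x. norm (f x) powr s \<partial>M) \<le> (\<integral>\<^sup>+x. ennreal (l powr s) + ennreal (l powr (s - q)) * ennreal (norm (f x) powr q) \<partial>M)"
    using powr_mix[OF _ assms(1-3)]
    by (intro nn_integral_mono) (simp add: ennreal_mult[symmetric] ennreal_plus[symmetric] del: ennreal_plus)
  also have "\<dots> = ennreal (l powr s) * emeasure M (space M) + ennreal (l powr (s - q)) * (\<integral>\<^sup>+x. norm (f x) powr q \<partial>M)"
    by (subst nn_integral_add) (auto simp: nn_integral_cmult)
  finally show ?thesis .
qed

locale bounded_open =
  fixes \<Omega> :: "(real^'n) set"
  assumes open_\<Omega>: "open \<Omega>" and bounded_\<Omega>: "bounded \<Omega>"
begin

sublocale finite_measure "lebesgue_on \<Omega>"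
  by (rule finite_measure_lebesgue_on[OF open_\<Omega> bounded_\<Omega>])

lemma \<Omega>_sets [simp]: "\<Omega> \<inter> space lebesgue \<in> sets lebesgue" "\<Omega> \<in> sets lebesgue"
  using open_\<Omega> by auto

lemma emeasure_\<Omega> [simp]: "emeasure (lebesgue_on \<Omega>) \<Omega> < top"
  by (simp add: less_top[symmetric])

lemma Lp_mono:
  fixes s q :: real
  assumes f: "f \<in> Lp q \<Omega>" and s: "0 \<le> s" "s \<le> q"
  shows "f \<in> Lp s \<Omega>"
proof -
  have [measurable]: "f \<in> borel_measurable (lebesgue_on \<Omega>)" using f by (simp add: Lp_iff)
  have "(\<integral>\<^sup>+x. norm (f x) powr s \<partial>lebesgue_on \<Omega>) \<le> emeasure (lebesgue_on \<Omega>) (space (lebesgue_on \<Omega>)) + (\<integral>\<^sup>+x. norm (f x) powr q \<partial>lebesgue_on \<Omega>)"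
    using nn_integral_powr_mix[of 1 s q f "lebesgue_on \<Omega>"] s by simp
  also have "\<dots> < \<infinity>" using f by (simp add: Lp_iff)
  finally show ?thesis by (simp add: Lp_iff)
qed

lemma Lp_inf_mono:
  fixes q :: real
  assumes f: "f \<in> Lp \<infinity> \<Omega>" and q: "q \<ge> 0"
  shows "f \<in> Lp q \<Omega>"
proof -
  obtain M where M: "f \<in> borel_measurable (lebesgue_on \<Omega>)" "AE x in lebesgue_on \<Omega>. norm (f x) \<le> M"
    using f by (auto simp: Lp_inf_iff)
  have "(\<integral>\<^sup>+x. norm (f x) powr q \<partial>lebesgue_on \<Omega>) \<le> (\<integral>\<^sup>+x. ennreal (M powr q) \<partial>lebesgue_on \<Omega>)"
    using M(2) q by (intro nn_integral_mono_AE) (auto elim!: eventually_mono intro!: ennreal_leI powr_mono2)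
  also have "\<dots> < \<infinity>" by (simp add: ennreal_mult_less_top)
  finally show ?thesis using M by (simp add: Lp_iff)
qed

lemma Lp_1_iff: "f \<in> Lp 1 \<Omega> \<longleftrightarrow> integrable (lebesgue_on \<Omega>) f"
  using Lp_iff[of f 1 \<Omega>] by (simp add: one_ereal_def integrable_iff_bounded)

lemma Lp_integrable: "f \<in> Lp (ereal q) \<Omega> \<Longrightarrow> q \<ge> 1 \<Longrightarrow> integrable (lebesgue_on \<Omega>) f"
  using Lp_mono[of f q 1] Lp_1_iff[of f] by (simp add: one_ereal_def)

lemma integrable_locally_integrable:
  fixes f :: "real^'n \<Rightarrow> 'b::euclidean_space"
  assumes f: "integrable (lebesgue_on \<Omega>) f" shows "locally_integrable \<Omega> f"
  unfolding locally_integrable_def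
proof (intro allI impI)
  fix K assume K: "compact K \<and> K \<subseteq> \<Omega>"
  then have sK: "K \<in> sets lebesgue" by (simp add: borel_compact)
  have "integrable lebesgue (\<lambda>x. indicator \<Omega> x *\<^sub>R f x)" using f by (simp add: integrable_restrict_space)
  from integrable_mult_indicator[OF sK this]
  have "integrable lebesgue (\<lambda>x. indicator K x *\<^sub>R indicator \<Omega> x *\<^sub>R f x)" .
  also have "(\<lambda>x. indicator K x *\<^sub>R indicator \<Omega> x *\<^sub>R f x) = (\<lambda>x. indicator K x *\<^sub>R f x)"
    using K by (auto simp: indicator_def fun_eq_iff of_bool_def)
  finally show "integrable (lebesgue_on K) f" using sK by (simp add: integrable_restrict_space)
qed

end

subsection \<open>Weak gradients\<close>

lemma integrable_vec_nth: "integrable M (f :: _ \<Rightarrow> 'b::euclidean_space^'k) \<Longrightarrow> integrable M (\<lambda>x. f x $ k)"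
  using integrable_bounded_linear[OF bounded_linear_vec_nth] by blast

lemma integrable_vec_lambda:
  fixes f :: "'i::finite \<Rightarrow> 'x \<Rightarrow> 'b::euclidean_space"
  assumes "\<And>k. integrable M (f k)"
  shows "integrable M (\<lambda>x. \<chi> k. f k x)"
proof -
  have eq: "(\<chi> k. f k x) = (\<Sum>k\<in>UNIV. axis k (f k x))" for x
    by (simp add: vec_eq_iff axis_def)
  have "bounded_linear (axis k :: 'b \<Rightarrow> 'b^'i)" for k
    by (rule bounded_linear_intro[where K = 1])
      (auto simp: axis_def vec_eq_iff norm_vec_def L2_set_def if_distrib[where f = "\<lambda>x. (norm x)\<^sup>2"] cong: if_cong)
  then have "integrable M (\<lambda>x. axis k (f k x) :: 'b^'i)" for k
    using integrable_bounded_linear assms by blast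
  then show ?thesis unfolding eq by auto
qed

lemma locally_integrable_nth: "locally_integrable \<Omega> u \<Longrightarrow> locally_integrable \<Omega> (\<lambda>x. u x $ k)"
  unfolding locally_integrable_def using integrable_vec_nth by blast

lemma locally_integrable_add:
  "locally_integrable \<Omega> u \<Longrightarrow> locally_integrable \<Omega> v \<Longrightarrow> locally_integrable \<Omega> (\<lambda>x. u x + v x)"
  unfolding locally_integrable_def using Bochner_Integration.integrable_add by blast

lemma locally_integrable_scaleR:
  "locally_integrable \<Omega> u \<Longrightarrow> locally_integrable \<Omega> (\<lambda>x. c *\<^sub>R u x)"
  unfolding locally_integrable_def using integrable_scaleR_right by blast

definition Dmap :: "(real^'n \<Rightarrow> real^'m) \<Rightarrow> real^'n \<Rightarrow> real^'n^'m" where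
  "Dmap \<phi> x = (\<chi> k. grad (\<lambda>y. \<phi> y $ k) x)"

context
  fixes \<Omega> :: "(real^'n) set"
  assumes \<Omega>: "open \<Omega>"
begin

lemma weak_gradient_products:
  assumes "weak_gradient \<Omega> u G" and \<phi>: "test_function \<Omega> \<phi>"
  shows "integrable (lebesgue_on \<Omega>) (\<lambda>x. u x $ k * pd i \<phi> x)" "integrable (lebesgue_on \<Omega>) (\<lambda>x. G x $ k $ i * \<phi> x)"
    and "(LINT x|lebesgue_on \<Omega>. u x $ k * pd i \<phi> x) = - (LINT x|lebesgue_on \<Omega>. G x $ k $ i * \<phi> x)"
  using assms locally_integrable_test[OF locally_integrable_nth test_function_pd[OF \<phi>] \<Omega>, of u i k]
    locally_integrable_test[OF locally_integrable_nth[OF locally_integrable_nth] \<phi> \<Omega>, of G k i]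
  unfolding weak_gradient_def pd_def by (auto simp: mult.commute)

lemma weak_gradientI:
  assumes "locally_integrable \<Omega> u" "locally_integrable \<Omega> G"
    and "\<And>\<phi> k i. test_function \<Omega> \<phi> \<Longrightarrow> (LINT x|lebesgue_on \<Omega>. u x $ k * pd i \<phi> x) = - (LINT x|lebesgue_on \<Omega>. G x $ k $ i * \<phi> x)"
  shows "weak_gradient \<Omega> u G"
  using assms unfolding weak_gradient_def pd_def by blast

lemma weak_gradient_lincomb:
  assumes u: "weak_gradient \<Omega> u G" and v: "weak_gradient \<Omega> v H"
  shows "weak_gradient \<Omega> (\<lambda>x. a *\<^sub>R u x + b *\<^sub>R v x) (\<lambda>x. a *\<^sub>R G x + b *\<^sub>R H x)"
proof (rule weak_gradientI)
  show "locally_integrable \<Omega> (\<lambda>x. a *\<^sub>R u x + b *\<^sub>R v x)" "locally_integrable \<Omega> (\<lambda>x. a *\<^sub>R G x + b *\<^sub>R H x)"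
    using u v by (auto simp: weak_gradient_def intro!: locally_integrable_add locally_integrable_scaleR)
  fix \<phi> k i assume \<phi>: "test_function \<Omega> \<phi>"
  note pu = weak_gradient_products[OF u \<phi>, of k i] and pv = weak_gradient_products[OF v \<phi>, of k i]
  have "(LINT x|lebesgue_on \<Omega>. (a *\<^sub>R u x + b *\<^sub>R v x) $ k * pd i \<phi> x) =
    (LINT x|lebesgue_on \<Omega>. a * (u x $ k * pd i \<phi> x) + b * (v x $ k * pd i \<phi> x))"
    by (simp add: algebra_simps)
  also have "\<dots> = a * (LINT x|lebesgue_on \<Omega>. u x $ k * pd i \<phi> x) + b * (LINT x|lebesgue_on \<Omega>. v x $ k * pd i \<phi> x)"
    using pu(1) pv(1) by simp
  also have "\<dots> = - (a * (LINT x|lebesgue_on \<Omega>. G x $ k $ i * \<phi> x) + b * (LINT x|lebesgue_on \<Omega>. H x $ k $ i * \<phi> x))"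
    unfolding pu(3) pv(3) by simp
  also have "\<dots> = - (LINT x|lebesgue_on \<Omega>. a * (G x $ k $ i * \<phi> x) + b * (H x $ k $ i * \<phi> x))"
    using pu(2) pv(2) by simp
  finally show "(LINT x|lebesgue_on \<Omega>. (a *\<^sub>R u x + b *\<^sub>R v x) $ k * pd i \<phi> x) =
    - (LINT x|lebesgue_on \<Omega>. (a *\<^sub>R G x + b *\<^sub>R H x) $ k $ i * \<phi> x)"
    by (simp add: algebra_simps)
qed

lemma weak_gradient_unique:
  fixes u :: "real^'n \<Rightarrow> real^'m"
  assumes G: "weak_gradient \<Omega> u G" and H: "weak_gradient \<Omega> u H"
  shows "AE x in lebesgue_on \<Omega>. G x = H x"
proof -
  have lG: "locally_integrable \<Omega> G" "locally_integrable \<Omega> H" using G H by (auto simp: weak_gradient_def)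
  have "AE x in lebesgue_on \<Omega>. G x $ k $ i - H x $ k $ i = 0" for k i
  proof (rule du_Bois_Reymond[OF \<Omega>])
    show "locally_integrable \<Omega> (\<lambda>x. G x $ k $ i - H x $ k $ i)"
      using locally_integrable_nth[OF locally_integrable_nth[OF locally_integrable_add[OF lG(1) locally_integrable_scaleR[OF lG(2), of "-1"]]], of k i]
      by simp
    fix \<phi> assume \<phi>: "test_function \<Omega> \<phi>"
    note pG = weak_gradient_products[OF G \<phi>, of k i] and pH = weak_gradient_products[OF H \<phi>, of k i]
    have "(LINT x|lebesgue_on \<Omega>. \<phi> x * (G x $ k $ i - H x $ k $ i)) =
      (LINT x|lebesgue_on \<Omega>. G x $ k $ i * \<phi> x - H x $ k $ i * \<phi> x)" by (simp add: algebra_simps)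
    also have "\<dots> = 0" using pG pH by simp
    finally show "(LINT x|lebesgue_on \<Omega>. \<phi> x * (G x $ k $ i - H x $ k $ i)) = 0" .
  qed
  then have "AE x in lebesgue_on \<Omega>. \<forall>k\<in>UNIV. \<forall>i\<in>UNIV. G x $ k $ i - H x $ k $ i = 0"
    by (intro AE_finite_allI) auto
  then show ?thesis by eventually_elim (simp add: vec_eq_iff)
qed

lemma wgrad_weak_gradient: "weak_gradient \<Omega> u G \<Longrightarrow> weak_gradient \<Omega> u (wgrad \<Omega> u)"
  unfolding wgrad_def by (rule someI[of "weak_gradient \<Omega> u"])

lemma wgrad_AE: "weak_gradient \<Omega> u G \<Longrightarrow> AE x in lebesgue_on \<Omega>. wgrad \<Omega> u x = G x"
  using weak_gradient_unique wgrad_weak_gradient by blast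

lemma W1_D:
  assumes "u \<in> W1 p \<Omega>"
  shows "u \<in> Lp p \<Omega>" "weak_gradient \<Omega> u (wgrad \<Omega> u)" "wgrad \<Omega> u \<in> Lp p \<Omega>"
proof -
  obtain G where G: "weak_gradient \<Omega> u G" "G \<in> Lp p \<Omega>" using assms by (auto simp: W1_def)
  show "u \<in> Lp p \<Omega>" using assms by (simp add: W1_def)
  show "weak_gradient \<Omega> u (wgrad \<Omega> u)" using wgrad_weak_gradient[OF G(1)] .
  have ae: "AE x in lebesgue_on \<Omega>. G x = wgrad \<Omega> u x" using wgrad_AE[OF G(1)] by eventually_elim simp
  have m: "G \<in> borel_measurable (lebesgue_on \<Omega>)" using G(2) by (simp add: Lp_def)
  have "wgrad \<Omega> u \<in> borel_measurable (lebesgue_on \<Omega>)" using lebesgue_on_AE_measurable[OF \<Omega> m ae] .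
  with Lp_norm_cong[OF ae m this, of p] G(2) show "wgrad \<Omega> u \<in> Lp p \<Omega>" by (simp add: Lp_def)
qed

lemma W1_norm_eq:
  assumes "weak_gradient \<Omega> u G" "G \<in> borel_measurable (lebesgue_on \<Omega>)"
  shows "W1_norm p \<Omega> u = Lp_norm p \<Omega> u + Lp_norm p \<Omega> G"
proof -
  have ae: "AE x in lebesgue_on \<Omega>. G x = wgrad \<Omega> u x" using wgrad_AE[OF assms(1)] by eventually_elim simp
  show ?thesis unfolding W1_norm_def
    using Lp_norm_cong[OF ae assms(2) lebesgue_on_AE_measurable[OF \<Omega> assms(2) ae]] by simp
qed

lemma test_function_integrable_on:
  assumes \<phi>: "test_function \<Omega> \<phi>"
  shows "integrable (lebesgue_on \<Omega>) \<phi>" "(LINT x|lebesgue_on \<Omega>. \<phi> x) = (LINT x|lborel. \<phi> x)"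
proof -
  have "\<phi> x = 0" if "x \<notin> \<Omega>" for x using test_function_support[OF \<phi>] that by blast
  from integral_lebesgue_on[OF \<Omega> test_function_borel[OF \<phi>] this] test_function_integrable[OF \<phi>]
  show "integrable (lebesgue_on \<Omega>) \<phi>" "(LINT x|lebesgue_on \<Omega>. \<phi> x) = (LINT x|lborel. \<phi> x)" by auto
qed

lemma Dmap_integrable:
  assumes \<phi>: "test_map \<Omega> \<phi>"
  shows "integrable (lebesgue_on \<Omega>) \<phi>" "integrable (lebesgue_on \<Omega>) (Dmap \<phi>)"
proof -
  have t: "test_function \<Omega> (\<lambda>x. \<phi> x $ k)" for k using \<phi> by (simp add: test_map_def)
  show "integrable (lebesgue_on \<Omega>) \<phi>"
    using integrable_vec_lambda[of "lebesgue_on \<Omega>" "\<lambda>k x. \<phi> x $ k"] test_function_integrable_on(1)[OF t] by simp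
  show "integrable (lebesgue_on \<Omega>) (Dmap \<phi>)"
    unfolding Dmap_def[abs_def] grad_def using test_function_integrable_on(1)[OF test_function_pd[OF t]]
    by (intro integrable_vec_lambda)
qed

text \<open>Here \<open>\<psi>\<close> lives on the whole space, since \<open>\<phi>\<close> itself
  has compact support in \<Omega>. This form survives in the limit and says that extension by zero
  is weakly differentiable.\<close>

lemma test_map_global_ibp:
  assumes \<phi>: "test_map \<Omega> \<phi>" and \<psi>: "test_function UNIV \<psi>"
  shows "(LINT x|lebesgue_on \<Omega>. \<phi> x $ k * pd i \<psi> x) = - (LINT x|lebesgue_on \<Omega>. Dmap \<phi> x $ k $ i * \<psi> x)"
proof -
  have t: "test_function \<Omega> (\<lambda>x. \<phi> x $ k)" using \<phi> by (simp add: test_map_def)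
  have s: "smooth \<psi>" using test_function_smooth[OF \<psi>] .
  have "(LINT x|lebesgue_on \<Omega>. \<phi> x $ k * pd i \<psi> x) = (LINT x|lborel. \<phi> x $ k * pd i \<psi> x)"
    by (rule test_function_integrable_on(2)[OF test_function_mult[OF t smooth_pd[OF s]]])
  also have "\<dots> = - (LINT x|lborel. pd i (\<lambda>x. \<phi> x $ k) x * \<psi> x)"
    by (rule test_ibp[OF test_function_mono[OF t] s]) simp
  also have "(LINT x|lborel. pd i (\<lambda>x. \<phi> x $ k) x * \<psi> x) = (LINT x|lebesgue_on \<Omega>. pd i (\<lambda>x. \<phi> x $ k) x * \<psi> x)"
    by (rule test_function_integrable_on(2)[OF test_function_mult[OF test_function_pd[OF t] s], symmetric])
  finally show ?thesis by (simp add: Dmap_def grad_def)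
qed

end

subsection \<open>Zero boundary values\<close>

context bounded_open
begin

text \<open>The W^{1,1} closure of the test maps as a relation between a map and its gradient.
  Carrying Z explicitly avoids the choice in \<open>wgrad\<close> and lets linear combinations and
  limits act on pairs; \<open>W1_0_D\<close> and \<open>W1_0_I\<close> translate from and to
  \<open>W1_0\<close>.\<close>

definition W0 :: "(real^'n \<Rightarrow> real^'m) \<Rightarrow> (real^'n \<Rightarrow> real^'n^'m) \<Rightarrow> bool" where
  "W0 z Z \<longleftrightarrow> integrable (lebesgue_on \<Omega>) z \<and> integrable (lebesgue_on \<Omega>) Z \<and>
    (\<exists>\<phi>. (\<forall>n::nat. test_map \<Omega> (\<phi> n)) \<and>
      (\<lambda>n. \<integral>\<^sup>+x. norm (\<phi> n x - z x) \<partial>lebesgue_on \<Omega>) \<longlonglongrightarrow> 0 \<and>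
      (\<lambda>n. \<integral>\<^sup>+x. norm (Dmap (\<phi> n) x - Z x) \<partial>lebesgue_on \<Omega>) \<longlonglongrightarrow> 0)"

lemma L1_limit_product:
  fixes f :: "nat \<Rightarrow> real^'n \<Rightarrow> real"
  assumes f: "\<And>n. integrable (lebesgue_on \<Omega>) (f n)" "integrable (lebesgue_on \<Omega>) g"
    and lim: "(\<lambda>n. \<integral>\<^sup>+x. norm (f n x - g x) \<partial>lebesgue_on \<Omega>) \<longlonglongrightarrow> 0" and \<psi>: "test_function UNIV \<psi>"
  shows "(\<lambda>n. LINT x|lebesgue_on \<Omega>. f n x * \<psi> x) \<longlonglongrightarrow> (LINT x|lebesgue_on \<Omega>. g x * \<psi> x)"
proof (rule tendsto_L1_int)
  obtain B where B: "B > 0" "\<And>x. \<bar>\<psi> x\<bar> \<le> B" using test_function_bounded[OF \<psi>] by blast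
  have m: "\<psi> \<in> borel_measurable (lebesgue_on \<Omega>)"
    using test_function_borel[OF \<psi>] by (simp add: measurable_completion measurable_restrict_space1)
  have i: "integrable (lebesgue_on \<Omega>) (\<lambda>x. h x * \<psi> x)" if h: "integrable (lebesgue_on \<Omega>) h" for h
  proof (rule Bochner_Integration.integrable_bound[OF integrable_mult_left[OF h, of B]])
    show "AE x in lebesgue_on \<Omega>. norm (h x * \<psi> x) \<le> norm (h x * B)"
      using B by (intro AE_I2) (auto simp: abs_mult intro!: mult_left_mono)
  qed (use h m in auto)
  show "integrable (lebesgue_on \<Omega>) (\<lambda>x. f n x * \<psi> x)" "integrable (lebesgue_on \<Omega>) (\<lambda>x. g x * \<psi> x)" for n
    using i f by auto
  have [measurable]: "f n \<in> borel_measurable (lebesgue_on \<Omega>)" "g \<in> borel_measurable (lebesgue_on \<Omega>)" for n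
    using f by (auto intro: borel_measurable_integrable)
  have "(\<lambda>n. ennreal B * (\<integral>\<^sup>+x. norm (f n x - g x) \<partial>lebesgue_on \<Omega>)) \<longlonglongrightarrow> ennreal B * 0"
    by (intro ennreal_tendsto_cmult lim) simp
  then have l: "(\<lambda>n. ennreal B * (\<integral>\<^sup>+x. norm (f n x - g x) \<partial>lebesgue_on \<Omega>)) \<longlonglongrightarrow> 0" by simp
  show "(\<lambda>n. \<integral>\<^sup>+x. norm (f n x * \<psi> x - g x * \<psi> x) \<partial>lebesgue_on \<Omega>) \<longlonglongrightarrow> 0"
  proof (rule tendsto_sandwich[OF _ _ tendsto_const l])
    show "\<forall>\<^sub>F n in sequentially. (\<integral>\<^sup>+x. norm (f n x * \<psi> x - g x * \<psi> x) \<partial>lebesgue_on \<Omega>) \<le> ennreal B * (\<integral>\<^sup>+x. norm (f n x - g x) \<partial>lebesgue_on \<Omega>)"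
    proof (intro always_eventually allI)
      fix n
      have "(\<integral>\<^sup>+x. norm (f n x * \<psi> x - g x * \<psi> x) \<partial>lebesgue_on \<Omega>) \<le> (\<integral>\<^sup>+x. ennreal B * norm (f n x - g x) \<partial>lebesgue_on \<Omega>)"
      proof (rule nn_integral_mono)
        fix x
        have "norm (f n x * \<psi> x - g x * \<psi> x) = \<bar>\<psi> x\<bar> * norm (f n x - g x)"
          by (simp add: abs_mult[symmetric] algebra_simps)
        also have "\<dots> \<le> B * norm (f n x - g x)" using B by (intro mult_right_mono) auto
        finally show "ennreal (norm (f n x * \<psi> x - g x * \<psi> x)) \<le> ennreal B * norm (f n x - g x)"
          using B by (simp add: ennreal_mult[symmetric])
      qed
      also have "\<dots> = ennreal B * (\<integral>\<^sup>+x. norm (f n x - g x) \<partial>lebesgue_on \<Omega>)" by (rule nn_integral_cmult) simp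
      finally show "(\<integral>\<^sup>+x. norm (f n x * \<psi> x - g x * \<psi> x) \<partial>lebesgue_on \<Omega>) \<le> ennreal B * (\<integral>\<^sup>+x. norm (f n x - g x) \<partial>lebesgue_on \<Omega>)" .
    qed
  qed auto
qed

lemma L1_limit_nth:
  fixes f :: "nat \<Rightarrow> 'x \<Rightarrow> 'b::euclidean_space^'k"
  assumes lim: "(\<lambda>n. \<integral>\<^sup>+x. norm (f n x - g x) \<partial>M) \<longlonglongrightarrow> (0::ennreal)"
  shows "(\<lambda>n. \<integral>\<^sup>+x. norm (f n x $ k - g x $ k) \<partial>M) \<longlonglongrightarrow> 0"
proof (rule tendsto_sandwich[OF _ _ tendsto_const lim])
  have "norm (f n x $ k - g x $ k) \<le> norm (f n x - g x)" for n x
    using Finite_Cartesian_Product.norm_nth_le[of "f n x - g x" k] by simp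
  then show "\<forall>\<^sub>F n in sequentially. (\<integral>\<^sup>+x. norm (f n x $ k - g x $ k) \<partial>M) \<le> (\<integral>\<^sup>+x. norm (f n x - g x) \<partial>M)"
    by (intro always_eventually allI nn_integral_mono ennreal_leI)
qed auto

lemma L1_limit_ibp:
  fixes f :: "nat \<Rightarrow> real^'n \<Rightarrow> real^'m"
  assumes f: "\<And>n. integrable (lebesgue_on \<Omega>) (f n)" "integrable (lebesgue_on \<Omega>) g"
    and F: "\<And>n. integrable (lebesgue_on \<Omega>) (F n)" "integrable (lebesgue_on \<Omega>) G"
    and lim: "(\<lambda>n. \<integral>\<^sup>+x. norm (f n x - g x) \<partial>lebesgue_on \<Omega>) \<longlonglongrightarrow> 0" "(\<lambda>n. \<integral>\<^sup>+x. norm (F n x - G x) \<partial>lebesgue_on \<Omega>) \<longlonglongrightarrow> 0"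
    and \<psi>: "test_function UNIV \<psi>"
    and ibp: "\<And>n. (LINT x|lebesgue_on \<Omega>. f n x $ k * pd i \<psi> x) = - (LINT x|lebesgue_on \<Omega>. F n x $ k $ i * \<psi> x)"
  shows "(LINT x|lebesgue_on \<Omega>. g x $ k * pd i \<psi> x) = - (LINT x|lebesgue_on \<Omega>. G x $ k $ i * \<psi> x)"
proof (rule LIMSEQ_unique)
  show "(\<lambda>n. LINT x|lebesgue_on \<Omega>. f n x $ k * pd i \<psi> x) \<longlonglongrightarrow> (LINT x|lebesgue_on \<Omega>. g x $ k * pd i \<psi> x)"
    by (intro L1_limit_product L1_limit_nth lim integrable_vec_nth f test_function_pd \<psi>)
  show "(\<lambda>n. LINT x|lebesgue_on \<Omega>. f n x $ k * pd i \<psi> x) \<longlonglongrightarrow> - (LINT x|lebesgue_on \<Omega>. G x $ k $ i * \<psi> x)"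
    unfolding ibp by (intro tendsto_minus L1_limit_product L1_limit_nth lim integrable_vec_nth F \<psi>)
qed

lemma weak_gradient_limit:
  fixes f :: "nat \<Rightarrow> real^'n \<Rightarrow> real^'m"
  assumes f: "\<And>n. integrable (lebesgue_on \<Omega>) (f n)" "integrable (lebesgue_on \<Omega>) g"
    and F: "\<And>n. integrable (lebesgue_on \<Omega>) (F n)" "integrable (lebesgue_on \<Omega>) G"
    and lim: "(\<lambda>n. \<integral>\<^sup>+x. norm (f n x - g x) \<partial>lebesgue_on \<Omega>) \<longlonglongrightarrow> 0" "(\<lambda>n. \<integral>\<^sup>+x. norm (F n x - G x) \<partial>lebesgue_on \<Omega>) \<longlonglongrightarrow> 0"
    and wg: "\<And>n. weak_gradient \<Omega> (f n) (F n)"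
  shows "weak_gradient \<Omega> g G"
proof (rule weak_gradientI[OF open_\<Omega>])
  fix \<phi> k i assume \<phi>: "test_function \<Omega> \<phi>"
  show "(LINT x|lebesgue_on \<Omega>. g x $ k * pd i \<phi> x) = - (LINT x|lebesgue_on \<Omega>. G x $ k $ i * \<phi> x)"
    using weak_gradient_products(3)[OF open_\<Omega> wg \<phi>] test_function_mono[OF \<phi>]
    by (intro L1_limit_ibp[OF f F lim]) auto
qed (use f F integrable_locally_integrable in auto)

text \<open>Zero boundary values show in \<open>\<psi>\<close> ranging over the test functions of
  the whole space: no boundary term appears.\<close>

lemma W0_ibp:
  assumes W: "W0 z Z" and \<psi>: "test_function UNIV \<psi>"
  shows "(LINT x|lebesgue_on \<Omega>. z x $ k * pd i \<psi> x) = - (LINT x|lebesgue_on \<Omega>. Z x $ k $ i * \<psi> x)"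
proof -
  obtain \<phi> where \<phi>: "\<And>n::nat. test_map \<Omega> (\<phi> n)"
      "(\<lambda>n. \<integral>\<^sup>+x. norm (\<phi> n x - z x) \<partial>lebesgue_on \<Omega>) \<longlonglongrightarrow> 0"
      "(\<lambda>n. \<integral>\<^sup>+x. norm (Dmap (\<phi> n) x - Z x) \<partial>lebesgue_on \<Omega>) \<longlonglongrightarrow> 0"
    using W by (auto simp: W0_def)
  show ?thesis
    using W Dmap_integrable[OF open_\<Omega> \<phi>(1)]
    by (intro L1_limit_ibp[OF _ _ _ _ \<phi>(2,3) \<psi>] test_map_global_ibp[OF open_\<Omega> \<phi>(1) \<psi>]) (auto simp: W0_def)
qed

lemma W0_integrable: "W0 z Z \<Longrightarrow> integrable (lebesgue_on \<Omega>) z" "W0 z Z \<Longrightarrow> integrable (lebesgue_on \<Omega>) Z"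
  by (simp_all add: W0_def)

lemma W0_weak_gradient: "W0 z Z \<Longrightarrow> weak_gradient \<Omega> z Z"
  by (intro weak_gradientI[OF open_\<Omega>] W0_ibp integrable_locally_integrable W0_integrable)
    (auto intro: test_function_mono)

lemma Dmap_lincomb:
  assumes \<phi>: "test_map \<Omega> \<phi>" and \<psi>: "test_map \<Omega> \<psi>"
  shows "test_map \<Omega> (\<lambda>x. a *\<^sub>R \<phi> x + b *\<^sub>R \<psi> x)"
    and "Dmap (\<lambda>x. a *\<^sub>R \<phi> x + b *\<^sub>R \<psi> x) x = a *\<^sub>R Dmap \<phi> x + b *\<^sub>R Dmap \<psi> x"
proof -
  have t: "test_function \<Omega> (\<lambda>x. \<phi> x $ k)" "test_function \<Omega> (\<lambda>x. \<psi> x $ k)" for k using \<phi> \<psi> by (auto simp: test_map_def)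
  show "test_map \<Omega> (\<lambda>x. a *\<^sub>R \<phi> x + b *\<^sub>R \<psi> x)" unfolding test_map_def
    using test_function_add[OF test_function_cmult[OF t(1)] test_function_cmult[OF t(2)]] by simp
  have s: "smooth (\<lambda>x. a * \<phi> x $ k)" "smooth (\<lambda>x. b * \<psi> x $ k)" for k
    using smooth_cmult[OF test_function_smooth[OF t(1)]] smooth_cmult[OF test_function_smooth[OF t(2)]] .
  show "Dmap (\<lambda>x. a *\<^sub>R \<phi> x + b *\<^sub>R \<psi> x) x = a *\<^sub>R Dmap \<phi> x + b *\<^sub>R Dmap \<psi> x"
    using pd_add[OF s] pd_cmult[OF test_function_smooth[OF t(1)]] pd_cmult[OF test_function_smooth[OF t(2)]]
    by (simp add: Dmap_def grad_def vec_eq_iff)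
qed

lemma L1_lincomb_tendsto:
  fixes f g :: "nat \<Rightarrow> 'x \<Rightarrow> 'b::euclidean_space"
  assumes [measurable]: "\<And>n. f n \<in> borel_measurable M" "\<And>n. g n \<in> borel_measurable M" "F \<in> borel_measurable M" "G \<in> borel_measurable M"
    and lim: "(\<lambda>n. \<integral>\<^sup>+x. norm (f n x - F x) \<partial>M) \<longlonglongrightarrow> 0" "(\<lambda>n. \<integral>\<^sup>+x. norm (g n x - G x) \<partial>M) \<longlonglongrightarrow> 0"
  shows "(\<lambda>n. \<integral>\<^sup>+x. norm ((a *\<^sub>R f n x + b *\<^sub>R g n x) - (a *\<^sub>R F x + b *\<^sub>R G x)) \<partial>M) \<longlonglongrightarrow> 0"
proof -
  have "(\<lambda>n. ennreal \<bar>a\<bar> * (\<integral>\<^sup>+x. norm (f n x - F x) \<partial>M) + ennreal \<bar>b\<bar> * (\<integral>\<^sup>+x. norm (g n x - G x) \<partial>M)) \<longlonglongrightarrow> ennreal \<bar>a\<bar> * 0 + ennreal \<bar>b\<bar> * 0"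
    by (intro tendsto_add ennreal_tendsto_cmult lim) auto
  then have l: "(\<lambda>n. ennreal \<bar>a\<bar> * (\<integral>\<^sup>+x. norm (f n x - F x) \<partial>M) + ennreal \<bar>b\<bar> * (\<integral>\<^sup>+x. norm (g n x - G x) \<partial>M)) \<longlonglongrightarrow> 0"
    by simp
  show ?thesis
  proof (rule tendsto_sandwich[OF _ _ tendsto_const l])
    show "\<forall>\<^sub>F n in sequentially. (\<integral>\<^sup>+x. norm ((a *\<^sub>R f n x + b *\<^sub>R g n x) - (a *\<^sub>R F x + b *\<^sub>R G x)) \<partial>M) \<le>
      ennreal \<bar>a\<bar> * (\<integral>\<^sup>+x. norm (f n x - F x) \<partial>M) + ennreal \<bar>b\<bar> * (\<integral>\<^sup>+x. norm (g n x - G x) \<partial>M)"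
    proof (intro always_eventually allI)
      fix n
      have "(\<integral>\<^sup>+x. norm ((a *\<^sub>R f n x + b *\<^sub>R g n x) - (a *\<^sub>R F x + b *\<^sub>R G x)) \<partial>M) \<le>
        (\<integral>\<^sup>+x. ennreal \<bar>a\<bar> * norm (f n x - F x) + ennreal \<bar>b\<bar> * norm (g n x - G x) \<partial>M)"
      proof (rule nn_integral_mono)
        fix x
        have "(a *\<^sub>R f n x + b *\<^sub>R g n x) - (a *\<^sub>R F x + b *\<^sub>R G x) = a *\<^sub>R (f n x - F x) + b *\<^sub>R (g n x - G x)"
          by (simp add: algebra_simps)
        then have "norm ((a *\<^sub>R f n x + b *\<^sub>R g n x) - (a *\<^sub>R F x + b *\<^sub>R G x)) \<le> \<bar>a\<bar> * norm (f n x - F x) + \<bar>b\<bar> * norm (g n x - G x)"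
          using norm_triangle_ineq[of "a *\<^sub>R (f n x - F x)" "b *\<^sub>R (g n x - G x)"] by simp
        then show "ennreal (norm ((a *\<^sub>R f n x + b *\<^sub>R g n x) - (a *\<^sub>R F x + b *\<^sub>R G x))) \<le>
           ennreal \<bar>a\<bar> * norm (f n x - F x) + ennreal \<bar>b\<bar> * norm (g n x - G x)"
          by (simp add: ennreal_mult[symmetric] ennreal_plus[symmetric] del: ennreal_plus)
      qed
      also have "\<dots> = ennreal \<bar>a\<bar> * (\<integral>\<^sup>+x. norm (f n x - F x) \<partial>M) + ennreal \<bar>b\<bar> * (\<integral>\<^sup>+x. norm (g n x - G x) \<partial>M)"
        by (subst nn_integral_add) (auto simp: nn_integral_cmult)
      finally show "(\<integral>\<^sup>+x. norm ((a *\<^sub>R f n x + b *\<^sub>R g n x) - (a *\<^sub>R F x + b *\<^sub>R G x)) \<partial>M) \<le>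
        ennreal \<bar>a\<bar> * (\<integral>\<^sup>+x. norm (f n x - F x) \<partial>M) + ennreal \<bar>b\<bar> * (\<integral>\<^sup>+x. norm (g n x - G x) \<partial>M)" .
    qed
  qed auto
qed

lemma W0_lincomb:
  assumes z: "W0 z Z" and y: "W0 y Y"
  shows "W0 (\<lambda>x. a *\<^sub>R z x + b *\<^sub>R y x) (\<lambda>x. a *\<^sub>R Z x + b *\<^sub>R Y x)"
proof -
  obtain \<phi> where \<phi>: "\<And>n::nat. test_map \<Omega> (\<phi> n)"
      "(\<lambda>n. \<integral>\<^sup>+x. norm (\<phi> n x - z x) \<partial>lebesgue_on \<Omega>) \<longlonglongrightarrow> 0"
      "(\<lambda>n. \<integral>\<^sup>+x. norm (Dmap (\<phi> n) x - Z x) \<partial>lebesgue_on \<Omega>) \<longlonglongrightarrow> 0"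
    using z by (auto simp: W0_def)
  obtain \<psi> where \<psi>: "\<And>n::nat. test_map \<Omega> (\<psi> n)"
      "(\<lambda>n. \<integral>\<^sup>+x. norm (\<psi> n x - y x) \<partial>lebesgue_on \<Omega>) \<longlonglongrightarrow> 0"
      "(\<lambda>n. \<integral>\<^sup>+x. norm (Dmap (\<psi> n) x - Y x) \<partial>lebesgue_on \<Omega>) \<longlonglongrightarrow> 0"
    using y by (auto simp: W0_def)
  have i: "integrable (lebesgue_on \<Omega>) z" "integrable (lebesgue_on \<Omega>) y" "integrable (lebesgue_on \<Omega>) Z" "integrable (lebesgue_on \<Omega>) Y"
    using z y by (auto simp: W0_def)
  have l1: "(\<lambda>n. \<integral>\<^sup>+x. norm ((a *\<^sub>R \<phi> n x + b *\<^sub>R \<psi> n x) - (a *\<^sub>R z x + b *\<^sub>R y x)) \<partial>lebesgue_on \<Omega>) \<longlonglongrightarrow> 0"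
    using i Dmap_integrable(1)[OF open_\<Omega> \<phi>(1)] Dmap_integrable(1)[OF open_\<Omega> \<psi>(1)]
    by (intro L1_lincomb_tendsto \<phi> \<psi>) (auto intro: borel_measurable_integrable)
  have l2: "(\<lambda>n. \<integral>\<^sup>+x. norm (Dmap (\<lambda>x. a *\<^sub>R \<phi> n x + b *\<^sub>R \<psi> n x) x - (a *\<^sub>R Z x + b *\<^sub>R Y x)) \<partial>lebesgue_on \<Omega>) \<longlonglongrightarrow> 0"
    unfolding Dmap_lincomb(2)[OF \<phi>(1) \<psi>(1)]
    using i Dmap_integrable(2)[OF open_\<Omega> \<phi>(1)] Dmap_integrable(2)[OF open_\<Omega> \<psi>(1)]
    by (intro L1_lincomb_tendsto \<phi> \<psi>) (auto intro: borel_measurable_integrable)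
  show ?thesis unfolding W0_def
    using l1 l2 i Dmap_lincomb(1)[OF \<phi>(1) \<psi>(1)] by (intro conjI exI[of _ "\<lambda>n x. a *\<^sub>R \<phi> n x + b *\<^sub>R \<psi> n x"] allI
      Bochner_Integration.integrable_add integrable_scaleR_right)
qed

text \<open>A diagonal choice: for each n a test map within 1 / (n + 1) of the pair (z n, Z n) in
  both L^1 distances.\<close>

lemma W0_limit:
  assumes W: "\<And>n. W0 (z n) (Z n)" and i: "integrable (lebesgue_on \<Omega>) y" "integrable (lebesgue_on \<Omega>) Y"
    and lim: "(\<lambda>n. \<integral>\<^sup>+x. norm (z n x - y x) \<partial>lebesgue_on \<Omega>) \<longlonglongrightarrow> 0" "(\<lambda>n. \<integral>\<^sup>+x. norm (Z n x - Y x) \<partial>lebesgue_on \<Omega>) \<longlonglongrightarrow> 0"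
  shows "W0 y Y"
proof -
  have zi: "integrable (lebesgue_on \<Omega>) (z n)" "integrable (lebesgue_on \<Omega>) (Z n)" for n using W by (auto simp: W0_def)
  have "\<forall>n. \<exists>\<phi>. test_map \<Omega> \<phi> \<and> (\<integral>\<^sup>+x. norm (\<phi> x - z n x) \<partial>lebesgue_on \<Omega>) \<le> ennreal (1 / real (Suc n)) \<and>
    (\<integral>\<^sup>+x. norm (Dmap \<phi> x - Z n x) \<partial>lebesgue_on \<Omega>) \<le> ennreal (1 / real (Suc n))"
  proof
    fix n
    obtain \<phi> where \<phi>: "\<And>n::nat. test_map \<Omega> (\<phi> n)"
      "(\<lambda>m. \<integral>\<^sup>+x. norm (\<phi> m x - z n x) \<partial>lebesgue_on \<Omega>) \<longlonglongrightarrow> 0"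
      "(\<lambda>m. \<integral>\<^sup>+x. norm (Dmap (\<phi> m) x - Z n x) \<partial>lebesgue_on \<Omega>) \<longlonglongrightarrow> 0"
      using W[of n] by (auto simp: W0_def)
    have e: "(0::real) < 1 / real (Suc n)" by simp
    from eventually_conj[OF ennreal_tendsto_0D[OF \<phi>(2) e] ennreal_tendsto_0D[OF \<phi>(3) e]]
    obtain m where "(\<integral>\<^sup>+x. norm (\<phi> m x - z n x) \<partial>lebesgue_on \<Omega>) \<le> ennreal (1 / real (Suc n))"
      "(\<integral>\<^sup>+x. norm (Dmap (\<phi> m) x - Z n x) \<partial>lebesgue_on \<Omega>) \<le> ennreal (1 / real (Suc n))"
      by (auto simp: eventually_sequentially)
    then show "\<exists>\<phi>. test_map \<Omega> \<phi> \<and> (\<integral>\<^sup>+x. norm (\<phi> x - z n x) \<partial>lebesgue_on \<Omega>) \<le> ennreal (1 / real (Suc n)) \<and>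
      (\<integral>\<^sup>+x. norm (Dmap \<phi> x - Z n x) \<partial>lebesgue_on \<Omega>) \<le> ennreal (1 / real (Suc n))"
      using \<phi>(1)[of m] by (intro exI[of _ "\<phi> m"] conjI)
  qed
  from choice[OF this] obtain \<phi> where P: "\<forall>n. test_map \<Omega> (\<phi> n) \<and> (\<integral>\<^sup>+x. norm (\<phi> n x - z n x) \<partial>lebesgue_on \<Omega>) \<le> ennreal (1 / real (Suc n)) \<and>
    (\<integral>\<^sup>+x. norm (Dmap (\<phi> n) x - Z n x) \<partial>lebesgue_on \<Omega>) \<le> ennreal (1 / real (Suc n))"
    by (elim exE)
  have \<phi>: "test_map \<Omega> (\<phi> n)"
    "(\<integral>\<^sup>+x. norm (\<phi> n x - z n x) \<partial>lebesgue_on \<Omega>) \<le> ennreal (1 / real (Suc n))"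
    "(\<integral>\<^sup>+x. norm (Dmap (\<phi> n) x - Z n x) \<partial>lebesgue_on \<Omega>) \<le> ennreal (1 / real (Suc n))" for n
    using P[rule_format, of n] by simp_all
  have e0: "(\<lambda>n. ennreal (1 / real (Suc n))) \<longlonglongrightarrow> 0"
    using tendsto_ennrealI[OF LIMSEQ_Suc[OF lim_1_over_n[where 'a = real]]] by simp
  have tri: "(\<lambda>n. \<integral>\<^sup>+x. norm (p n x - Y x) \<partial>lebesgue_on \<Omega>) \<longlonglongrightarrow> 0"
    if m: "\<And>n. integrable (lebesgue_on \<Omega>) (p n)" "\<And>n. integrable (lebesgue_on \<Omega>) (q n)" "integrable (lebesgue_on \<Omega>) Y"
      and b: "\<And>n. (\<integral>\<^sup>+x. norm (p n x - q n x) \<partial>lebesgue_on \<Omega>) \<le> ennreal (1 / real (Suc n))"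
      and l: "(\<lambda>n. \<integral>\<^sup>+x. norm (q n x - Y x) \<partial>lebesgue_on \<Omega>) \<longlonglongrightarrow> 0"
    for p q :: "nat \<Rightarrow> real^'n \<Rightarrow> 'c::euclidean_space" and Y
  proof -
    have [measurable]: "p n \<in> borel_measurable (lebesgue_on \<Omega>)" "q n \<in> borel_measurable (lebesgue_on \<Omega>)" "Y \<in> borel_measurable (lebesgue_on \<Omega>)" for n
      using m by (auto intro: borel_measurable_integrable)
    have "(\<lambda>n. ennreal (1 / real (Suc n)) + (\<integral>\<^sup>+x. norm (q n x - Y x) \<partial>lebesgue_on \<Omega>)) \<longlonglongrightarrow> 0 + 0"
      by (intro tendsto_add e0 l)
    then have l': "(\<lambda>n. ennreal (1 / real (Suc n)) + (\<integral>\<^sup>+x. norm (q n x - Y x) \<partial>lebesgue_on \<Omega>)) \<longlonglongrightarrow> 0" by simp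
    show ?thesis
    proof (rule tendsto_sandwich[OF _ _ tendsto_const l'])
      show "\<forall>\<^sub>F n in sequentially. (\<integral>\<^sup>+x. norm (p n x - Y x) \<partial>lebesgue_on \<Omega>) \<le> ennreal (1 / real (Suc n)) + (\<integral>\<^sup>+x. norm (q n x - Y x) \<partial>lebesgue_on \<Omega>)"
      proof (intro always_eventually allI)
        fix n
        have "norm (p n x - Y x) \<le> norm (p n x - q n x) + norm (q n x - Y x)" for x
          using norm_triangle_ineq[of "p n x - q n x" "q n x - Y x"] by simp
        then have "(\<integral>\<^sup>+x. norm (p n x - Y x) \<partial>lebesgue_on \<Omega>) \<le> (\<integral>\<^sup>+x. ennreal (norm (p n x - q n x)) + norm (q n x - Y x) \<partial>lebesgue_on \<Omega>)"
          by (intro nn_integral_mono) (simp flip: ennreal_plus)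
        also have "\<dots> = (\<integral>\<^sup>+x. norm (p n x - q n x) \<partial>lebesgue_on \<Omega>) + (\<integral>\<^sup>+x. norm (q n x - Y x) \<partial>lebesgue_on \<Omega>)"
          by (rule nn_integral_add) auto
        also have "\<dots> \<le> ennreal (1 / real (Suc n)) + (\<integral>\<^sup>+x. norm (q n x - Y x) \<partial>lebesgue_on \<Omega>)"
          by (intro add_right_mono b)
        finally show "(\<integral>\<^sup>+x. norm (p n x - Y x) \<partial>lebesgue_on \<Omega>) \<le> ennreal (1 / real (Suc n)) + (\<integral>\<^sup>+x. norm (q n x - Y x) \<partial>lebesgue_on \<Omega>)" .
      qed
    qed auto
  qed
  have "(\<lambda>n. \<integral>\<^sup>+x. norm (\<phi> n x - y x) \<partial>lebesgue_on \<Omega>) \<longlonglongrightarrow> 0"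
    using Dmap_integrable(1)[OF open_\<Omega> \<phi>(1)] zi(1) i(1) \<phi>(2) lim(1) by (rule tri)
  moreover have "(\<lambda>n. \<integral>\<^sup>+x. norm (Dmap (\<phi> n) x - Y x) \<partial>lebesgue_on \<Omega>) \<longlonglongrightarrow> 0"
    using Dmap_integrable(2)[OF open_\<Omega> \<phi>(1)] zi(2) i(2) \<phi>(3) lim(2) by (rule tri)
  ultimately show ?thesis unfolding W0_def using i \<phi>(1) by (intro conjI exI[of _ \<phi>] allI)
qed

end

section \<open>Morrey's inequality, Hoelder bounds and interpolation\<close>

subsection \<open>Morrey's inequality\<close>

text \<open>C bounds the integral of |F|^q, not the norm, and is added to the volume of the unit
  ball: this is the shape left by \<open>powr_mix\<close>, where Hoelder's inequality would give a
  product. What matters later is that only N, q and C enter.\<close>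

definition morrey_const :: "nat \<Rightarrow> real \<Rightarrow> real \<Rightarrow> real" where
  "morrey_const N q C = 4 * (unit_ball_vol N + C) / (unit_ball_vol N * (1 - N / q))"

text \<open>Integrate F along the segments from a to the points z of the ball and exchange the
  integrals. For fixed t the map z -> a + t (z - a) scales volume by t^N, and
  \<open>powr_mix\<close> turns the bound on the q-th powers into a factor t^(-N/q), which is
  integrable on [0,1] because q > N.\<close>

lemma morrey_average:
  fixes f :: "real^'n \<Rightarrow> real"
  assumes D: "\<And>x. (f has_derivative (\<lambda>h. F x \<bullet> h)) (at x)" and F: "continuous_on UNIV F"
    and q: "(q::real) > CARD('n)" and C: "C \<ge> 0" "(\<integral>\<^sup>+x. norm (F x) powr q \<partial>lborel) \<le> ennreal C"
    and l: "l > 0" and a: "\<And>z. z \<in> ball b l \<Longrightarrow> norm (z - a) \<le> 2 * l"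
  shows "(\<integral>\<^sup>+z. ennreal \<bar>f z - f a\<bar> * indicator (ball b l) z \<partial>lborel) \<le>
    ennreal (2 * l powr (1 - CARD('n) / q) * l powr CARD('n) * (unit_ball_vol CARD('n) + C) / (1 - CARD('n) / q))"
proof -
  let ?N = "real CARD('n)" and ?B = "ball b l" and ?\<omega> = "unit_ball_vol (real CARD('n))"
  have N: "?N > 0" by simp
  have [measurable]: "?B \<in> sets borel" by simp
  have q1: "q > 0" "q \<ge> 1" "?N / q < 1"
  proof -
    have "?N \<ge> 1" by simp
    then show "q \<ge> 1" using q by linarith
    show "q > 0" "?N / q < 1" using q N by (auto simp: divide_less_eq)
  qed
  have [measurable]: "F \<in> borel_measurable borel" using F by (rule borel_measurable_continuous_onI)
  have "continuous_on UNIV f"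
    using has_derivative_continuous[OF D] by (intro continuous_at_imp_continuous_on) simp
  then have [measurable]: "f \<in> borel_measurable borel" by (rule borel_measurable_continuous_onI)
  have FTC: "ennreal \<bar>f z - f a\<bar> * indicator ?B z \<le>
     (\<integral>\<^sup>+t. ennreal (2 * l) * (ennreal (norm (F (a + t *\<^sub>R (z - a)))) * indicator ?B z) * indicator {0..1} t \<partial>lborel)" for z
  proof (cases "z \<in> ?B")
    case True
    let ?g = "\<lambda>t. F (a + t *\<^sub>R (z - a)) \<bullet> (z - a)"
    have "continuous_on UNIV (\<lambda>t. F (a + t *\<^sub>R (z - a)))"
      by (rule continuous_on_compose2[OF F]) (auto intro!: continuous_intros)
    then have g: "continuous_on {0..1} ?g" by (auto intro!: continuous_intros elim: continuous_on_subset)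
    have d: "((\<lambda>t. f (a + t *\<^sub>R (z - a))) has_vector_derivative ?g t) (at t within {0..1})" for t
    proof -
      have "((\<lambda>t. a + t *\<^sub>R (z - a)) has_derivative (\<lambda>h. h *\<^sub>R (z - a))) (at t within {0..1})"
        by (auto intro!: derivative_eq_intros)
      from has_derivative_compose[OF this D]
      show ?thesis by (simp add: has_vector_derivative_def)
    qed
    have "(LINT t|lborel. indicator {0..1} t *\<^sub>R ?g t) = f (a + 1 *\<^sub>R (z - a)) - f (a + 0 *\<^sub>R (z - a))"
      by (rule integral_FTC_atLeastAtMost) (use g d in auto)
    then have "ennreal \<bar>f z - f a\<bar> = ennreal (norm (LINT t|lborel. indicator {0..1} t *\<^sub>R ?g t))" by simp
    also have "\<dots> \<le> (\<integral>\<^sup>+t. norm (indicator {0..1} t *\<^sub>R ?g t) \<partial>lborel)"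
      by (intro integral_norm_bound_ennreal borel_integrable_atLeastAtMost'[unfolded set_integrable_def] g)
    also have "\<dots> \<le> (\<integral>\<^sup>+t. ennreal (2 * l) * (ennreal (norm (F (a + t *\<^sub>R (z - a)))) * indicator ?B z) * indicator {0..1} t \<partial>lborel)"
    proof (rule nn_integral_mono)
      fix t
      have "\<bar>?g t\<bar> \<le> norm (F (a + t *\<^sub>R (z - a))) * norm (z - a)" by (rule Cauchy_Schwarz_ineq2)
      also have "\<dots> \<le> norm (F (a + t *\<^sub>R (z - a))) * (2 * l)" using a[OF True] by (intro mult_left_mono) auto
      finally have "ennreal \<bar>?g t\<bar> \<le> ennreal (2 * l) * ennreal (norm (F (a + t *\<^sub>R (z - a))))"
        using l by (simp add: ennreal_mult[symmetric] mult.commute ennreal_leI)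
      then show "ennreal (norm (indicator {0..1} t *\<^sub>R ?g t)) \<le>
          ennreal (2 * l) * (ennreal (norm (F (a + t *\<^sub>R (z - a)))) * indicator ?B z) * indicator {0..1} t"
        using True by (cases "t \<in> {0..1}") auto
    qed
    finally show ?thesis using True by simp
  qed auto
  have inner: "(\<integral>\<^sup>+z. ennreal (norm (F (a + t *\<^sub>R (z - a)))) * indicator ?B z \<partial>lborel) \<le>
      ennreal (t powr (- ?N / q) * (l powr (- ?N / q) * l powr ?N * (?\<omega> + C)))" if t: "t > 0" for t :: real
  proof -
    \<comment> \<open>The level at which both terms of \<open>powr_mix\<close> carry the same
      powers: ll^(1-q) * t^(-N) = ll * l^N.\<close>
    define ll where "ll = (t * l) powr (- ?N / q)"
    have ll: "ll > 0" using t l by (simp add: ll_def)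
    have "(\<integral>\<^sup>+z. ennreal (norm (F (a + t *\<^sub>R (z - a)))) * indicator ?B z \<partial>lborel) \<le>
      (\<integral>\<^sup>+z. ennreal ll * indicator ?B z + ennreal (ll powr (1 - q)) * ennreal (norm (F (a + t *\<^sub>R (z - a))) powr q) \<partial>lborel)"
    proof (rule nn_integral_mono)
      fix z
      have "norm (F (a + t *\<^sub>R (z - a))) \<le> ll + ll powr (1 - q) * norm (F (a + t *\<^sub>R (z - a))) powr q"
        using powr_mix[of "norm (F (a + t *\<^sub>R (z - a)))" ll 1 q] ll q1 by simp
      then show "ennreal (norm (F (a + t *\<^sub>R (z - a)))) * indicator ?B z \<le>
         ennreal ll * indicator ?B z + ennreal (ll powr (1 - q)) * ennreal (norm (F (a + t *\<^sub>R (z - a))) powr q)"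
        using ll by (cases "z \<in> ?B") (auto simp: ennreal_mult[symmetric] ennreal_plus[symmetric] simp del: ennreal_plus)
    qed
    also have "\<dots> = ennreal ll * emeasure lborel ?B + ennreal (ll powr (1 - q)) * (\<integral>\<^sup>+z. norm (F (a + t *\<^sub>R (z - a))) powr q \<partial>lborel)"
      by (subst nn_integral_add) (auto simp: nn_integral_cmult nn_integral_cmult_indicator)
    also have "(\<integral>\<^sup>+z. norm (F (a + t *\<^sub>R (z - a))) powr q \<partial>lborel) \<le> ennreal (t powr (- ?N) * C)"
    proof -
      have "(\<integral>\<^sup>+x. norm (F x) powr q \<partial>lborel) = ennreal (t ^ CARD('n)) * (\<integral>\<^sup>+z. norm (F ((a - t *\<^sub>R a) + t *\<^sub>R z)) powr q \<partial>lborel)"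
        using nn_integral_lborel_affine[of "\<lambda>x. ennreal (norm (F x) powr q)" t "a - t *\<^sub>R a"] t by simp
      then have "ennreal (t powr (- ?N)) * (\<integral>\<^sup>+x. norm (F x) powr q \<partial>lborel) =
         ennreal (t powr (- ?N)) * (ennreal (t ^ CARD('n)) * (\<integral>\<^sup>+z. norm (F ((a - t *\<^sub>R a) + t *\<^sub>R z)) powr q \<partial>lborel))" by simp
      also have "\<dots> = (\<integral>\<^sup>+z. norm (F ((a - t *\<^sub>R a) + t *\<^sub>R z)) powr q \<partial>lborel)"
        using t by (simp add: mult.assoc[symmetric] ennreal_mult[symmetric] powr_realpow[symmetric] powr_minus)
      also have "\<dots> = (\<integral>\<^sup>+z. norm (F (a + t *\<^sub>R (z - a))) powr q \<partial>lborel)" by (simp add: algebra_simps)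
      finally have "(\<integral>\<^sup>+z. norm (F (a + t *\<^sub>R (z - a))) powr q \<partial>lborel) = ennreal (t powr (- ?N)) * (\<integral>\<^sup>+x. norm (F x) powr q \<partial>lborel)" by simp
      also have "\<dots> \<le> ennreal (t powr (- ?N)) * ennreal C" using C by (intro mult_left_mono) auto
      finally show ?thesis using C by (simp add: ennreal_mult[symmetric])
    qed
    also have "emeasure lborel ?B = ennreal (?\<omega> * l powr ?N)" using emeasure_ball[of l b] l by (simp add: powr_realpow)
    finally have "(\<integral>\<^sup>+z. ennreal (norm (F (a + t *\<^sub>R (z - a)))) * indicator ?B z \<partial>lborel) \<le>
      ennreal (ll * (?\<omega> * l powr ?N) + ll powr (1 - q) * (t powr (- ?N) * C))"
      using ll C by (simp add: ennreal_mult[symmetric] ennreal_plus[symmetric] mult_left_mono add_mono del: ennreal_plus)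
    also have "ll powr (1 - q) * (t powr (- ?N) * C) = ll * l powr ?N * C"
    proof -
      have "ll powr (1 - q) = (t * l) powr (- ?N / q + ?N)"
      proof -
        have "- ?N / q * (1 - q) = - ?N / q + ?N" using q1(1) by (simp add: field_simps)
        then show ?thesis unfolding ll_def powr_powr by simp
      qed
      also have "\<dots> = ll * (t powr ?N * l powr ?N)" unfolding powr_add ll_def using t l by (simp add: powr_mult)
      finally show ?thesis using t by (simp add: powr_minus field_simps)
    qed
    also have "ll * (?\<omega> * l powr ?N) + ll * l powr ?N * C = t powr (- ?N / q) * (l powr (- ?N / q) * l powr ?N * (?\<omega> + C))"
      using t l by (simp add: ll_def powr_mult algebra_simps)
    finally show ?thesis .
  qed
  have ti: "(\<integral>\<^sup>+t. ennreal (t powr (- ?N / q)) * indicator {0..1} t \<partial>lborel) = ennreal (1 / (1 - ?N / q))"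
    using nn_integral_has_integral_lebesgue'[OF _ has_integral_powr_from_0[of "- ?N / q" 1]] q1 by simp
  define E where "E = l powr (- ?N / q) * l powr ?N * (?\<omega> + C)"
  have E: "E \<ge> 0" using C by (simp add: E_def)
  have "(\<integral>\<^sup>+z. ennreal \<bar>f z - f a\<bar> * indicator ?B z \<partial>lborel) \<le>
    (\<integral>\<^sup>+z. (\<integral>\<^sup>+t. ennreal (2 * l) * (ennreal (norm (F (a + t *\<^sub>R (z - a)))) * indicator ?B z) * indicator {0..1} t \<partial>lborel) \<partial>lborel)"
    by (intro nn_integral_mono FTC)
  also have "\<dots> = (\<integral>\<^sup>+t. (\<integral>\<^sup>+z. ennreal (2 * l) * (ennreal (norm (F (a + t *\<^sub>R (z - a)))) * indicator ?B z) * indicator {0..1} t \<partial>lborel) \<partial>lborel)"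
    by (rule nn_integral_Fubini_lborel) simp
  also have "\<dots> = (\<integral>\<^sup>+t. ennreal (2 * l) * (\<integral>\<^sup>+z. ennreal (norm (F (a + t *\<^sub>R (z - a)))) * indicator ?B z \<partial>lborel) * indicator {0..1} t \<partial>lborel)"
    by (simp add: nn_integral_cmult nn_integral_multc)
  also have "\<dots> \<le> (\<integral>\<^sup>+t. ennreal (2 * l * E) * (ennreal (t powr (- ?N / q)) * indicator {0..1} t) \<partial>lborel)"
  proof (rule nn_integral_mono_AE)
    \<comment> \<open>The bound \<open>inner\<close> is for t > 0; the remaining point t = 0 is a
      null set.\<close>
    have "AE t in lborel. t \<noteq> (0::real)" by (rule AE_lborel_singleton)
    then show "AE t in lborel. ennreal (2 * l) * (\<integral>\<^sup>+z. ennreal (norm (F (a + t *\<^sub>R (z - a)))) * indicator ?B z \<partial>lborel) * indicator {0..1} t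
      \<le> ennreal (2 * l * E) * (ennreal (t powr (- ?N / q)) * indicator {0..1} t)"
    proof eventually_elim
      case (elim t)
      show ?case
      proof (cases "t \<in> {0..1}")
        case True
        then have "t > 0" using elim by simp
        from inner[OF this] have "(\<integral>\<^sup>+z. ennreal (norm (F (a + t *\<^sub>R (z - a)))) * indicator ?B z \<partial>lborel) \<le> ennreal (t powr (- ?N / q) * E)"
          unfolding E_def .
        from mult_left_mono[OF this, of "ennreal (2 * l)"]
        have "ennreal (2 * l) * (\<integral>\<^sup>+z. ennreal (norm (F (a + t *\<^sub>R (z - a)))) * indicator ?B z \<partial>lborel) \<le>
          ennreal (2 * l) * ennreal (t powr (- ?N / q) * E)" by simp
        also have "\<dots> = ennreal (2 * l * E) * ennreal (t powr (- ?N / q))"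
          using l E by (simp only: ennreal_mult[symmetric] mult_nonneg_nonneg powr_ge_zero less_imp_le mult_ac zero_le_numeral)
        finally show ?thesis using True by simp
      qed auto
    qed
  qed
  also have "\<dots> = ennreal (2 * l * E * (1 / (1 - ?N / q)))"
    using ti E l q1 by (subst nn_integral_cmult) (auto simp: ennreal_mult[symmetric])
  also have "2 * l * E * (1 / (1 - ?N / q)) = 2 * l powr (1 - ?N / q) * l powr ?N * (?\<omega> + C) / (1 - ?N / q)"
    using l by (simp add: E_def powr_diff powr_minus field_simps)
  finally show ?thesis .
qed

text \<open>Average |f x - f y| \<le> |f z - f x| + |f z - f y| over z in the ball of radius |x - y|
  about x. Its points are within twice that radius of both x and y, so \<open>morrey_average\<close>
  applies with a = x and with a = y.\<close>

lemma morrey: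
  fixes f :: "real^'n \<Rightarrow> real"
  assumes D: "\<And>x. (f has_derivative (\<lambda>h. F x \<bullet> h)) (at x)" and F: "continuous_on UNIV F"
    and q: "(q::real) > CARD('n)" and C: "C \<ge> 0" "(\<integral>\<^sup>+x. norm (F x) powr q \<partial>lborel) \<le> ennreal C"
  shows "\<bar>f x - f y\<bar> \<le> morrey_const CARD('n) q C * dist x y powr (1 - CARD('n) / q)"
proof (cases "x = y")
  case False
  define l where "l = dist x y"
  have l: "l > 0" using False by (simp add: l_def)
  let ?N = "real CARD('n)" and ?B = "ball x l" and ?\<omega> = "unit_ball_vol (real CARD('n))"
  have \<omega>: "?\<omega> > 0" by simp
  have Nq: "1 - ?N / q > 0" using q by (simp add: divide_less_eq)
  define R where "R = 2 * l powr (1 - ?N / q) * l powr ?N * (?\<omega> + C) / (1 - ?N / q)"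
  have R: "R \<ge> 0" using C Nq \<omega> by (simp add: R_def)
  have "continuous_on UNIV f"
    using has_derivative_continuous[OF D] by (intro continuous_at_imp_continuous_on) simp
  then have [measurable]: "f \<in> borel_measurable borel" by (rule borel_measurable_continuous_onI)
  have ax: "norm (z - x) \<le> 2 * l" "norm (z - y) \<le> 2 * l" if "z \<in> ?B" for z
  proof -
    have "norm (z - x) < l" using that by (simp add: dist_norm norm_minus_commute)
    moreover have "norm (z - y) \<le> norm (z - x) + l"
      using norm_triangle_ineq[of "z - x" "x - y"] by (simp add: l_def dist_norm)
    ultimately show "norm (z - x) \<le> 2 * l" "norm (z - y) \<le> 2 * l" using l by linarith+
  qed
  have "ennreal (\<bar>f x - f y\<bar> * (?\<omega> * l powr ?N)) = (\<integral>\<^sup>+z. ennreal \<bar>f x - f y\<bar> * indicator ?B z \<partial>lborel)"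
    using emeasure_ball[of l x] l by (simp add: nn_integral_cmult_indicator ennreal_mult powr_realpow)
  also have "\<dots> \<le> (\<integral>\<^sup>+z. ennreal \<bar>f z - f x\<bar> * indicator ?B z + ennreal \<bar>f z - f y\<bar> * indicator ?B z \<partial>lborel)"
    by (intro nn_integral_mono) (auto simp: indicator_def ennreal_plus[symmetric] simp del: ennreal_plus intro!: ennreal_leI)
  also have "\<dots> = (\<integral>\<^sup>+z. ennreal \<bar>f z - f x\<bar> * indicator ?B z \<partial>lborel) + (\<integral>\<^sup>+z. ennreal \<bar>f z - f y\<bar> * indicator ?B z \<partial>lborel)"
    by (rule nn_integral_add)
      (intro borel_measurable_times_ennreal measurable_compose[OF _ measurable_ennreal] borel_measurable_abs
        borel_measurable_diff borel_measurable_const borel_measurable_indicator; simp)+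
  also have "\<dots> \<le> ennreal R + ennreal R" unfolding R_def
    by (intro add_mono morrey_average[OF D F q C l] ax)
  also have "\<dots> = ennreal (2 * R)" using R by (simp add: ennreal_plus[symmetric] del: ennreal_plus)
  finally have "\<bar>f x - f y\<bar> * (?\<omega> * l powr ?N) \<le> 2 * R" using R by simp
  then have "\<bar>f x - f y\<bar> \<le> 2 * R / (?\<omega> * l powr ?N)" using \<omega> l by (simp add: pos_le_divide_eq)
  also have "\<dots> = morrey_const CARD('n) q C * dist x y powr (1 - ?N / q)"
  proof -
    have "2 * (2 * P * L * (W + C) / D) / (W * L) = 4 * (W + C) / (W * D) * P"
      if "L \<noteq> 0" "W \<noteq> 0" "D \<noteq> 0" for P L W D :: real
      using that by (simp add: divide_simps)
    note key = this
    have n: "l powr ?N \<noteq> 0" "?\<omega> \<noteq> 0" "1 - ?N / q \<noteq> 0"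
      using l Nq less_imp_neq[OF \<omega>] by (simp, metis, linarith)
    show ?thesis unfolding R_def morrey_const_def l_def[symmetric] by (rule key[OF n])
  qed
  finally show ?thesis .
qed auto

subsection \<open>Mollification of functions with zero boundary values\<close>

lemma borel_measurable_vec_nth' [measurable (raw)]:
  fixes f :: "'x \<Rightarrow> 'b::euclidean_space^'k"
  shows "f \<in> borel_measurable M \<Longrightarrow> (\<lambda>x. f x $ k) \<in> borel_measurable M"
  by (rule borel_measurable_continuous_on[OF linear_continuous_on[OF bounded_linear_vec_nth]])

context bounded_open
begin

definition zero_extension :: "(real^'n \<Rightarrow> real^'m) \<Rightarrow> (real^'n \<Rightarrow> real^'n^'m) \<Rightarrow> bool" where
  "zero_extension z Z \<longleftrightarrow> integrable lborel z \<and> integrable lborel Z \<and> (\<forall>x. x \<notin> \<Omega> \<longrightarrow> z x = 0 \<and> Z x = 0) \<and>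
    (\<forall>\<psi> k i. test_function UNIV \<psi> \<longrightarrow> (LINT x|lborel. z x $ k * pd i \<psi> x) = - (LINT x|lborel. Z x $ k $ i * \<psi> x))"

lemma W0_zero_extension:
  assumes W: "W0 z Z"
  obtains y Y where "zero_extension y Y" "AE x in lebesgue_on \<Omega>. y x = z x" "AE x in lebesgue_on \<Omega>. Y x = Z x"
proof -
  note i = W0_integrable[OF W]
  obtain y where y: "y \<in> borel_measurable borel" "\<And>x. x \<notin> \<Omega> \<Longrightarrow> y x = 0" "AE x in lebesgue_on \<Omega>. y x = z x"
    using lebesgue_on_borel_rep[OF open_\<Omega> borel_measurable_integrable[OF i(1)]] by auto
  obtain Y where Y: "Y \<in> borel_measurable borel" "\<And>x. x \<notin> \<Omega> \<Longrightarrow> Y x = 0" "AE x in lebesgue_on \<Omega>. Y x = Z x"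
    using lebesgue_on_borel_rep[OF open_\<Omega> borel_measurable_integrable[OF i(2)]] by auto
  have m: "h \<in> borel_measurable (lebesgue_on \<Omega>)" if "h \<in> borel_measurable borel" for h :: "real^'n \<Rightarrow> 'c::euclidean_space"
    using that by (simp add: measurable_completion measurable_restrict_space1)
  have iy: "integrable (lebesgue_on \<Omega>) y" "integrable (lebesgue_on \<Omega>) Y"
    using integrable_cong_AE[OF m[OF y(1)] borel_measurable_integrable[OF i(1)] y(3)] i(1)
      integrable_cong_AE[OF m[OF Y(1)] borel_measurable_integrable[OF i(2)] Y(3)] i(2) by simp_all
  have "(LINT x|lborel. y x $ k * pd i \<psi> x) = - (LINT x|lborel. Y x $ k $ i * \<psi> x)" if \<psi>: "test_function UNIV \<psi>" for \<psi> k i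
  proof -
    have [measurable]: "y \<in> borel_measurable borel" "Y \<in> borel_measurable borel" by (fact y(1), fact Y(1))
    have [measurable]: "z \<in> borel_measurable (lebesgue_on \<Omega>)" "Z \<in> borel_measurable (lebesgue_on \<Omega>)"
      using i by (auto intro: borel_measurable_integrable)
    have [measurable]: "\<psi> \<in> borel_measurable borel" "pd i \<psi> \<in> borel_measurable borel"
      using test_function_borel[OF \<psi>] test_function_borel[OF test_function_pd[OF \<psi>]] by auto
    note [measurable] = m[OF \<open>\<psi> \<in> _\<close>] m[OF \<open>pd i \<psi> \<in> _\<close>]
    have "(LINT x|lborel. y x $ k * pd i \<psi> x) = (LINT x|lebesgue_on \<Omega>. y x $ k * pd i \<psi> x)"
      using y(2) by (intro integral_lebesgue_on(1)[OF open_\<Omega>, symmetric]) auto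
    also have "\<dots> = (LINT x|lebesgue_on \<Omega>. z x $ k * pd i \<psi> x)"
    proof (rule integral_cong_AE)
      show "(\<lambda>x. y x $ k * pd i \<psi> x) \<in> borel_measurable (lebesgue_on \<Omega>)" by (intro m) simp
      show "(\<lambda>x. z x $ k * pd i \<psi> x) \<in> borel_measurable (lebesgue_on \<Omega>)" by simp
      show "AE x in lebesgue_on \<Omega>. y x $ k * pd i \<psi> x = z x $ k * pd i \<psi> x" using y(3) by eventually_elim simp
    qed
    also have "\<dots> = - (LINT x|lebesgue_on \<Omega>. Z x $ k $ i * \<psi> x)" by (rule W0_ibp[OF W \<psi>])
    also have "(LINT x|lebesgue_on \<Omega>. Z x $ k $ i * \<psi> x) = (LINT x|lebesgue_on \<Omega>. Y x $ k $ i * \<psi> x)"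
    proof (rule integral_cong_AE)
      show "(\<lambda>x. Y x $ k $ i * \<psi> x) \<in> borel_measurable (lebesgue_on \<Omega>)" by (intro m) simp
      show "(\<lambda>x. Z x $ k $ i * \<psi> x) \<in> borel_measurable (lebesgue_on \<Omega>)" by simp
      show "AE x in lebesgue_on \<Omega>. Z x $ k $ i * \<psi> x = Y x $ k $ i * \<psi> x" using Y(3) by eventually_elim simp
    qed
    also have "\<dots> = (LINT x|lborel. Y x $ k $ i * \<psi> x)"
      using Y(2) by (intro integral_lebesgue_on(1)[OF open_\<Omega>]) auto
    finally show ?thesis .
  qed
  then have "zero_extension y Y" unfolding zero_extension_def
    using iy integral_lebesgue_on(2)[OF open_\<Omega> y(1,2)] integral_lebesgue_on(2)[OF open_\<Omega> Y(1,2)] y(2) Y(2) by auto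
  then show ?thesis using y(3) Y(3) by (rule that)
qed

lemma conv_nth:
  fixes f :: "real^'n \<Rightarrow> 'b::euclidean_space^'k"
  assumes "test_function UNIV \<phi>" "integrable lborel f"
  shows "conv \<phi> f x $ k = conv \<phi> (\<lambda>y. f y $ k) x"
  unfolding conv_def
  using integral_bounded_linear[OF bounded_linear_vec_nth[of k] conv_integrable[OF assms, of x]] by simp

text \<open>The derivative moves from the kernel to Z even at points near the boundary or outside
  \<Omega>, because the kernel is an admissible test function on the whole space.\<close>

lemma pd_mollified:
  assumes z: "zero_extension z Z" and e: "e > 0"
  shows "smooth (\<lambda>x. conv (mollifier e) z x $ k)"
    and "pd i (\<lambda>x. conv (mollifier e) z x $ k) x = conv (mollifier e) Z x $ k $ i"
proof -
  note t = mollifier_test[OF e]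
  have iz: "integrable lborel z" "integrable lborel Z" using z by (auto simp: zero_extension_def)
  have eq: "(\<lambda>x. conv (mollifier e) z x $ k) = conv (mollifier e) (\<lambda>y. z y $ k)"
    by (rule ext) (rule conv_nth[OF t iz(1)])
  show "smooth (\<lambda>x. conv (mollifier e) z x $ k)" unfolding eq
    by (rule smooth_conv[OF t integrable_vec_nth[OF iz(1)]])
  have s: "smooth (\<lambda>y. mollifier e (x - y))" by (rule test_function_translate(1)[OF test_function_smooth[OF t]])
  have "\<forall>y. y \<notin> cball x e \<longrightarrow> mollifier e (x - y) = 0"
    using mollifier_eq_0[OF e, of "x - _"] by (auto simp: dist_norm)
  then have \<psi>: "test_function UNIV (\<lambda>y. mollifier e (x - y))"
    unfolding test_function_iff using s compact_cball[of x e] by (intro conjI exI[of _ "cball x e"]) auto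
  have "pd i (\<lambda>x. conv (mollifier e) z x $ k) x = conv (pd i (mollifier e)) (\<lambda>y. z y $ k) x"
    unfolding eq pd_conv[OF t integrable_vec_nth[OF iz(1)]] ..
  also have "\<dots> = - (LINT y|lborel. z y $ k * pd i (\<lambda>y. mollifier e (x - y)) y)"
    unfolding conv_def test_function_translate(2)[OF test_function_smooth[OF t]] by (simp add: mult.commute)
  also have "\<dots> = (LINT y|lborel. Z y $ k $ i * mollifier e (x - y))"
    using z \<psi> by (simp add: zero_extension_def)
  also have "\<dots> = conv (mollifier e) (\<lambda>y. Z y $ k $ i) x" by (simp add: conv_def mult.commute)
  also have "\<dots> = conv (mollifier e) Z x $ k $ i"
    by (simp add: conv_nth[OF t iz(2)] conv_nth[OF t integrable_vec_nth[OF iz(2)]])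
  finally show "pd i (\<lambda>x. conv (mollifier e) z x $ k) x = conv (mollifier e) Z x $ k $ i" .
qed

end

subsection \<open>Hoelder estimates\<close>

context bounded_open
begin

lemma zero_extension_mollified_bounds:
  fixes z :: "real^'n \<Rightarrow> real^'m"
  assumes z: "zero_extension z Z" and q: "(q::real) > CARD('n)" and C: "C \<ge> 0" "(\<integral>\<^sup>+x. norm (Z x) powr q \<partial>lborel) \<le> ennreal C"
    and e: "0 < e" "e \<le> 1" and R: "R > 0" "\<Omega> \<subseteq> ball 0 R"
  shows "norm (conv (mollifier e) z x - conv (mollifier e) z y) \<le> CARD('m) * morrey_const CARD('n) q C * dist x y powr (1 - CARD('n) / q)"
    and "norm (conv (mollifier e) z x) \<le> CARD('m) * morrey_const CARD('n) q C * (2 * (R + 1)) powr (1 - CARD('n) / q)"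
proof -
  let ?f = "conv (mollifier e) z" and ?K = "morrey_const CARD('n) q C" and ?a = "1 - CARD('n) / q"
  have q1: "q \<ge> 1"
  proof -
    have "real CARD('n) \<ge> 1" by simp
    then show ?thesis using q by linarith
  qed
  have iz: "integrable lborel z" "integrable lborel Z" using z by (auto simp: zero_extension_def)
  have comp: "\<bar>?f x $ k - ?f y $ k\<bar> \<le> ?K * dist x y powr ?a" for x y k
  proof (rule morrey[OF _ _ q C(1)])
    have s: "smooth (\<lambda>x. ?f x $ k)" by (rule pd_mollified(1)[OF z e(1)])
    show "((\<lambda>x. ?f x $ k) has_derivative (\<lambda>h. grad (\<lambda>x. ?f x $ k) x \<bullet> h)) (at x)" for x
      by (rule smooth_has_derivative[OF s])
    show "continuous_on UNIV (grad (\<lambda>x. ?f x $ k))" by (rule continuous_grad[OF s])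
    have g: "grad (\<lambda>x. ?f x $ k) x = conv (mollifier e) Z x $ k" for x
      by (simp add: grad_def pd_mollified(2)[OF z e(1)] vec_eq_iff)
    have "(\<integral>\<^sup>+x. norm (grad (\<lambda>x. ?f x $ k) x) powr q \<partial>lborel) \<le> (\<integral>\<^sup>+x. norm (conv (mollifier e) Z x) powr q \<partial>lborel)"
      unfolding g using q1 by (intro nn_integral_mono ennreal_leI powr_mono2 Finite_Cartesian_Product.norm_nth_le) auto
    also have "\<dots> \<le> (\<integral>\<^sup>+x. norm (Z x) powr q \<partial>lborel)" by (rule nn_integral_conv_powr_le[OF e(1) iz(2) q1])
    finally show "(\<integral>\<^sup>+x. norm (grad (\<lambda>x. ?f x $ k) x) powr q \<partial>lborel) \<le> ennreal C" using C(2) by (rule order_trans)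
  qed
  have diff: "norm (?f x - ?f y) \<le> CARD('m) * ?K * dist x y powr ?a" for x y
  proof -
    have "norm (?f x - ?f y) \<le> (\<Sum>k\<in>UNIV. \<bar>(?f x - ?f y) $ k\<bar>)" by (rule norm_le_l1_cart)
    also have "\<dots> \<le> (\<Sum>k\<in>(UNIV::'m set). ?K * dist x y powr ?a)" by (intro sum_mono) (simp add: comp)
    finally show ?thesis by simp
  qed
  show "norm (?f x - ?f y) \<le> CARD('m) * ?K * dist x y powr ?a" by (rule diff)
  have a: "?a \<ge> 0" using q by (simp add: divide_le_eq)
  have K: "?K \<ge> 0"
    unfolding morrey_const_def using q C(1) by (intro divide_nonneg_nonneg mult_nonneg_nonneg add_nonneg_nonneg) (auto simp: divide_le_eq)
  have zero: "?f x = 0" if x: "norm x \<ge> R + 1" for x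
  proof (rule conv_eq_0[OF e(1)])
    fix y assume "dist x y < e"
    then have "norm y \<ge> R" using x e norm_triangle_ineq[of y "x - y"] by (simp add: dist_norm)
    then have "y \<notin> \<Omega>" using R(2) by auto
    then show "z y = 0" using z by (simp add: zero_extension_def)
  qed
  show "norm (?f x) \<le> CARD('m) * ?K * (2 * (R + 1)) powr ?a"
  proof (cases "norm x \<ge> R + 1")
    case True
    then show ?thesis using zero[OF True] K by simp
  next
    case False
    \<comment> \<open>A point of norm R + 1, where the mollified function is 0: the Hoelder bound
      between x and w becomes a bound for the value at x.\<close>
    define w :: "real^'n" where "w = (R + 1) *\<^sub>R axis undefined 1"
    have w: "norm w = R + 1" using R by (simp add: w_def norm_eq_sqrt_inner inner_axis_axis)
    have "dist x w \<le> 2 * (R + 1)" using False w norm_triangle_ineq4[of x w] by (simp add: dist_norm)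
    then have "dist x w powr ?a \<le> (2 * (R + 1)) powr ?a" using a by (intro powr_mono2) auto
    then have "CARD('m) * ?K * dist x w powr ?a \<le> CARD('m) * ?K * (2 * (R + 1)) powr ?a"
      using K by (intro mult_left_mono) auto
    moreover have "norm (?f x) \<le> CARD('m) * ?K * dist x w powr ?a" using diff[of x w] zero[of w] w by simp
    ultimately show ?thesis by (rule order_trans[rotated])
  qed
qed

text \<open>B is fixed before z, so it serves a whole family of maps at once. The mollified
  functions satisfy Morrey's bounds uniformly; Arzela-Ascoli yields a continuous limit on the
  closure, and a subsequence converging almost everywhere identifies it with z.\<close>

lemma W0_holder_bound:
  assumes q: "(q::real) > CARD('n)" and C: "C \<ge> 0"
  shows "\<exists>B. \<forall>(z :: real^'n \<Rightarrow> real^'m) Z. W0 z Z \<longrightarrow> (\<integral>\<^sup>+x. norm (Z x) powr q \<partial>lebesgue_on \<Omega>) \<le> ennreal C \<longrightarrow>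
    (\<exists>h. continuous_on (closure \<Omega>) h \<and> (AE x in lebesgue_on \<Omega>. h x = z x) \<and>
      (\<forall>x\<in>closure \<Omega>. norm (h x) \<le> B) \<and>
      (\<forall>x\<in>closure \<Omega>. \<forall>y\<in>closure \<Omega>. norm (h x - h y) \<le> B * dist x y powr (1 - CARD('n) / q)))"
proof -
  let ?a = "1 - CARD('n) / q"
  obtain R where R: "R > 0" "\<Omega> \<subseteq> ball 0 R"
    using bounded_\<Omega> bounded_subset_ballD[of \<Omega> 0] by auto
  have a: "?a > 0" using q by (simp add: divide_less_eq)
  define K where "K = CARD('m) * morrey_const CARD('n) q C"
  have K: "K \<ge> 0"
    unfolding K_def morrey_const_def using q C by (intro divide_nonneg_nonneg mult_nonneg_nonneg add_nonneg_nonneg) (auto simp: divide_le_eq)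
  define B where "B = K + K * (2 * (R + 1)) powr ?a"
  have B: "K \<le> B" "K * (2 * (R + 1)) powr ?a \<le> B" using K by (auto simp: B_def)
  have "\<exists>h. continuous_on (closure \<Omega>) h \<and> (AE x in lebesgue_on \<Omega>. h x = z x) \<and>
      (\<forall>x\<in>closure \<Omega>. norm (h x) \<le> B) \<and>
      (\<forall>x\<in>closure \<Omega>. \<forall>y\<in>closure \<Omega>. norm (h x - h y) \<le> B * dist x y powr ?a)"
    if W: "W0 z Z" and CZ: "(\<integral>\<^sup>+x. norm (Z x) powr q \<partial>lebesgue_on \<Omega>) \<le> ennreal C" for z :: "real^'n \<Rightarrow> real^'m" and Z
  proof -
    obtain y Y where y: "zero_extension y Y" "AE x in lebesgue_on \<Omega>. y x = z x" "AE x in lebesgue_on \<Omega>. Y x = Z x"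
      by (rule W0_zero_extension[OF W])
    have iy: "integrable lborel y" "integrable lborel Y" and Y0: "\<And>x. x \<notin> \<Omega> \<Longrightarrow> Y x = 0"
      using y(1) by (auto simp: zero_extension_def)
    have [measurable]: "Y \<in> borel_measurable borel" using iy by auto
    have "(\<integral>\<^sup>+x. norm (Y x) powr q \<partial>lborel) = (\<integral>\<^sup>+x. norm (Y x) powr q \<partial>lebesgue_on \<Omega>)"
      using Y0 by (intro nn_integral_lebesgue_on[OF open_\<Omega>, symmetric]) auto
    also have "\<dots> = (\<integral>\<^sup>+x. norm (Z x) powr q \<partial>lebesgue_on \<Omega>)"
      using y(3) by (intro nn_integral_cong_AE) (auto elim: eventually_mono)
    finally have CY: "(\<integral>\<^sup>+x. norm (Y x) powr q \<partial>lborel) \<le> ennreal C" using CZ by simp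
    define e where "e = (\<lambda>n. 1 / real (Suc n))"
    have e: "0 < e n" "e n \<le> 1" for n by (auto simp: e_def)
    define f where "f = (\<lambda>n. conv (mollifier (e n)) y)"
    have f1: "norm (f n v - f n w) \<le> K * dist v w powr ?a" for n v w
      using zero_extension_mollified_bounds(1)[OF y(1) q C CY e R] by (simp add: f_def K_def)
    have f2: "norm (f n v) \<le> K * (2 * (R + 1)) powr ?a" for n v
      using zero_extension_mollified_bounds(2)[OF y(1) q C CY e R] by (simp add: f_def K_def)
    have fi: "f n \<in> borel_measurable borel" for n
      unfolding f_def using iy by (intro conv_borel) auto
    have fint: "integrable (lebesgue_on \<Omega>) (\<lambda>x. f n x - y x)" for n
    proof (rule Bochner_Integration.integrable_diff)
      have "f n \<in> borel_measurable (lebesgue_on \<Omega>)" using fi[of n] by (simp add: measurable_completion measurable_restrict_space1)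
      then show "integrable (lebesgue_on \<Omega>) (f n)"
        using f2[of n] by (intro integrable_const_bound) auto
      show "integrable (lebesgue_on \<Omega>) y"
        using integral_lebesgue_on(2)[OF open_\<Omega>, of y] iy y(1) by (auto simp: zero_extension_def)
    qed
    have L1: "(\<lambda>n. \<integral>\<^sup>+x. norm (f n x - y x) \<partial>lebesgue_on \<Omega>) \<longlonglongrightarrow> 0"
    proof (rule ennreal_tendsto_0I)
      fix \<eta> :: real assume "\<eta> > 0"
      then obtain d where d: "d > 0" "\<And>e. 0 < e \<and> e < d \<Longrightarrow> (\<integral>\<^sup>+x. norm (conv (mollifier e) y x - y x) \<partial>lborel) \<le> ennreal \<eta>"
        using conv_L1[OF iy(1)] by blast
      have "e \<longlonglongrightarrow> 0" unfolding e_def using LIMSEQ_Suc[OF lim_1_over_n[where 'a = real]] by simp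
      then have "\<forall>\<^sub>F n in sequentially. e n < d" using d(1) by (rule order_tendstoD)
      then show "\<forall>\<^sub>F n in sequentially. (\<integral>\<^sup>+x. norm (f n x - y x) \<partial>lebesgue_on \<Omega>) \<le> ennreal \<eta>"
      proof eventually_elim
        case (elim n)
        have "(\<integral>\<^sup>+x. norm (f n x - y x) \<partial>lebesgue_on \<Omega>) = (\<integral>\<^sup>+x. ennreal (norm (f n x - y x)) * indicator \<Omega> x \<partial>lebesgue)"
          by (intro nn_integral_restrict_space) auto
        also have "\<dots> \<le> (\<integral>\<^sup>+x. norm (f n x - y x) \<partial>lebesgue)" by (intro nn_integral_mono) (auto simp: indicator_def)
        also have "\<dots> = (\<integral>\<^sup>+x. norm (f n x - y x) \<partial>lborel)" by (rule nn_integral_completion)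
        also have "\<dots> \<le> ennreal \<eta>" using d(2)[of "e n"] e elim by (simp add: f_def)
        finally show ?case .
      qed
    qed
    have L1': "(\<lambda>n. LINT x|lebesgue_on \<Omega>. norm (f n x - y x)) \<longlonglongrightarrow> 0"
    proof -
      have "(\<lambda>n. ennreal (LINT x|lebesgue_on \<Omega>. norm (f n x - y x))) \<longlonglongrightarrow> ennreal 0"
        using L1 nn_integral_eq_integral[OF integrable_norm[OF fint]] by simp
      then show ?thesis by (subst (asm) tendsto_ennreal_iff) auto
    qed
    obtain r where r: "strict_mono r" "AE x in lebesgue_on \<Omega>. (\<lambda>n. f (r n) x - y x) \<longlonglongrightarrow> 0"
      using tendsto_L1_AE_subseq[OF fint L1'] by blast
    have equi: "\<exists>d>0. \<forall>n w. w \<in> closure \<Omega> \<and> norm (v - w) < d \<longrightarrow> norm (f (r n) v - f (r n) w) < \<epsilon>" if "\<epsilon> > 0" for v \<epsilon>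
    proof -
      define d where "d = (\<epsilon> / (K + 1)) powr (1 / ?a)"
      have "d > 0" using that K by (simp add: d_def)
      moreover have "norm (f (r n) v - f (r n) w) < \<epsilon>" if "norm (v - w) < d" for n w
      proof -
        have "dist v w powr ?a \<le> d powr ?a" using that a by (intro powr_mono2) (auto simp: dist_norm)
        also have "\<dots> = \<epsilon> / (K + 1)"
        proof -
          have "1 / t * t = 1" if "t > 0" for t :: real using that by simp
          from this[OF a] show ?thesis using \<open>\<epsilon> > 0\<close> K unfolding d_def powr_powr by simp
        qed
        finally have "K * dist v w powr ?a \<le> K * (\<epsilon> / (K + 1))" using K by (intro mult_left_mono) auto
        also have "\<dots> < \<epsilon>" using K \<open>\<epsilon> > 0\<close> by (simp add: divide_less_eq algebra_simps)
        finally show ?thesis using f1[of "r n" v w] by linarith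
      qed
      ultimately show ?thesis by blast
    qed
    have comp: "compact (closure \<Omega>)" using bounded_\<Omega> by (simp add: compact_closure)
    obtain h k where h: "continuous_on (closure \<Omega>) h" "strict_mono (k :: nat \<Rightarrow> nat)"
      and hk: "\<And>\<epsilon>. 0 < \<epsilon> \<Longrightarrow> \<exists>N. \<forall>n x. n \<ge> N \<and> x \<in> closure \<Omega> \<longrightarrow> norm (f (r (k n)) x - h x) < \<epsilon>"
      by (rule Arzela_Ascoli[of "closure \<Omega>" "\<lambda>n. f (r n)" "K * (2 * (R + 1)) powr ?a"]) (use comp f2 equi in auto)
    have lim: "(\<lambda>n. f (r (k n)) x) \<longlonglongrightarrow> h x" if "x \<in> closure \<Omega>" for x
      using hk that unfolding LIMSEQ_iff by blast
    have "AE x in lebesgue_on \<Omega>. h x = y x"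
      using r(2) AE_space
    proof eventually_elim
      case (elim x)
      have "x \<in> closure \<Omega>" using elim(2) closure_subset by auto
      moreover have "(\<lambda>n. f (r (k n)) x - y x) \<longlonglongrightarrow> 0"
        using LIMSEQ_subseq_LIMSEQ[OF elim(1) h(2)] by (simp add: o_def)
      then have "(\<lambda>n. f (r (k n)) x) \<longlonglongrightarrow> y x" by (rule Lim_null[THEN iffD2])
      ultimately show ?case using lim LIMSEQ_unique by blast
    qed
    then have "AE x in lebesgue_on \<Omega>. h x = z x" using y(2) by eventually_elim simp
    moreover have "norm (h x) \<le> B" if "x \<in> closure \<Omega>" for x
      using Lim_bounded[OF tendsto_norm[OF lim[OF that]], of 0 "K * (2 * (R + 1)) powr ?a"] f2 B(2) by force
    moreover have "norm (h v - h w) \<le> B * dist v w powr ?a" if "v \<in> closure \<Omega>" "w \<in> closure \<Omega>" for v w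
    proof -
      have "norm (h v - h w) \<le> K * dist v w powr ?a"
        using Lim_bounded[OF tendsto_norm[OF tendsto_diff[OF lim[OF that(1)] lim[OF that(2)]]], of 0 "K * dist v w powr ?a"] f1 by force
      also have "\<dots> \<le> B * dist v w powr ?a" using B(1) by (intro mult_right_mono) auto
      finally show ?thesis .
    qed
    ultimately show ?thesis using h(1) by (intro exI[of _ h]) auto
  qed
  then show ?thesis by (intro exI[of _ B] allI impI)
qed

subsection \<open>Interpolation\<close>

text \<open>Above a level K the L^q bound controls the r-th power with the small factor K^(r-q);
  below it the L^1 norm does.\<close>

lemma L1_Lq_imp_Lr:
  fixes f :: "nat \<Rightarrow> real^'n \<Rightarrow> 'b::euclidean_space"
  assumes m: "\<And>n. f n \<in> borel_measurable (lebesgue_on \<Omega>)"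
    and L1: "(\<lambda>n. \<integral>\<^sup>+x. norm (f n x) \<partial>lebesgue_on \<Omega>) \<longlonglongrightarrow> 0"
    and Lq: "\<And>n. (\<integral>\<^sup>+x. norm (f n x) powr q \<partial>lebesgue_on \<Omega>) \<le> ennreal C" and C: "C \<ge> 0" and r: "1 \<le> r" "r < q"
  shows "(\<lambda>n. \<integral>\<^sup>+x. norm (f n x) powr r \<partial>lebesgue_on \<Omega>) \<longlonglongrightarrow> 0"
proof (rule ennreal_tendsto_0I)
  fix e :: real assume e: "e > 0"
  \<comment> \<open>The exponent 1 / (r - q) is negative: K is large when e is small, and K powr (r
    - q) = e / 2 / (C + 1).\<close>
  define K where "K = (e / 2 / (C + 1)) powr (1 / (r - q))"
  have K: "K > 0" using e C by (simp add: K_def)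
  have KC: "K powr (r - q) * C \<le> e / 2"
  proof -
    have "K powr (r - q) = e / 2 / (C + 1)" using r e C by (simp add: K_def powr_powr)
    then have "K powr (r - q) * C = (e / 2) * (C / (C + 1))" by simp
    also have "\<dots> \<le> (e / 2) * 1" using e C by (intro mult_left_mono) auto
    finally show ?thesis by simp
  qed
  have pt: "t powr r \<le> K powr (r - 1) * t + K powr (r - q) * t powr q" if "t \<ge> 0" for t
  proof (cases "t \<le> K")
    case True
    have "t powr r \<le> K powr (r - 1) * t"
    proof (cases "t = 0")
      case False
      then have "t powr r = t powr (r - 1) * t" using that by (simp add: powr_diff)
      also have "\<dots> \<le> K powr (r - 1) * t" using True that r by (intro mult_right_mono powr_mono2) auto
      finally show ?thesis .
    qed auto
    then show ?thesis by (simp add: add_increasing2)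
  next
    case False
    then have "t powr r = t powr (r - q) * t powr q" using K by (simp flip: powr_add)
    also have "\<dots> \<le> K powr (r - q) * t powr q" using False K r by (intro mult_right_mono powr_mono2') auto
    finally show ?thesis using that by (simp add: add_increasing)
  qed
  define \<delta> where "\<delta> = e / 2 / (K powr (r - 1) + 1)"
  have K1: "K powr (r - 1) + 1 > 0" by (simp add: add_nonneg_pos)
  have \<delta>: "\<delta> > 0" using e K1 by (simp add: \<delta>_def)
  have K\<delta>: "K powr (r - 1) * \<delta> \<le> e / 2"
  proof -
    have "K powr (r - 1) * \<delta> \<le> (K powr (r - 1) + 1) * \<delta>" using \<delta> by (intro mult_right_mono) auto
    also have "\<dots> = e / 2"
    proof -
      have "X * (e / 2 / X) = e / 2" if "X > 0" for X :: real using that by simp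
      from this[OF K1] show ?thesis unfolding \<delta>_def .
    qed
    finally show ?thesis .
  qed
  from ennreal_tendsto_0D[OF L1 \<delta>] show "\<forall>\<^sub>F n in sequentially. (\<integral>\<^sup>+x. norm (f n x) powr r \<partial>lebesgue_on \<Omega>) \<le> ennreal e"
  proof eventually_elim
    case (elim n)
    note [measurable] = m[of n]
    have "(\<integral>\<^sup>+x. norm (f n x) powr r \<partial>lebesgue_on \<Omega>) \<le>
      (\<integral>\<^sup>+x. ennreal (K powr (r - 1)) * ennreal (norm (f n x)) + ennreal (K powr (r - q)) * ennreal (norm (f n x) powr q) \<partial>lebesgue_on \<Omega>)"
      using pt[OF norm_ge_zero] by (intro nn_integral_mono) (simp add: ennreal_mult[symmetric] ennreal_plus[symmetric] ennreal_leI del: ennreal_plus)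
    also have "\<dots> = ennreal (K powr (r - 1)) * (\<integral>\<^sup>+x. norm (f n x) \<partial>lebesgue_on \<Omega>) + ennreal (K powr (r - q)) * (\<integral>\<^sup>+x. norm (f n x) powr q \<partial>lebesgue_on \<Omega>)"
      by (subst nn_integral_add) (auto simp: nn_integral_cmult)
    also have "\<dots> \<le> ennreal (K powr (r - 1)) * ennreal \<delta> + ennreal (K powr (r - q)) * ennreal C"
      by (intro add_mono mult_left_mono elim Lq) auto
    also have "\<dots> \<le> ennreal (e / 2) + ennreal (e / 2)"
      using KC K\<delta> \<delta> C by (intro add_mono) (auto simp: ennreal_mult[symmetric] intro!: ennreal_leI)
    also have "\<dots> = ennreal e" using e by (simp add: ennreal_plus[symmetric] del: ennreal_plus)
    finally show ?case .
  qed
qed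

end

section \<open>Mazur's lemma and weak convergence in Sobolev spaces\<close>

subsection \<open>Completeness in the mean\<close>

text \<open>The Riesz-Fischer argument: a subsequence with differences at most 2^(-k) in the mean
  converges absolutely almost everywhere, and Fatou's lemma carries the Cauchy estimate to the
  limit.\<close>

lemma L1_complete:
  fixes F :: "nat \<Rightarrow> 'x \<Rightarrow> 'b::euclidean_space"
  assumes F: "\<And>n. integrable M (F n)"
    and cauchy: "\<And>e::real. e > 0 \<Longrightarrow> \<exists>N. \<forall>n\<ge>N. \<forall>m\<ge>N. (\<integral>\<^sup>+x. norm (F n x - F m x) \<partial>M) \<le> ennreal e"
  shows "\<exists>G. integrable M G \<and> (\<lambda>n. \<integral>\<^sup>+x. norm (F n x - G x) \<partial>M) \<longlonglongrightarrow> 0"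
proof -
  have [measurable]: "F n \<in> borel_measurable M" for n using F by (rule borel_measurable_integrable)
  have "\<forall>k. \<exists>N. \<forall>n\<ge>N. \<forall>m\<ge>N. (\<integral>\<^sup>+x. norm (F n x - F m x) \<partial>M) \<le> ennreal ((1/2) ^ k)"
    using cauchy by simp
  from choice[OF this] obtain N where N: "\<And>k n m. n \<ge> N k \<Longrightarrow> m \<ge> N k \<Longrightarrow> (\<integral>\<^sup>+x. norm (F n x - F m x) \<partial>M) \<le> ennreal ((1/2) ^ k)"
    by auto
  \<comment> \<open>Summing the thresholds gives one sequence that has passed N j for every j \<le>
    k.\<close>
  define r where "r = (\<lambda>k. \<Sum>i\<le>k. N i)"
  have r: "N j \<le> r k" if "j \<le> k" for j k
    unfolding r_def using that by (intro member_le_sum) auto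
  define h where "h = (\<lambda>k x. F (r (Suc k)) x - F (r k) x)"
  have hi: "integrable M (h k)" for k unfolding h_def using F by auto
  have [measurable]: "h k \<in> borel_measurable M" for k using hi by (rule borel_measurable_integrable)
  have hb: "(\<integral>\<^sup>+x. norm (h k x) \<partial>M) \<le> ennreal ((1/2) ^ k)" for k
    unfolding h_def using N[of k "r (Suc k)" "r k"] r[of k "Suc k"] r[of k k] by simp
  have hb': "(LINT x|M. norm (h k x)) \<le> (1/2) ^ k" for k
    using hb[of k] nn_integral_eq_integral[OF integrable_norm[OF hi[of k]]] by simp
  have "(\<integral>\<^sup>+x. (\<Sum>k. ennreal (norm (h k x))) \<partial>M) = (\<Sum>k. \<integral>\<^sup>+x. norm (h k x) \<partial>M)"
    by (rule nn_integral_suminf) simp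
  also have "\<dots> \<le> (\<Sum>k. ennreal ((1/2) ^ k))" by (intro suminf_le hb) auto
  also have "\<dots> = ennreal (\<Sum>k. (1/2) ^ k)" by (intro suminf_ennreal2) auto
  finally have "(\<integral>\<^sup>+x. (\<Sum>k. ennreal (norm (h k x))) \<partial>M) \<noteq> \<infinity>" by (auto simp: top_unique)
  then have "AE x in M. (\<Sum>k. ennreal (norm (h k x))) \<noteq> \<infinity>" by (intro nn_integral_PInf_AE) auto
  then have hs: "AE x in M. summable (\<lambda>k. norm (h k x))"
    by eventually_elim (auto intro: summable_suminf_not_top)
  have hs2: "summable (\<lambda>k. LINT x|M. norm (h k x))"
    by (rule summable_comparison_test'[of "\<lambda>k. (1/2::real) ^ k" 0]) (use hb' in \<open>auto intro: integral_nonneg_AE\<close>)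
  define G where "G = (\<lambda>x. F (r 0) x + (\<Sum>k. h k x))"
  have Gi: "integrable M G" unfolding G_def
    using integrable_suminf[OF hi hs hs2] F by auto
  then have [measurable]: "G \<in> borel_measurable M" by (rule borel_measurable_integrable)
  have lim: "AE x in M. (\<lambda>k. F (r k) x) \<longlonglongrightarrow> G x"
    using hs
  proof eventually_elim
    case (elim x)
    have "(\<lambda>k. \<Sum>i<k. h i x) \<longlonglongrightarrow> (\<Sum>k. h k x)"
      by (rule summable_LIMSEQ[OF summable_norm_cancel[OF elim]])
    moreover have "(\<Sum>i<k. h i x) = F (r k) x - F (r 0) x" for k
      unfolding h_def by (rule sum_lessThan_telescope)
    ultimately have "(\<lambda>k. F (r 0) x + (F (r k) x - F (r 0) x)) \<longlonglongrightarrow> F (r 0) x + (\<Sum>k. h k x)"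
      by (intro tendsto_add) auto
    then show ?case by (simp add: G_def)
  qed
  have "(\<lambda>n. \<integral>\<^sup>+x. norm (F n x - G x) \<partial>M) \<longlonglongrightarrow> 0"
  proof (rule ennreal_tendsto_0I)
    fix e :: real assume e: "e > 0"
    obtain j where j: "(1/2::real) ^ j < e" using real_arch_pow_inv[OF e, of "1/2"] by auto
    have "(\<integral>\<^sup>+x. norm (F n x - G x) \<partial>M) \<le> ennreal e" if n: "n \<ge> N j" for n
    proof -
      have "(\<integral>\<^sup>+x. norm (F n x - G x) \<partial>M) \<le> (\<integral>\<^sup>+x. liminf (\<lambda>k. ennreal (norm (F n x - F (r k) x))) \<partial>M)"
      proof (rule nn_integral_mono_AE)
        show "AE x in M. ennreal (norm (F n x - G x)) \<le> liminf (\<lambda>k. ennreal (norm (F n x - F (r k) x)))"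
          using lim
        proof eventually_elim
          case (elim x)
          have "(\<lambda>k. ennreal (norm (F n x - F (r k) x))) \<longlonglongrightarrow> ennreal (norm (F n x - G x))"
            by (intro tendsto_ennrealI tendsto_norm tendsto_diff elim tendsto_const)
          from lim_imp_Liminf[OF _ this] show ?case by simp
        qed
      qed
      also have "\<dots> \<le> liminf (\<lambda>k. \<integral>\<^sup>+x. norm (F n x - F (r k) x) \<partial>M)" by (rule nn_integral_liminf) simp
      also have "\<dots> \<le> ennreal e"
      proof (rule order_trans[OF Liminf_le_Limsup Limsup_bounded])
        show "\<forall>\<^sub>F k in sequentially. (\<integral>\<^sup>+x. norm (F n x - F (r k) x) \<partial>M) \<le> ennreal e"
          using eventually_ge_at_top[of j]
        proof eventually_elim
          case (elim k)
          have "(\<integral>\<^sup>+x. norm (F n x - F (r k) x) \<partial>M) \<le> ennreal ((1/2) ^ j)" by (rule N[OF n r[OF elim]])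
          also have "\<dots> \<le> ennreal e" using j by (intro ennreal_leI) auto
          finally show ?case .
        qed
      qed simp
      finally show ?thesis .
    qed
    then show "\<forall>\<^sub>F n in sequentially. (\<integral>\<^sup>+x. norm (F n x - G x) \<partial>M) \<le> ennreal e"
      unfolding eventually_sequentially by auto
  qed
  with Gi show ?thesis by auto
qed

subsection \<open>Midpoint-convex hulls\<close>

text \<open>Iterated midpoints suffice for the parallelogram argument, so general convex combinations are
  not needed.\<close>

inductive mid_hull ::
  "((real^'n \<Rightarrow> real^'m) \<Rightarrow> (real^'n \<Rightarrow> real^'n^'m) \<Rightarrow> bool) \<Rightarrow> (real^'n \<Rightarrow> real^'m) \<Rightarrow> (real^'n \<Rightarrow> real^'n^'m) \<Rightarrow> bool"
  for S where
  base: "S y Y \<Longrightarrow> mid_hull S y Y"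
| mid: "mid_hull S y Y \<Longrightarrow> mid_hull S z Z \<Longrightarrow>
    mid_hull S (\<lambda>x. (1/2) *\<^sub>R y x + (1/2) *\<^sub>R z x) (\<lambda>x. (1/2) *\<^sub>R Y x + (1/2) *\<^sub>R Z x)"

lemma mid_hull_mono:
  assumes "mid_hull S y Y" "\<And>y Y. S y Y \<Longrightarrow> S' y Y" shows "mid_hull S' y Y"
  using assms by (induction rule: mid_hull.induct) (auto intro: mid_hull.intros)

lemma parallelogram_half:
  fixes a b :: "'a::real_inner"
  shows "(norm ((1/2) *\<^sub>R (a - b)))\<^sup>2 + (norm ((1/2) *\<^sub>R a + (1/2) *\<^sub>R b))\<^sup>2 = ((norm a)\<^sup>2 + (norm b)\<^sup>2) / 2"
  by (simp add: power2_norm_eq_inner algebra_simps inner_commute)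

lemma norm_mid_sq_le:
  fixes a b :: "'a::real_inner"
  shows "(norm ((1/2) *\<^sub>R a + (1/2) *\<^sub>R b))\<^sup>2 \<le> ((norm a)\<^sup>2 + (norm b)\<^sup>2) / 2"
  using parallelogram_half[of a b] zero_le_power2[of "norm ((1/2) *\<^sub>R (a - b))"] by linarith

lemma norm_mid_powr_le:
  fixes a b :: "'a::real_normed_vector"
  assumes q: "q \<ge> 1"
  shows "norm ((1/2) *\<^sub>R a + (1/2) *\<^sub>R b) powr q \<le> (norm a powr q + norm b powr q) / 2"
proof -
  define A where "A = (norm a + norm b) / 2"
  have A: "A \<ge> 0" by (simp add: A_def)
  have "norm ((1/2) *\<^sub>R a + (1/2) *\<^sub>R b) \<le> A"
    using norm_triangle_ineq[of "(1/2) *\<^sub>R a" "(1/2) *\<^sub>R b"] by (simp add: A_def add_divide_distrib)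
  then have "norm ((1/2) *\<^sub>R a + (1/2) *\<^sub>R b) powr q \<le> A powr q" using q by (intro powr_mono2) auto
  also have "A powr q \<le> (norm a powr q + norm b powr q) / 2"
  proof -
    have "q * (norm a * A powr (q-1)) + q * (norm b * A powr (q-1)) \<le> (norm a powr q + (q-1) * A powr q) + (norm b powr q + (q-1) * A powr q)"
      by (intro add_mono powr_tangent A q) auto
    moreover have "q * (norm a * A powr (q-1)) + q * (norm b * A powr (q-1)) = 2 * q * (A * A powr (q-1))"
      by (simp add: A_def algebra_simps)
    moreover have "A * A powr (q-1) = A powr q"
      using A q by (cases "A = 0") (auto simp: powr_diff)
    ultimately show ?thesis by (simp add: algebra_simps)
  qed
  finally show ?thesis .
qed

context bounded_open
begin

text \<open>Hilbert space projection by hand: Z n nearly minimises the integral Q of the square over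
  the hull of the tail from n on. For n \<le> m the midpoint of Z n and Z m still lies in the n-th
  hull, so its Q is at least d n, and the parallelogram identity bounds the distance between Z n and
  Z m.\<close>

lemma mazur_midpoints:
  fixes y :: "nat \<Rightarrow> real^'n \<Rightarrow> real^'m"
  assumes Y: "\<And>n. Y n \<in> borel_measurable (lebesgue_on \<Omega>)"
    and C: "\<And>n. (\<integral>\<^sup>+x. norm (Y n x) powr 2 \<partial>lebesgue_on \<Omega>) \<le> ennreal C" and C0: "C \<ge> 0"
  shows "\<exists>z Z G. (\<forall>n. mid_hull (\<lambda>v V. \<exists>k\<ge>n. v = y k \<and> V = Y k) (z n) (Z n)) \<and>
    integrable (lebesgue_on \<Omega>) G \<and> (\<lambda>n. \<integral>\<^sup>+x. norm (Z n x - G x) \<partial>lebesgue_on \<Omega>) \<longlonglongrightarrow> 0"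
proof -
  let ?M = "lebesgue_on \<Omega>"
  define H where "H = (\<lambda>n. mid_hull (\<lambda>v V. \<exists>k\<ge>n. v = y k \<and> V = Y k))"
  define Q where "Q = (\<lambda>V::real^'n \<Rightarrow> real^'n^'m. LINT x|?M. (norm (V x))\<^sup>2)"
  have Hinv: "V \<in> borel_measurable ?M \<and> integrable ?M (\<lambda>x. (norm (V x))\<^sup>2) \<and> Q V \<le> C" if "H n v V" for n v V
    using that unfolding H_def
  proof (induction rule: mid_hull.induct)
    case (base v V)
    then obtain k where V: "V = Y k" by auto
    have [measurable]: "V \<in> borel_measurable ?M" using Y V by simp
    have le: "(\<integral>\<^sup>+x. (norm (V x))\<^sup>2 \<partial>?M) \<le> ennreal C" using C[of k] by (simp add: V)
    have i: "integrable ?M (\<lambda>x. (norm (V x))\<^sup>2)"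
      by (rule integrableI_nonneg) (use le in \<open>auto intro: le_less_trans\<close>)
    then have "ennreal (Q V) \<le> ennreal C" unfolding Q_def
      using le nn_integral_eq_integral[OF i] by simp
    then show ?case using i C0 \<open>V \<in> _\<close> by simp
  next
    case (mid v V w W)
    then have [measurable]: "V \<in> borel_measurable ?M" "W \<in> borel_measurable ?M" by auto
    have i: "integrable ?M (\<lambda>x. ((norm (V x))\<^sup>2 + (norm (W x))\<^sup>2) / 2)" using mid by auto
    have i2: "integrable ?M (\<lambda>x. (norm ((1/2) *\<^sub>R V x + (1/2) *\<^sub>R W x))\<^sup>2)"
      by (rule Bochner_Integration.integrable_bound[OF i]) (use norm_mid_sq_le in auto)
    have "Q (\<lambda>x. (1/2) *\<^sub>R V x + (1/2) *\<^sub>R W x) \<le> (LINT x|?M. ((norm (V x))\<^sup>2 + (norm (W x))\<^sup>2) / 2)"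
      unfolding Q_def by (intro integral_mono i i2 norm_mid_sq_le)
    also have "\<dots> = (Q V + Q W) / 2" unfolding Q_def using mid by simp
    also have "\<dots> \<le> C" using mid by simp
    finally show ?case using i2 by simp
  qed
  have Hmono: "H n v V" if "H m v V" "n \<le> m" for n m v V
    using that(1) unfolding H_def
    by (rule mid_hull_mono) (use that(2) in \<open>auto intro: order_trans\<close>)
  have Q0: "Q V \<ge> 0" for V unfolding Q_def by (intro integral_nonneg_AE) auto
  define A where "A = (\<lambda>n. {a. \<exists>v V. H n v V \<and> a = Q V})"
  have An: "Q (Y n) \<in> A n" for n unfolding A_def H_def by (auto intro!: mid_hull.base exI[of _ "y n"] exI[of _ "Y n"])
  have Ab: "bdd_below (A n)" for n unfolding A_def using Q0 by (intro bdd_belowI[of _ 0]) auto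
  define d where "d = (\<lambda>n. Inf (A n))"
  have d_le: "d n \<le> Q V" if "H n v V" for n v V
    unfolding d_def using that Ab by (intro cInf_lower) (auto simp: A_def)
  have dC: "d n \<le> C" for n
  proof -
    have "H n (y n) (Y n)" unfolding H_def by (auto intro!: mid_hull.base)
    then show ?thesis using d_le Hinv order_trans by blast
  qed
  \<comment> \<open>The hulls shrink as n grows, so their infima increase; C bounds them from
    above.\<close>
  have dm: "incseq d" unfolding d_def
  proof (rule incseq_SucI, rule cInf_superset_mono)
    show "A (Suc n) \<noteq> {}" for n using An[of "Suc n"] by blast
    show "A (Suc n) \<subseteq> A n" for n unfolding A_def using Hmono[of "Suc n" _ _ n] by auto
  qed (rule Ab)
  obtain D where D: "d \<longlonglongrightarrow> D" "\<And>n. d n \<le> D"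
    using incseq_convergent[OF dm] dC by blast
  have "\<forall>n. \<exists>p. H n (fst p) (snd p) \<and> Q (snd p) < d n + 1 / real (Suc n)"
  proof
    fix n
    have "\<exists>a\<in>A n. a < d n + 1 / real (Suc n)"
      unfolding d_def using An[of n] by (intro cInf_lessD) auto
    then obtain v V where "H n v V" "Q V < d n + 1 / real (Suc n)" by (auto simp: A_def)
    then show "\<exists>p. H n (fst p) (snd p) \<and> Q (snd p) < d n + 1 / real (Suc n)" by (intro exI[of _ "(v, V)"]) simp
  qed
  from choice[OF this] obtain p where p: "\<And>n. H n (fst (p n)) (snd (p n))" "\<And>n. Q (snd (p n)) < d n + 1 / real (Suc n)"
    by auto
  define z Z where "z = (\<lambda>n. fst (p n))" and "Z = (\<lambda>n. snd (p n))"
  have zZ: "H n (z n) (Z n)" "Q (Z n) < d n + 1 / real (Suc n)" for n using p by (auto simp: z_def Z_def)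
  have Zm [measurable]: "Z n \<in> borel_measurable ?M" and Z2: "integrable ?M (\<lambda>x. (norm (Z n x))\<^sup>2)" for n
    using Hinv[OF zZ(1)] by auto
  have Zi: "integrable ?M (Z n)" for n
  proof (rule Bochner_Integration.integrable_bound[OF Bochner_Integration.integrable_add[OF integrable_const[of 1] Z2[of n]]])
    have "t \<le> 1 + t\<^sup>2" for t :: real
      using zero_le_power2[of "t - 1/2"] by (simp add: power2_eq_square algebra_simps)
    then show "AE x in ?M. norm (Z n x) \<le> norm (1 + (norm (Z n x))\<^sup>2)" by simp
  qed simp
  \<comment> \<open>Twice the gap D - d n left by the infima, plus 4 / (n + 1) from the two
    near-minimisers.\<close>
  define \<eta> where "\<eta> = (\<lambda>n. 2 * (D - d n) + 4 / real (Suc n))"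
  have diff: "integrable ?M (\<lambda>x. (norm (Z n x - Z m x))\<^sup>2)" "(LINT x|?M. (norm (Z n x - Z m x))\<^sup>2) \<le> \<eta> n" if nm: "n \<le> m" for n m
  proof -
    have "H n (\<lambda>x. (1/2) *\<^sub>R z n x + (1/2) *\<^sub>R z m x) (\<lambda>x. (1/2) *\<^sub>R Z n x + (1/2) *\<^sub>R Z m x)"
      using zZ(1)[of n] Hmono[OF zZ(1)[of m] nm] unfolding H_def by (rule mid_hull.mid)
    note mh = d_le[OF this] Hinv[OF this]
    have eq: "(norm (Z n x - Z m x))\<^sup>2 = 2 * (norm (Z n x))\<^sup>2 + 2 * (norm (Z m x))\<^sup>2 - 4 * (norm ((1/2) *\<^sub>R Z n x + (1/2) *\<^sub>R Z m x))\<^sup>2" for x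
      using parallelogram_half[of "Z n x" "Z m x"] by (simp add: power_mult_distrib power2_eq_square)
    show "integrable ?M (\<lambda>x. (norm (Z n x - Z m x))\<^sup>2)" unfolding eq using Z2[of n] Z2[of m] mh(2) by auto
    have "(LINT x|?M. (norm (Z n x - Z m x))\<^sup>2) = 2 * Q (Z n) + 2 * Q (Z m) - 4 * Q (\<lambda>x. (1/2) *\<^sub>R Z n x + (1/2) *\<^sub>R Z m x)"
      unfolding eq Q_def using Z2[of n] Z2[of m] mh(2) by simp
    also have "\<dots> \<le> 2 * (d n + 1 / real (Suc n)) + 2 * (D + 1 / real (Suc n)) - 4 * d n"
    proof -
      have "1 / real (Suc m) \<le> 1 / real (Suc n)" using nm by (intro divide_left_mono) auto
      moreover have "2 * a + 2 * b - 4 * c \<le> 2 * (u + e) + 2 * (D + e) - 4 * u"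
        if "a < u + e" "b < u' + e'" "e' \<le> e" "u' \<le> D" "u \<le> c" for a b c u u' e e' :: real
        using that by argo
      ultimately show ?thesis using zZ(2)[of n] zZ(2)[of m] D(2)[of m] mh(1) by blast
    qed
    also have "\<dots> = \<eta> n" by (simp add: \<eta>_def)
    finally show "(LINT x|?M. (norm (Z n x - Z m x))\<^sup>2) \<le> \<eta> n" .
  qed
  have \<eta>0: "\<eta> \<longlonglongrightarrow> 0"
  proof -
    have "(\<lambda>n. 2 * (D - d n) + 4 * (1 / real (Suc n))) \<longlonglongrightarrow> 2 * (D - D) + 4 * 0"
      by (intro tendsto_intros D LIMSEQ_Suc[OF lim_1_over_n[where 'a = real]])
    then show ?thesis by (simp add: \<eta>_def)
  qed
  have "\<exists>N. \<forall>n\<ge>N. \<forall>m\<ge>N. (\<integral>\<^sup>+x. norm (Z n x - Z m x) \<partial>?M) \<le> ennreal e" if e: "e > 0" for e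
  proof -
    define V where "V = measure ?M (space ?M)"
    have V: "V \<ge> 0" by (simp add: V_def)
    define s where "s = e / 2 / (V + 1)"
    have s: "s > 0" using e V by (simp add: s_def add_nonneg_pos)
    have sV: "s * V \<le> e / 2"
    proof -
      have "s * V \<le> s * (V + 1)" using s by (intro mult_left_mono) auto
      also have "\<dots> = e / 2"
      proof -
        have "e / 2 / X * X = e / 2" if "X > 0" for X :: real using that by simp
        moreover have "V + 1 > 0" using V by simp
        ultimately show ?thesis unfolding s_def by blast
      qed
      finally show ?thesis .
    qed
    have "\<forall>\<^sub>F n in sequentially. \<eta> n < s * (e / 2)" using \<eta>0 s e by (intro order_tendstoD) auto
    then obtain N where N: "\<And>n. n \<ge> N \<Longrightarrow> \<eta> n < s * (e / 2)" by (auto simp: eventually_sequentially)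
    have main: "(\<integral>\<^sup>+x. norm (Z n x - Z m x) \<partial>?M) \<le> ennreal e" if nm: "N \<le> n" "n \<le> m" for n m
    proof -
      have i: "integrable ?M (\<lambda>x. norm (Z n x - Z m x))" using Zi by auto
      \<comment> \<open>The bound t \<le> s + t^2 / s passes from L^2 to L^1 on a space of finite
        measure; s is chosen so that its first term contributes at most e / 2.\<close>
      have "(LINT x|?M. norm (Z n x - Z m x)) \<le> (LINT x|?M. s + (norm (Z n x - Z m x))\<^sup>2 / s)"
      proof (rule integral_mono[OF i])
        show "integrable ?M (\<lambda>x. s + (norm (Z n x - Z m x))\<^sup>2 / s)" using diff(1)[OF nm(2)] by auto
        fix x
        let ?t = "norm (Z n x - Z m x)"
        have "?t \<le> s + ?t\<^sup>2 / s"
        proof (cases "?t \<le> s")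
          case True
          moreover have "0 \<le> ?t\<^sup>2 / s" using s by simp
          ultimately show ?thesis by linarith
        next
          case False
          then have "?t * s \<le> ?t * ?t" by (intro mult_left_mono) auto
          then have "?t \<le> ?t\<^sup>2 / s" using s by (simp add: pos_le_divide_eq power2_eq_square)
          then show ?thesis using s by linarith
        qed
        then show "?t \<le> s + ?t\<^sup>2 / s" .
      qed
      also have "\<dots> = s * V + (LINT x|?M. (norm (Z n x - Z m x))\<^sup>2) / s"
        using diff(1)[OF nm(2)] by (simp add: V_def)
      also have "\<dots> \<le> e / 2 + e / 2"
      proof (intro add_mono sV)
        have "(LINT x|?M. (norm (Z n x - Z m x))\<^sup>2) \<le> s * (e / 2)" using diff(2)[OF nm(2)] N[OF nm(1)] by linarith
        then show "(LINT x|?M. (norm (Z n x - Z m x))\<^sup>2) / s \<le> e / 2" using s by (simp add: pos_divide_le_eq mult.commute)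
      qed
      finally have "(LINT x|?M. norm (Z n x - Z m x)) \<le> e" by simp
      then show ?thesis using nn_integral_eq_integral[OF i] by (simp add: ennreal_leI)
    qed
    show ?thesis
    proof (intro exI[of _ N] allI impI)
      fix n m assume "N \<le> n" "N \<le> m"
      then show "(\<integral>\<^sup>+x. norm (Z n x - Z m x) \<partial>?M) \<le> ennreal e"
        using main[of n m] main[of m n] by (cases "n \<le> m") (auto simp: norm_minus_commute)
    qed
  qed
  from L1_complete[OF Zi this] obtain G where "integrable ?M G" "(\<lambda>n. \<integral>\<^sup>+x. norm (Z n x - G x) \<partial>?M) \<longlonglongrightarrow> 0" by auto
  then show ?thesis using zZ(1) unfolding H_def by (intro exI[of _ z] exI[of _ Z] exI[of _ G] conjI allI)
qed

end

subsection \<open>Sobolev spaces\<close>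

lemma powr_add_le:
  fixes x y p :: real
  assumes "x \<ge> 0" "y \<ge> 0" "p \<ge> 0"
  shows "(x + y) powr p \<le> 2 powr p * (x powr p + y powr p)"
proof -
  have "(x + y) powr p \<le> (2 * max x y) powr p" using assms by (intro powr_mono2) auto
  also have "\<dots> = 2 powr p * max x y powr p" using assms by (simp add: powr_mult)
  also have "\<dots> \<le> 2 powr p * (x powr p + y powr p)" by (intro mult_left_mono) (auto simp: max_def)
  finally show ?thesis .
qed

lemma nn_integral_diff_powr_le:
  fixes f h :: "'a \<Rightarrow> 'b::{second_countable_topology, real_normed_vector}" and q A B :: real
  assumes q: "q \<ge> 1" and [measurable]: "f \<in> borel_measurable M" "h \<in> borel_measurable M"
    and f: "(\<integral>\<^sup>+x. norm (f x) powr q \<partial>M) \<le> ennreal A" and h: "(\<integral>\<^sup>+x. norm (h x) powr q \<partial>M) \<le> ennreal B"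
    and AB: "A \<ge> 0" "B \<ge> 0"
  shows "(\<integral>\<^sup>+x. norm (f x - h x) powr q \<partial>M) \<le> ennreal (2 powr q * (A + B))"
proof -
  have "(\<integral>\<^sup>+x. norm (f x - h x) powr q \<partial>M) \<le> (\<integral>\<^sup>+x. ennreal (2 powr q) * (ennreal (norm (f x) powr q) + ennreal (norm (h x) powr q)) \<partial>M)"
  proof (rule nn_integral_mono)
    fix x
    have "norm (f x - h x) powr q \<le> (norm (f x) + norm (h x)) powr q"
      using q by (intro powr_mono2 norm_triangle_ineq4) auto
    also have "\<dots> \<le> 2 powr q * (norm (f x) powr q + norm (h x) powr q)" using q by (intro powr_add_le) auto
    finally show "ennreal (norm (f x - h x) powr q) \<le> ennreal (2 powr q) * (ennreal (norm (f x) powr q) + ennreal (norm (h x) powr q))"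
      by (simp add: ennreal_mult[symmetric] ennreal_plus[symmetric] ennreal_leI del: ennreal_plus)
  qed
  also have "\<dots> = ennreal (2 powr q) * ((\<integral>\<^sup>+x. norm (f x) powr q \<partial>M) + (\<integral>\<^sup>+x. norm (h x) powr q \<partial>M))"
    by (subst nn_integral_cmult, simp, subst nn_integral_add, simp, simp, rule refl)
  also have "\<dots> \<le> ennreal (2 powr q) * (ennreal A + ennreal B)"
    by (intro mult_left_mono add_mono f h) auto
  also have "\<dots> = ennreal (2 powr q * (A + B))"
    by (simp only: ennreal_mult[OF powr_ge_zero add_nonneg_nonneg[OF AB]] ennreal_plus[OF AB])
  finally show ?thesis .
qed

lemma ennreal_half_add:
  assumes "c \<ge> 0" shows "ennreal (1/2) * ennreal c + ennreal (1/2) * ennreal c = ennreal c"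
proof -
  have "ennreal (1/2) * ennreal c = ennreal (1/2 * c)" using assms by (intro ennreal_mult[symmetric]) auto
  moreover have "ennreal (1/2 * c) + ennreal (1/2 * c) = ennreal (1/2 * c + 1/2 * c)"
    using assms by (intro ennreal_plus[symmetric]) auto
  ultimately show ?thesis by simp
qed

lemma Lp_lincomb:
  fixes f g :: "real^'n \<Rightarrow> 'b::euclidean_space" and p :: real
  assumes f: "f \<in> Lp p \<Omega>" and g: "g \<in> Lp p \<Omega>" and p: "p \<ge> 0"
  shows "(\<lambda>x. a *\<^sub>R f x + b *\<^sub>R g x) \<in> Lp p \<Omega>"
proof -
  have [measurable]: "f \<in> borel_measurable (lebesgue_on \<Omega>)" "g \<in> borel_measurable (lebesgue_on \<Omega>)"
    using f g by (auto simp: Lp_iff)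
  let ?c = "\<lambda>a. ennreal (2 powr p * \<bar>a\<bar> powr p)"
  have "(\<integral>\<^sup>+x. norm (a *\<^sub>R f x + b *\<^sub>R g x) powr p \<partial>lebesgue_on \<Omega>) \<le>
    (\<integral>\<^sup>+x. ?c a * ennreal (norm (f x) powr p) + ?c b * ennreal (norm (g x) powr p) \<partial>lebesgue_on \<Omega>)"
  proof (rule nn_integral_mono)
    fix x
    have "norm (a *\<^sub>R f x + b *\<^sub>R g x) powr p \<le> (norm (a *\<^sub>R f x) + norm (b *\<^sub>R g x)) powr p"
      using p by (intro powr_mono2 norm_triangle_ineq) auto
    also have "\<dots> \<le> 2 powr p * (norm (a *\<^sub>R f x) powr p + norm (b *\<^sub>R g x) powr p)"
      using p by (intro powr_add_le) auto
    also have "\<dots> = (2 powr p * \<bar>a\<bar> powr p) * norm (f x) powr p + (2 powr p * \<bar>b\<bar> powr p) * norm (g x) powr p"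
      by (simp add: powr_mult algebra_simps)
    finally show "ennreal (norm (a *\<^sub>R f x + b *\<^sub>R g x) powr p) \<le> ?c a * ennreal (norm (f x) powr p) + ?c b * ennreal (norm (g x) powr p)"
      by (simp add: ennreal_mult[symmetric] ennreal_plus[symmetric] ennreal_leI del: ennreal_plus)
  qed
  also have "\<dots> = ?c a * (\<integral>\<^sup>+x. norm (f x) powr p \<partial>lebesgue_on \<Omega>) + ?c b * (\<integral>\<^sup>+x. norm (g x) powr p \<partial>lebesgue_on \<Omega>)"
    by (subst nn_integral_add) (auto simp: nn_integral_cmult)
  also have "\<dots> < \<infinity>" using f g by (simp add: Lp_iff ennreal_mult_less_top)
  finally show ?thesis by (simp add: Lp_iff)
qed

context bounded_open
begin

lemma W1_I: "u \<in> Lp p \<Omega> \<Longrightarrow> weak_gradient \<Omega> u G \<Longrightarrow> G \<in> Lp p \<Omega> \<Longrightarrow> u \<in> W1 p \<Omega>"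
  unfolding W1_def by blast

lemmas W1_E = W1_D[OF open_\<Omega>]

lemma W1_lincomb:
  fixes p :: real
  assumes u: "u \<in> W1 p \<Omega>" and v: "v \<in> W1 p \<Omega>" and p: "p \<ge> 0"
  shows "(\<lambda>x. a *\<^sub>R u x + b *\<^sub>R v x) \<in> W1 p \<Omega>"
  by (rule W1_I[OF Lp_lincomb[OF W1_E(1)[OF u] W1_E(1)[OF v] p]
        weak_gradient_lincomb[OF open_\<Omega> W1_E(2)[OF u] W1_E(2)[OF v]] Lp_lincomb[OF W1_E(3)[OF u] W1_E(3)[OF v] p]])

lemma W1_mono:
  fixes p q :: real
  assumes "u \<in> W1 q \<Omega>" "0 \<le> p" "p \<le> q"
  shows "u \<in> W1 p \<Omega>"
  by (rule W1_I[OF Lp_mono[OF W1_E(1)] W1_E(2) Lp_mono[OF W1_E(3)]]) (rule assms)+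

lemma W1_inf_mono: "u \<in> W1 \<infinity> \<Omega> \<Longrightarrow> 0 \<le> p \<Longrightarrow> u \<in> W1 (ereal p) \<Omega>"
  by (rule W1_I[OF Lp_inf_mono[OF W1_E(1)] W1_E(2) Lp_inf_mono[OF W1_E(3)]])

lemma W1_integrable:
  assumes "u \<in> W1 (ereal p) \<Omega>" "p \<ge> 1"
  shows "integrable (lebesgue_on \<Omega>) u" "integrable (lebesgue_on \<Omega>) (wgrad \<Omega> u)"
  using W1_E[OF assms(1)] Lp_integrable assms(2) by auto

lemma wgrad_lincomb:
  assumes "weak_gradient \<Omega> u G" "weak_gradient \<Omega> v H"
  shows "AE x in lebesgue_on \<Omega>. wgrad \<Omega> (\<lambda>x. a *\<^sub>R u x + b *\<^sub>R v x) x = a *\<^sub>R G x + b *\<^sub>R H x"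
  by (rule wgrad_AE[OF open_\<Omega> weak_gradient_lincomb[OF open_\<Omega> assms]])

lemma W1_norm_tendsto:
  fixes s :: real and u :: "nat \<Rightarrow> real^'n \<Rightarrow> real^'m"
  assumes wg: "\<And>n. weak_gradient \<Omega> (u n) (U n)"
    and m: "\<And>n. U n \<in> borel_measurable (lebesgue_on \<Omega>)" and s: "s > 0"
    and lim: "(\<lambda>n. \<integral>\<^sup>+x. norm (u n x) powr s \<partial>lebesgue_on \<Omega>) \<longlonglongrightarrow> 0" "(\<lambda>n. \<integral>\<^sup>+x. norm (U n x) powr s \<partial>lebesgue_on \<Omega>) \<longlonglongrightarrow> 0"
    and e: "e > 0"
  shows "\<exists>n. W1_norm s \<Omega> (u n) \<le> ereal e"
proof -
  have e': "(e/2) powr s > 0" using e by simp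
  from eventually_conj[OF ennreal_tendsto_0D[OF lim(1) e'] ennreal_tendsto_0D[OF lim(2) e']]
  obtain n where n: "(\<integral>\<^sup>+x. norm (u n x) powr s \<partial>lebesgue_on \<Omega>) \<le> ennreal ((e/2) powr s)"
    "(\<integral>\<^sup>+x. norm (U n x) powr s \<partial>lebesgue_on \<Omega>) \<le> ennreal ((e/2) powr s)"
    by (auto simp: eventually_sequentially)
  have eq: "((e/2) powr s) powr (1/s) = e/2" using e s by (simp add: powr_powr)
  have "W1_norm s \<Omega> (u n) = Lp_norm s \<Omega> (u n) + Lp_norm s \<Omega> (U n)" by (rule W1_norm_eq[OF open_\<Omega> wg m])
  also have "\<dots> \<le> ereal (e/2) + ereal (e/2)"
    using Lp_norm_le[OF n(1) _ s] Lp_norm_le[OF n(2) _ s] unfolding eq by (intro add_mono) auto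
  finally show ?thesis by auto
qed

lemma W1_0_D:
  fixes z :: "real^'n \<Rightarrow> real^'m"
  assumes z: "z \<in> W1_0 p \<Omega>"
  shows "z \<in> W1 p \<Omega>" "W0 z (wgrad \<Omega> z)"
proof -
  show "z \<in> W1 p \<Omega>" using z by (simp add: W1_0_def)
  have z1: "z \<in> W1 (ereal 1) \<Omega>" using z by (simp add: W1_0_def one_ereal_def)
  obtain \<phi> where \<phi>: "\<And>n::nat. test_map \<Omega> (\<phi> n)" "(\<lambda>n. W1_norm 1 \<Omega> (\<lambda>x. \<phi> n x - z x)) \<longlonglongrightarrow> 0"
    using z by (auto simp: W1_0_def)
  note i = W1_integrable[OF z1 order_refl] and wz = W1_E(2)[OF z1]
  have wg: "weak_gradient \<Omega> (\<lambda>x. \<phi> n x - z x) (\<lambda>x. Dmap (\<phi> n) x - wgrad \<Omega> z x)" for n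
  proof -
    have "weak_gradient \<Omega> (\<phi> n) (Dmap (\<phi> n))"
      using Dmap_integrable[OF open_\<Omega> \<phi>(1)] test_map_global_ibp[OF open_\<Omega> \<phi>(1) test_function_mono]
      by (intro weak_gradientI[OF open_\<Omega>] integrable_locally_integrable) auto
    from weak_gradient_lincomb[OF open_\<Omega> this wz, of 1 "-1"] show ?thesis by simp
  qed
  have m: "(\<lambda>x. Dmap (\<phi> n) x - wgrad \<Omega> z x) \<in> borel_measurable (lebesgue_on \<Omega>)" for n
    using Dmap_integrable(2)[OF open_\<Omega> \<phi>(1)] i(2) by (intro borel_measurable_diff borel_measurable_integrable)
  have eq: "W1_norm 1 \<Omega> (\<lambda>x. \<phi> n x - z x) = enn2ereal ((\<integral>\<^sup>+x. norm (\<phi> n x - z x) \<partial>lebesgue_on \<Omega>) + (\<integral>\<^sup>+x. norm (Dmap (\<phi> n) x - wgrad \<Omega> z x) \<partial>lebesgue_on \<Omega>))" for n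
    by (simp add: W1_norm_eq[OF open_\<Omega> wg m] Lp_norm_1 plus_ennreal.rep_eq)
  have l: "(\<lambda>n. (\<integral>\<^sup>+x. norm (\<phi> n x - z x) \<partial>lebesgue_on \<Omega>) + (\<integral>\<^sup>+x. norm (Dmap (\<phi> n) x - wgrad \<Omega> z x) \<partial>lebesgue_on \<Omega>)) \<longlonglongrightarrow> 0"
    using \<phi>(2) unfolding eq by (simp flip: zero_ennreal.rep_eq)
  have "(\<lambda>n. \<integral>\<^sup>+x. norm (\<phi> n x - z x) \<partial>lebesgue_on \<Omega>) \<longlonglongrightarrow> 0"
    by (rule tendsto_sandwich[OF _ _ tendsto_const l]) (auto intro!: always_eventually)
  moreover have "(\<lambda>n. \<integral>\<^sup>+x. norm (Dmap (\<phi> n) x - wgrad \<Omega> z x) \<partial>lebesgue_on \<Omega>) \<longlonglongrightarrow> 0"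
    by (rule tendsto_sandwich[OF _ _ tendsto_const l]) (auto intro!: always_eventually)
  ultimately show "W0 z (wgrad \<Omega> z)" unfolding W0_def using i \<phi>(1) by (intro conjI exI[of _ \<phi>] allI)
qed

text \<open>The exponent p enters only through \<open>W1 p\<close>, while the approximation is
  always in W^{1,1}. This is how a map changes its exponent and keeps its boundary values.\<close>

lemma W1_0_I:
  fixes z :: "real^'n \<Rightarrow> real^'m"
  assumes z: "z \<in> W1 p \<Omega>" and W: "W0 z Z"
  shows "z \<in> W1_0 p \<Omega>"
proof -
  obtain \<phi> where \<phi>: "\<And>n::nat. test_map \<Omega> (\<phi> n)"
      "(\<lambda>n. \<integral>\<^sup>+x. norm (\<phi> n x - z x) \<partial>lebesgue_on \<Omega>) \<longlonglongrightarrow> 0"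
      "(\<lambda>n. \<integral>\<^sup>+x. norm (Dmap (\<phi> n) x - Z x) \<partial>lebesgue_on \<Omega>) \<longlonglongrightarrow> 0"
    using W by (auto simp: W0_def)
  note i = W0_integrable[OF W] and wz = W0_weak_gradient[OF W]
  have z1: "z \<in> W1 1 \<Omega>" using i wz by (intro W1_I) (auto simp: Lp_1_iff)
  have wg: "weak_gradient \<Omega> (\<lambda>x. \<phi> n x - z x) (\<lambda>x. Dmap (\<phi> n) x - Z x)" for n
  proof -
    have "weak_gradient \<Omega> (\<phi> n) (Dmap (\<phi> n))"
      using Dmap_integrable[OF open_\<Omega> \<phi>(1)] test_map_global_ibp[OF open_\<Omega> \<phi>(1) test_function_mono]
      by (intro weak_gradientI[OF open_\<Omega>] integrable_locally_integrable) auto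
    from weak_gradient_lincomb[OF open_\<Omega> this wz, of 1 "-1"] show ?thesis by simp
  qed
  have m: "(\<lambda>x. Dmap (\<phi> n) x - Z x) \<in> borel_measurable (lebesgue_on \<Omega>)" for n
    using Dmap_integrable(2)[OF open_\<Omega> \<phi>(1)] i(2) by (intro borel_measurable_diff borel_measurable_integrable)
  have eq: "W1_norm 1 \<Omega> (\<lambda>x. \<phi> n x - z x) = enn2ereal ((\<integral>\<^sup>+x. norm (\<phi> n x - z x) \<partial>lebesgue_on \<Omega>) + (\<integral>\<^sup>+x. norm (Dmap (\<phi> n) x - Z x) \<partial>lebesgue_on \<Omega>))" for n
    by (simp add: W1_norm_eq[OF open_\<Omega> wg m] Lp_norm_1 plus_ennreal.rep_eq)
  have "(\<lambda>n. W1_norm 1 \<Omega> (\<lambda>x. \<phi> n x - z x)) \<longlonglongrightarrow> enn2ereal (0 + 0)"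
    unfolding eq by (subst tendsto_enn2ereal_iff) (intro tendsto_add \<phi>)
  then have "(\<lambda>n. W1_norm 1 \<Omega> (\<lambda>x. \<phi> n x - z x)) \<longlonglongrightarrow> 0" by (simp add: zero_ennreal.rep_eq)
  then show ?thesis unfolding W1_0_def using z z1 \<phi>(1) by auto
qed

text \<open>Makes test maps admissible in \<open>quasiconvex\<close>, with their classical gradient
  in the integrand.\<close>

lemma test_map_W1_0_inf:
  assumes \<phi>: "test_map \<Omega> \<phi>"
  shows "\<phi> \<in> W1_0 \<infinity> \<Omega>" and "AE x in lebesgue_on \<Omega>. wgrad \<Omega> \<phi> x = Dmap \<phi> x"
proof -
  note i = Dmap_integrable[OF open_\<Omega> \<phi>]
  have t: "test_function \<Omega> (\<lambda>x. \<phi> x $ k)" for k using \<phi> by (simp add: test_map_def)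
  have W: "W0 \<phi> (Dmap \<phi>)" unfolding W0_def using i \<phi> by (intro conjI exI[of _ "\<lambda>n. \<phi>"]) auto
  have bf: "\<exists>B. \<forall>x. \<bar>f x\<bar> \<le> B" if "test_function \<Omega> f" for f
    using test_function_bounded[OF that] by metis
  have "\<forall>k. \<exists>B. \<forall>x. \<bar>\<phi> x $ k\<bar> \<le> B" using bf[OF t] by simp
  from choice[OF this] obtain B where B: "\<And>k x. \<bar>\<phi> x $ k\<bar> \<le> B k" by auto
  have "norm (\<phi> x) \<le> (\<Sum>k\<in>UNIV. B k)" for x
    using norm_le_l1_cart[of "\<phi> x"] sum_mono[of UNIV "\<lambda>k. \<bar>\<phi> x $ k\<bar>" B] B by fastforce
  then have "\<phi> \<in> Lp \<infinity> \<Omega>" unfolding Lp_inf_iff using i(1) by (auto intro: borel_measurable_integrable)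
  moreover have "Dmap \<phi> \<in> Lp \<infinity> \<Omega>"
  proof -
    have "\<forall>p. \<exists>B. \<forall>x. \<bar>pd (snd p) (\<lambda>y. \<phi> y $ fst p) x\<bar> \<le> B" using bf[OF test_function_pd[OF t]] by simp
    from choice[OF this] obtain B' where B': "\<And>k i x. \<bar>pd i (\<lambda>y. \<phi> y $ k) x\<bar> \<le> B' (k, i)" by auto
    have "norm (Dmap \<phi> x) \<le> (\<Sum>k\<in>UNIV. \<Sum>i\<in>UNIV. B' (k, i))" for x
    proof -
      have "norm (Dmap \<phi> x) \<le> (\<Sum>k\<in>UNIV. norm (Dmap \<phi> x $ k))" unfolding norm_vec_def by (rule L2_set_le_sum) simp
      also have "\<dots> \<le> (\<Sum>k\<in>UNIV. \<Sum>i\<in>UNIV. \<bar>Dmap \<phi> x $ k $ i\<bar>)" by (intro sum_mono norm_le_l1_cart)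
      also have "\<dots> \<le> (\<Sum>k\<in>UNIV. \<Sum>i\<in>UNIV. B' (k, i))" using B' by (intro sum_mono) (simp add: Dmap_def grad_def)
      finally show ?thesis .
    qed
    then show ?thesis unfolding Lp_inf_iff using i(2) by (auto intro: borel_measurable_integrable)
  qed
  ultimately have "\<phi> \<in> W1 \<infinity> \<Omega>" using W0_weak_gradient[OF W] by (intro W1_I)
  then show "\<phi> \<in> W1_0 \<infinity> \<Omega>" using W by (rule W1_0_I)
  show "AE x in lebesgue_on \<Omega>. wgrad \<Omega> \<phi> x = Dmap \<phi> x" by (rule wgrad_AE[OF open_\<Omega> W0_weak_gradient[OF W]])
qed

subsection \<open>Weak convergence from uniform convergence and gradient bounds\<close>

lemma midpoint_close:
  fixes a b w :: "'a::real_normed_vector"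
  assumes "norm (a - w) \<le> e" "norm (b - w) \<le> e"
  shows "norm (((1/2) *\<^sub>R a + (1/2) *\<^sub>R b) - w) \<le> e"
proof -
  have "((1/2) *\<^sub>R a + (1/2) *\<^sub>R b) - w = (1/2) *\<^sub>R (a - w) + (1/2) *\<^sub>R (b - w)"
    by (simp add: algebra_simps flip: scaleR_add_left)
  then show ?thesis
    using norm_triangle_ineq[of "(1/2) *\<^sub>R (a - w)" "(1/2) *\<^sub>R (b - w)"] assms by simp
qed

text \<open>The L^q bound on the gradients and the uniform distance to w are convex conditions, so
  the midpoint hulls inherit them. Mazur's lemma in L^2, hence q \<ge> 2, produces a limit G of the
  gradients, which is the weak gradient of w because the maps converge too. Fatou's lemma puts G in
  L^q, and interpolation with the L^q bound reaches every s < q.\<close>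

lemma mazur_W1:
  fixes v :: "nat \<Rightarrow> real^'n \<Rightarrow> real^'m" and q :: real
  assumes q: "q \<ge> 2" and v: "\<And>n. v n \<in> W1 q \<Omega>" and C: "C \<ge> 0" "\<And>n. (\<integral>\<^sup>+x. norm (wgrad \<Omega> (v n) x) powr q \<partial>lebesgue_on \<Omega>) \<le> ennreal C"
    and w: "w \<in> borel_measurable (lebesgue_on \<Omega>)"
    and \<epsilon>: "decseq \<epsilon>" "\<epsilon> \<longlonglongrightarrow> 0" and close: "\<And>n. AE x in lebesgue_on \<Omega>. norm (v n x - w x) \<le> \<epsilon> n"
  shows "w \<in> W1 q \<Omega> \<and> (\<exists>z Z. (\<forall>n. mid_hull (\<lambda>y Y. \<exists>k\<ge>n. y = v k \<and> Y = wgrad \<Omega> (v k)) (z n) (Z n)) \<and>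
    (\<forall>s. 1 \<le> s \<longrightarrow> s < q \<longrightarrow> (\<lambda>n. \<integral>\<^sup>+x. norm (z n x - w x) powr s \<partial>lebesgue_on \<Omega>) \<longlonglongrightarrow> 0) \<and>
    (\<forall>s. 1 \<le> s \<longrightarrow> s < q \<longrightarrow> (\<lambda>n. \<integral>\<^sup>+x. norm (Z n x - wgrad \<Omega> w x) powr s \<partial>lebesgue_on \<Omega>) \<longlonglongrightarrow> 0) \<and>
    (\<forall>n. weak_gradient \<Omega> (z n) (Z n) \<and> z n \<in> W1 q \<Omega> \<and> Z n \<in> Lp q \<Omega>))"
proof -
  let ?M = "lebesgue_on \<Omega>" and ?S = "\<lambda>n y Y. \<exists>k\<ge>n. y = v k \<and> Y = wgrad \<Omega> (v k)"
  have m: "wgrad \<Omega> (v n) \<in> borel_measurable ?M" for n using W1_E(3)[OF v] by (simp add: Lp_iff)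
  define C2 where "C2 = measure ?M (space ?M) + C"
  have C2: "(\<integral>\<^sup>+x. norm (wgrad \<Omega> (v n) x) powr 2 \<partial>?M) \<le> ennreal C2" for n
  proof -
    have "(\<integral>\<^sup>+x. norm (wgrad \<Omega> (v n) x) powr 2 \<partial>?M) \<le> emeasure ?M (space ?M) + (\<integral>\<^sup>+x. norm (wgrad \<Omega> (v n) x) powr q \<partial>?M)"
      using nn_integral_powr_mix[of 1 2 q "wgrad \<Omega> (v n)" ?M] q m by simp
    also have "\<dots> \<le> ennreal (measure ?M (space ?M)) + ennreal C" using C(2) by (intro add_mono) (simp_all add: emeasure_eq_measure)
    finally show ?thesis using C(1) by (simp add: C2_def)
  qed
  have C20: "C2 \<ge> 0" using C by (simp add: C2_def)
  obtain z Z G where zZ0: "\<forall>n. mid_hull (?S n) (z n) (Z n)" and G: "integrable ?M G"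
    and ZG: "(\<lambda>n. \<integral>\<^sup>+x. norm (Z n x - G x) \<partial>?M) \<longlonglongrightarrow> 0"
    using mazur_midpoints[where y = v and Y = "\<lambda>n. wgrad \<Omega> (v n)", OF m C2 C20] by (elim exE conjE)
  have zZ: "mid_hull (?S n) (z n) (Z n)" for n using zZ0 by (rule spec)
  have inv: "weak_gradient \<Omega> y Y \<and> y \<in> W1 q \<Omega> \<and> Y \<in> Lp q \<Omega> \<and> (\<integral>\<^sup>+x. norm (Y x) powr q \<partial>?M) \<le> ennreal C \<and>
      (AE x in ?M. norm (y x - w x) \<le> \<epsilon> n)" if "mid_hull (?S n) y Y" for n y Y
    using that
  proof (induction rule: mid_hull.induct)
    case (base y Y)
    then obtain k where k: "k \<ge> n" "y = v k" "Y = wgrad \<Omega> (v k)" by auto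
    have "AE x in ?M. norm (v k x - w x) \<le> \<epsilon> n"
      using close[of k] decseqD[OF \<epsilon>(1) k(1)] by (auto elim!: eventually_mono intro: order_trans)
    then show ?case using k W1_E[OF v[of k]] v C(2) by auto
  next
    case (mid y Y y' Y')
    have [measurable]: "Y \<in> borel_measurable ?M" "Y' \<in> borel_measurable ?M" using mid by (auto simp: Lp_iff)
    have "(\<integral>\<^sup>+x. norm ((1/2) *\<^sub>R Y x + (1/2) *\<^sub>R Y' x) powr q \<partial>?M) \<le>
      (\<integral>\<^sup>+x. ennreal (1/2) * ennreal (norm (Y x) powr q) + ennreal (1/2) * ennreal (norm (Y' x) powr q) \<partial>?M)"
    proof (rule nn_integral_mono)
      fix x
      have "norm ((1/2) *\<^sub>R Y x + (1/2) *\<^sub>R Y' x) powr q \<le> (1/2) * norm (Y x) powr q + (1/2) * norm (Y' x) powr q"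
        using norm_mid_powr_le[of q "Y x" "Y' x"] q by simp
      then show "ennreal (norm ((1/2) *\<^sub>R Y x + (1/2) *\<^sub>R Y' x) powr q) \<le> ennreal (1/2) * ennreal (norm (Y x) powr q) + ennreal (1/2) * ennreal (norm (Y' x) powr q)"
        by (subst ennreal_mult[symmetric], simp, simp, subst ennreal_mult[symmetric], simp, simp, subst ennreal_plus[symmetric], simp, simp, rule ennreal_leI)
    qed
    also have "\<dots> = ennreal (1/2) * (\<integral>\<^sup>+x. norm (Y x) powr q \<partial>?M) + ennreal (1/2) * (\<integral>\<^sup>+x. norm (Y' x) powr q \<partial>?M)"
      by (subst nn_integral_add, simp, simp, subst nn_integral_cmult, simp, subst nn_integral_cmult, simp, rule refl)
    also have "\<dots> \<le> ennreal (1/2) * ennreal C + ennreal (1/2) * ennreal C"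
      using mid by (intro add_mono mult_left_mono) auto
    also have "\<dots> = ennreal C" by (rule ennreal_half_add[OF C(1)])
    finally have b: "(\<integral>\<^sup>+x. norm ((1/2) *\<^sub>R Y x + (1/2) *\<^sub>R Y' x) powr q \<partial>?M) \<le> ennreal C" .
    have c: "AE x in ?M. norm (((1/2) *\<^sub>R y x + (1/2) *\<^sub>R y' x) - w x) \<le> \<epsilon> n"
      using mid.IH(1)[THEN conjunct2, THEN conjunct2, THEN conjunct2, THEN conjunct2]
        mid.IH(2)[THEN conjunct2, THEN conjunct2, THEN conjunct2, THEN conjunct2]
      by eventually_elim (rule midpoint_close)
    show ?case
      using weak_gradient_lincomb[OF open_\<Omega>, of y Y y' Y' "1/2" "1/2"] W1_lincomb[of y q y' "1/2" "1/2"] Lp_lincomb[of Y q \<Omega> Y' "1/2" "1/2"]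
        mid.IH b c q by auto
  qed
  have zi: "integrable ?M (z n)" "integrable ?M (Z n)" for n
    using inv[OF zZ[of n]] W1_integrable(1)[of "z n" q] Lp_integrable[of "Z n" q] q by auto
  have w1: "integrable ?M w"
  proof -
    have "integrable ?M (\<lambda>x. z 0 x - w x)"
      using inv[OF zZ[of 0]] zi(1)[of 0] w by (intro integrable_const_bound[of _ "\<epsilon> 0"]) (auto intro: borel_measurable_integrable)
    from Bochner_Integration.integrable_diff[OF zi(1)[of 0] this] show ?thesis by simp
  qed
  have zw: "(\<lambda>n. \<integral>\<^sup>+x. norm (z n x - w x) powr s \<partial>?M) \<longlonglongrightarrow> 0" if s: "s \<ge> 1" for s
  proof -
    have "(\<lambda>n. \<epsilon> n powr s) \<longlonglongrightarrow> 0 powr s"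
      using \<epsilon>(2) s decseq_ge[OF \<epsilon>] by (intro tendsto_powr'[OF _ tendsto_const]) auto
    then have "(\<lambda>n. ennreal (\<epsilon> n powr s)) \<longlonglongrightarrow> ennreal 0" using s by (intro tendsto_ennrealI) simp
    then have "(\<lambda>n. ennreal (\<epsilon> n powr s) * emeasure ?M (space ?M)) \<longlonglongrightarrow> ennreal 0 * emeasure ?M (space ?M)"
      by (intro tendsto_mult_ennreal tendsto_const) auto
    then have l: "(\<lambda>n. ennreal (\<epsilon> n powr s) * emeasure ?M (space ?M)) \<longlonglongrightarrow> 0" by simp
    show ?thesis
    proof (rule tendsto_sandwich[OF _ _ tendsto_const l])
      have "(\<integral>\<^sup>+x. norm (z n x - w x) powr s \<partial>?M) \<le> ennreal (\<epsilon> n powr s) * emeasure ?M (space ?M)" for n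
      proof -
        have "AE x in ?M. norm (z n x - w x) \<le> \<epsilon> n" using inv[OF zZ[of n]] by blast
        then have "(\<integral>\<^sup>+x. norm (z n x - w x) powr s \<partial>?M) \<le> (\<integral>\<^sup>+x. ennreal (\<epsilon> n powr s) \<partial>?M)"
          using s by (intro nn_integral_mono_AE) (auto elim!: eventually_mono intro!: ennreal_leI powr_mono2)
        then show ?thesis by simp
      qed
      then show "\<forall>\<^sub>F n in sequentially. (\<integral>\<^sup>+x. norm (z n x - w x) powr s \<partial>?M) \<le> ennreal (\<epsilon> n powr s) * emeasure ?M (space ?M)"
        by (intro always_eventually allI)
    qed auto
  qed
  have zw1: "(\<lambda>n. \<integral>\<^sup>+x. norm (z n x - w x) \<partial>?M) \<longlonglongrightarrow> 0" using zw[of 1] by simp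
  have wG: "weak_gradient \<Omega> w G"
    using inv[OF zZ] by (intro weak_gradient_limit[OF zi(1) w1 zi(2) G zw1 ZG]) auto
  have wq: "w \<in> Lp q \<Omega>"
  proof -
    have "(\<lambda>x. z 0 x - w x) \<in> Lp \<infinity> \<Omega>" unfolding Lp_inf_iff
      using inv[OF zZ[of 0]] zi(1)[of 0] w by (auto intro!: exI[of _ "\<epsilon> 0"] borel_measurable_diff borel_measurable_integrable)
    then have d: "(\<lambda>x. z 0 x - w x) \<in> Lp q \<Omega>" using q by (intro Lp_inf_mono) auto
    have "z 0 \<in> Lp q \<Omega>" using W1_E(1) inv[OF zZ[of 0]] by blast
    from Lp_lincomb[OF this d, of 1 "-1"] q show ?thesis by simp
  qed
  have Gm [measurable]: "G \<in> borel_measurable ?M" using G by (rule borel_measurable_integrable)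
  have Zm [measurable]: "Z n \<in> borel_measurable ?M" for n using zi(2) by (rule borel_measurable_integrable)
  have Gq: "(\<integral>\<^sup>+x. norm (G x) powr q \<partial>?M) \<le> ennreal C"
  proof -
    have "(\<lambda>n. ennreal (LINT x|?M. norm (Z n x - G x))) \<longlonglongrightarrow> ennreal 0"
      using ZG nn_integral_eq_integral[OF integrable_norm[OF Bochner_Integration.integrable_diff[OF zi(2) G]]] by simp
    then have "(\<lambda>n. LINT x|?M. norm (Z n x - G x)) \<longlonglongrightarrow> 0" by (subst (asm) tendsto_ennreal_iff) auto
    from tendsto_L1_AE_subseq[OF Bochner_Integration.integrable_diff[OF zi(2) G] this]
    obtain r where r: "strict_mono r" "AE x in ?M. (\<lambda>n. Z (r n) x - G x) \<longlonglongrightarrow> 0" by auto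
    have "(\<integral>\<^sup>+x. norm (G x) powr q \<partial>?M) \<le> (\<integral>\<^sup>+x. liminf (\<lambda>n. ennreal (norm (Z (r n) x) powr q)) \<partial>?M)"
    proof (rule nn_integral_mono_AE)
      show "AE x in ?M. ennreal (norm (G x) powr q) \<le> liminf (\<lambda>n. ennreal (norm (Z (r n) x) powr q))"
        using r(2)
      proof eventually_elim
        case (elim x)
        have "(\<lambda>n. Z (r n) x) \<longlonglongrightarrow> G x" using elim by (rule Lim_null[THEN iffD2])
        then have "(\<lambda>n. ennreal (norm (Z (r n) x) powr q)) \<longlonglongrightarrow> ennreal (norm (G x) powr q)"
          using q by (intro tendsto_ennrealI tendsto_powr'[OF tendsto_norm tendsto_const]) auto
        from lim_imp_Liminf[OF _ this] show ?case by simp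
      qed
    qed
    also have "\<dots> \<le> liminf (\<lambda>n. \<integral>\<^sup>+x. norm (Z (r n) x) powr q \<partial>?M)" by (rule nn_integral_liminf) simp
    also have "\<dots> \<le> ennreal C"
      using inv[OF zZ] by (intro order_trans[OF Liminf_le_Limsup Limsup_bounded] always_eventually allI) auto
    finally show ?thesis .
  qed
  have wW: "w \<in> W1 q \<Omega>" by (rule W1_I[OF wq wG]) (use le_less_trans[OF Gq ennreal_less_top] in \<open>simp add: Lp_iff\<close>)
  have GAE: "AE x in ?M. wgrad \<Omega> w x = G x" by (rule wgrad_AE[OF open_\<Omega> wG])
  have Zw: "(\<lambda>n. \<integral>\<^sup>+x. norm (Z n x - wgrad \<Omega> w x) powr s \<partial>?M) \<longlonglongrightarrow> 0" if s: "1 \<le> s" "s < q" for s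
  proof -
    have "(\<integral>\<^sup>+x. norm (Z n x - G x) powr q \<partial>?M) \<le> ennreal (2 powr q * (C + C))" for n
    proof -
      have "(\<integral>\<^sup>+x. norm (Z n x - G x) powr q \<partial>?M) \<le> (\<integral>\<^sup>+x. ennreal (2 powr q) * (ennreal (norm (Z n x) powr q) + ennreal (norm (G x) powr q)) \<partial>?M)"
      proof (rule nn_integral_mono)
        fix x
        have "norm (Z n x - G x) powr q \<le> (norm (Z n x) + norm (G x)) powr q"
          using q by (intro powr_mono2 norm_triangle_ineq4) auto
        also have "\<dots> \<le> 2 powr q * (norm (Z n x) powr q + norm (G x) powr q)" using q by (intro powr_add_le) auto
        finally show "ennreal (norm (Z n x - G x) powr q) \<le> ennreal (2 powr q) * (ennreal (norm (Z n x) powr q) + ennreal (norm (G x) powr q))"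
          by (simp add: ennreal_mult[symmetric] ennreal_plus[symmetric] ennreal_leI del: ennreal_plus)
      qed
      also have "\<dots> = ennreal (2 powr q) * ((\<integral>\<^sup>+x. norm (Z n x) powr q \<partial>?M) + (\<integral>\<^sup>+x. norm (G x) powr q \<partial>?M))"
        by (subst nn_integral_cmult, simp, subst nn_integral_add, simp, simp, rule refl)
      also have "\<dots> \<le> ennreal (2 powr q) * (ennreal C + ennreal C)"
        using inv[OF zZ[of n]] Gq by (intro mult_left_mono add_mono) auto
      also have "\<dots> = ennreal (2 powr q * (C + C))"
        by (simp only: ennreal_mult[OF powr_ge_zero add_nonneg_nonneg[OF C(1) C(1)]] ennreal_plus[OF C(1) C(1)])
      finally show ?thesis .
    qed
    then have "(\<lambda>n. \<integral>\<^sup>+x. norm (Z n x - G x) powr s \<partial>?M) \<longlonglongrightarrow> 0"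
      using C(1) s by (intro L1_Lq_imp_Lr[OF _ ZG, of q "2 powr q * (C + C)"]) auto
    also have "(\<lambda>n. \<integral>\<^sup>+x. norm (Z n x - G x) powr s \<partial>?M) = (\<lambda>n. \<integral>\<^sup>+x. norm (Z n x - wgrad \<Omega> w x) powr s \<partial>?M)"
      using GAE by (intro ext nn_integral_cong_AE) (auto elim: eventually_mono)
    finally show ?thesis .
  qed
  show ?thesis
    using zZ wW zw Zw inv[OF zZ] by (intro conjI exI[of _ z] exI[of _ Z] allI impI) auto
qed

text \<open>If L (v n) does not tend to L w, then along a subsequence and for one sign
  \<open>\<sigma>\<close> the condition \<open>\<sigma> * (L y - L w) \<ge> e\<close> holds. It is
  affine in y, so it passes to the midpoint hulls, some elements of which converge to w in W^{1,s}
  by \<open>mazur_W1\<close>; this contradicts the boundedness of L.\<close>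

lemma W1_weak_convI:
  fixes v :: "nat \<Rightarrow> real^'n \<Rightarrow> real^'m" and q s :: real
  assumes q: "q \<ge> 2" and v: "\<And>n. v n \<in> W1 q \<Omega>" and C: "C \<ge> 0" "\<And>n. (\<integral>\<^sup>+x. norm (wgrad \<Omega> (v n) x) powr q \<partial>lebesgue_on \<Omega>) \<le> ennreal C"
    and w: "w \<in> borel_measurable (lebesgue_on \<Omega>)"
    and \<epsilon>: "decseq \<epsilon>" "\<epsilon> \<longlonglongrightarrow> 0" and close: "\<And>n. AE x in lebesgue_on \<Omega>. norm (v n x - w x) \<le> \<epsilon> n"
    and s: "1 \<le> s" "s < q"
  shows "W1_weak_conv s \<Omega> v w"
proof -
  let ?M = "lebesgue_on \<Omega>"
  have wW: "w \<in> W1 q \<Omega>" using mazur_W1[OF q v C w \<epsilon> close] by (rule conjunct1)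
  have ws: "w \<in> W1 s \<Omega>" using W1_mono[OF wW] s by auto
  have vs: "v n \<in> W1 s \<Omega>" for n using W1_mono[OF v] s by auto
  have "(\<lambda>n. L (v n)) \<longlonglongrightarrow> L w" if L: "W1_dual s \<Omega> L" for L
  proof (rule ccontr)
    have add: "L (\<lambda>x. y x + y' x) = L y + L y'" if "y \<in> W1 s \<Omega>" "y' \<in> W1 s \<Omega>" for y y'
      using L that by (simp add: W1_dual_def)
    have scale: "L (\<lambda>x. c *\<^sub>R y x) = c * L y" if "y \<in> W1 s \<Omega>" for y c
      using L that by (simp add: W1_dual_def)
    have sc: "(\<lambda>x. c *\<^sub>R y x) \<in> W1 s \<Omega>" if "y \<in> W1 s \<Omega>" for y :: "real^'n \<Rightarrow> real^'m" and c
      using W1_lincomb[OF that that, of c 0] s by simp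
    have lc: "L (\<lambda>x. a *\<^sub>R y x + b *\<^sub>R y' x) = a * L y + b * L y'" if "y \<in> W1 s \<Omega>" "y' \<in> W1 s \<Omega>" for a b y y'
      using add[OF sc[OF that(1), of a] sc[OF that(2), of b]] scale that by simp
    obtain K where "\<forall>y\<in>W1 s \<Omega>. ereal \<bar>L y\<bar> \<le> ereal K * W1_norm s \<Omega> y"
      using L unfolding W1_dual_def by (elim conjE exE)
    then have K: "ereal \<bar>L y\<bar> \<le> ereal K * W1_norm s \<Omega> y" if "y \<in> W1 s \<Omega>" for y using that by (rule bspec)
    assume "\<not> (\<lambda>n. L (v n)) \<longlonglongrightarrow> L w"
    then obtain e where e: "e > 0" and fr: "\<exists>\<^sub>F n in sequentially. \<not> dist (L (v n)) (L w) < e"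
      by (auto simp: tendsto_iff frequently_def)
    have "\<exists>\<sigma>::real. \<bar>\<sigma>\<bar> = 1 \<and> (\<exists>\<^sub>F n in sequentially. \<sigma> * (L (v n) - L w) \<ge> e)"
    proof -
      have "\<exists>\<^sub>F n in sequentially. 1 * (L (v n) - L w) \<ge> e \<or> (-1) * (L (v n) - L w) \<ge> e"
        using fr by (rule frequently_elim1) (auto simp: dist_real_def)
      then consider "\<exists>\<^sub>F n in sequentially. 1 * (L (v n) - L w) \<ge> e" | "\<exists>\<^sub>F n in sequentially. (-1) * (L (v n) - L w) \<ge> e"
        unfolding frequently_disj_iff by blast
      then show ?thesis by cases (rule exI[of _ 1], simp, rule exI[of _ "-1"], simp)
    qed
    then obtain \<sigma> :: real where \<sigma>: "\<bar>\<sigma>\<bar> = 1" "\<exists>\<^sub>F n in sequentially. \<sigma> * (L (v n) - L w) \<ge> e" by auto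
    from \<sigma>(2) have "infinite {n. \<sigma> * (L (v n) - L w) \<ge> e}"
      by (simp add: frequently_cofinite[symmetric] cofinite_eq_sequentially)
    from infinite_enumerate[OF this] obtain r :: "nat \<Rightarrow> nat" where r: "strict_mono r" "\<And>n. \<sigma> * (L (v (r n)) - L w) \<ge> e" by auto
    have \<epsilon>r: "decseq (\<lambda>n. \<epsilon> (r n))" "(\<lambda>n. \<epsilon> (r n)) \<longlonglongrightarrow> 0"
      using \<epsilon> r(1) LIMSEQ_subseq_LIMSEQ[OF \<epsilon>(2) r(1)]
      by (auto simp: decseq_def strict_mono_less_eq o_def)
    have vr: "\<And>n. v (r n) \<in> W1 q \<Omega>" "\<And>n. (\<integral>\<^sup>+x. norm (wgrad \<Omega> (v (r n)) x) powr q \<partial>lebesgue_on \<Omega>) \<le> ennreal C"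
      "\<And>n. AE x in lebesgue_on \<Omega>. norm (v (r n) x - w x) \<le> \<epsilon> (r n)" using v C(2) close by auto
    from mazur_W1[where v = "\<lambda>n. v (r n)", OF q vr(1) C(1) vr(2) w \<epsilon>r vr(3), THEN conjunct2]
    obtain z Z where zZ: "\<forall>n. mid_hull (\<lambda>y Y. \<exists>k\<ge>n. y = v (r k) \<and> Y = wgrad \<Omega> (v (r k))) (z n) (Z n)"
      and l: "\<forall>s. 1 \<le> s \<longrightarrow> s < q \<longrightarrow> (\<lambda>n. \<integral>\<^sup>+x. norm (z n x - w x) powr s \<partial>?M) \<longlonglongrightarrow> 0"
        "\<forall>s. 1 \<le> s \<longrightarrow> s < q \<longrightarrow> (\<lambda>n. \<integral>\<^sup>+x. norm (Z n x - wgrad \<Omega> w x) powr s \<partial>?M) \<longlonglongrightarrow> 0"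
      and zzz: "\<forall>n. weak_gradient \<Omega> (z n) (Z n) \<and> z n \<in> W1 q \<Omega> \<and> Z n \<in> Lp q \<Omega>"
      by (elim exE conjE)
    note zz = zzz[rule_format, THEN conjunct1] zzz[rule_format, THEN conjunct2, THEN conjunct1] zzz[rule_format, THEN conjunct2, THEN conjunct2]
    have zs: "z n \<in> W1 s \<Omega>" for n using W1_mono[OF zz(2)] s by auto
    have Lz: "\<sigma> * (L (z n) - L w) \<ge> e" for n
    proof -
      have "y \<in> W1 s \<Omega> \<and> \<sigma> * (L y - L w) \<ge> e"
        if "mid_hull (\<lambda>y Y. \<exists>k\<ge>n. y = v (r k) \<and> Y = wgrad \<Omega> (v (r k))) y Y" for y Y
        using that
      proof (induction rule: mid_hull.induct)
        case (base y Y)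
        then show ?case using vs r(2) by auto
      next
        case (mid y Y y' Y')
        have "\<sigma> * ((1/2 * L y + 1/2 * L y') - L w) = 1/2 * (\<sigma> * (L y - L w)) + 1/2 * (\<sigma> * (L y' - L w))"
          by (simp add: algebra_simps)
        then show ?case using mid.IH W1_lincomb[of y s y' "1/2" "1/2"] lc[of y y' "1/2" "1/2"] s by auto
      qed
      from this[OF zZ[rule_format, of n]] show ?thesis by simp
    qed
    define d where "d = (\<lambda>n x. z n x - w x)"
    have dW: "d n \<in> W1 s \<Omega>" for n unfolding d_def using W1_lincomb[OF zs[of n] ws, of 1 "-1"] s by simp
    have dwg: "weak_gradient \<Omega> (d n) (\<lambda>x. Z n x - wgrad \<Omega> w x)" for n
      using weak_gradient_lincomb[OF open_\<Omega> zz(1)[of n] W1_E(2)[OF ws], of 1 "-1"] by (simp add: d_def)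
    have dm: "(\<lambda>x. Z n x - wgrad \<Omega> w x) \<in> borel_measurable ?M" for n
      using zz(3)[of n] W1_E(3)[OF ws] by (auto simp: Lp_iff)
    \<comment> \<open>The constant K may be negative, hence the absolute value; the factor 2 makes
      the final inequality strict.\<close>
    define \<delta> where "\<delta> = e / (2 * (\<bar>K\<bar> + 1))"
    have \<delta>: "\<delta> > 0" using e by (simp add: \<delta>_def)
    obtain n where n: "W1_norm s \<Omega> (d n) \<le> ereal \<delta>"
      using W1_norm_tendsto[of d, OF dwg dm _ _ _ \<delta>, of s] l[rule_format, OF s] s by (auto simp: d_def)
    have Ld: "L (d n) = L (z n) - L w" unfolding d_def using lc[OF zs[of n] ws, of 1 "-1"] by simp
    have "e \<le> \<bar>L (d n)\<bar>" using Lz[of n] \<sigma>(1) abs_ge_self[of "\<sigma> * (L (z n) - L w)"] unfolding Ld by (simp add: abs_mult)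
    moreover have "ereal \<bar>L (d n)\<bar> \<le> ereal (\<bar>K\<bar> * \<delta>)"
    proof -
      have "0 \<le> W1_norm s \<Omega> (d n)" unfolding W1_norm_def by (intro add_nonneg_nonneg Lp_norm_nonneg) auto
      have "ereal \<bar>L (d n)\<bar> \<le> ereal K * W1_norm s \<Omega> (d n)" using K[OF dW] .
      also have "\<dots> \<le> ereal \<bar>K\<bar> * W1_norm s \<Omega> (d n)"
        using \<open>0 \<le> W1_norm s \<Omega> (d n)\<close> by (intro ereal_mult_right_mono) auto
      also have "\<dots> \<le> ereal \<bar>K\<bar> * ereal \<delta>" using n by (intro ereal_mult_left_mono) auto
      finally show ?thesis by simp
    qed
    moreover have "\<bar>K\<bar> * \<delta> < e"
    proof -
      have "\<bar>K\<bar> * \<delta> \<le> (\<bar>K\<bar> + 1) * \<delta>" using \<delta> by (intro mult_right_mono) auto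
      also have "\<dots> = e / 2"
      proof -
        have "X * (e / (2 * X)) = e / 2" if "X > 0" for X :: real using that by simp
        moreover have "\<bar>K\<bar> + 1 > 0" by simp
        ultimately show ?thesis unfolding \<delta>_def by blast
      qed
      also have "\<dots> < e" using e by simp
      finally show ?thesis .
    qed
    ultimately show False by simp
  qed
  then show ?thesis unfolding W1_weak_conv_def using vs ws by auto
qed

end

section \<open>Quasiconvexity and the pointwise constraint in the limit\<close>

subsection \<open>A domain filled by a given set up to a small proportion\<close>

text \<open>Takes the place of a density point. Choose a compact F in E of positive measure and an
  open U in \<Omega> around it whose excess over F is below \<open>\<kappa>\<close> times the
  measure of F. If every component of U exceeded the proportion \<open>\<kappa>\<close>, summing
  over the countably many components would contradict this. A component is connected, as
  \<open>quasiconvex\<close> demands of D.\<close>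

lemma dense_component:
  fixes E \<Omega> :: "(real^'n) set"
  assumes \<Omega>: "open \<Omega>" "bounded \<Omega>" and E: "E \<in> sets lebesgue" "E \<subseteq> \<Omega>" "emeasure lebesgue E > 0" and \<kappa>: "\<kappa> > 0"
  shows "\<exists>D K. open D \<and> connected D \<and> D \<noteq> {} \<and> D \<subseteq> \<Omega> \<and> compact K \<and> K \<subseteq> D \<and> K \<subseteq> E \<and>
    emeasure lborel (D - K) \<le> ennreal \<kappa> * emeasure lborel D"
proof -
  have "bounded E" using \<Omega>(2) E(2) by (rule bounded_subset)
  have Efin: "emeasure lebesgue E < \<infinity>"
    using emeasure_mono[OF E(2), of lebesgue] emeasure_bounded_finite[OF \<Omega>(2)] \<Omega>(1) by (simp add: le_less_trans)
  define m where "m = measure lebesgue E"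
  have mE: "emeasure lebesgue E = ennreal m" using Efin by (simp add: m_def emeasure_eq_ennreal_measure less_top)
  have m0: "m > 0" using E(3) mE by simp
  obtain F where F: "closed F" "F \<subseteq> E" "emeasure lebesgue (E - F) < ennreal m"
    by (rule sets_lebesgue_inner_closed[OF E(1) m0])
  have cF: "compact F" using F(1) bounded_subset[OF \<open>bounded E\<close> F(2)] by (simp add: compact_eq_bounded_closed)
  have [measurable]: "F \<in> sets borel" using F(1) by simp
  have F0: "emeasure lborel F > 0"
  proof (rule ccontr)
    assume "\<not> emeasure lborel F > 0"
    then have "emeasure lebesgue F = 0" by simp
    moreover have "emeasure lebesgue E \<le> emeasure lebesgue (E - F) + emeasure lebesgue F"
      using F(2) E(1) emeasure_subadditive[of "E - F" lebesgue F] by (simp add: Un_absorb2)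
    ultimately show False using F(3) mE by simp
  qed
  have Ffin: "emeasure lborel F < \<infinity>" by (rule emeasure_compact_finite[OF cF])
  define \<mu> where "\<mu> = measure lborel F"
  have \<mu>: "emeasure lborel F = ennreal \<mu>" "\<mu> > 0"
    using Ffin F0 by (auto simp: \<mu>_def emeasure_eq_ennreal_measure less_top)
  obtain U0 where U0: "open U0" "F \<subseteq> U0" "emeasure lborel (U0 - F) < ennreal (\<kappa> * \<mu>)"
    using outer_regular_lborel[of F "\<kappa> * \<mu>"] \<kappa> \<mu>(2) by auto
  define U where "U = U0 \<inter> \<Omega>"
  have U: "open U" "F \<subseteq> U" "U \<subseteq> \<Omega>" using U0 \<Omega>(1) F(2) E(2) by (auto simp: U_def)
  have Um: "emeasure lborel (U - F) < ennreal (\<kappa> * \<mu>)"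
  proof -
    have "emeasure lborel (U - F) \<le> emeasure lborel (U0 - F)" using U0(1) \<Omega>(1) by (intro emeasure_mono) (auto simp: U_def)
    then show ?thesis using U0(3) by (rule le_less_trans)
  qed
  let ?C = "components U"
  have op: "open D" if "D \<in> ?C" for D using that U(1) open_components by blast
  have [measurable]: "D \<in> sets borel" if "D \<in> ?C" for D using op[OF that] by simp
  have disj: "pairwise disjnt ?C" by (rule pairwise_disjoint_components[unfolded disjnt_def[symmetric]])
  have cnt: "countable ?C" by (rule countable_disjoint_open_subsets[OF op disj])
  have UC: "U = (\<Union>D\<in>?C. D)" using Union_components[of U] by simp
  have df: "disjoint_family_on (\<lambda>D. D) ?C" "disjoint_family_on (\<lambda>D. D - F) ?C"
    using disj by (auto simp: disjoint_family_on_def pairwise_def disjnt_def)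
  have e1: "emeasure lborel U = (\<integral>\<^sup>+D. emeasure lborel D \<partial>count_space ?C)"
    by (subst UC) (rule emeasure_UN_countable[OF _ cnt df(1)], simp)
  have e2: "emeasure lborel (U - F) = (\<integral>\<^sup>+D. emeasure lborel (D - F) \<partial>count_space ?C)"
  proof -
    have "U - F = (\<Union>D\<in>?C. D - F)" using UC by auto
    then show ?thesis by (simp only:) (rule emeasure_UN_countable[OF _ cnt df(2)], simp)
  qed
  have "\<exists>D\<in>?C. emeasure lborel (D - F) \<le> ennreal \<kappa> * emeasure lborel D"
  proof (rule ccontr)
    assume "\<not> ?thesis"
    then have "ennreal \<kappa> * emeasure lborel D \<le> emeasure lborel (D - F)" if "D \<in> ?C" for D using that by (auto simp: not_le intro: less_imp_le)
    then have "(\<integral>\<^sup>+D. ennreal \<kappa> * emeasure lborel D \<partial>count_space ?C) \<le> emeasure lborel (U - F)"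
      unfolding e2 by (intro nn_integral_mono) simp
    also have "\<dots> < ennreal \<kappa> * ennreal \<mu>" using Um \<kappa> \<mu>(2) by (simp add: ennreal_mult)
    also have "\<dots> \<le> ennreal \<kappa> * emeasure lborel U"
      unfolding \<mu>(1)[symmetric] using U by (intro mult_left_mono emeasure_mono) auto
    also have "\<dots> = (\<integral>\<^sup>+D. ennreal \<kappa> * emeasure lborel D \<partial>count_space ?C)" unfolding e1 by (simp add: nn_integral_cmult)
    finally show False by simp
  qed
  then obtain D where D: "D \<in> ?C" "emeasure lborel (D - F) \<le> ennreal \<kappa> * emeasure lborel D" by auto
  have oD: "open (\<Union>(?C - {D}))" using op by (intro open_Union) auto
  \<comment> \<open>The other components form an open set; removing it from the compact F leaves the
    part in D, which is therefore compact.\<close>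
  have "F \<inter> D = F - \<Union>(?C - {D})"
  proof (rule set_eqI)
    fix x
    have "D \<inter> D' = {}" if "D' \<in> ?C - {D}" for D'
      using pairwiseD[OF disj D(1), of D'] that by (auto simp: disjnt_def)
    moreover have "\<exists>D'\<in>?C. x \<in> D'" if "x \<in> F"
    proof -
      have "x \<in> \<Union>?C" using subsetD[OF U(2) that] unfolding Union_components .
      then show ?thesis by (simp only: Union_iff)
    qed
    ultimately show "x \<in> F \<inter> D \<longleftrightarrow> x \<in> F - \<Union>(?C - {D})" by blast
  qed
  then have "compact (F \<inter> D)" using compact_diff[OF cF oD] by simp
  moreover have "D - F \<inter> D = D - F" by auto
  moreover have "D \<noteq> {}" "connected D" "D \<subseteq> U"
    using in_components_nonempty[OF D(1)] in_components_connected[OF D(1)] in_components_subset[OF D(1)] by simp_all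
  ultimately show ?thesis using D op[OF D(1)] U F(2) by (intro exI[of _ D] exI[of _ "F \<inter> D"] conjI) auto
qed

lemma AE_positive_part:
  assumes ae: "AE x in M. \<exists>i\<in>I. P i x" and I: "countable I" and pos: "emeasure M A > 0" "A \<in> sets M"
    and P: "\<And>i. i \<in> I \<Longrightarrow> {x\<in>A. P i x} \<in> sets M"
  shows "\<exists>i\<in>I. emeasure M {x\<in>A. P i x} > 0"
proof (rule ccontr)
  assume "\<not> ?thesis"
  then have "{x\<in>A. P i x} \<in> null_sets M" if "i \<in> I" for i using that P by (auto simp: null_sets_def)
  then have "(\<Union>i\<in>I. {x\<in>A. P i x}) \<in> null_sets M" by (intro null_sets_UN' I)
  then have "AE x in M. x \<notin> (\<Union>i\<in>I. {x\<in>A. P i x})" by (rule AE_not_in)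
  with ae have "AE x in M. x \<notin> A" by eventually_elim auto
  then have "emeasure M A = 0" using pos(2) by (subst (asm) AE_iff_measurable[OF pos(2)]) (use sets.sets_into_space in auto)
  then show False using pos by simp
qed

subsection \<open>Caratheodory integrands with growth conditions\<close>

locale growth_integrand = bounded_open \<Omega> for \<Omega> :: "(real^'n) set" +
  fixes T :: "real^'n \<Rightarrow> real^'n^'m \<Rightarrow> real" and r \<alpha> \<beta> :: real
  assumes T_nonneg: "\<And>x \<xi>. x \<in> \<Omega> \<Longrightarrow> 0 \<le> T x \<xi>"
    and carath: "caratheodory_function \<Omega> T"
    and r1: "r \<ge> 1" and \<alpha>: "0 < \<alpha>"
    and growth: "AE x in lebesgue_on \<Omega>. \<forall>\<xi>. \<alpha> * (1 + norm \<xi> powr r) \<le> T x \<xi> \<and> T x \<xi> \<le> \<beta> * (1 + norm \<xi> powr r)"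
begin

text \<open>Along a simple function, T is a finite sum of measurable slices times indicators.
  Continuity in the second variable carries this to the limit almost everywhere, which suffices for
  a complete measure.\<close>

lemma T_measurable:
  assumes G: "G \<in> borel_measurable (lebesgue_on \<Omega>)"
  shows "(\<lambda>x. T x (G x)) \<in> borel_measurable (lebesgue_on \<Omega>)"
proof -
  let ?M = "lebesgue_on \<Omega>"
  have T[measurable]: "(\<lambda>x. T x \<xi>) \<in> borel_measurable ?M" for \<xi> using carath by (simp add: caratheodory_function_def)
  obtain F where F: "\<And>i. simple_function ?M (F i)" "\<And>x. x \<in> space ?M \<Longrightarrow> (\<lambda>i. F i x) \<longlonglongrightarrow> G x"
    using borel_measurable_implies_sequence_metric[OF G, of 0] by metis
  have m: "(\<lambda>x. T x (F i x)) \<in> borel_measurable ?M" for i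
  proof -
    have fin: "finite (F i ` space ?M)" using F(1)[of i] by (simp add: simple_function_def)
    have s: "F i -` {y} \<inter> space ?M \<in> sets ?M" if "y \<in> F i ` space ?M" for y
      using F(1)[of i] that unfolding simple_function_def by blast
    have "(\<lambda>x. \<Sum>y\<in>F i ` space ?M. indicator (F i -` {y} \<inter> space ?M) x * T x y) \<in> borel_measurable ?M"
      using s by (intro borel_measurable_sum borel_measurable_times T borel_measurable_indicator)
    also have "?this \<longleftrightarrow> ?thesis"
    proof (rule measurable_cong)
      fix x assume x: "x \<in> space ?M"
      have "(\<Sum>y\<in>F i ` space ?M. indicator (F i -` {y} \<inter> space ?M) x * T x y) = (\<Sum>y\<in>F i ` space ?M. if y = F i x then T x y else 0)"
        using x by (intro sum.cong) (auto simp: indicator_def)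
      also have "\<dots> = T x (F i x)" using x fin by simp
      finally show "(\<Sum>y\<in>F i ` space ?M. indicator (F i -` {y} \<inter> space ?M) x * T x y) = T x (F i x)" .
    qed
    finally show ?thesis .
  qed
  have l: "(\<lambda>x. lim (\<lambda>i. T x (F i x))) \<in> borel_measurable ?M" by (rule borel_measurable_lim_metric[OF m])
  have "AE x in ?M. continuous_on UNIV (T x)" using carath by (simp add: caratheodory_function_def)
  then have "AE x in ?M. lim (\<lambda>i. T x (F i x)) = T x (G x)"
    using AE_space
  proof eventually_elim
    case (elim x)
    then have "isCont (T x) (G x)" by (simp add: continuous_on_eq_continuous_at)
    then have "(\<lambda>i. T x (F i x)) \<longlonglongrightarrow> T x (G x)" using F(2)[OF elim(2)] by (rule isCont_tendsto_compose)
    then show ?case by (rule limI)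
  qed
  then show ?thesis by (rule lebesgue_on_AE_measurable[OF open_\<Omega> l])
qed

text \<open>The radius beyond which the coercivity of \<^term>\<open>T\<close> forces \<^term>\<open>T x \<xi> > 2\<close>.\<close>

definition radius :: real where "radius = 1 + 2 / \<alpha>"

lemma radius_ge_1: "radius \<ge> 1" using \<alpha> by (simp add: radius_def)

lemma coercive:
  assumes g: "\<forall>\<xi>. \<alpha> * (1 + norm \<xi> powr r) \<le> T x \<xi> \<and> T x \<xi> \<le> \<beta> * (1 + norm \<xi> powr r)"
  shows "norm \<xi> powr r \<le> T x \<xi> / \<alpha>" and "T x \<xi> \<le> 2 \<Longrightarrow> norm \<xi> \<le> radius"
proof -
  have "\<alpha> * norm \<xi> powr r \<le> \<alpha> * (1 + norm \<xi> powr r)" using \<alpha> by simp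
  also have "\<dots> \<le> T x \<xi>" using g by blast
  finally show 1: "norm \<xi> powr r \<le> T x \<xi> / \<alpha>" using \<alpha> by (simp add: pos_le_divide_eq mult.commute)
  show "norm \<xi> \<le> radius" if "T x \<xi> \<le> 2"
  proof (cases "norm \<xi> \<le> 1")
    case True then show ?thesis using radius_ge_1 by linarith
  next
    case False
    then have "norm \<xi> powr 1 \<le> norm \<xi> powr r" using r1 by (intro powr_mono) auto
    moreover have "norm \<xi> powr 1 = norm \<xi>" by simp
    moreover have "T x \<xi> / \<alpha> \<le> 2 / \<alpha>" using that \<alpha> by (intro divide_right_mono) auto
    ultimately show ?thesis using 1 by (simp add: radius_def)
  qed
qed

text \<open>The full value above the level, not the excess over it: for l \<ge> 1 it dominates both
  the indicator of the set where T exceeds l and, by coercivity, \<alpha> times |V|^r on that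
  set.\<close>

definition tail :: "real \<Rightarrow> (real^'n \<Rightarrow> real^'n^'m) \<Rightarrow> real^'n \<Rightarrow> real" where
  "tail l V x = (if T x (V x) > l then T x (V x) else 0)"

lemma tail_measurable:
  assumes "V \<in> borel_measurable (lebesgue_on \<Omega>)"
  shows "tail l V \<in> borel_measurable (lebesgue_on \<Omega>)"
  unfolding tail_def[abs_def] using T_measurable[OF assms] by measurable

text \<open>A crude first bound from the convexity of the norm. The excess max 0 (|V| -
  \<open>radius\<close>) is at most 1 / \<alpha> times the tail at level 2, so its integral tends to
  0 along the sequence; being convex and Lipschitz, it survives midpoints and the L^1 limit.\<close>

lemma limit_gradient_bounded:
  fixes v :: "nat \<Rightarrow> real^'n \<Rightarrow> real^'m" and q :: real
  assumes q: "q \<ge> 2" and v: "\<And>n. v n \<in> W1 q \<Omega>" and C: "C \<ge> 0" "\<And>n. (\<integral>\<^sup>+x. norm (wgrad \<Omega> (v n) x) powr q \<partial>lebesgue_on \<Omega>) \<le> ennreal C"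
    and w: "w \<in> borel_measurable (lebesgue_on \<Omega>)"
    and \<epsilon>: "decseq \<epsilon>" "\<epsilon> \<longlonglongrightarrow> 0" and close: "\<And>n. AE x in lebesgue_on \<Omega>. norm (v n x - w x) \<le> \<epsilon> n"
    and tl: "(\<lambda>n. \<integral>\<^sup>+x. tail 2 (wgrad \<Omega> (v n)) x \<partial>lebesgue_on \<Omega>) \<longlonglongrightarrow> 0"
  shows "AE x in lebesgue_on \<Omega>. norm (wgrad \<Omega> w x) \<le> radius"
proof -
  let ?M = "lebesgue_on \<Omega>"
  from mazur_W1[OF q v C w \<epsilon> close]
  obtain z Z where wW: "w \<in> W1 q \<Omega>" and zZ: "\<forall>n. mid_hull (\<lambda>y Y. \<exists>k\<ge>n. y = v k \<and> Y = wgrad \<Omega> (v k)) (z n) (Z n)"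
    and l: "\<forall>s. 1 \<le> s \<longrightarrow> s < q \<longrightarrow> (\<lambda>n. \<integral>\<^sup>+x. norm (Z n x - wgrad \<Omega> w x) powr s \<partial>?M) \<longlonglongrightarrow> 0"
    and ZL: "\<forall>n. weak_gradient \<Omega> (z n) (Z n) \<and> z n \<in> W1 q \<Omega> \<and> Z n \<in> Lp q \<Omega>"
    by (elim exE conjE)
  have l1: "(\<lambda>n. \<integral>\<^sup>+x. norm (Z n x - wgrad \<Omega> w x) \<partial>?M) \<longlonglongrightarrow> 0" using l[rule_format, of 1] q by simp
  have Gm [measurable]: "wgrad \<Omega> w \<in> borel_measurable ?M" using W1_E(3)[OF wW] by (simp add: Lp_iff)
  have Zm [measurable]: "Z n \<in> borel_measurable ?M" for n using ZL by (auto simp: Lp_iff)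
  let ?\<psi> = "\<lambda>Y. \<integral>\<^sup>+x. ennreal (max 0 (norm (Y x :: real^'n^'m) - radius)) \<partial>?M"
  have vm: "wgrad \<Omega> (v n) \<in> borel_measurable ?M" for n using W1_E(3)[OF v[of n]] by (simp add: Lp_iff)
  have basebound: "?\<psi> (wgrad \<Omega> (v n)) \<le> ennreal (1 / \<alpha>) * (\<integral>\<^sup>+x. tail 2 (wgrad \<Omega> (v n)) x \<partial>?M)" for n
  proof -
    have "?\<psi> (wgrad \<Omega> (v n)) \<le> (\<integral>\<^sup>+x. ennreal (1 / \<alpha>) * ennreal (tail 2 (wgrad \<Omega> (v n)) x) \<partial>?M)"
    proof (rule nn_integral_mono_AE)
      show "AE x in ?M. ennreal (max 0 (norm (wgrad \<Omega> (v n) x) - radius)) \<le> ennreal (1 / \<alpha>) * ennreal (tail 2 (wgrad \<Omega> (v n)) x)"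
        using growth
      proof eventually_elim
        case (elim x)
        let ?\<xi> = "wgrad \<Omega> (v n) x"
        show ?case
        proof (cases "norm ?\<xi> \<le> radius")
          case False
          then have t: "T x ?\<xi> > 2" using coercive(2)[OF elim, of ?\<xi>] by force
          have "norm ?\<xi> powr 1 \<le> norm ?\<xi> powr r" using False radius_ge_1 r1 by (intro powr_mono) auto
          then have "norm ?\<xi> \<le> T x ?\<xi> / \<alpha>" using coercive(1)[OF elim, of ?\<xi>] by simp
          then have "max 0 (norm ?\<xi> - radius) \<le> 1 / \<alpha> * T x ?\<xi>" using False radius_ge_1 by simp
          then show ?thesis using t \<alpha> by (simp add: tail_def ennreal_mult[symmetric] ennreal_leI)
        qed simp
      qed
    qed
    also have "\<dots> = ennreal (1 / \<alpha>) * (\<integral>\<^sup>+x. tail 2 (wgrad \<Omega> (v n)) x \<partial>?M)"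
      using tail_measurable[OF vm] by (intro nn_integral_cmult) simp
    finally show ?thesis .
  qed
  have "?\<psi> (wgrad \<Omega> w) \<le> 0 + ennreal e" if e: "e > 0" for e
  proof -
    define e' where "e' = e / 2 * \<alpha>"
    have e': "e' > 0" using e \<alpha> by (simp add: e'_def)
    obtain N where N: "\<And>n. n \<ge> N \<Longrightarrow> (\<integral>\<^sup>+x. tail 2 (wgrad \<Omega> (v n)) x \<partial>?M) \<le> ennreal e'"
      using ennreal_tendsto_0D[OF tl e'] by (auto simp: eventually_sequentially)
    have bN: "?\<psi> (wgrad \<Omega> (v n)) \<le> ennreal (e / 2)" if "n \<ge> N" for n
    proof -
      have "?\<psi> (wgrad \<Omega> (v n)) \<le> ennreal (1 / \<alpha>) * ennreal e'"
        by (rule order_trans[OF basebound mult_left_mono[OF N[OF that]]]) simp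
      also have "\<dots> = ennreal (e / 2)" using e e' \<alpha> by (simp add: ennreal_mult[symmetric] e'_def)
      finally show ?thesis .
    qed
    have hull: "Y \<in> borel_measurable ?M \<and> ?\<psi> Y \<le> ennreal (e / 2)"
      if "mid_hull (\<lambda>y Y. \<exists>k\<ge>n. y = v k \<and> Y = wgrad \<Omega> (v k)) y Y" "n \<ge> N" for n y Y
      using that(1)
    proof (induction rule: mid_hull.induct)
      case (base y Y)
      then show ?case using bN vm that(2) by auto
    next
      case (mid y Y y' Y')
      then have [measurable]: "Y \<in> borel_measurable ?M" "Y' \<in> borel_measurable ?M" by auto
      have "?\<psi> (\<lambda>x. (1/2) *\<^sub>R Y x + (1/2) *\<^sub>R Y' x) \<le>
        (\<integral>\<^sup>+x. ennreal (1/2) * ennreal (max 0 (norm (Y x) - radius)) + ennreal (1/2) * ennreal (max 0 (norm (Y' x) - radius)) \<partial>?M)"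
      proof (rule nn_integral_mono)
        fix x
        have "norm ((1/2) *\<^sub>R Y x + (1/2) *\<^sub>R Y' x) \<le> 1/2 * norm (Y x) + 1/2 * norm (Y' x)"
          using norm_triangle_ineq[of "(1/2) *\<^sub>R Y x" "(1/2) *\<^sub>R Y' x"] by simp
        moreover have "max 0 (a - d) \<le> 1/2 * max 0 (b - d) + 1/2 * max 0 (c - d)" if "a \<le> 1/2 * b + 1/2 * c" for a b c d :: real
        proof -
          have "b - d \<le> max 0 (b - d)" "c - d \<le> max 0 (c - d)" "0 \<le> max 0 (b - d)" "0 \<le> max 0 (c - d)" by auto
          then show ?thesis using that by (intro max.boundedI) argo+
        qed
        ultimately have "max 0 (norm ((1/2) *\<^sub>R Y x + (1/2) *\<^sub>R Y' x) - radius) \<le> 1/2 * max 0 (norm (Y x) - radius) + 1/2 * max 0 (norm (Y' x) - radius)"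
          by blast
        then show "ennreal (max 0 (norm ((1/2) *\<^sub>R Y x + (1/2) *\<^sub>R Y' x) - radius)) \<le> ennreal (1/2) * ennreal (max 0 (norm (Y x) - radius)) + ennreal (1/2) * ennreal (max 0 (norm (Y' x) - radius))"
          by (subst ennreal_mult[symmetric], simp, simp, subst ennreal_mult[symmetric], simp, simp, subst ennreal_plus[symmetric], simp, simp, rule ennreal_leI)
      qed
      also have "\<dots> = ennreal (1/2) * ?\<psi> Y + ennreal (1/2) * ?\<psi> Y'"
        by (subst nn_integral_add, simp, simp, subst nn_integral_cmult, simp, subst nn_integral_cmult, simp, rule refl)
      also have "\<dots> \<le> ennreal (1/2) * ennreal (e/2) + ennreal (1/2) * ennreal (e/2)"
        using mid by (intro add_mono mult_left_mono) auto
      also have "\<dots> = ennreal (e/2)" using e by (intro ennreal_half_add) simp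
      finally show ?case by simp
    qed
    have e2: "e / 2 > 0" using e by simp
    from eventually_conj[OF ennreal_tendsto_0D[OF l1 e2] eventually_ge_at_top[of N]]
    obtain n where n: "(\<integral>\<^sup>+x. norm (Z n x - wgrad \<Omega> w x) \<partial>?M) \<le> ennreal (e/2)" "n \<ge> N"
      by (auto simp: eventually_sequentially)
    have "?\<psi> (wgrad \<Omega> w) \<le> (\<integral>\<^sup>+x. ennreal (max 0 (norm (Z n x) - radius)) + ennreal (norm (Z n x - wgrad \<Omega> w x)) \<partial>?M)"
    proof (rule nn_integral_mono)
      fix x
      have "norm (wgrad \<Omega> w x) \<le> norm (Z n x) + norm (Z n x - wgrad \<Omega> w x)"
        using norm_triangle_ineq4[of "Z n x" "Z n x - wgrad \<Omega> w x"] by simp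
      then have "max 0 (norm (wgrad \<Omega> w x) - radius) \<le> max 0 (norm (Z n x) - radius) + norm (Z n x - wgrad \<Omega> w x)"
        by (auto simp: max_def)
      then show "ennreal (max 0 (norm (wgrad \<Omega> w x) - radius)) \<le> ennreal (max 0 (norm (Z n x) - radius)) + ennreal (norm (Z n x - wgrad \<Omega> w x))"
        by (subst ennreal_plus[symmetric], simp, simp, rule ennreal_leI)
    qed
    also have "\<dots> = ?\<psi> (Z n) + (\<integral>\<^sup>+x. norm (Z n x - wgrad \<Omega> w x) \<partial>?M)" by (rule nn_integral_add) auto
    also have "\<dots> \<le> ennreal (e/2) + ennreal (e/2)" using hull[OF zZ[rule_format] n(2)] n(1) by (intro add_mono) auto
    also have "\<dots> = ennreal e" using e by (simp add: ennreal_plus[symmetric] del: ennreal_plus)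
    finally show ?thesis by simp
  qed
  then have "?\<psi> (wgrad \<Omega> w) \<le> 0" by (rule ennreal_le_epsilon) auto
  then have "?\<psi> (wgrad \<Omega> w) = 0" by simp
  then have "AE x in ?M. ennreal (max 0 (norm (wgrad \<Omega> w x) - radius)) = 0"
    by (subst (asm) nn_integral_0_iff_AE) auto
  then show ?thesis by eventually_elim (auto simp: max_def ennreal_eq_0_iff split: if_splits)
qed

text \<open>Countably many labels are enough to separate the integrands \<^term>\<open>T x\<close> up to a small uniform
  error on a ball, so a set of positive measure contains a piece of positive measure on which they are
  uniformly close to each other and equicontinuous.\<close>

lemma nearly_constant_piece:
  fixes G :: "real^'n \<Rightarrow> real^'n^'m"
  assumes E: "E \<in> sets (lebesgue_on \<Omega>)" "emeasure (lebesgue_on \<Omega>) E > 0" "E \<subseteq> \<Omega>"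
    and cont: "\<And>x. x \<in> E \<Longrightarrow> continuous_on UNIV (T x)"
    and G: "G \<in> borel_measurable (lebesgue_on \<Omega>)" "\<And>x. x \<in> E \<Longrightarrow> norm (G x) \<le> R"
    and \<delta>: "\<delta> > 0"
  shows "\<exists>E' \<eta> \<xi>0. E' \<in> sets (lebesgue_on \<Omega>) \<and> emeasure (lebesgue_on \<Omega>) E' > 0 \<and> E' \<subseteq> E \<and> 0 < \<eta> \<and> \<eta> \<le> 1 \<and>
    (\<forall>x\<in>E'. norm (\<xi>0 - G x) < \<eta> / 3) \<and>
    (\<forall>x\<in>E'. \<forall>y\<in>E'. \<forall>\<xi>\<in>cball 0 R. \<forall>\<zeta>\<in>cball 0 R. norm (\<xi> - \<zeta>) < \<eta> \<longrightarrow> \<bar>T x \<xi> - T y \<zeta>\<bar> \<le> 4 * \<delta>)"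
proof -
  let ?M = "lebesgue_on \<Omega>"
  note [measurable] = G(1)
  have Tm[measurable]: "(\<lambda>x. T x \<xi>) \<in> borel_measurable ?M" for \<xi> using carath by (simp add: caratheodory_function_def)
  have spE: "{x\<in>E. P x} = E \<inter> {x\<in>space ?M. P x}" for P using E(3) by auto
  obtain Q :: "(real^'n^'m) set" where Q: "countable Q" "\<And>X. open X \<Longrightarrow> X \<noteq> {} \<Longrightarrow> \<exists>d\<in>Q. d \<in> X"
    using countable_dense_setE by metis
  define h where "h = (\<lambda>j::nat. 1 / real (Suc j))"
  \<comment> \<open>Quantifying over the countable dense set Q makes the set of these x measurable;
    the radius R + 1 leaves room for points of Q that approximate the boundary of the ball of radius
    R.\<close>
  define A where "A = (\<lambda>j x. \<forall>a\<in>Q. \<forall>b\<in>Q. a \<in> ball 0 (R+1) \<longrightarrow> b \<in> ball 0 (R+1) \<longrightarrow> norm (a - b) < h j \<longrightarrow> \<bar>T x a - T x b\<bar> \<le> \<delta>)"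
  have Am: "{x\<in>E. A j x} \<in> sets ?M" for j
  proof -
    have "{x \<in> space ?M. A j x} \<in> sets ?M" unfolding A_def
      by (intro sets.sets_Collect_countable_All' sets.sets_Collect_countable_Ball Q(1)) (measurable)
    then show ?thesis unfolding spE using E(1) by auto
  qed
  have "AE x in ?M. \<exists>j\<in>UNIV. x \<in> E \<longrightarrow> A j x"
  proof (rule AE_I2)
    fix x
    show "\<exists>j\<in>UNIV. x \<in> E \<longrightarrow> A j x"
    proof (cases "x \<in> E")
      case True
      have "uniformly_continuous_on (cball 0 (R+1)) (T x)"
        by (rule compact_uniformly_continuous[OF continuous_on_subset[OF cont[OF True]]]) auto
      then obtain d where d: "d > 0" "\<And>a b. a \<in> cball 0 (R+1) \<Longrightarrow> b \<in> cball 0 (R+1) \<Longrightarrow> dist b a < d \<Longrightarrow> dist (T x b) (T x a) < \<delta>"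
        using \<delta> unfolding uniformly_continuous_on_def by metis
      obtain j where j: "h j < d" using reals_Archimedean[OF d(1)] unfolding h_def by (auto simp: inverse_eq_divide)
      have "A j x" unfolding A_def
      proof (intro ballI impI)
        fix a b :: "real^'n^'m" assume "a \<in> ball 0 (R+1)" "b \<in> ball 0 (R+1)" "norm (a - b) < h j"
        then show "\<bar>T x a - T x b\<bar> \<le> \<delta>" using d(2)[of b a] j by (auto simp: dist_norm)
      qed
      then show ?thesis by auto
    qed auto
  qed
  from AE_positive_part[OF this _ E(2,1)] Am
  obtain j where j: "emeasure ?M {x\<in>E. A j x} > 0" by (auto simp: conj_commute cong: conj_cong)
  define \<eta> where "\<eta> = h j"
  have \<eta>: "0 < \<eta>" "\<eta> \<le> 1" by (auto simp: \<eta>_def h_def)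
  define E1 where "E1 = {x\<in>E. A j x}"
  have E1: "E1 \<in> sets ?M" "emeasure ?M E1 > 0" "E1 \<subseteq> E" using Am[of j] j by (auto simp: E1_def)
  have equi: "\<bar>T x \<xi> - T x \<zeta>\<bar> \<le> \<delta>" if x: "x \<in> E1" and b: "\<xi> \<in> cball 0 R" "\<zeta> \<in> cball 0 R" "norm (\<xi> - \<zeta>) < \<eta>" for x \<xi> \<zeta>
  proof -
    have app: "\<exists>s::nat \<Rightarrow> real^'n^'m. (\<forall>n. s n \<in> Q) \<and> s \<longlonglongrightarrow> \<xi>" for \<xi>
    proof -
      have "\<forall>n. \<exists>d. d \<in> Q \<and> d \<in> ball \<xi> (h n)" using Q(2)[of "ball \<xi> (h _)"] by (auto simp: h_def)
      from choice[OF this] obtain s where s: "\<And>n. s n \<in> Q" "\<And>n. s n \<in> ball \<xi> (h n)" by auto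
      have "(\<lambda>n. dist \<xi> (s n)) \<longlonglongrightarrow> 0"
        by (rule tendsto_sandwich[OF _ _ tendsto_const LIMSEQ_Suc[OF lim_1_over_n[where 'a = real]]])
          (use s(2) less_imp_le in \<open>auto simp: h_def intro!: always_eventually\<close>)
      then have "(\<lambda>n. dist (s n) \<xi>) \<longlonglongrightarrow> 0" by (simp only: dist_commute)
      then have "s \<longlonglongrightarrow> \<xi>" by (rule tendsto_dist_iff[THEN iffD2])
      then show ?thesis using s(1) by auto
    qed
    obtain s where s: "\<And>n. s n \<in> Q" "s \<longlonglongrightarrow> \<xi>" using app[of \<xi>] by auto
    obtain t where t: "\<And>n. t n \<in> Q" "t \<longlonglongrightarrow> \<zeta>" using app[of \<zeta>] by auto
    have ev: "\<forall>\<^sub>F n in sequentially. \<bar>T x (s n) - T x (t n)\<bar> \<le> \<delta>"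
    proof -
      have "\<forall>\<^sub>F n in sequentially. s n \<in> ball 0 (R+1)" "\<forall>\<^sub>F n in sequentially. t n \<in> ball 0 (R+1)"
        using topological_tendstoD[OF s(2) open_ball, of 0 "R+1"] topological_tendstoD[OF t(2) open_ball, of 0 "R+1"] b by auto
      moreover have "\<forall>\<^sub>F n in sequentially. norm (s n - t n) < \<eta>"
        by (rule order_tendstoD(2)[OF tendsto_norm[OF tendsto_diff[OF s(2) t(2)]] b(3)])
      ultimately show ?thesis
      proof eventually_elim
        case (elim n)
        have "A j x" using x by (simp add: E1_def)
        then show ?case unfolding A_def using s(1) t(1) elim by (auto simp: \<eta>_def)
      qed
    qed
    have c: "isCont (T x) y" for y using cont[of x] x E1(3) by (auto simp: continuous_on_eq_continuous_at)
    have "(\<lambda>n. \<bar>T x (s n) - T x (t n)\<bar>) \<longlonglongrightarrow> \<bar>T x \<xi> - T x \<zeta>\<bar>"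
      by (intro tendsto_rabs tendsto_diff isCont_tendsto_compose[OF c] s(2) t(2))
    from tendsto_upperbound[OF this ev] show ?thesis by simp
  qed
  obtain F where F: "finite F" "F \<subseteq> cball 0 R" "cball (0::real^'n^'m) R \<subseteq> (\<Union>f\<in>F. ball f (\<eta>/3))"
  proof (rule compactE_image[of "cball (0::real^'n^'m) R" "cball 0 R" "\<lambda>f. ball f (\<eta>/3)"])
    show "cball 0 R \<subseteq> (\<Union>c\<in>cball 0 R. ball c (\<eta> / 3))" using \<eta> by force
  qed auto
  obtain L where L: "set L = F" using finite_list[OF F(1)] by blast
  \<comment> \<open>Equal labels mean that the values of T at the points of the net F fall into the
    same cells of width \<open>\<delta>\<close>; there are only countably many lists of
    integers.\<close>
  define lab where "lab = (\<lambda>x. map (\<lambda>f. \<lfloor>T x f / \<delta>\<rfloor>) L)"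
  define B where "B = (\<lambda>(l, f) x. lab x = l \<and> norm (f - G x) < \<eta>/3)"
  have labm: "{x\<in>space ?M. lab x = l} \<in> sets ?M" for l
  proof -
    have "{x\<in>space ?M. map (\<lambda>f. \<lfloor>T x f / \<delta>\<rfloor>) L = l} \<in> sets ?M"
    proof (induction L arbitrary: l)
      case Nil
      have "{x\<in>space ?M. [] = l} = (if l = [] then space ?M else {})" by auto
      then have "{x\<in>space ?M. [] = l} \<in> sets ?M" by (simp only: sets.top sets.empty_sets split: if_split) simp
      then show ?case unfolding list.map .
    next
      case (Cons f L)
      have 1: "{x\<in>space ?M. \<lfloor>T x f / \<delta>\<rfloor> = k} \<in> sets ?M" for k
      proof -
        have "{x\<in>space ?M. \<lfloor>T x f / \<delta>\<rfloor> = k} = {x\<in>space ?M. real_of_int k \<le> T x f / \<delta> \<and> T x f / \<delta> < real_of_int k + 1}"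
          by (auto simp: floor_eq_iff)
        also have "\<dots> \<in> sets ?M" by measurable
        finally show ?thesis .
      qed
      show ?case
      proof (cases l)
        case (Cons k l')
        have "{x\<in>space ?M. map (\<lambda>f. \<lfloor>T x f / \<delta>\<rfloor>) (f # L) = l} = {x\<in>space ?M. \<lfloor>T x f / \<delta>\<rfloor> = k} \<inter> {x\<in>space ?M. map (\<lambda>f. \<lfloor>T x f / \<delta>\<rfloor>) L = l'}"
          using Cons by auto
        then show ?thesis using 1[of k] Cons.IH[of l'] by simp
      qed simp
    qed
    then show ?thesis by (simp add: lab_def)
  qed
  have Bm: "{x\<in>E1. B p x} \<in> sets ?M" for p
  proof -
    have "{x\<in>space ?M. norm (snd p - G x) < \<eta>/3} \<in> sets ?M" by measurable
    moreover have "{x\<in>E1. B p x} = E1 \<inter> {x\<in>space ?M. lab x = fst p} \<inter> {x\<in>space ?M. norm (snd p - G x) < \<eta>/3}"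
      using E1(3) E(3) by (auto simp: B_def case_prod_beta)
    ultimately show ?thesis using labm[of "fst p"] E1(1) by auto
  qed
  have "AE x in ?M. \<exists>p\<in>UNIV \<times> F. x \<in> E1 \<longrightarrow> B p x"
  proof (rule AE_I2)
    fix x
    show "\<exists>p\<in>UNIV \<times> F. x \<in> E1 \<longrightarrow> B p x"
    proof (cases "x \<in> E1")
      case True
      then have "G x \<in> cball 0 R" using G(2) E1(3) by auto
      then obtain f where "f \<in> F" "G x \<in> ball f (\<eta>/3)" using F(3) by blast
      then show ?thesis by (intro bexI[of _ "(lab x, f)"]) (auto simp: B_def dist_norm)
    next
      case False
      have "emeasure ?M E1 \<noteq> 0" using E1(2) by auto
      then have "E1 \<noteq> {}" by auto
      then obtain y where "y \<in> E1" by auto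
      then have "norm (G y) \<le> R" using G(2) E1(3) by auto
      then have "G y \<in> cball 0 R" by simp
      then obtain f where "f \<in> F" using F(3) by blast
      then show ?thesis using False by (intro bexI[of _ "([], f)"]) auto
    qed
  qed
  moreover have "countable (UNIV \<times> F :: (int list \<times> (real^'n^'m)) set)" using F(1) by (auto intro: countable_finite)
  moreover have E1eq: "{x\<in>E1. x \<in> E1 \<longrightarrow> B p x} = {x\<in>E1. B p x}" for p by auto
  ultimately have "\<exists>p\<in>UNIV \<times> F. emeasure ?M {x\<in>E1. x \<in> E1 \<longrightarrow> B p x} > 0"
    using E1(1,2) Bm
    by (intro AE_positive_part[where M = ?M and I = "UNIV \<times> F" and P = "\<lambda>p x. x \<in> E1 \<longrightarrow> B p x" and A = E1]) (simp_all only: E1eq)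
  then obtain p where p: "emeasure ?M {x\<in>E1. B p x} > 0" unfolding E1eq by auto
  define E2 where "E2 = {x\<in>E1. B p x}"
  have E2: "E2 \<in> sets ?M" "emeasure ?M E2 > 0" "E2 \<subseteq> E1" using Bm[of p] p by (auto simp: E2_def)
  have net: "\<bar>T x f - T y f\<bar> \<le> \<delta>" if "x \<in> E2" "y \<in> E2" "f \<in> F" for x y f
  proof -
    have "lab x = lab y" using that by (auto simp: E2_def B_def case_prod_beta)
    then have "\<lfloor>T x f / \<delta>\<rfloor> = \<lfloor>T y f / \<delta>\<rfloor>" using that(3) L unfolding lab_def by (auto simp: map_eq_conv)
    then have "\<bar>T x f / \<delta> - T y f / \<delta>\<bar> < 1" by linarith
    then have "\<bar>T x f - T y f\<bar> / \<delta> < 1" using \<delta> by (simp add: diff_divide_distrib[symmetric] abs_divide)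
    then show ?thesis using \<delta> by (simp add: divide_less_eq)
  qed
  have close: "\<bar>T x \<xi> - T y \<zeta>\<bar> \<le> 4 * \<delta>" if xy: "x \<in> E2" "y \<in> E2" and b: "\<xi> \<in> cball 0 R" "\<zeta> \<in> cball 0 R" "norm (\<xi> - \<zeta>) < \<eta>" for x y \<xi> \<zeta>
  proof -
    obtain f where f: "f \<in> F" "\<zeta> \<in> ball f (\<eta>/3)" using F(3) b(2) by blast
    have fz: "norm (\<zeta> - f) < \<eta>" "norm (f - \<zeta>) < \<eta>" using f(2) \<eta> by (auto simp: dist_norm norm_minus_commute)
    have x1: "x \<in> E1" "y \<in> E1" "f \<in> cball 0 R" using xy E2(3) f F(2) by auto
    \<comment> \<open>Four errors of size \<open>\<delta>\<close>: at x from \<open>\<xi>\<close> to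
      \<open>\<zeta>\<close> and from \<open>\<zeta>\<close> to the net point f, then at f from x to
      y, and at y back from f to \<open>\<zeta>\<close>.\<close>
    show ?thesis
      using equi[OF x1(1) b] equi[OF x1(1) b(2) x1(3) fz(1)] net[OF xy f(1)] equi[OF x1(2) x1(3) b(2) fz(2)] \<delta>
      by argo
  qed
  have "norm (snd p - G x) < \<eta> / 3" if "x \<in> E2" for x using that by (auto simp: E2_def B_def case_prod_beta)
  then show ?thesis using E2 E1(3) \<eta> close
    by (intro exI[of _ E2] exI[of _ \<eta>] exI[of _ "snd p"]) (auto intro: subset_trans)
qed

end

subsection \<open>The constraint in the limit\<close>

lemma rank_one_norm_le:
  fixes w :: "real^'m" and b :: "real^'n" and e B :: real
  assumes "norm w \<le> e" "norm b \<le> B" "e \<ge> 0"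
  shows "norm (\<chi> k. w $ k *\<^sub>R b :: real^'n^'m) \<le> CARD('m) * e * B"
proof -
  have B: "B \<ge> 0" using assms(2) norm_ge_zero[of b] by linarith
  have "norm (\<chi> k. w $ k *\<^sub>R b :: real^'n^'m) \<le> (\<Sum>k\<in>UNIV. norm ((\<chi> k. w $ k *\<^sub>R b :: real^'n^'m) $ k))"
    unfolding norm_vec_def by (rule L2_set_le_sum) simp
  also have "\<dots> \<le> (\<Sum>k\<in>(UNIV::'m set). e * B)"
  proof (rule sum_mono)
    fix k
    have "\<bar>w $ k\<bar> \<le> e" using component_le_norm_cart[of w k] assms(1) by linarith
    then have "\<bar>w $ k\<bar> * norm b \<le> e * B" using assms B by (intro mult_mono) auto
    then show "norm ((\<chi> k. w $ k *\<^sub>R b :: real^'n^'m) $ k) \<le> e * B" by simp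
  qed
  finally show ?thesis by simp
qed

text \<open>A function that is not integrable has Bochner integral 0, so the inequality holds in
  that case too. The inequality in \<open>quasiconvex\<close>, written with the Bochner integral,
  thus passes to the nonnegative integral whether or not the integrand is integrable.\<close>

lemma ennreal_integral_le_nn_integral:
  assumes "AE x in M. (0::real) \<le> f x"
  shows "ennreal (LINT x|M. f x) \<le> (\<integral>\<^sup>+x. f x \<partial>M)"
  by (cases "integrable M f") (use assms in \<open>auto simp: nn_integral_eq_integral not_integrable_integral_eq\<close>)

text \<open>The maps used to test quasiconvexity on a subdomain: cut off the mollified difference of the
  sequence and its limit.\<close>

lemma quasiconvex_test:
  fixes f :: "real^'n^'m \<Rightarrow> real" and w :: "real^'n \<Rightarrow> real^'m"
  assumes D: "open D" "bounded D" "D \<noteq> {}"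
    and f: "\<And>\<xi>. 0 \<le> f \<xi>" and th: "test_function D \<theta>" and w: "\<And>k. smooth (\<lambda>x. w x $ k)"
    and qc: "\<And>\<phi>. \<phi> \<in> W1_0 \<infinity> D \<Longrightarrow> f \<xi>0 \<le> 1 / measure lebesgue D * (LINT x|lebesgue_on D. f (\<xi>0 + wgrad D \<phi> x))"
  shows "ennreal (f \<xi>0) * emeasure lborel D \<le>
    (\<integral>\<^sup>+x. f (\<xi>0 + (\<theta> x *\<^sub>R Dmap w x + (\<chi> k. w x $ k *\<^sub>R grad \<theta> x))) \<partial>lebesgue_on D)"
proof -
  interpret D: bounded_open D by unfold_locales (rule D)+
  define \<phi> where "\<phi> = (\<lambda>x. \<theta> x *\<^sub>R w x)"
  have \<phi>: "test_map D \<phi>" unfolding test_map_def \<phi>_def using test_function_mult[OF th w] by simp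
  have Dm: "Dmap \<phi> x = \<theta> x *\<^sub>R Dmap w x + (\<chi> k. w x $ k *\<^sub>R grad \<theta> x)" for x
    using pd_mult[OF test_function_smooth[OF th] w]
    by (simp add: Dmap_def \<phi>_def grad_def vec_eq_iff mult.commute)
  let ?m = "measure lebesgue D"
  have "emeasure lborel D < \<infinity>" using emeasure_bounded_finite[OF D(2)] .
  then have em: "emeasure lborel D = ennreal ?m" using D(1) by (simp add: emeasure_eq_ennreal_measure less_top)
  have "emeasure lborel D \<noteq> 0"
    using open_not_negligible[OF D(1,3)] D(1) by (auto simp: negligible_iff_null_sets null_sets_def)
  then have m: "?m > 0" using em by (metis ennreal_0 measure_nonneg less_eq_real_def)
  have "f \<xi>0 \<le> 1 / ?m * (LINT x|lebesgue_on D. f (\<xi>0 + wgrad D \<phi> x))"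
    by (rule qc[OF D.test_map_W1_0_inf(1)[OF \<phi>]])
  then have "f \<xi>0 * ?m \<le> (LINT x|lebesgue_on D. f (\<xi>0 + wgrad D \<phi> x))" using m by (simp add: field_simps)
  then have "ennreal (f \<xi>0 * ?m) \<le> ennreal (LINT x|lebesgue_on D. f (\<xi>0 + wgrad D \<phi> x))" by (rule ennreal_leI)
  also have "\<dots> \<le> (\<integral>\<^sup>+x. f (\<xi>0 + wgrad D \<phi> x) \<partial>lebesgue_on D)" using f by (intro ennreal_integral_le_nn_integral) auto
  also have "\<dots> = (\<integral>\<^sup>+x. f (\<xi>0 + Dmap \<phi> x) \<partial>lebesgue_on D)"
    using D.test_map_W1_0_inf(2)[OF \<phi>] by (intro nn_integral_cong_AE) (auto elim: eventually_mono)
  finally show ?thesis unfolding Dm em using f m by (simp add: ennreal_mult)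
qed

context growth_integrand
begin

text \<open>The radius is chosen for each n so that the gradient error is at most 1 / (n + 1) in
  L^1; the uniform L^q bound upgrades this to L^r, where r is the growth exponent of T.
  Mollification keeps the uniform bound \<open>\<epsilon> n\<close>, on which the cut-off
  relies.\<close>

lemma mollified_differences:
  fixes z :: "nat \<Rightarrow> real^'n \<Rightarrow> real^'m" and q :: real
  assumes W: "\<And>n. W0 (z n) (Z n)" and q: "q > r"
    and C: "C \<ge> 0" "\<And>n. (\<integral>\<^sup>+x. norm (Z n x) powr q \<partial>lebesgue_on \<Omega>) \<le> ennreal C"
    and \<epsilon>: "\<And>n. \<epsilon> n \<ge> 0" and close: "\<And>n. AE x in lebesgue_on \<Omega>. norm (z n x) \<le> \<epsilon> n"
  shows "\<exists>w. (\<forall>n k. smooth (\<lambda>x. w n x $ k)) \<and> (\<forall>n x. norm (w n x) \<le> \<epsilon> n) \<and>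
    (\<forall>n. Dmap (w n) \<in> borel_measurable borel) \<and>
    (\<lambda>n. \<integral>\<^sup>+x. norm (Dmap (w n) x - Z n x) \<partial>lebesgue_on \<Omega>) \<longlonglongrightarrow> 0 \<and>
    (\<lambda>n. \<integral>\<^sup>+x. norm (Dmap (w n) x - Z n x) powr r \<partial>lebesgue_on \<Omega>) \<longlonglongrightarrow> 0"
proof -
  let ?M = "lebesgue_on \<Omega>"
  have q1: "q \<ge> 1" using q r1 by simp
  have Zm [measurable]: "Z n \<in> borel_measurable ?M" for n using W0_integrable(2)[OF W] by (rule borel_measurable_integrable)
  have "\<forall>n. \<exists>p. zero_extension (fst p) (snd p) \<and> (AE x in ?M. fst p x = z n x) \<and> (AE x in ?M. snd p x = Z n x)"
  proof
    fix n
    obtain y Y where "zero_extension y Y" "AE x in ?M. y x = z n x" "AE x in ?M. Y x = Z n x"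
      by (rule W0_zero_extension[OF W[of n]])
    then show "\<exists>p. zero_extension (fst p) (snd p) \<and> (AE x in ?M. fst p x = z n x) \<and> (AE x in ?M. snd p x = Z n x)"
      by (intro exI[of _ "(y, Y)"]) simp
  qed
  from choice[OF this] obtain p where p: "\<And>n. zero_extension (fst (p n)) (snd (p n))"
    "\<And>n. AE x in ?M. fst (p n) x = z n x" "\<And>n. AE x in ?M. snd (p n) x = Z n x" by auto
  define y Y where "y = (\<lambda>n. fst (p n))" and "Y = (\<lambda>n. snd (p n))"
  have y: "zero_extension (y n) (Y n)" "AE x in ?M. y n x = z n x" "AE x in ?M. Y n x = Z n x" for n
    using p by (auto simp: y_def Y_def)
  have iy: "integrable lborel (y n)" "integrable lborel (Y n)" and off: "x \<notin> \<Omega> \<Longrightarrow> y n x = 0" "x \<notin> \<Omega> \<Longrightarrow> Y n x = 0" for n x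
    using y(1)[of n] by (auto simp: zero_extension_def)
  have Ym [measurable]: "Y n \<in> borel_measurable borel" for n using iy(2)[of n] by auto
  have "\<forall>n. \<exists>e>0. (\<integral>\<^sup>+x. norm (conv (mollifier e) (Y n) x - Y n x) \<partial>lborel) \<le> ennreal (1 / real (Suc n))"
  proof
    fix n
    obtain d where d: "d > 0" "\<And>e. 0 < e \<and> e < d \<Longrightarrow> (\<integral>\<^sup>+x. norm (conv (mollifier e) (Y n) x - Y n x) \<partial>lborel) \<le> ennreal (1 / real (Suc n))"
      using conv_L1[OF iy(2)[of n], of "1 / real (Suc n)"] by auto
    then show "\<exists>e>0. (\<integral>\<^sup>+x. norm (conv (mollifier e) (Y n) x - Y n x) \<partial>lborel) \<le> ennreal (1 / real (Suc n))"
      by (intro exI[of _ "d/2"]) auto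
  qed
  from choice[OF this] obtain e where e: "\<And>n. 0 < e n"
    "\<And>n. (\<integral>\<^sup>+x. norm (conv (mollifier (e n)) (Y n) x - Y n x) \<partial>lborel) \<le> ennreal (1 / real (Suc n))" by auto
  define w where "w = (\<lambda>n. conv (mollifier (e n)) (y n))"
  have Dw: "Dmap (w n) = conv (mollifier (e n)) (Y n)" for n
    unfolding Dmap_def[abs_def] grad_def w_def
    by (rule ext) (simp add: pd_mollified(2)[OF y(1) e(1)] vec_eq_iff)
  have cm [measurable]: "conv (mollifier (e n)) (Y n) \<in> borel_measurable borel" for n by (intro conv_borel) auto
  have sm: "smooth (\<lambda>x. w n x $ k)" for n k unfolding w_def by (rule pd_mollified(1)[OF y(1) e(1)])
  have wb: "norm (w n x) \<le> \<epsilon> n" for n x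
  proof -
    have "AE x in ?M. norm (y n x) \<le> \<epsilon> n" using close[of n] y(2)[of n] by eventually_elim simp
    then have "AE x in lebesgue. x \<in> \<Omega> \<longrightarrow> norm (y n x) \<le> \<epsilon> n" by (simp add: AE_restrict_space_iff)
    then have "AE x in lebesgue. norm (y n x) \<le> \<epsilon> n"
      by eventually_elim (use off(1)[of _ n] \<epsilon>[of n] in force)
    then have "AE x in lborel. norm (y n x) \<le> \<epsilon> n" by (simp add: AE_completion_iff)
    then show ?thesis unfolding w_def by (rule conv_bounded[OF e(1) iy(1)])
  qed
  have toM: "(\<integral>\<^sup>+x. h x \<partial>?M) \<le> (\<integral>\<^sup>+x. h x \<partial>lborel)" for h :: "real^'n \<Rightarrow> ennreal"
  proof -
    have "(\<integral>\<^sup>+x. h x \<partial>?M) = (\<integral>\<^sup>+x. h x * indicator \<Omega> x \<partial>lebesgue)" by (intro nn_integral_restrict_space) auto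
    also have "\<dots> \<le> (\<integral>\<^sup>+x. h x \<partial>lebesgue)" by (intro nn_integral_mono) (auto simp: indicator_def)
    also have "\<dots> = (\<integral>\<^sup>+x. h x \<partial>lborel)" by (rule nn_integral_completion)
    finally show ?thesis .
  qed
  have cong: "(\<integral>\<^sup>+x. g (Y n x) x \<partial>?M) = (\<integral>\<^sup>+x. g (Z n x) x \<partial>?M)" for g :: "real^'n^'m \<Rightarrow> real^'n \<Rightarrow> ennreal" and n
    using y(3)[of n] by (intro nn_integral_cong_AE) (auto elim: eventually_mono)
  have L1: "(\<lambda>n. \<integral>\<^sup>+x. norm (Dmap (w n) x - Z n x) \<partial>?M) \<longlonglongrightarrow> 0"
  proof (rule tendsto_sandwich[OF _ _ tendsto_const])
    show "(\<lambda>n. ennreal (1 / real (Suc n))) \<longlonglongrightarrow> 0"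
      using tendsto_ennrealI[OF LIMSEQ_Suc[OF lim_1_over_n[where 'a = real]]] by simp
    have "(\<integral>\<^sup>+x. norm (Dmap (w n) x - Z n x) \<partial>?M) \<le> ennreal (1 / real (Suc n))" for n
    proof -
      have "(\<integral>\<^sup>+x. norm (Dmap (w n) x - Z n x) \<partial>?M) = (\<integral>\<^sup>+x. norm (Dmap (w n) x - Y n x) \<partial>?M)"
        using cong[of "\<lambda>a x. ennreal (norm (Dmap (w n) x - a))" n] by simp
      also have "\<dots> \<le> (\<integral>\<^sup>+x. norm (Dmap (w n) x - Y n x) \<partial>lborel)" by (rule toM)
      also have "\<dots> \<le> ennreal (1 / real (Suc n))" unfolding Dw by (rule e(2))
      finally show ?thesis .
    qed
    then show "\<forall>\<^sub>F n in sequentially. (\<integral>\<^sup>+x. norm (Dmap (w n) x - Z n x) \<partial>?M) \<le> ennreal (1 / real (Suc n))"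
      by (intro always_eventually allI)
  qed auto
  have Dm: "Dmap (w n) \<in> borel_measurable ?M" for n
    unfolding Dw using cm[of n] by (simp add: measurable_completion measurable_restrict_space1)
  have Lq: "(\<integral>\<^sup>+x. norm (Dmap (w n) x - Z n x) powr q \<partial>?M) \<le> ennreal (2 powr q * (C + C))" for n
  proof -
    note [measurable] = Dm[of n]
    have CY: "(\<integral>\<^sup>+x. norm (Y n x) powr q \<partial>lborel) \<le> ennreal C"
    proof -
      have "(\<integral>\<^sup>+x. norm (Y n x) powr q \<partial>lborel) = (\<integral>\<^sup>+x. norm (Y n x) powr q \<partial>?M)"
        using off(2) by (intro nn_integral_lebesgue_on[OF open_\<Omega>, symmetric]) auto
      also have "\<dots> = (\<integral>\<^sup>+x. norm (Z n x) powr q \<partial>?M)" by (rule cong)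
      finally show ?thesis using C(2)[of n] by simp
    qed
    have "(\<integral>\<^sup>+x. norm (Dmap (w n) x - Z n x) powr q \<partial>?M) \<le>
      (\<integral>\<^sup>+x. ennreal (2 powr q) * (ennreal (norm (Dmap (w n) x) powr q) + ennreal (norm (Z n x) powr q)) \<partial>?M)"
    proof (rule nn_integral_mono)
      fix x
      have "norm (Dmap (w n) x - Z n x) powr q \<le> (norm (Dmap (w n) x) + norm (Z n x)) powr q"
        using q1 by (intro powr_mono2 norm_triangle_ineq4) auto
      also have "\<dots> \<le> 2 powr q * (norm (Dmap (w n) x) powr q + norm (Z n x) powr q)" using q1 by (intro powr_add_le) auto
      finally show "ennreal (norm (Dmap (w n) x - Z n x) powr q) \<le>
          ennreal (2 powr q) * (ennreal (norm (Dmap (w n) x) powr q) + ennreal (norm (Z n x) powr q))"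
        by (simp add: ennreal_mult[symmetric] ennreal_plus[symmetric] ennreal_leI del: ennreal_plus)
    qed
    also have "\<dots> = ennreal (2 powr q) * ((\<integral>\<^sup>+x. norm (Dmap (w n) x) powr q \<partial>?M) + (\<integral>\<^sup>+x. norm (Z n x) powr q \<partial>?M))"
      by (subst nn_integral_cmult, simp, subst nn_integral_add, simp, simp, rule refl)
    also have "\<dots> \<le> ennreal (2 powr q) * (ennreal C + ennreal C)"
    proof (intro mult_left_mono add_mono C(2))
      have "(\<integral>\<^sup>+x. norm (Dmap (w n) x) powr q \<partial>?M) \<le> (\<integral>\<^sup>+x. norm (conv (mollifier (e n)) (Y n) x) powr q \<partial>lborel)"
        unfolding Dw by (rule toM)
      also have "\<dots> \<le> (\<integral>\<^sup>+x. norm (Y n x) powr q \<partial>lborel)" by (rule nn_integral_conv_powr_le[OF e(1) iy(2) q1])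
      finally show "(\<integral>\<^sup>+x. norm (Dmap (w n) x) powr q \<partial>?M) \<le> ennreal C" using CY by (rule order_trans)
    qed simp
    also have "\<dots> = ennreal (2 powr q * (C + C))"
      by (simp only: ennreal_mult[OF powr_ge_zero add_nonneg_nonneg[OF C(1) C(1)]] ennreal_plus[OF C(1) C(1)])
    finally show ?thesis .
  qed
  have Lr: "(\<lambda>n. \<integral>\<^sup>+x. norm (Dmap (w n) x - Z n x) powr r \<partial>?M) \<longlonglongrightarrow> 0"
    by (rule L1_Lq_imp_Lr[OF borel_measurable_diff[OF Dm Zm] L1 Lq]) (use C(1) r1 q in auto)
  show ?thesis using sm wb L1 Lr cm unfolding Dw[symmetric]
    by (intro exI[of _ w] conjI allI)
qed

text \<open>T is frozen at one point x0 and the gradient of u at one matrix \<open>\<xi>0\<close>,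
  with \<open>T x0 \<xi>0\<close> above 1 + 9 * \<open>\<delta>\<close>. The gradients of v n
  satisfy T \<le> l = 1 + \<open>\<delta>\<close> off the tail, so the quasiconvexity test gives
  \<open>T x0 \<xi>0\<close> \<le> 1 + 4 * \<open>\<delta>\<close>: one further
  \<open>\<delta>\<close> pays for freezing, one for the part of D outside K, and one for the errors
  that vanish with n.\<close>

lemma limit_constraint:
  fixes v :: "nat \<Rightarrow> real^'n \<Rightarrow> real^'m" and q :: real
  assumes ne: "\<Omega> \<noteq> {}" and qc: "quasiconvex \<Omega> T"
    and q: "q \<ge> 2" "q > r" and v: "\<And>n. v n \<in> W1 q \<Omega>"
    and C: "C \<ge> 0" "\<And>n. (\<integral>\<^sup>+x. norm (wgrad \<Omega> (v n) x) powr q \<partial>lebesgue_on \<Omega>) \<le> ennreal C"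
    and u: "u \<in> W1 q \<Omega>" and W: "\<And>n. W0 (\<lambda>x. v n x - u x) (\<lambda>x. wgrad \<Omega> (v n) x - wgrad \<Omega> u x)"
    and \<epsilon>: "decseq \<epsilon>" "\<epsilon> \<longlonglongrightarrow> 0" and close: "\<And>n. AE x in lebesgue_on \<Omega>. norm (v n x - u x) \<le> \<epsilon> n"
    and tl: "\<And>l. l > 1 \<Longrightarrow> (\<lambda>n. \<integral>\<^sup>+x. tail l (wgrad \<Omega> (v n)) x \<partial>lebesgue_on \<Omega>) \<longlonglongrightarrow> 0"
  shows "AE x in lebesgue_on \<Omega>. T x (wgrad \<Omega> u x) \<le> 1"
proof (rule ccontr)
  let ?M = "lebesgue_on \<Omega>"
  define G where "G = wgrad \<Omega> u"
  define V where "V = (\<lambda>n. wgrad \<Omega> (v n))"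
  assume "\<not> (AE x in ?M. T x (wgrad \<Omega> u x) \<le> 1)"
  then have nae: "\<not> (AE x in ?M. T x (G x) \<le> 1)" by (simp add: G_def)
  have um: "u \<in> borel_measurable ?M" using W1_E(1)[OF u] by (simp add: Lp_iff)
  have Gm [measurable]: "G \<in> borel_measurable ?M" using W1_E(3)[OF u] by (simp add: Lp_iff G_def)
  have Vm [measurable]: "V n \<in> borel_measurable ?M" for n using W1_E(3)[OF v[of n]] by (simp add: Lp_iff V_def)
  have \<epsilon>0: "\<epsilon> n \<ge> 0" for n by (rule decseq_ge[OF \<epsilon>])
  define M where "M = radius"
  have M1: "M \<ge> 1" using radius_ge_1 by (simp add: M_def)
  have GM: "AE x in ?M. norm (G x) \<le> M"
    unfolding G_def M_def by (rule limit_gradient_bounded[OF q(1) v C um \<epsilon> close tl]) simp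
  note TG = T_measurable[OF Gm]
  \<comment> \<open>Collects the conditions that hold almost everywhere, so that a point x0 outside
    a single null set has them all at once.\<close>
  define good where "good = (\<lambda>x. continuous_on UNIV (T x) \<and>
    (\<forall>\<xi>. \<alpha> * (1 + norm \<xi> powr r) \<le> T x \<xi> \<and> T x \<xi> \<le> \<beta> * (1 + norm \<xi> powr r)) \<and>
    (\<forall>\<xi>0 D \<phi>. bounded_domain D \<and> \<phi> \<in> W1_0 \<infinity> D \<longrightarrow>
        T x \<xi>0 \<le> 1 / measure lebesgue D * (LINT y|lebesgue_on D. T x (\<xi>0 + wgrad D \<phi> y))) \<and> norm (G x) \<le> M)"
  have "AE x in ?M. good x"
    using GM growth carath[unfolded caratheodory_function_def, THEN conjunct2] qc[unfolded quasiconvex_def]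
    by eventually_elim (simp add: good_def)
  then obtain N where N: "{x \<in> space ?M. \<not> good x} \<subseteq> N" "emeasure ?M N = 0" "N \<in> sets ?M" by (rule AE_E)
  have "\<exists>\<delta>>0. emeasure ?M {x\<in>space ?M. T x (G x) > 1 + 10 * \<delta>} > 0"
  proof (rule ccontr)
    assume *: "\<not> ?thesis"
    have "AE x in ?M. T x (G x) \<le> 1 + 10 * (1 / real (Suc n))" for n
    proof -
      have "emeasure ?M {x\<in>space ?M. T x (G x) > 1 + 10 * (1 / real (Suc n))} = 0"
        using *[simplified, rule_format, of "1 / real (Suc n)"] by simp
      moreover have "{x\<in>space ?M. T x (G x) > 1 + 10 * (1 / real (Suc n))} \<in> sets ?M" using TG by measurable
      ultimately show ?thesis
        by (subst AE_iff_measurable[OF _ refl]) (auto simp: not_le)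
    qed
    then have "AE x in ?M. \<forall>n. T x (G x) \<le> 1 + 10 * (1 / real (Suc n))" by (simp only: AE_all_countable) simp
    then have "AE x in ?M. T x (G x) \<le> 1"
    proof eventually_elim
      case (elim x)
      have "(\<lambda>n. 1 + 10 * (1 / real (Suc n))) \<longlonglongrightarrow> 1 + 10 * 0"
        by (intro tendsto_intros LIMSEQ_Suc[OF lim_1_over_n[where 'a = real]])
      from tendsto_lowerbound[OF this always_eventually[OF elim]] show ?case by simp
    qed
    with nae show False by simp
  qed
  then obtain \<delta>0 where \<delta>0: "\<delta>0 > 0" "emeasure ?M {x\<in>space ?M. T x (G x) > 1 + 10 * \<delta>0} > 0" by auto
  \<comment> \<open>At most 1, so that the level l = 1 + \<open>\<delta>\<close> does not exceed 2,
    up to which coercivity gives the bound \<open>radius\<close>.\<close>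
  define \<delta> where "\<delta> = min \<delta>0 1"
  have \<delta>: "\<delta> > 0" "\<delta> \<le> 1" "\<delta> \<le> \<delta>0" using \<delta>0(1) by (auto simp: \<delta>_def)
  define E where "E = {x\<in>space ?M. T x (G x) > 1 + 10 * \<delta>0} - N"
  have E0s: "{x\<in>space ?M. T x (G x) > 1 + 10 * \<delta>0} \<in> sets ?M" using TG by measurable
  have Es: "E \<in> sets ?M" unfolding E_def using E0s N(3) by (rule sets.Diff)
  have Ep: "emeasure ?M E > 0"
  proof -
    have "emeasure ?M E = emeasure ?M {x\<in>space ?M. T x (G x) > 1 + 10 * \<delta>0}"
      unfolding E_def using N(2,3) E0s by (intro emeasure_Diff_null_set) (auto simp: null_sets_def)
    then show ?thesis using \<delta>0(2) by simp
  qed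
  have E\<Omega>: "E \<subseteq> \<Omega>" by (auto simp: E_def)
  have Eg: "good x" "T x (G x) > 1 + 10 * \<delta>" if "x \<in> E" for x
  proof -
    show "good x" using that N(1) by (auto simp: E_def)
    have "T x (G x) > 1 + 10 * \<delta>0" using that by (simp add: E_def)
    then show "T x (G x) > 1 + 10 * \<delta>" using \<delta>(3) by linarith
  qed
  \<comment> \<open>Room for the matrices compared below: on the good set the gradient of v n has
    norm at most M, and \<open>F n x\<close> differs from it by less than \<open>\<eta>\<close>
    \<le> 1.\<close>
  define R where "R = M + 2"
  have np: "\<exists>E' \<eta> \<xi>0. E' \<in> sets ?M \<and> emeasure ?M E' > 0 \<and> E' \<subseteq> E \<and> 0 < \<eta> \<and> \<eta> \<le> 1 \<and>
    (\<forall>x\<in>E'. norm (\<xi>0 - G x) < \<eta> / 3) \<and>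
    (\<forall>x\<in>E'. \<forall>y\<in>E'. \<forall>\<xi>\<in>cball 0 R. \<forall>\<zeta>\<in>cball 0 R. norm (\<xi> - \<zeta>) < \<eta> \<longrightarrow> \<bar>T x \<xi> - T y \<zeta>\<bar> \<le> 4 * (\<delta>/4))"
  proof (rule nearly_constant_piece[OF Es Ep E\<Omega> _ Gm])
    show "continuous_on UNIV (T x)" if "x \<in> E" for x using Eg(1)[OF that] by (simp add: good_def)
    show "norm (G x) \<le> R" if "x \<in> E" for x using Eg(1)[OF that] by (simp add: good_def R_def)
    show "\<delta> / 4 > 0" using \<delta> by simp
  qed
  then obtain E' \<eta> \<xi>0 where E': "E' \<in> sets ?M" "emeasure ?M E' > 0" "E' \<subseteq> E" and \<eta>: "0 < \<eta>" "\<eta> \<le> 1"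
    and \<xi>0': "\<forall>x\<in>E'. norm (\<xi>0 - G x) < \<eta> / 3"
    and cl0: "\<forall>x\<in>E'. \<forall>y\<in>E'. \<forall>\<xi>\<in>cball 0 R. \<forall>\<zeta>\<in>cball 0 R. norm (\<xi> - \<zeta>) < \<eta> \<longrightarrow> \<bar>T x \<xi> - T y \<zeta>\<bar> \<le> 4 * (\<delta>/4)"
    by (elim exE conjE)
  note \<xi>0 = \<xi>0'[rule_format]
  have cl: "\<bar>T x \<xi> - T y \<zeta>\<bar> \<le> \<delta>" if "x \<in> E'" "y \<in> E'" "norm \<xi> \<le> R" "norm \<zeta> \<le> R" "norm (\<xi> - \<zeta>) < \<eta>" for x y \<xi> \<zeta>
    using cl0[rule_format, OF that(1,2), of \<xi> \<zeta>] that(3-5) by simp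
  have "E' \<noteq> {}" using E'(2) by auto
  then obtain x0 where x0: "x0 \<in> E'" by auto
  have x0g: "good x0" "T x0 (G x0) > 1 + 10 * \<delta>" using Eg x0 E'(3) by auto
  have x0\<Omega>: "x0 \<in> \<Omega>" using x0 E'(3) E\<Omega> by auto
  have Gx0: "norm (G x0) \<le> M" using x0g(1) by (simp add: good_def)
  have n\<xi>0: "norm \<xi>0 \<le> M + 1"
    using \<xi>0[OF x0] Gx0 norm_triangle_ineq[of "\<xi>0 - G x0" "G x0"] \<eta> by simp
  have T\<xi>0: "T x0 \<xi>0 > 1 + 9 * \<delta>"
  proof -
    have "norm (G x0 - \<xi>0) < \<eta>" using \<xi>0[OF x0] \<eta> by (simp add: norm_minus_commute)
    then have "\<bar>T x0 (G x0) - T x0 \<xi>0\<bar> \<le> \<delta>"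
      using cl[OF x0 x0, of "G x0" \<xi>0] Gx0 n\<xi>0 by (simp add: R_def)
    then show ?thesis using x0g(2) by argo
  qed
  define l where "l = 1 + \<delta>"
  have l: "l > 1" "l \<le> 2" using \<delta> by (auto simp: l_def)
  have \<beta>0: "\<beta> \<ge> 0"
  proof -
    have "0 \<le> T x0 0" by (rule T_nonneg[OF x0\<Omega>])
    moreover have "T x0 0 \<le> \<beta> * (1 + norm (0::real^'n^'m) powr r)" using x0g(1) unfolding good_def by blast
    ultimately show ?thesis using r1 by simp
  qed
  \<comment> \<open>Constants of the growth bound for \<open>T x0 (F n x)\<close>: 3 * M + 2
    collects the norms of \<open>\<xi>0\<close>, of the bounded part of \<open>V n x\<close>, of
    \<open>G x\<close> and of \<open>P n x\<close>; the powers of 2 come from two splittings by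
    \<open>powr_add_le\<close>.\<close>
  define C2 where "C2 = 1 + \<beta> * (1 + 2 powr r * (3 * M + 2) powr r + 2 powr r * (2 powr r * (1 + 1 / \<alpha>)))"
  have C2: "C2 > 0" unfolding C2_def using \<beta>0 M1 \<alpha> by (intro add_pos_nonneg mult_nonneg_nonneg add_nonneg_nonneg) auto
  \<comment> \<open>The part of D outside K then contributes at most C2 * \<open>\<kappa>\<close> =
    \<open>\<delta>\<close> per unit volume of D.\<close>
  define \<kappa> where "\<kappa> = \<delta> / C2"
  have \<kappa>: "\<kappa> > 0" "C2 * \<kappa> = \<delta>" using \<delta> C2 by (auto simp: \<kappa>_def)
  have E'l: "E' \<in> sets lebesgue" "emeasure lebesgue E' > 0" "E' \<subseteq> \<Omega>"
    using E' E\<Omega> by (auto simp: sets_restrict_space_iff emeasure_restrict_space)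
  obtain D K where D: "open D" "connected D" "D \<noteq> {}" "D \<subseteq> \<Omega>" and K: "compact K" "K \<subseteq> D" "K \<subseteq> E'"
    and DK: "emeasure lborel (D - K) \<le> ennreal \<kappa> * emeasure lborel D"
    using dense_component[OF open_\<Omega> bounded_\<Omega> E'l(1,3,2) \<kappa>(1)] by auto
  have bD: "bounded D" by (rule bounded_subset[OF bounded_\<Omega> D(4)])
  obtain \<theta> where \<theta>: "test_function D \<theta>" "\<And>x. 0 \<le> \<theta> x" "\<And>x. \<theta> x \<le> 1" "\<And>x. x \<in> K \<Longrightarrow> \<theta> x = 1"
    by (rule smooth_cutoff[OF K(1) D(1) K(2)]) (rule that)
  obtain B where B: "B > 0" "\<And>x. norm (grad \<theta> x) \<le> B"
  proof -
    have "\<forall>i. \<exists>b. \<forall>x. \<bar>pd i \<theta> x\<bar> \<le> b" using test_function_bounded[OF test_function_pd[OF \<theta>(1)]] by metis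
    from choice[OF this] obtain b where b: "\<And>i x. \<bar>pd i \<theta> x\<bar> \<le> b i" by auto
    have "norm (grad \<theta> x) \<le> 1 + \<bar>\<Sum>i\<in>UNIV. b i\<bar>" for x
    proof -
      have "norm (grad \<theta> x) \<le> (\<Sum>i\<in>UNIV. \<bar>grad \<theta> x $ i\<bar>)" by (rule norm_le_l1_cart)
      also have "\<dots> \<le> (\<Sum>i\<in>UNIV. b i)" using b by (intro sum_mono) (simp add: grad_def)
      finally show ?thesis by linarith
    qed
    then show ?thesis by (intro that[of "1 + \<bar>\<Sum>i\<in>UNIV. b i\<bar>"]) auto
  qed
  define CG where "CG = enn2real (\<integral>\<^sup>+x. norm (G x) powr q \<partial>?M)"
  have CG: "CG \<ge> 0" "(\<integral>\<^sup>+x. norm (G x) powr q \<partial>?M) = ennreal CG"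
    using W1_E(3)[OF u] by (auto simp: CG_def Lp_iff G_def)
  have q1: "q \<ge> 1" using q by simp
  have VC: "(\<integral>\<^sup>+x. norm (V n x) powr q \<partial>?M) \<le> ennreal C" for n unfolding V_def by (rule C(2))
  have Zq: "(\<integral>\<^sup>+x. norm (V n x - G x) powr q \<partial>?M) \<le> ennreal (2 powr q * (C + CG))" for n
    by (rule nn_integral_diff_powr_le[OF q1 Vm Gm VC eq_refl[OF CG(2)] C(1) CG(1)])
  have Z: "\<And>n. W0 (\<lambda>x. v n x - u x) (\<lambda>x. V n x - G x)" using W by (simp add: V_def G_def)
  have C4: "2 powr q * (C + CG) \<ge> 0" using C(1) CG(1) by simp
  from mollified_differences[where z = "\<lambda>n x. v n x - u x" and Z = "\<lambda>n x. V n x - G x", OF Z q(2) C4 Zq \<epsilon>0 close]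
  obtain w where w: "\<forall>n k. smooth (\<lambda>x. w n x $ k)" "\<forall>n x. norm (w n x) \<le> \<epsilon> n" "\<forall>n. Dmap (w n) \<in> borel_measurable borel"
    and wL1: "(\<lambda>n. \<integral>\<^sup>+x. norm (Dmap (w n) x - (V n x - G x)) \<partial>?M) \<longlonglongrightarrow> 0"
    and wLr: "(\<lambda>n. \<integral>\<^sup>+x. norm (Dmap (w n) x - (V n x - G x)) powr r \<partial>?M) \<longlonglongrightarrow> 0"
    by (elim exE conjE)
  define e where "e = (\<lambda>n x. Dmap (w n) x - (V n x - G x))"
  have Dwm [measurable]: "Dmap (w n) \<in> borel_measurable ?M" for n
    using w(3) by (simp add: measurable_completion measurable_restrict_space1)
  have em [measurable]: "e n \<in> borel_measurable ?M" for n unfolding e_def by measurable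
  define P where "P = (\<lambda>n x. (\<chi> k. w n x $ k *\<^sub>R grad \<theta> x) :: real^'n^'m)"
  \<comment> \<open>The argument of \<open>T x0\<close> in the quasiconvexity test. P n stems from
    the gradient of the cut-off and is small because w n tends to 0 uniformly while the cut-off is
    fixed.\<close>
  define F where "F = (\<lambda>n x. \<xi>0 + (\<theta> x *\<^sub>R Dmap (w n) x + P n x))"
  have Pb: "norm (P n x) \<le> CARD('m) * \<epsilon> n * B" for n x
    unfolding P_def using w(2) B(2) \<epsilon>0 by (intro rank_one_norm_le) auto
  have "(\<lambda>n. CARD('m) * \<epsilon> n * B) \<longlonglongrightarrow> real CARD('m) * 0 * B" by (intro tendsto_intros \<epsilon>(2))
  then have Pe: "\<forall>\<^sub>F n in sequentially. CARD('m) * \<epsilon> n * B < \<eta> / 3" using \<eta> by (intro order_tendstoD) auto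
  define tt where "tt = (\<lambda>n. tail l (V n))"
  have ttm [measurable]: "tt n \<in> borel_measurable ?M" for n unfolding tt_def by (rule tail_measurable[OF Vm])
  define C5 where "C5 = C2 * (2 + 3 / \<eta>)"
  have C5: "C5 \<ge> 0" "2 * C2 \<le> C5" using C2 \<eta> by (auto simp: C5_def)
  \<comment> \<open>On the good part of K, \<open>F n x\<close> is within \<open>\<eta>\<close> of
    the gradient of v n and near-constancy applies. Elsewhere only the growth bound is available,
    and its constant term has to be absorbed: off K by the indicator, on K by the tail or by |e n
    x|.\<close>
  have pt: "AE x in ?M. x \<in> D \<longrightarrow> T x0 (F n x) \<le> (l + \<delta>) + C2 * indicator (D - K) x + C5 * (norm (e n x) + norm (e n x) powr r + tt n x)"
    if Pn: "CARD('m) * \<epsilon> n * B < \<eta> / 3" for n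
    using growth GM AE_space
  proof eventually_elim
    case (elim x)
    show ?case
    proof
      assume xD: "x \<in> D"
      have x\<Omega>: "x \<in> \<Omega>" using xD D(4) by auto
      have tn: "tt n x \<ge> 0" using T_nonneg[OF x\<Omega>] by (simp add: tt_def tail_def)
      have Px: "norm (P n x) < \<eta> / 3" using Pb[of n x] Pn by simp
      have general: "T x0 (F n x) \<le> C2 + C2 * (norm (e n x) powr r + tt n x)"
      proof -
        define V' where "V' = (if T x (V n x) > l then norm (V n x) else 0)"
        have Vb: "norm (V n x) \<le> M + V'"
          using coercive(2)[OF elim(1), of "V n x"] l(2) M1 by (auto simp: V'_def M_def)
        have V'0: "V' \<ge> 0" by (simp add: V'_def)
        have V'r: "V' powr r \<le> tt n x / \<alpha>"
          using coercive(1)[OF elim(1), of "V n x"] tn r1 by (auto simp: V'_def tt_def tail_def)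
        have "Dmap (w n) x = V n x - G x + e n x" by (simp add: e_def)
        then have "norm (Dmap (w n) x) \<le> norm (V n x) + norm (G x) + norm (e n x)"
          using norm_triangle_ineq[of "V n x - G x" "e n x"] norm_triangle_ineq4[of "V n x" "G x"] by simp
        moreover have "norm (\<theta> x *\<^sub>R Dmap (w n) x) \<le> norm (Dmap (w n) x)"
          using \<theta>(2,3)[of x] by (simp add: mult_left_le_one_le)
        moreover have "norm (F n x) \<le> norm \<xi>0 + (norm (\<theta> x *\<^sub>R Dmap (w n) x) + norm (P n x))"
          unfolding F_def by (intro norm_triangle_le add_left_mono norm_triangle_ineq)
        ultimately have "norm (F n x) \<le> (3 * M + 2) + (V' + norm (e n x))"
          using n\<xi>0 Vb elim(2) Px \<eta>(2) by linarith
        then have "norm (F n x) powr r \<le> ((3 * M + 2) + (V' + norm (e n x))) powr r"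
          using r1 by (intro powr_mono2) auto
        also have "\<dots> \<le> 2 powr r * ((3 * M + 2) powr r + (V' + norm (e n x)) powr r)"
          using r1 M1 V'0 by (intro powr_add_le) auto
        also have "\<dots> \<le> 2 powr r * ((3 * M + 2) powr r + 2 powr r * (V' powr r + norm (e n x) powr r))"
          using r1 V'0 by (intro mult_left_mono add_left_mono powr_add_le) auto
        also have "\<dots> \<le> 2 powr r * ((3 * M + 2) powr r + 2 powr r * (tt n x / \<alpha> + norm (e n x) powr r))"
          using V'r by (intro mult_left_mono add_left_mono add_right_mono) auto
        finally have Fr: "norm (F n x) powr r \<le> 2 powr r * ((3 * M + 2) powr r + 2 powr r * (tt n x / \<alpha> + norm (e n x) powr r))" .
        define s where "s = norm (e n x) powr r + tt n x"
        have s0: "s \<ge> 0" using tn by (simp add: s_def)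
        have "tt n x / \<alpha> \<le> (1 / \<alpha>) * s" using \<alpha> by (simp add: s_def divide_right_mono)
        moreover have "norm (e n x) powr r \<le> 1 * s" using tn by (simp add: s_def)
        ultimately have "tt n x / \<alpha> + norm (e n x) powr r \<le> (1 + 1 / \<alpha>) * s" by (simp add: algebra_simps)
        then have "2 powr r * ((3 * M + 2) powr r + 2 powr r * (tt n x / \<alpha> + norm (e n x) powr r)) \<le>
          2 powr r * ((3 * M + 2) powr r + 2 powr r * ((1 + 1 / \<alpha>) * s))"
          by (intro mult_left_mono add_left_mono) auto
        with Fr have Fr': "norm (F n x) powr r \<le> 2 powr r * ((3 * M + 2) powr r + 2 powr r * ((1 + 1 / \<alpha>) * s))" by linarith
        have "T x0 (F n x) \<le> \<beta> * (1 + norm (F n x) powr r)" using x0g(1) by (simp add: good_def)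
        also have "\<dots> \<le> \<beta> * (1 + 2 powr r * ((3 * M + 2) powr r + 2 powr r * ((1 + 1 / \<alpha>) * s)))"
          using Fr' \<beta>0 by (intro mult_left_mono) auto
        also have "\<dots> \<le> C2 * (1 + s)"
        proof -
          define a b where "a = 2 powr r * (3 * M + 2) powr r" and "b = 2 powr r * (2 powr r * (1 + 1 / \<alpha>))"
          have ab: "a \<ge> 0" "b \<ge> 0" using M1 \<alpha> by (auto simp: a_def b_def)
          have "\<beta> * (1 + 2 powr r * ((3 * M + 2) powr r + 2 powr r * ((1 + 1 / \<alpha>) * s))) = \<beta> * (1 + a) + \<beta> * b * s"
            by (simp add: a_def b_def algebra_simps)
          also have "\<dots> \<le> C2 + C2 * s"
          proof (intro add_mono mult_right_mono s0)
            have C2': "C2 = 1 + \<beta> * (1 + a + b)" by (simp add: C2_def a_def b_def)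
            have "\<beta> * (1 + a) \<le> \<beta> * (1 + a + b)" "\<beta> * b \<le> \<beta> * (1 + a + b)" using \<beta>0 ab by (auto intro!: mult_left_mono)
            then show "\<beta> * (1 + a) \<le> C2" "\<beta> * b \<le> C2" unfolding C2' by linarith+
          qed
          finally show ?thesis by (simp add: algebra_simps)
        qed
        finally show ?thesis by (simp add: s_def algebra_simps)
      qed
      have pos: "0 \<le> norm (e n x) powr r" "0 \<le> norm (e n x)" by auto
      have C5a: "2 * C2 * (norm (e n x) powr r + tt n x) \<le> C5 * (norm (e n x) powr r + tt n x)"
        using C5(2) tn by (intro mult_right_mono) auto
      have C5b: "0 \<le> C5 * norm (e n x)" using C5(1) by simp
      show "T x0 (F n x) \<le> (l + \<delta>) + C2 * indicator (D - K) x + C5 * (norm (e n x) + norm (e n x) powr r + tt n x)"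
      proof (cases "x \<in> K")
        case False
        have "C2 * (norm (e n x) powr r + tt n x) \<le> 2 * C2 * (norm (e n x) powr r + tt n x)"
          using C2 tn by (intro mult_right_mono) auto
        moreover have "C5 * (norm (e n x) + norm (e n x) powr r + tt n x) = C5 * norm (e n x) + C5 * (norm (e n x) powr r + tt n x)"
          by (simp add: algebra_simps)
        ultimately show ?thesis using general False xD C5a C5b l(1) \<delta>(1) by simp
      next
        case True
        then have xE: "x \<in> E'" using K(3) by auto
        show ?thesis
        proof (cases "T x (V n x) \<le> l \<and> norm (e n x) < \<eta> / 3")
          case True
          have VM: "norm (V n x) \<le> M" using coercive(2)[OF elim(1), of "V n x"] True l(2) by (simp add: M_def)
          \<comment> \<open>On K the cut-off is 1, so the difference has three terms, each of norm
            below \<open>\<eta> / 3\<close>.\<close>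
          have Feq: "F n x - V n x = (\<xi>0 - G x) + (e n x + P n x)"
            using \<theta>(4)[OF \<open>x \<in> K\<close>] by (simp add: F_def e_def)
          have "norm (F n x - V n x) \<le> norm (\<xi>0 - G x) + (norm (e n x) + norm (P n x))"
            unfolding Feq by (intro norm_triangle_le add_left_mono norm_triangle_ineq)
          then have FV: "norm (F n x - V n x) < \<eta>" using \<xi>0[OF xE] True Px by linarith
          have "norm (F n x) \<le> norm (V n x) + norm (F n x - V n x)" using norm_triangle_ineq[of "V n x" "F n x - V n x"] by simp
          then have "norm (F n x) \<le> R" using VM FV \<eta>(2) by (simp add: R_def)
          then have "\<bar>T x0 (F n x) - T x (V n x)\<bar> \<le> \<delta>" using cl[OF x0 xE _ _ FV] VM by (simp add: R_def)
          then have "T x0 (F n x) \<le> l + \<delta>" using True by linarith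
          moreover have "0 \<le> C5 * (norm (e n x) + norm (e n x) powr r + tt n x)" using C5(1) tn by simp
          ultimately show ?thesis using \<open>x \<in> K\<close> by simp
        next
          case False
          \<comment> \<open>A failure of the good case is charged to the errors: either the tail
            exceeds l > 1, or |e n x| is at least \<open>\<eta> / 3\<close>.\<close>
          have "1 \<le> tt n x + 3 / \<eta> * norm (e n x)"
          proof (cases "T x (V n x) \<le> l")
            case True
            then have "\<eta> / 3 \<le> norm (e n x)" using False by simp
            then have "1 \<le> 3 / \<eta> * norm (e n x)" using \<eta> by (simp add: field_simps)
            then show ?thesis using tn by linarith
          next
            case False
            then have "tt n x \<ge> 1" using l by (simp add: tt_def tail_def)
            moreover have "0 \<le> 3 / \<eta> * norm (e n x)" using \<eta> by simp
            ultimately show ?thesis by linarith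
          qed
          then have "C2 * 1 \<le> C2 * (tt n x + 3 / \<eta> * norm (e n x))" using C2 by (intro mult_left_mono) auto
          then have "C2 + C2 * (norm (e n x) powr r + tt n x) \<le> C2 * (3 / \<eta>) * norm (e n x) + 2 * C2 * (norm (e n x) powr r + tt n x)"
            using C2 using mult_nonneg_nonneg[OF less_imp_le[OF C2] powr_ge_zero[of "norm (e n x)" r]]
            unfolding distrib_left mult.assoc[symmetric] by linarith
          also have "\<dots> \<le> C5 * norm (e n x) + C5 * (norm (e n x) powr r + tt n x)"
            using C2 using C2 by (intro add_mono C5a mult_right_mono) (auto simp: C5_def distrib_left)
          finally show ?thesis using general \<open>x \<in> K\<close> l(1) \<delta>(1) by (simp add: algebra_simps)
        qed
      qed
    qed
  qed
  define I where "I = (\<lambda>n. ennreal C5 * ((\<integral>\<^sup>+x. norm (e n x) \<partial>?M) + (\<integral>\<^sup>+x. norm (e n x) powr r \<partial>?M) + (\<integral>\<^sup>+x. tt n x \<partial>?M)))"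
  have I0: "I \<longlonglongrightarrow> 0"
  proof -
    have "I \<longlonglongrightarrow> ennreal C5 * (0 + 0 + 0)" unfolding I_def e_def tt_def V_def
      using wL1 wLr tl[OF l(1)] unfolding V_def by (intro ennreal_tendsto_cmult tendsto_add) auto
    then show ?thesis by simp
  qed
  have finD: "emeasure lborel D < \<infinity>" by (rule emeasure_bounded_finite[OF bD])
  define d where "d = measure lborel D"
  have dD: "emeasure lborel D = ennreal d" using finD by (simp add: d_def emeasure_eq_ennreal_measure less_top)
  have "emeasure lborel D \<noteq> 0"
    using open_not_negligible[OF D(1,3)] D(1) by (auto simp: negligible_iff_null_sets null_sets_def)
  then have d: "d > 0" using dD by (cases "d > 0") (auto simp: ennreal_neg)
  have "\<delta> * d > 0" using \<delta> d by simp
  from eventually_conj[OF Pe ennreal_tendsto_0D[OF I0 this]]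
  obtain n where n: "CARD('m) * \<epsilon> n * B < \<eta> / 3" "I n \<le> ennreal (\<delta> * d)" by (auto simp: eventually_sequentially)
  have Ds: "D \<inter> space lebesgue \<in> sets lebesgue" "D \<in> sets lebesgue" "K \<in> sets lebesgue" "K \<in> sets borel" "D \<in> sets borel"
    using D(1) K(1) by (auto simp: borel_compact)
  have "ennreal (T x0 \<xi>0) * emeasure lborel D \<le> (\<integral>\<^sup>+x. T x0 (F n x) \<partial>lebesgue_on D)"
    unfolding F_def P_def
  proof (rule quasiconvex_test[OF D(1) bD D(3) _ \<theta>(1)])
    show "0 \<le> T x0 \<xi>" for \<xi> by (rule T_nonneg[OF x0\<Omega>])
    show "smooth (\<lambda>x. w n x $ k)" for k using w(1) by simp
    show "T x0 \<xi>0 \<le> 1 / measure lebesgue D * (LINT x|lebesgue_on D. T x0 (\<xi>0 + wgrad D \<phi> x))" if "\<phi> \<in> W1_0 \<infinity> D" for \<phi>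
    proof -
      have "bounded_domain D" using D bD by (simp add: bounded_domain_def)
      then show ?thesis using x0g(1) that unfolding good_def by blast
    qed
  qed
  also have "\<dots> = (\<integral>\<^sup>+x. ennreal (T x0 (F n x)) * indicator D x \<partial>lebesgue)" by (rule nn_integral_restrict_space[OF Ds(1)])
  also have "\<dots> = (\<integral>\<^sup>+x. ennreal (T x0 (F n x)) * indicator D x \<partial>?M)"
  proof -
    have "(\<integral>\<^sup>+x. ennreal (T x0 (F n x)) * indicator D x \<partial>?M) = (\<integral>\<^sup>+x. ennreal (T x0 (F n x)) * indicator D x * indicator \<Omega> x \<partial>lebesgue)"
      by (rule nn_integral_restrict_space) simp
    also have "\<dots> = (\<integral>\<^sup>+x. ennreal (T x0 (F n x)) * indicator D x \<partial>lebesgue)"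
      using D(4) by (intro nn_integral_cong) (auto simp: indicator_def)
    finally show ?thesis by simp
  qed
  also have "\<dots> \<le> (\<integral>\<^sup>+x. (ennreal (l + \<delta>) * indicator D x + ennreal C2 * indicator (D - K) x) +
      ennreal C5 * (ennreal (norm (e n x)) + ennreal (norm (e n x) powr r) + ennreal (tt n x)) \<partial>?M)"
  proof (rule nn_integral_mono_AE)
    show "AE x in ?M. ennreal (T x0 (F n x)) * indicator D x \<le> (ennreal (l + \<delta>) * indicator D x + ennreal C2 * indicator (D - K) x) +
      ennreal C5 * (ennreal (norm (e n x)) + ennreal (norm (e n x) powr r) + ennreal (tt n x))"
      using pt[OF n(1)] AE_space
    proof eventually_elim
      case (elim x)
      show ?case
      proof (cases "x \<in> D")
        case True
        have tn: "tt n x \<ge> 0" using T_nonneg[of x] elim(2) by (simp add: tt_def tail_def)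
        have "ennreal (T x0 (F n x)) \<le> ennreal (((l + \<delta>) + C2 * indicator (D - K) x) + C5 * (norm (e n x) + norm (e n x) powr r + tt n x))"
          using elim(1) True by (intro ennreal_leI) simp
        also have "\<dots> = (ennreal (l + \<delta>) + ennreal (C2 * indicator (D - K) x)) + ennreal C5 * (ennreal (norm (e n x)) + ennreal (norm (e n x) powr r) + ennreal (tt n x))"
          using l(1) \<delta>(1) C2 C5(1) tn by (simp add: ennreal_plus[symmetric] ennreal_mult[symmetric] del: ennreal_plus)
        finally show ?thesis using True by (cases "x \<in> K") auto
      qed simp
    qed
  qed
  also have "\<dots> = (\<integral>\<^sup>+x. ennreal (l + \<delta>) * indicator D x + ennreal C2 * indicator (D - K) x \<partial>?M) + I n"
  proof -
    have [measurable]: "D \<in> sets ?M" "D - K \<in> sets ?M" using Ds D(4) by (auto simp: sets_restrict_space_iff)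
    have "(\<integral>\<^sup>+x. ennreal C5 * (ennreal (norm (e n x)) + ennreal (norm (e n x) powr r) + ennreal (tt n x)) \<partial>?M) = I n"
      unfolding I_def by (subst nn_integral_cmult, simp, subst nn_integral_add, simp, simp, subst nn_integral_add, simp, simp, rule refl)
    then show ?thesis by (subst nn_integral_add, simp, simp, simp)
  qed
  also have "(\<integral>\<^sup>+x. ennreal (l + \<delta>) * indicator D x + ennreal C2 * indicator (D - K) x \<partial>?M) = ennreal (l + \<delta>) * emeasure lborel D + ennreal C2 * emeasure lborel (D - K)"
  proof -
    have sM: "D \<in> sets ?M" "D - K \<in> sets ?M" using Ds D(4) by (auto simp: sets_restrict_space_iff)
    have "D - K \<in> sets borel" "D - K \<subseteq> \<Omega>" using Ds(4,5) D(4) by auto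
    then have eM: "emeasure ?M D = emeasure lborel D" "emeasure ?M (D - K) = emeasure lborel (D - K)"
      using D(4) Ds(5) by (simp_all add: emeasure_restrict_space)
    show ?thesis using sM unfolding eM[symmetric]
      by (subst nn_integral_add) (auto simp: nn_integral_cmult_indicator)
  qed
  \<comment> \<open>Per unit volume of D: l + \<open>\<delta>\<close> for all of D,
    \<open>\<delta>\<close> for D - K, and \<open>\<delta>\<close> for the integrated
    errors.\<close>
  also have "\<dots> + I n \<le> ennreal (l + \<delta>) * ennreal d + ennreal C2 * (ennreal \<kappa> * ennreal d) + ennreal (\<delta> * d)"
    using DK n(2) unfolding dD by (intro add_mono mult_left_mono order_refl) auto
  also have "\<dots> = ennreal ((l + \<delta>) * d + C2 * \<kappa> * d + \<delta> * d)"
    using l(1) \<delta>(1) d C2 \<kappa>(1) by (simp add: ennreal_plus[symmetric] ennreal_mult[symmetric] mult.assoc del: ennreal_plus)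
  finally have "ennreal (T x0 \<xi>0 * d) \<le> ennreal ((l + \<delta>) * d + C2 * \<kappa> * d + \<delta> * d)"
    using T_nonneg[OF x0\<Omega>, of \<xi>0] d by (simp add: dD ennreal_mult)
  then have "T x0 \<xi>0 * d \<le> (l + \<delta>) * d + C2 * \<kappa> * d + \<delta> * d"
    using l(1) \<delta>(1) d C2 \<kappa>(1) by (subst (asm) ennreal_le_iff) auto
  also have "\<dots> = (1 + 4 * \<delta>) * d" unfolding \<kappa>(2) l_def by (simp add: algebra_simps)
  finally have "T x0 \<xi>0 \<le> 1 + 4 * \<delta>" using d by simp
  then show False using T\<xi>0 \<delta>(1) by argo
qed

end

section \<open>Compactness in Hoelder spaces and estimates up to the boundary\<close>

subsection \<open>Hoelder spaces\<close>

lemma holder_norm_le: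
  assumes "\<And>x. x \<in> S \<Longrightarrow> norm (f x) \<le> A" "\<And>x y. x \<in> S \<Longrightarrow> y \<in> S \<Longrightarrow> norm (f x - f y) \<le> H * dist x y powr a"
  shows "holder_norm a S f \<le> ereal (A + H)"
proof -
  have "holder_norm a S f \<le> ereal A + ereal H" unfolding holder_norm_def
  proof (rule add_mono)
    show "(SUP x\<in>S. ereal (norm (f x))) \<le> ereal A" using assms(1) by (intro SUP_least) simp
    show "(SUP (x, y)\<in>{(x, y). x \<in> S \<and> y \<in> S \<and> x \<noteq> y}. ereal (norm (f x - f y) / dist x y powr a)) \<le> ereal H"
    proof (rule SUP_least, clarify)
      fix x y assume "x \<in> S" "y \<in> S" "x \<noteq> y"
      then show "ereal (norm (f x - f y) / dist x y powr a) \<le> ereal H"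
        using assms(2)[of x y] by (simp add: pos_divide_le_eq)
    qed
  qed
  then show ?thesis by simp
qed

text \<open>Without two distinct points a supremum in the norm is over the empty set and equals minus infinity.\<close>

lemma holder_norm_nonneg:
  assumes "x \<in> S" "y \<in> S" "x \<noteq> y"
  shows "0 \<le> holder_norm a S f"
proof -
  have "0 \<le> ereal (norm (f x))" by simp
  also have "\<dots> \<le> (SUP x\<in>S. ereal (norm (f x)))" by (rule SUP_upper[OF assms(1)])
  finally have 1: "0 \<le> (SUP x\<in>S. ereal (norm (f x)))" .
  have "0 \<le> (case (x, y) of (x, y) \<Rightarrow> ereal (norm (f x - f y) / dist x y powr a))" by simp
  also have "\<dots> \<le> (SUP (x, y)\<in>{(x, y). x \<in> S \<and> y \<in> S \<and> x \<noteq> y}. ereal (norm (f x - f y) / dist x y powr a))"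
    by (rule SUP_upper) (use assms in auto)
  finally show ?thesis unfolding holder_norm_def using 1 by (intro add_nonneg_nonneg)
qed

lemma holder_norm_add:
  "holder_norm a S (\<lambda>x. f x + h x) \<le> holder_norm a S f + holder_norm a S h"
proof -
  let ?A = "\<lambda>f. SUP x\<in>S. ereal (norm (f x))"
  let ?H = "\<lambda>f. SUP (x, y)\<in>{(x, y). x \<in> S \<and> y \<in> S \<and> x \<noteq> y}. ereal (norm (f x - f y) / dist x y powr a)"
  have "?A (\<lambda>x. f x + h x) \<le> ?A f + ?A h"
  proof (rule SUP_least)
    fix x assume x: "x \<in> S"
    have "ereal (norm (f x + h x)) \<le> ereal (norm (f x)) + ereal (norm (h x))" by (simp add: norm_triangle_ineq)
    also have "\<dots> \<le> ?A f + ?A h" by (intro add_mono SUP_upper x)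
    finally show "ereal (norm (f x + h x)) \<le> ?A f + ?A h" .
  qed
  moreover have "?H (\<lambda>x. f x + h x) \<le> ?H f + ?H h"
  proof (rule SUP_least, clarify)
    fix x y assume xy: "x \<in> S" "y \<in> S" "x \<noteq> y"
    have up: "ereal (norm (k x - k y) / dist x y powr a) \<le> ?H k" for k :: "real^'a \<Rightarrow> real^'b"
      using SUP_upper[of "(x, y)" "{(x, y). x \<in> S \<and> y \<in> S \<and> x \<noteq> y}" "\<lambda>(x, y). ereal (norm (k x - k y) / dist x y powr a)"] xy by simp
    have "norm ((f x + h x) - (f y + h y)) \<le> norm (f x - f y) + norm (h x - h y)"
      by (metis add_diff_add norm_triangle_ineq)
    then have "norm ((f x + h x) - (f y + h y)) / dist x y powr a \<le> norm (f x - f y) / dist x y powr a + norm (h x - h y) / dist x y powr a"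
      by (simp add: add_divide_distrib[symmetric] divide_right_mono)
    then have "ereal (norm ((f x + h x) - (f y + h y)) / dist x y powr a) \<le> ereal (norm (f x - f y) / dist x y powr a) + ereal (norm (h x - h y) / dist x y powr a)"
      by simp
    also have "\<dots> \<le> ?H f + ?H h" by (intro add_mono up)
    finally show "ereal (norm ((f x + h x) - (f y + h y)) / dist x y powr a) \<le> ?H f + ?H h" .
  qed
  ultimately have "?A (\<lambda>x. f x + h x) + ?H (\<lambda>x. f x + h x) \<le> (?A f + ?A h) + (?H f + ?H h)" by (rule add_mono)
  also have "\<dots> = (?A f + ?H f) + (?A h + ?H h)" by (simp only: ac_simps)
  finally show ?thesis unfolding holder_norm_def .
qed

text \<open>Uniform convergence is interpolated with the bound for the larger exponent.\<close>

lemma holder_compact: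
  fixes f :: "nat \<Rightarrow> real^'n \<Rightarrow> real^'m" and a a' B :: real
  assumes S: "compact S" "x1 \<in> S" "x2 \<in> S" "x1 \<noteq> x2" and a: "0 < a" "a < a'"
    and B: "\<And>k x. x \<in> S \<Longrightarrow> norm (f k x) \<le> B"
    and H: "\<And>k x y. x \<in> S \<Longrightarrow> y \<in> S \<Longrightarrow> norm (f k x - f k y) \<le> B * dist x y powr a'"
  shows "\<exists>\<rho> w. strict_mono (\<rho> :: nat \<Rightarrow> nat) \<and> continuous_on S w \<and> w \<in> holder_space a S \<and>
    (\<lambda>k. holder_norm a S (\<lambda>x. f (\<rho> k) x - w x)) \<longlonglongrightarrow> 0 \<and>
    (\<forall>e>0. \<exists>N. \<forall>k\<ge>N. \<forall>x\<in>S. norm (f (\<rho> k) x - w x) < e)"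
proof -
  have B0: "B \<ge> 0" using B[OF S(2), of 0] norm_ge_zero[of "f 0 x1"] by linarith
  have equi: "\<exists>d. 0 < d \<and> (\<forall>n y. y \<in> S \<and> norm (x - y) < d \<longrightarrow> norm (f n x - f n y) < e)" if "x \<in> S" "0 < e" for x e
  proof -
    define d where "d = (e / (B + 1)) powr (1 / a')"
    have d: "d > 0" using that B0 by (simp add: d_def)
    have "norm (f n x - f n y) < e" if y: "y \<in> S" "norm (x - y) < d" for n y
    proof -
      have "dist x y powr a' \<le> d powr a'" using y a by (intro powr_mono2) (auto simp: dist_norm)
      also have "d powr a' = e / (B + 1)" using that \<open>0 < e\<close> B0 a by (simp add: d_def powr_powr)
      finally have "B * dist x y powr a' \<le> B * (e / (B + 1))" using B0 by (intro mult_left_mono)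
      also have "\<dots> < e" using \<open>0 < e\<close> B0 by (simp add: field_simps)
      finally show ?thesis using H[OF \<open>x \<in> S\<close> y(1), of n] by linarith
    qed
    then show ?thesis using d by blast
  qed
  obtain w \<rho> where w: "continuous_on S w" and \<rho>: "strict_mono (\<rho> :: nat \<Rightarrow> nat)"
    and cv: "\<And>e. 0 < e \<Longrightarrow> \<exists>N. \<forall>n x. n \<ge> N \<and> x \<in> S \<longrightarrow> norm (f (\<rho> n) x - w x) < e"
    by (rule Arzela_Ascoli[OF S(1) B equi]) (assumption | rule that)+
  have pw: "(\<lambda>n. f (\<rho> n) x) \<longlonglongrightarrow> w x" if "x \<in> S" for x
  proof (rule LIMSEQ_I)
    fix e :: real assume "0 < e"
    from cv[OF this] show "\<exists>no. \<forall>n\<ge>no. norm (f (\<rho> n) x - w x) < e" using that by blast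
  qed
  have wH: "norm (w x - w y) \<le> B * dist x y powr a'" if "x \<in> S" "y \<in> S" for x y
    using H[OF that] by (intro tendsto_upperbound[OF tendsto_norm[OF tendsto_diff[OF pw[OF that(1)] pw[OF that(2)]]]] always_eventually allI) auto
  have wB: "norm (w x) \<le> B" if "x \<in> S" for x
    using B[OF that] by (intro tendsto_upperbound[OF tendsto_norm[OF pw[OF that]]] always_eventually allI) auto
  \<comment> \<open>The factor with exponent a / a' uses the Hoelder bound for a', the other one the
    uniform bound; a small uniform distance thus makes the Hoelder seminorm for a small.\<close>
  have interp: "norm (y :: real^'m) \<le> (2 * B) powr (a / a') * (2 * \<sigma>) powr (1 - a / a') * t powr a"
    if "norm y \<le> 2 * B * t powr a'" "norm y \<le> 2 * \<sigma>" "t \<ge> 0" for y \<sigma> t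
  proof -
    have "norm y = norm y powr (a / a') * norm y powr (1 - a / a')"
      by (cases "norm y = 0") (simp_all add: powr_add[symmetric])
    also have "\<dots> \<le> (2 * B * t powr a') powr (a / a') * (2 * \<sigma>) powr (1 - a / a')"
      using that a by (intro mult_mono powr_mono2) auto
    also have "(2 * B * t powr a') powr (a / a') = (2 * B) powr (a / a') * t powr a"
      using B0 a by (simp add: powr_mult powr_powr)
    finally show ?thesis by (simp add: ac_simps)
  qed
  have hn: "holder_norm a S (\<lambda>x. f (\<rho> k) x - w x) \<le> ereal (\<sigma> + (2 * B) powr (a / a') * (2 * \<sigma>) powr (1 - a / a'))"
    if k: "\<And>x. x \<in> S \<Longrightarrow> norm (f (\<rho> k) x - w x) \<le> \<sigma>" for k \<sigma>
  proof (rule holder_norm_le[OF k])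
    fix x y assume xy: "x \<in> S" "y \<in> S"
    let ?d = "(f (\<rho> k) x - w x) - (f (\<rho> k) y - w y)"
    have "norm ?d \<le> norm (f (\<rho> k) x - f (\<rho> k) y) + norm (w x - w y)"
      using norm_triangle_ineq4[of "f (\<rho> k) x - f (\<rho> k) y" "w x - w y"] by (simp add: algebra_simps)
    then have "norm ?d \<le> 2 * B * dist x y powr a'" using H[OF xy, of "\<rho> k"] wH[OF xy] by simp
    moreover have "norm ?d \<le> 2 * \<sigma>" using norm_triangle_ineq4[of "f (\<rho> k) x - w x" "f (\<rho> k) y - w y"] k[OF xy(1)] k[OF xy(2)] by linarith
    ultimately show "norm ?d \<le> (2 * B) powr (a / a') * (2 * \<sigma>) powr (1 - a / a') * dist x y powr a" by (rule interp) simp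
  qed
  have lim: "(\<lambda>k. holder_norm a S (\<lambda>x. f (\<rho> k) x - w x)) \<longlonglongrightarrow> 0"
  proof (rule order_tendstoI)
    fix y :: ereal assume "y < 0"
    then show "\<forall>\<^sub>F k in sequentially. y < holder_norm a S (\<lambda>x. f (\<rho> k) x - w x)"
      using holder_norm_nonneg[OF S(2-4)] by (intro always_eventually allI) (rule less_le_trans)
  next
    fix y :: ereal assume "0 < y"
    then obtain e where e: "0 < ereal e" "ereal e < y" using ereal_dense2 by blast
    have "((\<lambda>\<sigma>. \<sigma> + (2 * B) powr (a / a') * (2 * \<sigma>) powr (1 - a / a')) \<longlongrightarrow> 0 + (2 * B) powr (a / a') * (2 * 0) powr (1 - a / a')) (at_right 0)"
      using a by (intro tendsto_intros tendsto_powr') (auto simp: eventually_at_filter)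
    then have "((\<lambda>\<sigma>. \<sigma> + (2 * B) powr (a / a') * (2 * \<sigma>) powr (1 - a / a')) \<longlongrightarrow> 0) (at_right 0)" by simp
    from order_tendstoD(2)[OF this, of e] have "\<forall>\<^sub>F \<sigma> in at_right 0. \<sigma> + (2 * B) powr (a / a') * (2 * \<sigma>) powr (1 - a / a') < e" using e by simp
    then obtain b where b: "b > 0" "\<And>\<sigma>. 0 < \<sigma> \<Longrightarrow> \<sigma> < b \<Longrightarrow> \<sigma> + (2 * B) powr (a / a') * (2 * \<sigma>) powr (1 - a / a') < e"
      by (auto simp: eventually_at_right_field)
    obtain N where N: "\<And>n x. n \<ge> N \<Longrightarrow> x \<in> S \<Longrightarrow> norm (f (\<rho> n) x - w x) < b / 2" using cv[of "b/2"] b(1) by auto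
    have "holder_norm a S (\<lambda>x. f (\<rho> k) x - w x) < y" if "k \<ge> N" for k
    proof -
      have "holder_norm a S (\<lambda>x. f (\<rho> k) x - w x) \<le> ereal (b/2 + (2 * B) powr (a / a') * (2 * (b/2)) powr (1 - a / a'))"
        by (rule hn) (use N[OF that] in \<open>auto intro: less_imp_le\<close>)
      also have "\<dots> < y" using b(2)[of "b/2"] b(1) e(2) by (intro less_trans[OF _ e(2)]) simp
      finally show ?thesis .
    qed
    then show "\<forall>\<^sub>F k in sequentially. holder_norm a S (\<lambda>x. f (\<rho> k) x - w x) < y"
      by (auto simp: eventually_sequentially)
  qed
  have "w \<in> holder_space a S"
  proof -
    have "norm (w x - w y) \<le> (2 * B) powr (a / a') * (2 * B) powr (1 - a / a') * dist x y powr a" if xy: "x \<in> S" "y \<in> S" for x y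
    proof (rule interp)
      show "norm (w x - w y) \<le> 2 * B * dist x y powr a'" using wH[OF xy] B0 by (intro order_trans[OF wH[OF xy]] mult_right_mono) auto
      show "norm (w x - w y) \<le> 2 * B" using norm_triangle_ineq4[of "w x" "w y"] wB[OF xy(1)] wB[OF xy(2)] by linarith
    qed simp
    from holder_norm_le[OF wB this] have "holder_norm a S w \<le> ereal (B + (2 * B) powr (a / a') * (2 * B) powr (1 - a / a'))" .
    then show ?thesis unfolding holder_space_def by (auto intro: le_less_trans)
  qed
  moreover have "\<forall>e>0. \<exists>N. \<forall>k\<ge>N. \<forall>x\<in>S. norm (f (\<rho> k) x - w x) < e" using cv by blast
  ultimately show ?thesis using w \<rho> lim by (intro exI[of _ \<rho>] exI[of _ w]) blast
qed

lemma frequently_at_top_ex: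
  fixes M :: real
  assumes "\<exists>\<^sub>F p in at_top. Q p"
  shows "\<exists>p\<ge>M. Q p"
  using assms by (auto simp: frequently_def eventually_at_top_linorder)

context bounded_open
begin

text \<open>The part of \<Omega> where d > e is open, and a nonempty open set is not null;
  continuity extends the bound to the closure.\<close>

lemma AE_le_closure:
  fixes d :: "real^'n \<Rightarrow> real"
  assumes c: "continuous_on (closure \<Omega>) d" and ae: "AE x in lebesgue_on \<Omega>. d x \<le> e" and x: "x \<in> closure \<Omega>"
  shows "d x \<le> e"
proof (rule continuous_le_on_closure[OF c x])
  fix y assume y: "y \<in> \<Omega>"
  let ?U = "d -` {e<..} \<inter> \<Omega>"
  have U: "open ?U"
    using continuous_on_subset[OF c closure_subset] continuous_on_open_vimage[OF open_\<Omega>, of d] open_greaterThan[of e] by blast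
  show "d y \<le> e"
  proof (rule ccontr)
    assume "\<not> d y \<le> e"
    then have "y \<in> ?U" using y by (simp add: not_le)
    then have "?U \<noteq> {}" by blast
    then have "\<not> negligible ?U" using open_not_negligible U by blast
    moreover have "AE x in lebesgue. x \<in> \<Omega> \<longrightarrow> d x \<le> e" using ae open_\<Omega> by (subst (asm) AE_restrict_space_iff) auto
    then have "AE x in lebesgue. x \<notin> ?U" by eventually_elim auto
    then have "?U \<in> null_sets lebesgue" using U by (subst AE_iff_null_sets) auto
    ultimately show False by (simp add: negligible_iff_null_sets)
  qed
qed

lemma AE_dist_le_closure:
  fixes f h :: "real^'n \<Rightarrow> real^'m"
  assumes "continuous_on (closure \<Omega>) f" "continuous_on (closure \<Omega>) h"
    "AE x in lebesgue_on \<Omega>. norm (f x - h x) \<le> e" "x \<in> closure \<Omega>"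
  shows "norm (f x - h x) \<le> e"
  using assms by (intro AE_le_closure[where d = "\<lambda>x. norm (f x - h x)"] continuous_intros)

lemma continuous_representative_unique:
  assumes "continuous_representative \<Omega> v f" "continuous_representative \<Omega> v h" "x \<in> closure \<Omega>"
  shows "f x = h x"
proof -
  have "AE x in lebesgue_on \<Omega>. f x = v x" "AE x in lebesgue_on \<Omega>. h x = v x" using assms by (auto simp: continuous_representative_def)
  then have "AE x in lebesgue_on \<Omega>. norm (f x - h x) \<le> 0" by eventually_elim simp
  with assms have "norm (f x - h x) \<le> 0" by (intro AE_dist_le_closure) (auto simp: continuous_representative_def)
  then show ?thesis by simp
qed

lemma W0_cong_AE:
  fixes z :: "real^'n \<Rightarrow> real^'m"
  assumes "W0 z Z" "Z' \<in> borel_measurable (lebesgue_on \<Omega>)" "AE x in lebesgue_on \<Omega>. Z x = Z' x"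
  shows "W0 z Z'"
proof (rule W0_limit[of "\<lambda>n. z" "\<lambda>n. Z"])
  show "W0 z Z" by fact
  show "integrable (lebesgue_on \<Omega>) z" by (rule W0_integrable(1)[OF assms(1)])
  show "integrable (lebesgue_on \<Omega>) Z'"
    by (rule integrable_cong_AE_imp[OF W0_integrable(2)[OF assms(1)] assms(2)]) (use assms(3) in \<open>eventually_elim, simp\<close>)
  have "(\<integral>\<^sup>+x. norm (Z x - Z' x) \<partial>lebesgue_on \<Omega>) = (\<integral>\<^sup>+x. 0 \<partial>lebesgue_on \<Omega>)"
    by (intro nn_integral_cong_AE) (rule AE_mp[OF assms(3)], simp)
  then show "(\<lambda>n. \<integral>\<^sup>+x. norm (Z x - Z' x) \<partial>lebesgue_on \<Omega>) \<longlonglongrightarrow> 0" by simp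
qed simp

lemma W0_zero:
  fixes z :: "real^'n \<Rightarrow> real^'m"
  shows "W0 z Z \<Longrightarrow> W0 (\<lambda>x. 0 :: real^'m) (\<lambda>x. 0)"
  using W0_lincomb[of z Z z Z 0 0] by simp

lemma W0_diff: "W0 z Z \<Longrightarrow> W0 y Y \<Longrightarrow> W0 (\<lambda>x. z x - y x) (\<lambda>x. Z x - Y x)"
  using W0_lincomb[of z Z y Y 1 "-1"] by simp

lemma mid_hull_W0:
  fixes g :: "real^'n \<Rightarrow> real^'m"
  assumes "mid_hull S z Z" "\<And>y Y. S y Y \<Longrightarrow> W0 (\<lambda>x. y x - g x) (\<lambda>x. Y x - G x)"
  shows "W0 (\<lambda>x. z x - g x) (\<lambda>x. Z x - G x)"
  using assms(1)
proof induction
  case (base y Y)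
  then show ?case by (rule assms(2))
next
  case (mid y Y z Z)
  have half: "(1/2) *\<^sub>R a + (1/2) *\<^sub>R b - c = (1/2) *\<^sub>R (a - c) + (1/2) *\<^sub>R (b - c)" for a b c :: "'v::real_vector"
  proof -
    have "c = (1/2) *\<^sub>R c + (1/2) *\<^sub>R c" by (simp add: scaleR_left_distrib[symmetric])
    then show ?thesis by (simp add: algebra_simps)
  qed
  show ?case using W0_lincomb[OF mid.IH, of "1/2" "1/2"] unfolding half .
qed

lemma affine_W1_0_D:
  fixes v g :: "real^'n \<Rightarrow> real^'m" and p :: real
  assumes v: "v \<in> affine_W1_0 g p \<Omega>" and g: "g \<in> W1 p \<Omega>" and p: "p \<ge> 0"
  shows "v \<in> W1 p \<Omega>" "W0 (\<lambda>x. v x - g x) (\<lambda>x. wgrad \<Omega> v x - wgrad \<Omega> g x)"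
proof -
  have z: "(\<lambda>x. v x - g x) \<in> W1_0 p \<Omega>" using v by (simp add: affine_W1_0_def)
  note zD = W1_0_D[OF z]
  show vW: "v \<in> W1 p \<Omega>" using W1_lincomb[OF zD(1) g p, of 1 1] by simp
  have "AE x in lebesgue_on \<Omega>. wgrad \<Omega> (\<lambda>x. v x - g x) x = wgrad \<Omega> v x - wgrad \<Omega> g x"
    using wgrad_lincomb[OF W1_E(2)[OF vW] W1_E(2)[OF g], of 1 "-1"] by simp
  moreover have "(\<lambda>x. wgrad \<Omega> v x - wgrad \<Omega> g x) \<in> borel_measurable (lebesgue_on \<Omega>)"
    using W1_E(3)[OF vW] W1_E(3)[OF g] by (auto simp: Lp_iff)
  ultimately show "W0 (\<lambda>x. v x - g x) (\<lambda>x. wgrad \<Omega> v x - wgrad \<Omega> g x)" by (intro W0_cong_AE[OF zD(2)])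
qed

lemma affine_W1_0_I:
  fixes v g :: "real^'n \<Rightarrow> real^'m" and p :: real
  assumes "v \<in> W1 p \<Omega>" "g \<in> W1 p \<Omega>" "p \<ge> 0" "W0 (\<lambda>x. v x - g x) Z"
  shows "v \<in> affine_W1_0 g p \<Omega>"
  using W1_lincomb[OF assms(1,2,3), of 1 "-1"] assms(4) by (auto simp: affine_W1_0_def intro: W1_0_I)

end

section \<open>Estimates for the minimizers and identification of the cluster points\<close>

subsection \<open>Minimizers of the penalised functionals\<close>

locale penalised_minimizers = growth_integrand \<Omega> T r \<alpha> \<beta>
  for \<Omega> :: "(real^'n) set" and T :: "real^'n \<Rightarrow> real^'n^'m \<Rightarrow> real" and r \<alpha> \<beta> :: real +
  fixes J :: "(real^'n \<Rightarrow> real^'m) \<Rightarrow> ereal" and g :: "real^'n \<Rightarrow> real^'m"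
    and u :: "real \<Rightarrow> real^'n \<Rightarrow> real^'m" and s c :: real
  assumes ne: "\<Omega> \<noteq> {}" and s1: "s \<ge> 1" and qc: "quasiconvex \<Omega> T"
    and J_bound: "\<And>v. v \<in> W1 s \<Omega> \<Longrightarrow> ereal c \<le> J v"
    and J_lsc: "weakly_seq_lsc s \<Omega> J"
    and g_W1: "g \<in> W1 \<infinity> \<Omega>" and g_cont: "continuous_on (closure \<Omega>) g"
    and J_g: "J g < \<infinity>" and T_g: "AE x in lebesgue_on \<Omega>. T x (wgrad \<Omega> g x) \<le> 1"
    and u_min: "\<And>p. p > max r s \<Longrightarrow> is_arg_min (J_pow J T \<Omega> r p) (\<lambda>v. v \<in> affine_W1_0 g p \<Omega>) (u p)"
begin

abbreviation "\<mu> \<equiv> lebesgue_on \<Omega>"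

definition vol :: real where "vol = measure \<mu> \<Omega>"

lemma vol: "emeasure \<mu> \<Omega> = ennreal vol" "vol \<ge> 0"
  using emeasure_eq_measure[of \<Omega>] by (auto simp: vol_def)

lemma g_W1_p: "p \<ge> 0 \<Longrightarrow> g \<in> W1 (ereal p) \<Omega>"
  by (rule W1_inf_mono[OF g_W1])

lemma u_affine: "p > max r s \<Longrightarrow> u p \<in> affine_W1_0 g p \<Omega>"
  using u_min[of p] by (simp add: is_arg_min_def)

lemma u_W1: "p > max r s \<Longrightarrow> u p \<in> W1 (ereal p) \<Omega>"
  and u_W0: "p > max r s \<Longrightarrow> W0 (\<lambda>x. u p x - g x) (\<lambda>x. wgrad \<Omega> (u p) x - wgrad \<Omega> g x)"
  using affine_W1_0_D[OF u_affine[of p] g_W1_p[of p]] r1 by auto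

lemma u_le: "p > max r s \<Longrightarrow> v \<in> affine_W1_0 g p \<Omega> \<Longrightarrow> J_pow J T \<Omega> r p (u p) \<le> J_pow J T \<Omega> r p v"
  using u_min[of p] by (auto simp: is_arg_min_def not_less)

lemma u_W1_s: "p > max r s \<Longrightarrow> u p \<in> W1 (ereal s) \<Omega>"
  using W1_mono[OF u_W1, of p s] s1 by simp

lemma g_affine:
  assumes "p \<ge> 0" shows "g \<in> affine_W1_0 g (ereal p) \<Omega>"
proof (rule affine_W1_0_I[OF g_W1_p[OF assms] g_W1_p[OF assms] assms])
  \<comment> \<open>The zero map arises as 0 times u p - g for one admissible p.\<close>
  show "W0 (\<lambda>x. g x - g x) (\<lambda>x. 0)"
    using W0_zero[OF u_W0[of "max r s + 1"]] by simp
qed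

lemma J_pow_le:
  assumes v: "AE x in \<mu>. T x (wgrad \<Omega> v x) \<le> 1" and p: "p > 0"
  shows "J_pow J T \<Omega> r p v \<le> J v + ereal (r / p * vol)"
proof -
  have "(\<integral>\<^sup>+x. ennreal (T x (wgrad \<Omega> v x) powr (p / r)) \<partial>\<mu>) \<le> (\<integral>\<^sup>+x. 1 \<partial>\<mu>)"
  proof (rule nn_integral_mono_AE)
    show "AE x in \<mu>. ennreal (T x (wgrad \<Omega> v x) powr (p / r)) \<le> 1"
      using v AE_space
    proof eventually_elim
      case (elim x)
      then have "T x (wgrad \<Omega> v x) powr (p / r) \<le> 1 powr (p / r)"
        using p r1 T_nonneg[of x] by (intro powr_mono2) auto
      then show ?case by (simp add: ennreal_le_1)
    qed
  qed
  also have "\<dots> = ennreal vol" by (simp add: vol)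
  finally have "enn2ereal (\<integral>\<^sup>+x. ennreal (T x (wgrad \<Omega> v x) powr (p / r)) \<partial>\<mu>) \<le> enn2ereal (ennreal vol)"
    by (simp add: less_eq_ennreal.rep_eq)
  then have "ereal (r / p) * enn2ereal (\<integral>\<^sup>+x. ennreal (T x (wgrad \<Omega> v x) powr (p / r)) \<partial>\<mu>) \<le> ereal (r / p) * ereal vol"
    using p r1 vol(2) by (intro ereal_mult_left_mono) auto
  then show ?thesis unfolding J_pow_def by (intro add_left_mono) simp
qed

lemma J_le_J_pow: "p > 0 \<Longrightarrow> J v \<le> J_pow J T \<Omega> r p v"
proof -
  assume "p > 0"
  then have "0 \<le> ereal (r / p) * enn2ereal (\<integral>\<^sup>+x. ennreal (T x (wgrad \<Omega> v x) powr (p / r)) \<partial>\<mu>)"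
    using r1 by (intro ereal_0_le_mult) auto
  then have "J v + 0 \<le> J_pow J T \<Omega> r p v" unfolding J_pow_def by (intro add_left_mono)
  then show ?thesis by simp
qed

text \<open>Compare u p with g, whose penalty is at most r / p times the volume, and bound J (u p)
  below by c. Multiplying by p / r leaves a bound linear in p.\<close>

lemma energy_bound:
  "\<exists>K\<ge>0. \<forall>p > max r s. (\<integral>\<^sup>+x. ennreal (T x (wgrad \<Omega> (u p) x) powr (p / r)) \<partial>\<mu>) \<le> ennreal (p * K)"
proof -
  obtain jg where jg: "J g = ereal jg" "c \<le> jg"
    using J_bound[OF g_W1_p[of s]] s1 J_g by (cases "J g") auto
  \<comment> \<open>(jg - c) / r stems from the two values of J, vol from the penalty of g; p \<ge>
    1 lets vol join the common factor p.\<close>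
  define K where "K = (jg - c) / r + vol"
  have K: "K \<ge> 0" using jg(2) r1 vol(2) by (simp add: K_def)
  have "(\<integral>\<^sup>+x. ennreal (T x (wgrad \<Omega> (u p) x) powr (p / r)) \<partial>\<mu>) \<le> ennreal (p * K)" if p: "p > max r s" for p
  proof -
    let ?E = "\<integral>\<^sup>+x. ennreal (T x (wgrad \<Omega> (u p) x) powr (p / r)) \<partial>\<mu>"
    have p1: "p \<ge> 1" "p > 0" using p r1 by auto
    have "ereal c + ereal (r / p) * enn2ereal ?E \<le> J_pow J T \<Omega> r p (u p)"
      unfolding J_pow_def by (intro add_right_mono J_bound u_W1_s p)
    also have "\<dots> \<le> J_pow J T \<Omega> r p g" using p1 by (intro u_le p g_affine) auto
    also have "\<dots> \<le> ereal (jg + r / p * vol)" using J_pow_le[OF T_g p1(2)] jg by simp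
    finally have le: "ereal c + ereal (r / p) * enn2ereal ?E \<le> ereal (jg + r / p * vol)" .
    show ?thesis
    proof (cases ?E)
      case (real e)
      have "c + r / p * e \<le> jg + r / p * vol" using le unfolding real(2) using real(1) by simp
      then have "r / p * (e - vol) \<le> jg - c" by (simp add: algebra_simps)
      then have "(p / r) * (r / p * (e - vol)) \<le> (p / r) * (jg - c)" using p1 r1 by (intro mult_left_mono) auto
      then have "e - vol \<le> p * ((jg - c) / r)" using p1 r1 by simp
      moreover have "vol \<le> p * vol" using p1 vol(2) mult_right_mono[of 1 p vol] by simp
      ultimately have "e \<le> p * K" by (simp add: K_def algebra_simps)
      then show ?thesis unfolding real(2) by (rule ennreal_leI)
    next
      case top
      have h: "ereal (r / p) * enn2ereal ?E = \<infinity>" unfolding top using p1 r1 by simp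
      show ?thesis using le unfolding h by simp
    qed
  qed
  then show ?thesis using K by blast
qed

definition energy_const :: real where
  "energy_const = (SOME K. K \<ge> 0 \<and> (\<forall>p > max r s. (\<integral>\<^sup>+x. ennreal (T x (wgrad \<Omega> (u p) x) powr (p / r)) \<partial>\<mu>) \<le> ennreal (p * K)))"

lemma energy_const: "energy_const \<ge> 0" "p > max r s \<Longrightarrow> (\<integral>\<^sup>+x. ennreal (T x (wgrad \<Omega> (u p) x) powr (p / r)) \<partial>\<mu>) \<le> ennreal (p * energy_const)"
proof -
  have *: "energy_const \<ge> 0 \<and> (\<forall>p > max r s. (\<integral>\<^sup>+x. ennreal (T x (wgrad \<Omega> (u p) x) powr (p / r)) \<partial>\<mu>) \<le> ennreal (p * energy_const))"
    unfolding energy_const_def by (rule someI_ex[OF energy_bound])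
  show "energy_const \<ge> 0" using * by (rule conjunct1)
  show "p > max r s \<Longrightarrow> (\<integral>\<^sup>+x. ennreal (T x (wgrad \<Omega> (u p) x) powr (p / r)) \<partial>\<mu>) \<le> ennreal (p * energy_const)"
    using conjunct2[OF *, rule_format] .
qed

lemma wgrad_u_measurable: "p > max r s \<Longrightarrow> wgrad \<Omega> (u p) \<in> borel_measurable \<mu>"
  using W1_E(3)[OF u_W1[of p]] by (simp add: Lp_iff)

text \<open>The exponent 1 - p / r is negative, so t = t powr (1 - p / r) * t powr (p / r) gains the
  factor l powr (1 - p / r) where t > l.\<close>

lemma tail_bound:
  assumes p: "p > max r s" and l: "l > 1"
  shows "(\<integral>\<^sup>+x. tail l (wgrad \<Omega> (u p)) x \<partial>\<mu>) \<le> ennreal (l powr (1 - p / r) * (p * energy_const))"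
proof -
  have Vm: "wgrad \<Omega> (u p) \<in> borel_measurable \<mu>" by (rule wgrad_u_measurable[OF p])
  note [measurable] = T_measurable[OF Vm]
  have "(\<integral>\<^sup>+x. tail l (wgrad \<Omega> (u p)) x \<partial>\<mu>) \<le> (\<integral>\<^sup>+x. ennreal (l powr (1 - p / r)) * ennreal (T x (wgrad \<Omega> (u p) x) powr (p / r)) \<partial>\<mu>)"
  proof (rule nn_integral_mono)
    fix x
    define t where "t = T x (wgrad \<Omega> (u p) x)"
    have "tail l (wgrad \<Omega> (u p)) x \<le> l powr (1 - p / r) * t powr (p / r)"
    proof (cases "t > l")
      case True
      have "t = t powr (1 - p / r) * t powr (p / r)" using True l by (simp add: powr_add[symmetric])
      also have "\<dots> \<le> l powr (1 - p / r) * t powr (p / r)"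
        using True l p r1 by (intro mult_right_mono powr_mono2') (auto simp: le_divide_eq)
      finally show ?thesis using True by (simp add: tail_def t_def)
    qed (simp add: tail_def t_def)
    then show "ennreal (tail l (wgrad \<Omega> (u p)) x) \<le> ennreal (l powr (1 - p / r)) * ennreal (T x (wgrad \<Omega> (u p) x) powr (p / r))"
      unfolding t_def[symmetric] by (simp add: ennreal_mult[symmetric] ennreal_leI)
  qed
  also have "\<dots> = ennreal (l powr (1 - p / r)) * (\<integral>\<^sup>+x. ennreal (T x (wgrad \<Omega> (u p) x) powr (p / r)) \<partial>\<mu>)"
    by (rule nn_integral_cmult) measurable
  also have "\<dots> \<le> ennreal (l powr (1 - p / r)) * ennreal (p * energy_const)" by (intro mult_left_mono energy_const p) auto
  also have "\<dots> = ennreal (l powr (1 - p / r) * (p * energy_const))" using energy_const(1) p r1 by (intro ennreal_mult[symmetric]) auto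
  finally show ?thesis .
qed

text \<open>For l > 1 the factor l powr (- p / r) decays exponentially in p and beats the linear
  growth of the energy.\<close>

lemma tail_tendsto:
  assumes l: "l > 1"
  shows "((\<lambda>p. \<integral>\<^sup>+x. tail l (wgrad \<Omega> (u p)) x \<partial>\<mu>) \<longlongrightarrow> 0) at_top"
proof -
  define a where "a = ln l / r"
  have a: "a > 0" using l r1 by (simp add: a_def)
  have "filterlim (\<lambda>p. a * p) at_top at_top" using a by (intro filterlim_tendsto_pos_mult_at_top[OF tendsto_const _ filterlim_ident]) auto
  then have "((\<lambda>p. l * energy_const / a * ((a * p) ^ 1 / exp (a * p))) \<longlongrightarrow> l * energy_const / a * 0) at_top"
    by (intro tendsto_mult tendsto_const filterlim_compose[OF tendsto_power_div_exp_0])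
  moreover have "l * energy_const / a * ((a * p) ^ 1 / exp (a * p)) = l powr (1 - p / r) * (p * energy_const)" for p
  proof -
    have "l powr (p / r) = exp (a * p)" using l by (simp add: powr_def a_def ac_simps)
    then have "l powr (1 - p / r) = l / exp (a * p)" using l by (simp add: powr_diff)
    then show ?thesis using a by (simp add: field_simps)
  qed
  ultimately have "((\<lambda>p. l powr (1 - p / r) * (p * energy_const)) \<longlongrightarrow> 0) at_top" by simp
  then have "((\<lambda>p. ennreal (l powr (1 - p / r) * (p * energy_const))) \<longlongrightarrow> ennreal 0) at_top" by (rule tendsto_ennrealI)
  then have lim: "((\<lambda>p. ennreal (l powr (1 - p / r) * (p * energy_const))) \<longlongrightarrow> 0) at_top" by simp
  show ?thesis
  proof (rule tendsto_sandwich[OF _ _ tendsto_const lim])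
    show "\<forall>\<^sub>F p in at_top. (\<integral>\<^sup>+x. tail l (wgrad \<Omega> (u p)) x \<partial>\<mu>) \<le> ennreal (l powr (1 - p / r) * (p * energy_const))"
      using eventually_gt_at_top[of "max r s"] by eventually_elim (rule tail_bound[OF _ l])
  qed simp
qed

text \<open>\<open>powr_mix\<close> at a fixed level L lowers the exponent from p to q. L exceeds
  \<alpha> powr (- (1 / r)) by the factor exp 1, so the energy is multiplied by L powr q * exp (-
  p), which outweighs its factor p.\<close>

lemma gradient_bound:
  assumes q: "q \<ge> 0"
  shows "\<exists>C\<ge>0. \<forall>p > max r s. p \<ge> q \<longrightarrow> (\<integral>\<^sup>+x. norm (wgrad \<Omega> (u p) x) powr q \<partial>\<mu>) \<le> ennreal C"
proof -
  define L where "L = exp 1 * \<alpha> powr (- (1 / r))"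
  have L: "L > 0" using \<alpha> by (simp add: L_def)
  define C where "C = L powr q * (vol + energy_const)"
  have C: "C \<ge> 0" using vol(2) energy_const(1) by (simp add: C_def)
  have "(\<integral>\<^sup>+x. norm (wgrad \<Omega> (u p) x) powr q \<partial>\<mu>) \<le> ennreal C" if p: "p > max r s" "p \<ge> q" for p
  proof -
    have p0: "p > 0" using p r1 by auto
    note Vm = wgrad_u_measurable[OF p(1)]
    note [measurable] = T_measurable[OF Vm]
    have "(\<integral>\<^sup>+x. norm (wgrad \<Omega> (u p) x) powr p \<partial>\<mu>) \<le> (\<integral>\<^sup>+x. ennreal (\<alpha> powr (- (p / r))) * ennreal (T x (wgrad \<Omega> (u p) x) powr (p / r)) \<partial>\<mu>)"
    proof (rule nn_integral_mono_AE)
      show "AE x in \<mu>. ennreal (norm (wgrad \<Omega> (u p) x) powr p) \<le> ennreal (\<alpha> powr (- (p / r))) * ennreal (T x (wgrad \<Omega> (u p) x) powr (p / r))"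
        using growth AE_space
      proof eventually_elim
        case (elim x)
        have "norm (wgrad \<Omega> (u p) x) powr p = (norm (wgrad \<Omega> (u p) x) powr r) powr (p / r)" using r1 by (simp add: powr_powr)
        also have "\<dots> \<le> (T x (wgrad \<Omega> (u p) x) / \<alpha>) powr (p / r)"
          using p0 r1 by (intro powr_mono2 coercive(1)[OF elim(1)]) auto
        also have "\<dots> = \<alpha> powr (- (p / r)) * T x (wgrad \<Omega> (u p) x) powr (p / r)"
          using \<alpha> T_nonneg[of x] elim(2) by (simp add: powr_divide powr_minus_divide)
        finally show ?case by (simp add: ennreal_mult[symmetric] ennreal_leI)
      qed
    qed
    also have "\<dots> = ennreal (\<alpha> powr (- (p / r))) * (\<integral>\<^sup>+x. ennreal (T x (wgrad \<Omega> (u p) x) powr (p / r)) \<partial>\<mu>)"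
      by (rule nn_integral_cmult) measurable
    also have "\<dots> \<le> ennreal (\<alpha> powr (- (p / r))) * ennreal (p * energy_const)" by (intro mult_left_mono energy_const p(1)) auto
    also have "\<dots> = ennreal (\<alpha> powr (- (p / r)) * (p * energy_const))" using energy_const(1) p0 by (intro ennreal_mult[symmetric]) auto
    finally have Ip: "(\<integral>\<^sup>+x. norm (wgrad \<Omega> (u p) x) powr p \<partial>\<mu>) \<le> ennreal (\<alpha> powr (- (p / r)) * (p * energy_const))" .
    have "(\<integral>\<^sup>+x. norm (wgrad \<Omega> (u p) x) powr q \<partial>\<mu>) \<le>
      ennreal (L powr q) * emeasure \<mu> (space \<mu>) + ennreal (L powr (q - p)) * (\<integral>\<^sup>+x. norm (wgrad \<Omega> (u p) x) powr p \<partial>\<mu>)"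
      by (rule nn_integral_powr_mix[OF L q p(2) Vm])
    also have "\<dots> \<le> ennreal (L powr q) * ennreal vol + ennreal (L powr (q - p)) * ennreal (\<alpha> powr (- (p / r)) * (p * energy_const))"
      using Ip by (intro add_mono mult_left_mono) (auto simp: vol)
    also have "\<dots> = ennreal (L powr q * vol + L powr (q - p) * (\<alpha> powr (- (p / r)) * (p * energy_const)))"
      using vol(2) energy_const(1) p0 by (simp add: ennreal_mult ennreal_plus)
    also have "\<dots> \<le> ennreal C"
    proof (rule ennreal_leI)
      define A where "A = \<alpha> powr (- (p / r))"
      have A: "A > 0" using \<alpha> by (simp add: A_def)
      have "exp 1 powr p = exp p" by (simp add: powr_def)
      then have "L powr p = exp p * A" unfolding L_def A_def by (simp add: powr_mult powr_powr)
      then have "L powr (q - p) * A = L powr q * exp (- p)" using A by (simp add: powr_diff exp_minus field_simps)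
      then have "L powr (q - p) * (\<alpha> powr (- (p / r)) * (p * energy_const)) = L powr q * ((p * exp (- p)) * energy_const)"
        unfolding A_def[symmetric] by (metis mult.assoc mult.commute)
      moreover have p_le: "p \<le> exp p" using exp_ge_add_one_self[of p] by linarith
      have "p * exp (- p) \<le> 1" using p_le by (simp add: exp_minus divide_simps)
      then have "L powr q * ((p * exp (- p)) * energy_const) \<le> L powr q * (1 * energy_const)" using energy_const(1) by (intro mult_left_mono mult_right_mono) auto
      ultimately show "L powr q * vol + L powr (q - p) * (\<alpha> powr (- (p / r)) * (p * energy_const)) \<le> C" unfolding C_def distrib_left mult_1_left by linarith
    qed
    finally show ?thesis .
  qed
  then show ?thesis using C by blast
qed

text \<open>The difference and not u p is represented: g is continuous on the closure, but on an
  irregular domain it need not be Hoelder there.\<close>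

definition diff_rep :: "real \<Rightarrow> real^'n \<Rightarrow> real^'m" where
  "diff_rep p = (SOME h. continuous_representative \<Omega> (\<lambda>x. u p x - g x) h)"

lemma diff_rep_bounds:
  fixes q :: real
  assumes q: "q > CARD('n)"
  shows "\<exists>B\<ge>0. \<forall>p > max r s. p \<ge> q \<longrightarrow> continuous_representative \<Omega> (\<lambda>x. u p x - g x) (diff_rep p) \<and>
    (\<forall>x\<in>closure \<Omega>. norm (diff_rep p x) \<le> B) \<and>
    (\<forall>x\<in>closure \<Omega>. \<forall>y\<in>closure \<Omega>. norm (diff_rep p x - diff_rep p y) \<le> B * dist x y powr (1 - CARD('n) / q))"
proof -
  have "CARD('n) \<ge> 1" by (simp add: Suc_leI)
  then have "real CARD('n) \<ge> 1" by linarith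
  then have q1: "q \<ge> 1" using q by linarith
  obtain C where C: "C \<ge> 0" "\<And>p. p > max r s \<Longrightarrow> p \<ge> q \<Longrightarrow> (\<integral>\<^sup>+x. norm (wgrad \<Omega> (u p) x) powr q \<partial>\<mu>) \<le> ennreal C"
    using gradient_bound[of q] q1 by auto
  have gL: "wgrad \<Omega> g \<in> Lp q \<Omega>" using W1_E(3)[OF g_W1_p[of q]] q1 by simp
  then have gm: "wgrad \<Omega> g \<in> borel_measurable \<mu>" by (simp add: Lp_iff)
  define G where "G = enn2real (\<integral>\<^sup>+x. norm (wgrad \<Omega> g x) powr q \<partial>\<mu>)"
  have G: "(\<integral>\<^sup>+x. norm (wgrad \<Omega> g x) powr q \<partial>\<mu>) \<le> ennreal G" "G \<ge> 0" using gL by (auto simp: G_def Lp_iff)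
  have C': "2 powr q * (C + G) \<ge> 0" using C(1) G(2) by simp
  from W0_holder_bound[OF q C'] obtain B where B: "\<forall>(z :: real^'n \<Rightarrow> real^'m) Z. W0 z Z \<longrightarrow> (\<integral>\<^sup>+x. norm (Z x) powr q \<partial>\<mu>) \<le> ennreal (2 powr q * (C + G)) \<longrightarrow>
    (\<exists>h. continuous_on (closure \<Omega>) h \<and> (AE x in \<mu>. h x = z x) \<and>
      (\<forall>x\<in>closure \<Omega>. norm (h x) \<le> B) \<and>
      (\<forall>x\<in>closure \<Omega>. \<forall>y\<in>closure \<Omega>. norm (h x - h y) \<le> B * dist x y powr (1 - CARD('n) / q)))" by (elim exE)
  have main: "continuous_representative \<Omega> (\<lambda>x. u p x - g x) (diff_rep p) \<and>
    (\<forall>x\<in>closure \<Omega>. norm (diff_rep p x) \<le> B) \<and>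
    (\<forall>x\<in>closure \<Omega>. \<forall>y\<in>closure \<Omega>. norm (diff_rep p x - diff_rep p y) \<le> B * dist x y powr (1 - CARD('n) / q))"
    if p: "p > max r s" "p \<ge> q" for p
  proof -
    have "(\<integral>\<^sup>+x. norm (wgrad \<Omega> (u p) x - wgrad \<Omega> g x) powr q \<partial>\<mu>) \<le> ennreal (2 powr q * (C + G))"
      by (rule nn_integral_diff_powr_le[OF q1 wgrad_u_measurable[OF p(1)] gm C(2)[OF p] G(1) C(1) G(2)])
    from B[rule_format, OF u_W0[OF p(1)] this] obtain h where
      h: "continuous_on (closure \<Omega>) h" "AE x in \<mu>. h x = u p x - g x" "\<forall>x\<in>closure \<Omega>. norm (h x) \<le> B"
      "\<forall>x\<in>closure \<Omega>. \<forall>y\<in>closure \<Omega>. norm (h x - h y) \<le> B * dist x y powr (1 - CARD('n) / q)"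
      by (elim exE conjE)
    have hr: "continuous_representative \<Omega> (\<lambda>x. u p x - g x) h" using h(1,2) by (simp add: continuous_representative_def)
    have dr: "continuous_representative \<Omega> (\<lambda>x. u p x - g x) (diff_rep p)" unfolding diff_rep_def by (rule someI[of _ h]) (rule hr)
    have "diff_rep p x = h x" if "x \<in> closure \<Omega>" for x by (rule continuous_representative_unique[OF dr hr that])
    then show ?thesis using dr h(3,4) by simp
  qed
  obtain x0 where x0: "x0 \<in> closure \<Omega>" using ne closure_subset by blast
  define p0 where "p0 = max (max r s + 1) q"
  have p0: "p0 > max r s" "p0 \<ge> q" by (auto simp: p0_def)
  have "norm (diff_rep p0 x0) \<le> B" using main[OF p0] x0 by blast
  then have "B \<ge> 0" by (rule order_trans[OF norm_ge_zero])
  then show ?thesis using main by blast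
qed

text \<open>Ensures that the Hoelder supremum runs over a nonempty set of pairs, as
  \<open>holder_norm_nonneg\<close> demands.\<close>

lemma two_points: "\<exists>x\<in>closure \<Omega>. \<exists>y\<in>closure \<Omega>. x \<noteq> y"
proof -
  obtain x where x: "x \<in> \<Omega>" using ne by auto
  then obtain e where e: "e > 0" "ball x e \<subseteq> \<Omega>" using open_\<Omega> open_contains_ball by blast
  define y where "y = x + (e/2) *\<^sub>R axis undefined 1"
  have "y \<in> ball x e" "y \<noteq> x" using e by (auto simp: y_def dist_norm axis_eq_0_iff)
  then show ?thesis using x e(2) closure_subset by blast
qed

lemma compact_closure: "compact (closure \<Omega>)"
  using bounded_\<Omega> by (simp add: compact_closure)

text \<open>Bounds for the larger exponent q + 1 give compactness in the weaker Hoelder norm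
  belonging to q. They are available once P k \<ge> q + 1, hence the shift by k0 and the restriction
  to indices tending to infinity.\<close>

lemma diff_rep_subsequence:
  fixes q :: real and P :: "nat \<Rightarrow> real"
  assumes q: "q > CARD('n)" and P: "filterlim P at_top sequentially"
  shows "\<exists>\<rho> w. strict_mono (\<rho> :: nat \<Rightarrow> nat) \<and> continuous_on (closure \<Omega>) w \<and> w \<in> holder_space (1 - CARD('n) / q) (closure \<Omega>) \<and>
    (\<lambda>k. holder_norm (1 - CARD('n) / q) (closure \<Omega>) (\<lambda>x. diff_rep (P (\<rho> k)) x - w x)) \<longlonglongrightarrow> 0 \<and>
    (\<forall>e>0. \<exists>N. \<forall>k\<ge>N. \<forall>x\<in>closure \<Omega>. norm (diff_rep (P (\<rho> k)) x - w x) < e)"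
proof -
  define q' where "q' = q + 1"
  have q': "q' > CARD('n)" using q by (simp add: q'_def)
  have q0: "q > 0" using q by (meson le_less_trans of_nat_0_le_iff)
  obtain B where B: "\<And>p. p > max r s \<Longrightarrow> p \<ge> q' \<Longrightarrow>
    (\<forall>x\<in>closure \<Omega>. norm (diff_rep p x) \<le> B) \<and>
    (\<forall>x\<in>closure \<Omega>. \<forall>y\<in>closure \<Omega>. norm (diff_rep p x - diff_rep p y) \<le> B * dist x y powr (1 - CARD('n) / q'))"
    using diff_rep_bounds[OF q'] by blast
  obtain k0 where k0: "\<And>k. k \<ge> k0 \<Longrightarrow> P k \<ge> max (max r s + 1) q'"
    using P unfolding filterlim_at_top eventually_sequentially by blast
  have Pk: "P (k + k0) > max r s" "P (k + k0) \<ge> q'" for k using k0[of "k + k0"] by auto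
  obtain x y where xy: "x \<in> closure \<Omega>" "y \<in> closure \<Omega>" "x \<noteq> y" using two_points by blast
  have N0: "real CARD('n) > 0" by simp
  have "\<exists>\<rho> w. strict_mono (\<rho> :: nat \<Rightarrow> nat) \<and> continuous_on (closure \<Omega>) w \<and> w \<in> holder_space (1 - CARD('n) / q) (closure \<Omega>) \<and>
    (\<lambda>k. holder_norm (1 - CARD('n) / q) (closure \<Omega>) (\<lambda>x. diff_rep (P (\<rho> k + k0)) x - w x)) \<longlonglongrightarrow> 0 \<and>
    (\<forall>e>0. \<exists>N. \<forall>k\<ge>N. \<forall>x\<in>closure \<Omega>. norm (diff_rep (P (\<rho> k + k0)) x - w x) < e)"
  proof (rule holder_compact[where f = "\<lambda>k. diff_rep (P (k + k0))" and B = B, OF compact_closure xy])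
    show "0 < 1 - CARD('n) / q" using q q0 by (simp add: field_simps)
    show "1 - CARD('n) / q < 1 - CARD('n) / q'" using q0 N0 by (simp add: q'_def divide_strict_left_mono)
    show "norm (diff_rep (P (k + k0)) x) \<le> B" if "x \<in> closure \<Omega>" for k x using B[OF Pk[of k]] that by blast
    show "norm (diff_rep (P (k + k0)) x - diff_rep (P (k + k0)) y) \<le> B * dist x y powr (1 - CARD('n) / q')"
      if "x \<in> closure \<Omega>" "y \<in> closure \<Omega>" for k x y using B[OF Pk[of k]] that by blast
  qed
  then obtain \<rho> w where *: "strict_mono (\<rho> :: nat \<Rightarrow> nat)" "continuous_on (closure \<Omega>) w" "w \<in> holder_space (1 - CARD('n) / q) (closure \<Omega>)"
    "(\<lambda>k. holder_norm (1 - CARD('n) / q) (closure \<Omega>) (\<lambda>x. diff_rep (P (\<rho> k + k0)) x - w x)) \<longlonglongrightarrow> 0"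
    "\<forall>e>0. \<exists>N. \<forall>k\<ge>N. \<forall>x\<in>closure \<Omega>. norm (diff_rep (P (\<rho> k + k0)) x - w x) < e"
    by (elim exE conjE)
  show ?thesis
    by (rule exI[of _ "\<lambda>k. \<rho> k + k0"], rule exI[of _ w], intro conjI) (use * in \<open>simp_all add: strict_mono_def\<close>)
qed

lemma W1_norm_bounded:
  fixes q :: real
  assumes q: "q > CARD('n)"
  shows "\<exists>C::real. \<forall>p > max r s. p \<ge> q \<longrightarrow> u p \<in> W1 q \<Omega> \<and> W1_norm q \<Omega> (u p) \<le> ereal C"
proof -
  have q0: "q > 0" using q by (meson le_less_trans of_nat_0_le_iff)
  obtain B where B: "B \<ge> 0" "\<And>p. p > max r s \<Longrightarrow> p \<ge> q \<Longrightarrow> continuous_representative \<Omega> (\<lambda>x. u p x - g x) (diff_rep p) \<and>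
    (\<forall>x\<in>closure \<Omega>. norm (diff_rep p x) \<le> B)" using diff_rep_bounds[OF q] by blast
  obtain C where C: "C \<ge> 0" "\<And>p. p > max r s \<Longrightarrow> p \<ge> q \<Longrightarrow> (\<integral>\<^sup>+x. norm (wgrad \<Omega> (u p) x) powr q \<partial>\<mu>) \<le> ennreal C"
    using gradient_bound[of q] q0 by auto
  have "bounded (g ` closure \<Omega>)" by (intro compact_imp_bounded compact_continuous_image g_cont compact_closure)
  then obtain Bg where Bg: "\<And>x. x \<in> closure \<Omega> \<Longrightarrow> norm (g x) \<le> Bg" by (auto simp: bounded_iff)
  obtain x0 where x0: "x0 \<in> closure \<Omega>" using two_points by blast
  have Bg0: "Bg \<ge> 0" using Bg[OF x0] norm_ge_zero[of "g x0"] by linarith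
  define E where "E = (B + Bg) powr q * vol"
  have E0: "E \<ge> 0" using vol(2) by (simp add: E_def)
  have "u p \<in> W1 q \<Omega> \<and> W1_norm q \<Omega> (u p) \<le> ereal (E powr (1/q) + C powr (1/q))" if p: "p > max r s" "p \<ge> q" for p
  proof
    show "u p \<in> W1 q \<Omega>" using W1_mono[OF u_W1[OF p(1)], of q] p(2) q0 by simp
    have "AE x in \<mu>. diff_rep p x = u p x - g x" using B(2)[OF p] by (simp add: continuous_representative_def)
    then have ae: "AE x in \<mu>. norm (u p x) \<le> B + Bg"
      using AE_space
    proof eventually_elim
      case (elim x)
      then have xc: "x \<in> closure \<Omega>" using closure_subset by auto
      have "u p x = diff_rep p x + g x" using elim(1) by simp
      then have "norm (u p x) \<le> norm (diff_rep p x) + norm (g x)" using norm_triangle_ineq by metis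
      then show ?case using B(2)[OF p] Bg[OF xc] xc by fastforce
    qed
    have "(\<integral>\<^sup>+x. norm (u p x) powr q \<partial>\<mu>) \<le> (\<integral>\<^sup>+x. ennreal ((B + Bg) powr q) \<partial>\<mu>)"
      by (rule nn_integral_mono_AE, rule AE_mp[OF ae]) (use q0 in \<open>auto intro!: ennreal_leI powr_mono2\<close>)
    also have "\<dots> = ennreal E" using vol(2) by (simp add: vol(1) E_def ennreal_mult)
    finally have "Lp_norm q \<Omega> (u p) \<le> ereal (E powr (1/q))" by (rule Lp_norm_le[OF _ E0 q0])
    moreover have "Lp_norm q \<Omega> (wgrad \<Omega> (u p)) \<le> ereal (C powr (1/q))" by (rule Lp_norm_le[OF C(2)[OF p] C(1) q0])
    ultimately have "W1_norm q \<Omega> (u p) \<le> ereal (E powr (1/q)) + ereal (C powr (1/q))" unfolding W1_norm_def by (rule add_mono)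
    then show "W1_norm q \<Omega> (u p) \<le> ereal (E powr (1/q) + C powr (1/q))" by simp
  qed
  then show ?thesis by blast
qed

lemma diff_rep_holder_space:
  fixes q p :: real
  assumes q: "q > CARD('n)" and p: "p > max r s" "p \<ge> q"
  shows "continuous_representative \<Omega> (\<lambda>x. u p x - g x) (diff_rep p)" "diff_rep p \<in> holder_space (1 - CARD('n) / q) (closure \<Omega>)"
proof -
  obtain B where B: "continuous_representative \<Omega> (\<lambda>x. u p x - g x) (diff_rep p)"
    "\<forall>x\<in>closure \<Omega>. norm (diff_rep p x) \<le> B"
    "\<forall>x\<in>closure \<Omega>. \<forall>y\<in>closure \<Omega>. norm (diff_rep p x - diff_rep p y) \<le> B * dist x y powr (1 - CARD('n) / q)"
    using diff_rep_bounds[OF q] p by blast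
  show "continuous_representative \<Omega> (\<lambda>x. u p x - g x) (diff_rep p)" by fact
  have "holder_norm (1 - CARD('n) / q) (closure \<Omega>) (diff_rep p) \<le> ereal (B + B)"
    using B(2,3) by (intro holder_norm_le) auto
  then show "diff_rep p \<in> holder_space (1 - CARD('n) / q) (closure \<Omega>)" unfolding holder_space_def by (auto intro: le_less_trans)
qed

lemma compact_net:
  fixes q :: real
  assumes q: "q > CARD('n)"
  shows "holder_relatively_compact_net (1 - CARD('n) / q) \<Omega> {p. p \<ge> q \<and> p > max r s} (\<lambda>p x. u p x - g x)"
    and "g \<in> holder_space (1 - CARD('n) / q) (closure \<Omega>) \<Longrightarrow>
      holder_relatively_compact_net (1 - CARD('n) / q) \<Omega> {p. p \<ge> q \<and> p > max r s} u"
proof -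
  let ?a = "1 - CARD('n) / q"
  have sub: "\<exists>\<rho> w. strict_mono (\<rho> :: nat \<Rightarrow> nat) \<and> w \<in> holder_space ?a (closure \<Omega>) \<and>
      (\<lambda>k. holder_norm ?a (closure \<Omega>) (\<lambda>x. diff_rep (P (\<rho> k)) x - w x)) \<longlonglongrightarrow> 0" if "filterlim P at_top sequentially" for P
    using diff_rep_subsequence[OF q that] by blast
  show "holder_relatively_compact_net ?a \<Omega> {p. p \<ge> q \<and> p > max r s} (\<lambda>p x. u p x - g x)"
    unfolding holder_relatively_compact_net_def
    by (rule exI[of _ diff_rep], intro conjI ballI allI impI) (use diff_rep_holder_space[OF q] sub in auto)
  assume g: "g \<in> holder_space ?a (closure \<Omega>)"
  have add: "(\<lambda>x. f x + g x) \<in> holder_space ?a (closure \<Omega>)" if "f \<in> holder_space ?a (closure \<Omega>)" for f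
  proof -
    have "holder_norm ?a (closure \<Omega>) f + holder_norm ?a (closure \<Omega>) g < \<infinity>" using that g by (simp add: holder_space_def)
    then show ?thesis unfolding holder_space_def using le_less_trans[OF holder_norm_add] by blast
  qed
  show "holder_relatively_compact_net ?a \<Omega> {p. p \<ge> q \<and> p > max r s} u"
    unfolding holder_relatively_compact_net_def
  proof (rule exI[of _ "\<lambda>p x. diff_rep p x + g x"], intro conjI ballI allI impI)
    fix p assume "p \<in> {p. p \<ge> q \<and> p > max r s}"
    then have p: "p > max r s" "p \<ge> q" by auto
    note d = diff_rep_holder_space[OF q p]
    show "(\<lambda>x. diff_rep p x + g x) \<in> holder_space ?a (closure \<Omega>)" by (rule add[OF d(2)])
    have "AE x in \<mu>. diff_rep p x = u p x - g x" using d(1) by (simp add: continuous_representative_def)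
    then have "AE x in \<mu>. diff_rep p x + g x = u p x" by eventually_elim simp
    then show "continuous_representative \<Omega> (u p) (\<lambda>x. diff_rep p x + g x)"
      using d(1) g_cont by (auto simp: continuous_representative_def intro: continuous_on_add)
  next
    fix P :: "nat \<Rightarrow> real" assume P: "range P \<subseteq> {p. p \<ge> q \<and> p > max r s} \<and> filterlim P at_top sequentially"
    obtain \<rho> w where *: "strict_mono (\<rho> :: nat \<Rightarrow> nat)" "w \<in> holder_space ?a (closure \<Omega>)"
      "(\<lambda>k. holder_norm ?a (closure \<Omega>) (\<lambda>x. diff_rep (P (\<rho> k)) x - w x)) \<longlonglongrightarrow> 0" using sub[OF conjunct2[OF P]] by blast
    show "\<exists>\<rho> w. strict_mono (\<rho> :: nat \<Rightarrow> nat) \<and> w \<in> holder_space ?a (closure \<Omega>) \<and>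
      (\<lambda>k. holder_norm ?a (closure \<Omega>) (\<lambda>x. diff_rep (P (\<rho> k)) x + g x - w x)) \<longlonglongrightarrow> 0"
      by (rule exI[of _ \<rho>], rule exI[of _ "\<lambda>x. w x + g x"]) (use * add[OF *(2)] in simp)
  qed
qed

lemma sup_constraint_iff:
  assumes "v \<in> W1 (ereal s) \<Omega>"
  shows "sup_constraint T \<Omega> v \<longleftrightarrow> (AE x in \<mu>. T x (wgrad \<Omega> v x) \<le> 1)"
proof -
  have "wgrad \<Omega> v \<in> borel_measurable \<mu>" using W1_E(3)[OF assms] by (simp add: Lp_iff)
  from T_measurable[OF this] have m: "(\<lambda>x. ereal (T x (wgrad \<Omega> v x))) \<in> borel_measurable \<mu>" by measurable
  show ?thesis
  proof
    assume "sup_constraint T \<Omega> v"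
    then have le: "esssup \<mu> (\<lambda>x. ereal (T x (wgrad \<Omega> v x))) \<le> 1" by (simp add: sup_constraint_def)
    show "AE x in \<mu>. T x (wgrad \<Omega> v x) \<le> 1"
      using esssup_AE[of "\<lambda>x. ereal (T x (wgrad \<Omega> v x))" \<mu>]
    proof eventually_elim
      case (elim x)
      then have "ereal (T x (wgrad \<Omega> v x)) \<le> 1" using le by (rule order_trans)
      then show ?case by simp
    qed
  next
    assume "AE x in \<mu>. T x (wgrad \<Omega> v x) \<le> 1"
    then show "sup_constraint T \<Omega> v" unfolding sup_constraint_def using m by (intro esssup_I) auto
  qed
qed

text \<open>Coercivity bounds the gradient of a feasible v, so v - g has bounded gradient and, by
  \<open>W0_holder_bound\<close>, is itself bounded. It therefore lies in W^{1,\<infinity>} and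
  keeps its boundary values for every exponent, which makes v a competitor for every p.\<close>

lemma feasible_affine:
  assumes v: "v \<in> affine_W1_0 g (ereal s) \<Omega>" and sc: "sup_constraint T \<Omega> v" and p: "p \<ge> 1"
  shows "v \<in> affine_W1_0 g (ereal p) \<Omega>" "AE x in \<mu>. T x (wgrad \<Omega> v x) \<le> 1"
proof -
  have s0: "s \<ge> 0" using s1 by simp
  note vD = affine_W1_0_D[OF v g_W1_p[OF s0] s0]
  show ae: "AE x in \<mu>. T x (wgrad \<Omega> v x) \<le> 1" using sup_constraint_iff[OF vD(1)] sc by simp
  have vm: "wgrad \<Omega> v \<in> borel_measurable \<mu>" using W1_E(3)[OF vD(1)] by (simp add: Lp_iff)
  have vb: "AE x in \<mu>. norm (wgrad \<Omega> v x) \<le> radius" using ae growth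
  proof eventually_elim
    case (elim x)
    show ?case using coercive(2)[OF elim(2), of "wgrad \<Omega> v x"] elim(1) by simp
  qed
  obtain Mg where gb: "AE x in \<mu>. norm (wgrad \<Omega> g x) \<le> Mg" and gm: "wgrad \<Omega> g \<in> borel_measurable \<mu>"
    using W1_E(3)[OF g_W1] unfolding Lp_inf_iff by blast
  have Zb: "AE x in \<mu>. norm (wgrad \<Omega> v x - wgrad \<Omega> g x) \<le> radius + Mg"
    using vb gb
  proof eventually_elim
    case (elim x)
    then show ?case using norm_triangle_ineq4[of "wgrad \<Omega> v x" "wgrad \<Omega> g x"] by linarith
  qed
  have Zm: "(\<lambda>x. wgrad \<Omega> v x - wgrad \<Omega> g x) \<in> borel_measurable \<mu>" using vm gm by (rule borel_measurable_diff)
  have ZL: "(\<lambda>x. wgrad \<Omega> v x - wgrad \<Omega> g x) \<in> Lp \<infinity> \<Omega>" unfolding Lp_inf_iff using Zm Zb by blast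
  \<comment> \<open>An exponent above N, as Morrey's inequality demands.\<close>
  define q where "q = real CARD('n) + 1"
  have q: "q > CARD('n)" "q \<ge> 0" by (auto simp: q_def)
  have "(\<lambda>x. wgrad \<Omega> v x - wgrad \<Omega> g x) \<in> Lp q \<Omega>" by (rule Lp_inf_mono[OF ZL q(2)])
  then have fin: "(\<integral>\<^sup>+x. norm (wgrad \<Omega> v x - wgrad \<Omega> g x) powr q \<partial>\<mu>) < \<infinity>" by (simp add: Lp_iff)
  define C where "C = enn2real (\<integral>\<^sup>+x. norm (wgrad \<Omega> v x - wgrad \<Omega> g x) powr q \<partial>\<mu>)"
  have C: "C \<ge> 0" "(\<integral>\<^sup>+x. norm (wgrad \<Omega> v x - wgrad \<Omega> g x) powr q \<partial>\<mu>) \<le> ennreal C" using fin by (auto simp: C_def)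
  from W0_holder_bound[OF q(1) C(1), THEN exE] obtain B where B: "\<forall>(z :: real^'n \<Rightarrow> real^'m) Z. W0 z Z \<longrightarrow> (\<integral>\<^sup>+x. norm (Z x) powr q \<partial>\<mu>) \<le> ennreal C \<longrightarrow>
    (\<exists>h. continuous_on (closure \<Omega>) h \<and> (AE x in \<mu>. h x = z x) \<and>
      (\<forall>x\<in>closure \<Omega>. norm (h x) \<le> B) \<and>
      (\<forall>x\<in>closure \<Omega>. \<forall>y\<in>closure \<Omega>. norm (h x - h y) \<le> B * dist x y powr (1 - CARD('n) / q)))" .
  from B[rule_format, OF vD(2) C(2)] obtain h where h: "AE x in \<mu>. h x = v x - g x" "\<forall>x\<in>closure \<Omega>. norm (h x) \<le> B"
    by (elim exE conjE)
  have zb: "AE x in \<mu>. norm (v x - g x) \<le> B" using h(1) AE_space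
  proof eventually_elim
    case (elim x)
    then have "x \<in> closure \<Omega>" using closure_subset by auto
    then show ?case using h(2) elim(1) by auto
  qed
  have zm: "(\<lambda>x. v x - g x) \<in> borel_measurable \<mu>" using W0_integrable(1)[OF vD(2)] by simp
  have zL: "(\<lambda>x. v x - g x) \<in> Lp \<infinity> \<Omega>" unfolding Lp_inf_iff using zm zb by blast
  have "(\<lambda>x. v x - g x) \<in> W1 \<infinity> \<Omega>" by (rule W1_I[OF zL W0_weak_gradient[OF vD(2)] ZL])
  then have "(\<lambda>x. v x - g x) \<in> W1 (ereal p) \<Omega>" using p by (intro W1_inf_mono) auto
  then have "(\<lambda>x. v x - g x) \<in> W1_0 (ereal p) \<Omega>" by (rule W1_0_I[OF _ vD(2)])
  then show "v \<in> affine_W1_0 g (ereal p) \<Omega>" by (simp add: affine_W1_0_def)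
qed

lemma J_pow_u_le:
  assumes "v \<in> affine_W1_0 g (ereal s) \<Omega>" "sup_constraint T \<Omega> v" "p > max r s"
  shows "J_pow J T \<Omega> r p (u p) \<le> J v + ereal (r / p * vol)"
proof -
  have p: "p \<ge> 1" "p > 0" using assms(3) r1 by auto
  note f = feasible_affine[OF assms(1,2) p(1)]
  show ?thesis by (rule order_trans[OF u_le[OF assms(3) f(1)] J_pow_le[OF f(2) p(2)]])
qed

text \<open>All indices are at least one fixed q, so the bounds are taken in W^{1,q} and leave room
  below q for the exponents s of J and r of T. The boundary values pass to w through the midpoint
  hulls, where the convergence is strong.\<close>

lemma limit_feasible:
  fixes P :: "nat \<Rightarrow> real" and w :: "real^'n \<Rightarrow> real^'m"
  assumes P: "filterlim P at_top sequentially" and Pq: "\<And>k. P k \<ge> q" and q: "q \<ge> 2" "q > max r s"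
    and w: "w \<in> borel_measurable \<mu>"
    and \<epsilon>: "decseq \<epsilon>" "\<epsilon> \<longlonglongrightarrow> 0" and close: "\<And>k. AE x in \<mu>. norm (u (P k) x - w x) \<le> \<epsilon> k"
  shows "w \<in> affine_W1_0 g (ereal s) \<Omega>" "sup_constraint T \<Omega> w" "J w \<le> liminf (\<lambda>k. J (u (P k)))"
proof -
  have Ps: "P k > max r s" for k using Pq[of k] q(2) by linarith
  have q0: "q \<ge> 0" "q \<ge> s" "q > s" "q > r" using q by auto
  define v where "v = (\<lambda>k. u (P k))"
  have v: "v k \<in> W1 q \<Omega>" for k unfolding v_def using W1_mono[OF u_W1[OF Ps[of k]], of q] Pq[of k] q0(1) by simp
  obtain C where C: "C \<ge> 0" "\<And>p. p > max r s \<Longrightarrow> p \<ge> q \<Longrightarrow> (\<integral>\<^sup>+x. norm (wgrad \<Omega> (u p) x) powr q \<partial>\<mu>) \<le> ennreal C"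
    using gradient_bound[of q] q0(1) by blast
  have vC: "(\<integral>\<^sup>+x. norm (wgrad \<Omega> (v k) x) powr q \<partial>\<mu>) \<le> ennreal C" for k unfolding v_def by (rule C(2)[OF Ps Pq])
  have cl: "AE x in \<mu>. norm (v k x - w x) \<le> \<epsilon> k" for k unfolding v_def by (rule close)
  have vW0: "W0 (\<lambda>x. v k x - g x) (\<lambda>x. wgrad \<Omega> (v k) x - wgrad \<Omega> g x)" for k unfolding v_def by (rule u_W0[OF Ps])
  note mz = mazur_W1[OF q(1) v C(1) vC w \<epsilon> cl]
  have wW: "w \<in> W1 q \<Omega>" using mz by (rule conjunct1)
  from conjunct2[OF mz] obtain z Z where zh: "\<forall>n. mid_hull (\<lambda>y Y. \<exists>k\<ge>n. y = v k \<and> Y = wgrad \<Omega> (v k)) (z n) (Z n)"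
    and zl: "\<forall>s. 1 \<le> s \<longrightarrow> s < q \<longrightarrow> (\<lambda>n. \<integral>\<^sup>+x. norm (z n x - w x) powr s \<partial>\<mu>) \<longlonglongrightarrow> 0"
    and Zl: "\<forall>s. 1 \<le> s \<longrightarrow> s < q \<longrightarrow> (\<lambda>n. \<integral>\<^sup>+x. norm (Z n x - wgrad \<Omega> w x) powr s \<partial>\<mu>) \<longlonglongrightarrow> 0"
    by (elim exE conjE)
  have one: "(1::real) \<le> 1" "1 < q" using q(1) by auto
  have zW0: "W0 (\<lambda>x. z n x - g x) (\<lambda>x. Z n x - wgrad \<Omega> g x)" for n
    by (rule mid_hull_W0[OF zh[rule_format, of n]]) (use vW0 in auto)
  have gq: "g \<in> W1 q \<Omega>" by (rule g_W1_p[OF q0(1)])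
  have int: "integrable \<mu> w" "integrable \<mu> (wgrad \<Omega> w)" "integrable \<mu> g" "integrable \<mu> (wgrad \<Omega> g)"
    using Lp_integrable[OF W1_E(1)[OF wW]] Lp_integrable[OF W1_E(3)[OF wW]] Lp_integrable[OF W1_E(1)[OF gq]] Lp_integrable[OF W1_E(3)[OF gq]] one(2) by auto
  have wW0: "W0 (\<lambda>x. w x - g x) (\<lambda>x. wgrad \<Omega> w x - wgrad \<Omega> g x)"
  proof (rule W0_limit[OF zW0])
    show "integrable \<mu> (\<lambda>x. w x - g x)" "integrable \<mu> (\<lambda>x. wgrad \<Omega> w x - wgrad \<Omega> g x)" using int by auto
    show "(\<lambda>n. \<integral>\<^sup>+x. norm (z n x - g x - (w x - g x)) \<partial>\<mu>) \<longlonglongrightarrow> 0"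
      using zl[rule_format, OF one] by simp
    show "(\<lambda>n. \<integral>\<^sup>+x. norm (Z n x - wgrad \<Omega> g x - (wgrad \<Omega> w x - wgrad \<Omega> g x)) \<partial>\<mu>) \<longlonglongrightarrow> 0"
      using Zl[rule_format, OF one] by simp
  qed
  have s0: "s \<ge> 0" using s1 by simp
  have wWs: "w \<in> W1 (ereal s) \<Omega>" by (rule W1_mono[OF wW s0 q0(2)])
  show "w \<in> affine_W1_0 g (ereal s) \<Omega>" by (rule affine_W1_0_I[OF wWs g_W1_p[OF s0] s0 wW0])
  have "W0 (\<lambda>x. v k x - w x) (\<lambda>x. wgrad \<Omega> (v k) x - wgrad \<Omega> w x)" for k
    using W0_diff[OF vW0[of k] wW0] by simp
  moreover have "(\<lambda>n. \<integral>\<^sup>+x. tail l (wgrad \<Omega> (v n)) x \<partial>\<mu>) \<longlonglongrightarrow> 0" if "l > 1" for l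
    unfolding v_def by (rule filterlim_compose[OF tail_tendsto[OF that] P])
  ultimately have "AE x in \<mu>. T x (wgrad \<Omega> w x) \<le> 1"
    by (intro limit_constraint[OF ne qc q(1) q0(4) v C(1) vC wW _ \<epsilon> cl])
  then show "sup_constraint T \<Omega> w" using sup_constraint_iff[OF wWs] by simp
  have "W1_weak_conv s \<Omega> v w" by (rule W1_weak_convI[OF q(1) v C(1) vC w \<epsilon> cl s1 q0(3)])
  then show "J w \<le> liminf (\<lambda>k. J (u (P k)))" using J_lsc unfolding weakly_seq_lsc_def v_def by blast
qed

lemma continuous_measurable:
  fixes w :: "real^'n \<Rightarrow> real^'m"
  assumes "continuous_on (closure \<Omega>) w"
  shows "w \<in> borel_measurable \<mu>"
  by (rule continuous_imp_measurable_on_sets_lebesgue[OF continuous_on_subset[OF assms closure_subset]]) (use open_\<Omega> in simp)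

text \<open>Q carries a further property of the chosen indices: \<open>True\<close> for the given
  cluster point, and \<open>J (u p) \<le> y\<close> in the argument by contradiction for the lower
  limit.\<close>

lemma limit_feasible_indices:
  fixes w :: "real^'n \<Rightarrow> real^'m"
  assumes w: "continuous_on (closure \<Omega>) w"
    and ex: "\<forall>M. \<forall>e>0. \<exists>p\<ge>M. Q p \<and> (AE x in \<mu>. norm (u p x - w x) \<le> e)"
  shows "\<exists>P. filterlim P at_top sequentially \<and> (\<forall>k. Q (P k)) \<and> (\<forall>k. P k > max r s) \<and>
    w \<in> affine_W1_0 g (ereal s) \<Omega> \<and> sup_constraint T \<Omega> w \<and> J w \<le> liminf (\<lambda>k::nat. J (u (P k)))"
proof -
  define q where "q = max (max r s + 1) 2"
  have q: "q \<ge> 2" "q > max r s" by (auto simp: q_def)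
  have "\<forall>k::nat. \<exists>p. p \<ge> max q (real k) \<and> Q p \<and> (AE x in \<mu>. norm (u p x - w x) \<le> inverse (real (Suc k)))"
  proof
    fix k :: nat
    show "\<exists>p. p \<ge> max q (real k) \<and> Q p \<and> (AE x in \<mu>. norm (u p x - w x) \<le> inverse (real (Suc k)))"
      using ex[rule_format, of "inverse (real (Suc k))" "max q (real k)"] by auto
  qed
  from choice[OF this] obtain P where P: "\<And>k. P k \<ge> max q (real k)" "\<And>k. Q (P k)"
    "\<And>k. AE x in \<mu>. norm (u (P k) x - w x) \<le> inverse (real (Suc k))" by auto
  have Plim: "filterlim P at_top sequentially"
    by (rule filterlim_at_top_mono[OF filterlim_real_sequentially]) (use P(1) in \<open>auto intro!: always_eventually\<close>)
  have Pq: "P k \<ge> q" for k using P(1)[of k] by simp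
  have Pm: "P k > max r s" for k using Pq[of k] q(2) by linarith
  have dec: "decseq (\<lambda>k. inverse (real (Suc k)))" by (auto simp: decseq_def divide_simps)
  note lf = limit_feasible[OF Plim Pq q continuous_measurable[OF w] dec LIMSEQ_inverse_real_of_nat P(3)]
  show ?thesis using Plim P(2) Pm lf by blast
qed

text \<open>J (u p) is at most its penalised value, which minimality bounds by J v + r / p * vol,
  and the last term vanishes.\<close>

lemma liminf_le_feasible:
  assumes P: "filterlim P at_top sequentially" "\<And>k. P k > max r s"
    and v: "v \<in> affine_W1_0 g (ereal s) \<Omega>" "sup_constraint T \<Omega> v"
  shows "liminf (\<lambda>k::nat. J (u (P k))) \<le> J v"
proof (cases "J v")
  case (real j)
  have le: "J (u (P k)) \<le> ereal (j + r / P k * vol)" for k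
  proof -
    have "P k > 0" using P(2)[of k] r1 by auto
    then show ?thesis using order_trans[OF J_le_J_pow J_pow_u_le[OF v P(2)[of k]]] real by simp
  qed
  have "(\<lambda>k. r / P k) \<longlonglongrightarrow> 0" by (rule tendsto_divide_0[OF tendsto_const filterlim_at_top_imp_at_infinity[OF P(1)]])
  then have "(\<lambda>k. j + r / P k * vol) \<longlonglongrightarrow> j + 0 * vol" by (intro tendsto_intros)
  then have "(\<lambda>k. ereal (j + r / P k * vol)) \<longlonglongrightarrow> J v" using real by simp
  from lim_imp_Liminf[OF _ this] have "liminf (\<lambda>k. ereal (j + r / P k * vol)) = J v" by simp
  moreover have "liminf (\<lambda>k. J (u (P k))) \<le> liminf (\<lambda>k. ereal (j + r / P k * vol))"
    using le by (intro Liminf_mono always_eventually allI)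
  ultimately show ?thesis by simp
next
  case MInf
  have "v \<in> W1 s \<Omega>" using affine_W1_0_D(1)[OF v(1) g_W1_p] s1 by simp
  then show ?thesis using J_bound[of v] MInf by simp
qed simp

text \<open>For the whole family the upper bound comes from w as a competitor for every p, the lower
  bound from compactness: indices tending to infinity with J (u p) \<le> y < J w would lead to
  another cluster point, feasible and with J \<le> y, against the optimality of w.\<close>

lemma cluster_point:
  assumes cp: "uniform_cluster_point \<Omega> u w"
  shows "is_arg_min J (\<lambda>v. v \<in> affine_W1_0 g s \<Omega> \<and> sup_constraint T \<Omega> v) w"
    "((\<lambda>p. INF v\<in>affine_W1_0 g p \<Omega>. J_pow J T \<Omega> r p v) \<longlongrightarrow> J w) at_top"
    "((\<lambda>p. J_pow J T \<Omega> r p (u p)) \<longlongrightarrow> J w) at_top"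
    "((\<lambda>p. J (u p)) \<longlongrightarrow> J w) at_top"
    "J w = (INF v\<in>affine_W1_0 g s \<Omega>. J_infty J T \<Omega> v)"
proof -
  have wc: "continuous_on (closure \<Omega>) w" using cp by (simp add: uniform_cluster_point_def)
  have ex: "\<forall>M. \<forall>e>0. \<exists>p\<ge>M. True \<and> (AE x in \<mu>. norm (u p x - w x) \<le> e)"
  proof (intro allI impI)
    fix M e :: real assume "e > 0"
    have "\<exists>\<^sub>F p in at_top. \<exists>h. continuous_representative \<Omega> (u p) h \<and> (\<forall>x\<in>closure \<Omega>. dist (h x) (w x) < e)"
      using cp \<open>e > 0\<close> by (simp add: uniform_cluster_point_def)
    from frequently_at_top_ex[OF this, of M] obtain p h where
      p: "p \<ge> M" "continuous_representative \<Omega> (u p) h" "\<forall>x\<in>closure \<Omega>. dist (h x) (w x) < e" by blast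
    have "AE x in \<mu>. h x = u p x" using p(2) by (simp add: continuous_representative_def)
    then have "AE x in \<mu>. norm (u p x - w x) \<le> e" using AE_space
    proof eventually_elim
      case (elim x)
      then have "x \<in> closure \<Omega>" using closure_subset by auto
      then show ?case using p(3) elim(1) by (auto simp: dist_norm intro: less_imp_le)
    qed
    then show "\<exists>p\<ge>M. True \<and> (AE x in \<mu>. norm (u p x - w x) \<le> e)" using p(1) by blast
  qed
  from limit_feasible_indices[where Q = "\<lambda>_. True", OF wc ex] obtain P where P: "filterlim P at_top sequentially" "\<forall>k. P k > max r s"
    and wf: "w \<in> affine_W1_0 g (ereal s) \<Omega>" "sup_constraint T \<Omega> w" and Jw: "J w \<le> liminf (\<lambda>k::nat. J (u (P k)))"
    by (elim exE conjE)
  have opt: "J w \<le> J v" if "v \<in> affine_W1_0 g (ereal s) \<Omega>" "sup_constraint T \<Omega> v" for v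
    using order_trans[OF Jw liminf_le_feasible[OF P(1) _ that]] P(2) by blast
  show "is_arg_min J (\<lambda>v. v \<in> affine_W1_0 g s \<Omega> \<and> sup_constraint T \<Omega> v) w"
    using wf opt by (auto simp: is_arg_min_def not_less)
  have s0: "s \<ge> 0" using s1 by simp
  have gs: "sup_constraint T \<Omega> g" using sup_constraint_iff[OF g_W1_p[OF s0]] T_g by simp
  have "J w \<le> J g" by (rule opt[OF g_affine[OF s0] gs])
  moreover have "w \<in> W1 s \<Omega>" by (rule affine_W1_0_D(1)[OF wf(1) g_W1_p[OF s0] s0])
  \<comment> \<open>J w is finite, between c and J g, so the upper bounds J w + r / p * vol can be
    handled as real numbers.\<close>
  ultimately obtain jw where jw: "J w = ereal jw" using J_bound[of w] J_g by (cases "J w") auto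
  have "((\<lambda>p. r / p) \<longlongrightarrow> 0) at_top" by (rule tendsto_divide_0[OF tendsto_const filterlim_at_top_imp_at_infinity[OF filterlim_ident]])
  then have "((\<lambda>p. jw + r / p * vol) \<longlongrightarrow> jw + 0 * vol) at_top" by (intro tendsto_intros)
  then have up: "((\<lambda>p. ereal (jw + r / p * vol)) \<longlongrightarrow> J w) at_top" using jw by simp
  have le1: "\<forall>\<^sub>F p in at_top. J (u p) \<le> J_pow J T \<Omega> r p (u p)"
    using eventually_gt_at_top[of 0] by eventually_elim (rule J_le_J_pow)
  have le2: "\<forall>\<^sub>F p in at_top. J_pow J T \<Omega> r p (u p) \<le> ereal (jw + r / p * vol)"
    using eventually_gt_at_top[of "max r s"]
  proof eventually_elim
    case (elim p)
    show ?case using J_pow_u_le[OF wf elim] jw by simp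
  qed
  have lower: "\<forall>\<^sub>F p in at_top. y < J (u p)" if y: "y < J w" for y
  proof (rule ccontr)
    assume "\<not> ?thesis"
    then have fr: "\<exists>\<^sub>F p in at_top. J (u p) \<le> y" by (simp add: not_eventually not_less)
    have "\<forall>k::nat. \<exists>p. p \<ge> real k \<and> J (u p) \<le> y" using frequently_at_top_ex[OF fr] by blast
    from choice[OF this] obtain R where R: "\<And>k. R k \<ge> real k" "\<And>k. J (u (R k)) \<le> y" by auto
    have Rlim: "filterlim R at_top sequentially"
      by (rule filterlim_at_top_mono[OF filterlim_real_sequentially]) (use R(1) in \<open>auto intro!: always_eventually\<close>)
    define q where "q = real CARD('n) + 1"
    have q: "q > CARD('n)" by (simp add: q_def)
    from diff_rep_subsequence[OF q Rlim] obtain \<rho> y0 where \<rho>: "strict_mono (\<rho> :: nat \<Rightarrow> nat)" and y0: "continuous_on (closure \<Omega>) y0"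
      and conv: "\<forall>e>0. \<exists>N. \<forall>k\<ge>N. \<forall>x\<in>closure \<Omega>. norm (diff_rep (R (\<rho> k)) x - y0 x) < e" by (elim exE conjE)
    define w' where "w' = (\<lambda>x. y0 x + g x)"
    have w'c: "continuous_on (closure \<Omega>) w'" unfolding w'_def by (intro continuous_on_add y0 g_cont)
    have ex': "\<forall>M. \<forall>e>0. \<exists>p\<ge>M. J (u p) \<le> y \<and> (AE x in \<mu>. norm (u p x - w' x) \<le> e)"
    proof (intro allI impI)
      fix M e :: real assume e: "e > 0"
      obtain N where N: "\<And>k x. k \<ge> N \<Longrightarrow> x \<in> closure \<Omega> \<Longrightarrow> norm (diff_rep (R (\<rho> k)) x - y0 x) < e" using conv e by blast
      \<comment> \<open>Makes the index exceed M and also enter the range in which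
        \<open>diff_rep\<close> represents u p - g.\<close>
      define M' where "M' = Max {M, max r s + 1, q}"
      define k where "k = max N (nat \<lceil>M'\<rceil>)"
      have "real k \<ge> M'" unfolding k_def by linarith
      moreover have "\<rho> k \<ge> k" by (rule strict_mono_imp_increasing[OF \<rho>])
      moreover have "R (\<rho> k) \<ge> real (\<rho> k)" by (rule R(1))
      ultimately have "R (\<rho> k) \<ge> M'" by linarith
      then have p: "R (\<rho> k) \<ge> M" "R (\<rho> k) > max r s" "R (\<rho> k) \<ge> q" by (auto simp: M'_def)
      have "AE x in \<mu>. diff_rep (R (\<rho> k)) x = u (R (\<rho> k)) x - g x"
        using diff_rep_holder_space(1)[OF q p(2,3)] by (simp add: continuous_representative_def)
      then have "AE x in \<mu>. norm (u (R (\<rho> k)) x - w' x) \<le> e" using AE_space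
      proof eventually_elim
        case (elim x)
        then have "x \<in> closure \<Omega>" using closure_subset by auto
        moreover have "k \<ge> N" by (simp add: k_def)
        moreover have "u (R (\<rho> k)) x - w' x = diff_rep (R (\<rho> k)) x - y0 x" using elim(1) by (simp add: w'_def)
        ultimately show ?case using N[of k x] by simp
      qed
      then show "\<exists>p\<ge>M. J (u p) \<le> y \<and> (AE x in \<mu>. norm (u p x - w' x) \<le> e)" using p(1) R(2)[of "\<rho> k"] by blast
    qed
    from limit_feasible_indices[where Q = "\<lambda>p. J (u p) \<le> y", OF w'c ex'] obtain P' where P': "\<forall>k. J (u (P' k)) \<le> y"
      and w'f: "w' \<in> affine_W1_0 g (ereal s) \<Omega>" "sup_constraint T \<Omega> w'" and Jw': "J w' \<le> liminf (\<lambda>k::nat. J (u (P' k)))"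
      by (elim exE conjE)
    have "liminf (\<lambda>k. J (u (P' k))) \<le> liminf (\<lambda>k::nat. y)" using P' by (intro Liminf_mono always_eventually allI) auto
    also have "\<dots> = y" by (simp add: Liminf_const)
    finally have "J w' \<le> y" using Jw' by (rule order_trans[rotated])
    then show False using opt[OF w'f] y by (meson le_less_trans less_le_not_le order_trans)
  qed
  show lim: "((\<lambda>p. J (u p)) \<longlongrightarrow> J w) at_top"
  proof (rule order_tendstoI)
    fix y assume "y < J w" then show "\<forall>\<^sub>F p in at_top. y < J (u p)" by (rule lower)
  next
    fix y assume "J w < y"
    from order_tendstoD(2)[OF up this] le1 le2 show "\<forall>\<^sub>F p in at_top. J (u p) < y"
      by eventually_elim (rule le_less_trans[OF order_trans])
  qed
  show lim2: "((\<lambda>p. J_pow J T \<Omega> r p (u p)) \<longlongrightarrow> J w) at_top" by (rule tendsto_sandwich[OF le1 le2 lim up])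
  have "\<forall>\<^sub>F p in at_top. (INF v\<in>affine_W1_0 g p \<Omega>. J_pow J T \<Omega> r p v) = J_pow J T \<Omega> r p (u p)"
    using eventually_gt_at_top[of "max r s"]
  proof eventually_elim
    case (elim p)
    show ?case by (intro antisym INF_lower u_affine elim INF_greatest u_le)
  qed
  then show "((\<lambda>p. INF v\<in>affine_W1_0 g p \<Omega>. J_pow J T \<Omega> r p v) \<longlongrightarrow> J w) at_top"
    using lim2 by (simp add: tendsto_cong)
  show "J w = (INF v\<in>affine_W1_0 g s \<Omega>. J_infty J T \<Omega> v)"
  proof (intro antisym INF_greatest)
    fix v assume "v \<in> affine_W1_0 g s \<Omega>"
    then show "J w \<le> J_infty J T \<Omega> v" using opt by (simp add: J_infty_def)
  next
    have "J w = J_infty J T \<Omega> w" using wf(2) by (simp add: J_infty_def)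
    then show "(INF v\<in>affine_W1_0 g s \<Omega>. J_infty J T \<Omega> v) \<le> J w" using wf(1) by (auto intro: INF_lower)
  qed
qed

end

text \<open>The Hoelder compactness comes in two forms: for u p - g on every bounded domain, and for
  u p itself once g is Hoelder on the closure, which on an irregular domain need not follow from
  W^{1,\<infinity>} and continuity.\<close>

theorem theorem2p1:
  fixes \<Omega> :: "(real^'n) set"
    and T :: "real^'n \<Rightarrow> real^'n^'m \<Rightarrow> real"
    and J :: "(real^'n \<Rightarrow> real^'m) \<Rightarrow> ereal"
    and g :: "real^'n \<Rightarrow> real^'m"
    and u :: "real \<Rightarrow> real^'n \<Rightarrow> real^'m"
    and s r \<alpha>1 \<beta>1 c :: real
  assumes "bounded_domain \<Omega>"
    and "s \<ge> 1" and "r \<ge> 1"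
    and "\<And>x \<xi>. x \<in> \<Omega> \<Longrightarrow> 0 \<le> T x \<xi>"
    and "caratheodory_function \<Omega> T"
    and "quasiconvex \<Omega> T"
    and "0 < \<alpha>1" and "\<alpha>1 \<le> \<beta>1"
    and "AE x in lebesgue_on \<Omega>. \<forall>\<xi>. \<alpha>1 * (1 + norm \<xi> powr r) \<le> T x \<xi> \<and>
                                       T x \<xi> \<le> \<beta>1 * (1 + norm \<xi> powr r)"
    and "respects_AE s \<Omega> J"
    and "\<And>v. v \<in> W1 s \<Omega> \<Longrightarrow> ereal c \<le> J v"
    and "weakly_seq_lsc s \<Omega> J"
    and "g \<in> W1 \<infinity> \<Omega>" and "continuous_on (closure \<Omega>) g"
    and "J g < \<infinity>"
    and "AE x in lebesgue_on \<Omega>. T x (wgrad \<Omega> g x) \<le> 1"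
    and "\<And>p. p > max r s \<Longrightarrow>
           is_arg_min (J_pow J T \<Omega> r p) (\<lambda>v. v \<in> affine_W1_0 g p \<Omega>) (u p)"
  shows
    "(\<forall>q::real. q \<ge> Max {real CARD('n) + 1, r, s} \<longrightarrow>
       (let I = {p. p \<ge> q \<and> p > max r s}; \<alpha> = 1 - real CARD('n) / q in
         (\<exists>C::real. \<forall>p\<in>I. u p \<in> W1 q \<Omega> \<and> W1_norm q \<Omega> (u p) \<le> ereal C) \<and>
         holder_relatively_compact_net \<alpha> \<Omega> I (\<lambda>p x. u p x - g x) \<and>
         (g \<in> holder_space \<alpha> (closure \<Omega>) \<longrightarrow> holder_relatively_compact_net \<alpha> \<Omega> I u))) \<and>
     (\<forall>u_inf. uniform_cluster_point \<Omega> u u_inf \<longrightarrow>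
       is_arg_min J (\<lambda>v. v \<in> affine_W1_0 g s \<Omega> \<and> sup_constraint T \<Omega> v) u_inf \<and>
       ((\<lambda>p. INF v\<in>affine_W1_0 g p \<Omega>. J_pow J T \<Omega> r p v) \<longlongrightarrow> J u_inf) at_top \<and>
       ((\<lambda>p. J_pow J T \<Omega> r p (u p)) \<longlongrightarrow> J u_inf) at_top \<and>
       ((\<lambda>p. J (u p)) \<longlongrightarrow> J u_inf) at_top \<and>
       J u_inf = (INF v\<in>affine_W1_0 g s \<Omega>. J_infty J T \<Omega> v))"
proof -
  interpret penalised_minimizers \<Omega> T r \<alpha>1 \<beta>1 J g u s c
    using assms unfolding bounded_domain_def by unfold_locales auto
  show ?thesis
  proof (intro conjI allI impI)
    fix q :: real assume "q \<ge> Max {real CARD('n) + 1, r, s}"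
    then have q: "q > CARD('n)" by simp
    obtain C :: real where C: "\<forall>p > max r s. p \<ge> q \<longrightarrow> u p \<in> W1 q \<Omega> \<and> W1_norm q \<Omega> (u p) \<le> ereal C"
      using W1_norm_bounded[OF q] by (elim exE)
    show "let I = {p. p \<ge> q \<and> p > max r s}; \<alpha> = 1 - real CARD('n) / q in
         (\<exists>C::real. \<forall>p\<in>I. u p \<in> W1 q \<Omega> \<and> W1_norm q \<Omega> (u p) \<le> ereal C) \<and>
         holder_relatively_compact_net \<alpha> \<Omega> I (\<lambda>p x. u p x - g x) \<and>
         (g \<in> holder_space \<alpha> (closure \<Omega>) \<longrightarrow> holder_relatively_compact_net \<alpha> \<Omega> I u)"
      unfolding Let_def
    proof (intro conjI impI)
      show "\<exists>C::real. \<forall>p\<in>{p. p \<ge> q \<and> p > max r s}. u p \<in> W1 q \<Omega> \<and> W1_norm q \<Omega> (u p) \<le> ereal C"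
        using C by (intro exI[of _ C]) blast
    qed (rule compact_net[OF q]; assumption)+
  next
    fix u_inf assume "uniform_cluster_point \<Omega> u u_inf"
    note cp = cluster_point[OF this]
    show "is_arg_min J (\<lambda>v. v \<in> affine_W1_0 g s \<Omega> \<and> sup_constraint T \<Omega> v) u_inf" by (rule cp(1))
    show "((\<lambda>p. INF v\<in>affine_W1_0 g p \<Omega>. J_pow J T \<Omega> r p v) \<longlongrightarrow> J u_inf) at_top" by (rule cp(2))
    show "((\<lambda>p. J_pow J T \<Omega> r p (u p)) \<longlongrightarrow> J u_inf) at_top" by (rule cp(3))
    show "((\<lambda>p. J (u p)) \<longlongrightarrow> J u_inf) at_top" by (rule cp(4))
    show "J u_inf = (INF v\<in>affine_W1_0 g s \<Omega>. J_infty J T \<Omega> v)" by (rule cp(5))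
  qed
qed

end
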